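(* Let $\alpha\in(0,1)$ and let $f\in\mathcal{D}(\mathbb{T})$ be such that $|f|\in\mathcal{C}^{1+\alpha}(\mathbb{T})$. Then the following assertions are equivalent: (1) $f^2$ is cyclic for $\mathcal{D}(\mathbb{T})$; (2) $\log|f|\notin L^1(\mathbb{T})$ and $c(\mathcal{Z}(f))=0$.
   Context: $\mathbb{T}$ is the unit circle and $\mathbb{N}=\{n\in\mathbb{Z}:n\ge 0\}$. The harmonic Dirichlet space $\mathcal{D}(\mathbb{T})$ is the Hilbert space of functions $f\in L^2(\mathbb{T})$ with $\|f\|_{\mathcal{D}(\mathbb{T})}^2:=\sum_{n\in\mathbb{Z}}(1+|n|)|\hat f(n)|^2<\infty$, where $\hat f(n)=\frac1{2\pi}\int_{\mathbb{T}}f(\zeta)\bar\zeta^{n}|d\zeta|$. For $g\in\mathcal{D}(\mathbb{T})$, $[g]_{\mathbb{N}}$ denotes the closure in $\mathcal{D}(\mathbb{T})$ of the linear span of $\{\zeta^n g(\zeta):n\in\mathbb{N}\}$. The function $g$ is cyclic for $\mathcal{D}(\mathbb{T})$ if $[g]_{\mathbb{N}}=\mathcal{D}(\mathbb{T})$. The energy of a Borel probability measure $\mu$ on $\mathbb{T}$ is $I(\mu):=\iint_{\mathbb{T}^2}\log\frac1{|\zeta-\zeta'|}\,d\mu(\zeta)\,d\mu(\zeta')=\sum_{n\ge1}|\hat\mu(n)|^2/n$. The logarithmic capacity of a Borel set $E\subset\mathbb{T}$ is $c(E):=1/\inf\{I(\mu):\mu\in\mathcal{P}(E)\}$, where $\mathcal{P}(E)$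 is the set of Borel probability measures supported on a compact subset of $E$ (so $c(E)=0$ when no $\mu\in\mathcal P(E)$ has finite energy). A property holds quasi-everywhere (q.e.) if it holds outside a set of logarithmic capacity zero. For $f\in\mathcal{D}(\mathbb{T})$, the radial limit of the Poisson integral of $f$ exists q.e. on $\mathbb{T}$ and equals $f$ a.e.; $f$ is identified with this radial limit, hence is defined q.e. on $\mathbb{T}$. Its zero set $\mathcal{Z}(f):=\{\zeta\in\mathbb{T}:f(\zeta)=0\}$ is thus defined up to sets of logarithmic capacity zero. For $\beta\in(0,1]$, $\mathrm{Lip}_\beta(\mathbb{T})$ is the set of continuous functions $g$ on $\mathbb{T}$ with $\sup_{\zeta\ne\zeta'}|g(\zeta)-g(\zeta')|/|\zeta-\zeta'|^\beta<\infty$. For $\alpha\in(0,1)$, $\mathcal{C}^{1+\alpha}(\mathbb{T}):=\{g\in C^1(\mathbb{T}):g'\in\mathrm{Lip}_\alpha(\mathbb{T})\}$. *)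

theory Defs
  imports "HOL-Analysis.Analysis" "HOL-Probability.Probability"
begin

abbreviation circle :: "complex set" where
  "circle \<equiv> sphere 0 1"

text \<open>The (completed) arc-length measure \<open>|d\<zeta>|\<close> on the unit circle, of total mass \<open>2 * pi\<close>.\<close>

definition arc_length :: "complex measure" where
  "arc_length =
     completion (distr (restrict_space lborel {0..<2*pi}) (restrict_space borel circle) cis)"

text \<open>Elements of the function spaces on the circle are represented by functions on \<open>\<complex>\<close>, of which
  only the almost everywhere class on the circle matters.\<close>

definition L2_circle :: "(complex \<Rightarrow> complex) set" where
  "L2_circle = {f \<in> borel_measurable arc_length. integrable arc_length (\<lambda>\<zeta>. (cmod (f \<zeta>))\<^sup>2)}"

definition fourier_coeff :: "(complex \<Rightarrow> complex) \<Rightarrow> int \<Rightarrow> complex" where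
  "fourier_coeff f n = (LINT \<zeta>|arc_length. f \<zeta> * cnj \<zeta> powi n) / (2 * pi)"

definition harmonic_dirichlet :: "(complex \<Rightarrow> complex) set" where
  "harmonic_dirichlet =
     {f \<in> L2_circle. (\<lambda>n::int. (1 + \<bar>real_of_int n\<bar>) * (cmod (fourier_coeff f n))\<^sup>2) summable_on UNIV}"

definition dirichlet_norm :: "(complex \<Rightarrow> complex) \<Rightarrow> real" where
  "dirichlet_norm f =
     sqrt (\<Sum>\<^sub>\<infinity>n::int. (1 + \<bar>real_of_int n\<bar>) * (cmod (fourier_coeff f n))\<^sup>2)"

definition shift_span :: "(complex \<Rightarrow> complex) \<Rightarrow> (complex \<Rightarrow> complex) set" where
  "shift_span g = {(\<lambda>\<zeta>. \<Sum>n<N. a n * (\<zeta> ^ n * g \<zeta>)) | (N::nat) (a::nat \<Rightarrow> complex). True}"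

definition shift_closure :: "(complex \<Rightarrow> complex) \<Rightarrow> (complex \<Rightarrow> complex) set" where
  "shift_closure g =
     {h \<in> harmonic_dirichlet. \<forall>\<epsilon>>0. \<exists>p\<in>shift_span g. dirichlet_norm (\<lambda>\<zeta>. h \<zeta> - p \<zeta>) < \<epsilon>}"

definition cyclic_dirichlet :: "(complex \<Rightarrow> complex) \<Rightarrow> bool" where
  "cyclic_dirichlet g \<longleftrightarrow> g \<in> harmonic_dirichlet \<and> shift_closure g = harmonic_dirichlet"

text \<open>The kernel is \<open>\<infinity>\<close> on the diagonal, where the real-valued \<open>ln (1 / 0)\<close> would be \<open>0\<close>.\<close>

definition log_kernel :: "complex \<Rightarrow> complex \<Rightarrow> ereal" where
  "log_kernel \<zeta> \<zeta>' = (if \<zeta> = \<zeta>' then \<infinity> else ereal (ln (1 / cmod (\<zeta> - \<zeta>'))))"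

text \<open>The integral of the kernel as the integral of its positive part minus that of its negative
  part (\<open>e2ennreal\<close> truncates negative values to \<open>0\<close>). For a probability measure on the circle the
  second integral is at most \<open>ln 2\<close>, so the difference is well-defined.\<close>

definition log_energy :: "complex measure \<Rightarrow> ereal" where
  "log_energy \<mu> =
     enn2ereal (\<integral>\<^sup>+(\<zeta>, \<zeta>'). e2ennreal (log_kernel \<zeta> \<zeta>') \<partial>(\<mu> \<Otimes>\<^sub>M \<mu>)) -
     enn2ereal (\<integral>\<^sup>+(\<zeta>, \<zeta>'). e2ennreal (- log_kernel \<zeta> \<zeta>') \<partial>(\<mu> \<Otimes>\<^sub>M \<mu>))"

text \<open>Measures on the circle are represented as Borel measures on \<open>\<complex>\<close> concentrated on it.\<close>

definition prob_on :: "complex set \<Rightarrow> complex measure set" where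
  "prob_on E = {\<mu>. sets \<mu> = sets borel \<and> prob_space \<mu> \<and>
     (\<exists>K. compact K \<and> K \<subseteq> E \<and> emeasure \<mu> (- K) = 0)}"

text \<open>For Borel subsets of the circle. In \<^typ>\<open>ereal\<close>, \<open>1 / \<infinity> = 0\<close> and \<open>1 / 0 = \<infinity>\<close>, and the
  infimum of the empty set is \<open>\<infinity>\<close>.\<close>

definition log_capacity :: "complex set \<Rightarrow> ereal" where
  "log_capacity E = 1 / (INF \<mu>\<in>prob_on E. log_energy \<mu>)"

definition poisson_integral :: "(complex \<Rightarrow> complex) \<Rightarrow> complex \<Rightarrow> complex" where
  "poisson_integral f z =
     (LINT \<zeta>|arc_length. of_real ((1 - (cmod z)\<^sup>2) / (cmod (\<zeta> - z))\<^sup>2) * f \<zeta>) / (2 * pi)"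

text \<open>The zero set of the quasi-everywhere defined representative of \<open>f\<close>, namely the radial limit of
  its Poisson integral; it does not depend on the choice of \<open>f\<close> in its almost everywhere class.\<close>

definition zero_set :: "(complex \<Rightarrow> complex) \<Rightarrow> complex set" where
  "zero_set f =
     {\<zeta> \<in> circle. ((\<lambda>r. poisson_integral f (of_real r * \<zeta>)) \<longlongrightarrow> 0) (at_left 1)}"

text \<open>With \<open>log 0 = -\<infinity>\<close>, a function vanishing on a set of positive measure does not have
  integrable logarithm; as \<open>ln 0 = 0\<close> in the library, this has to be required separately.\<close>

definition log_modulus_integrable :: "(complex \<Rightarrow> complex) \<Rightarrow> bool" where
  "log_modulus_integrable f \<longleftrightarrow>
     (AE \<zeta> in arc_length. f \<zeta> \<noteq> 0) \<and> integrable arc_length (\<lambda>\<zeta>. ln (cmod (f \<zeta>)))"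

definition Lip_circle :: "real \<Rightarrow> (complex \<Rightarrow> 'a::real_normed_vector) set" where
  "Lip_circle \<beta> = {g. continuous_on circle g \<and>
     bdd_above {norm (g \<zeta> - g \<zeta>') / cmod (\<zeta> - \<zeta>') powr \<beta> | \<zeta> \<zeta>'.
                  \<zeta> \<in> circle \<and> \<zeta>' \<in> circle \<and> \<zeta> \<noteq> \<zeta>'}}"

text \<open>The derivative is taken with respect to the angle. Continuity of \<open>g'\<close>, hence \<open>g \<in> C\<^sup>1\<close>, is
  part of the Lipschitz condition.\<close>

definition C1_Lip_circle :: "real \<Rightarrow> (complex \<Rightarrow> 'a::real_normed_vector) set" where
  "C1_Lip_circle \<alpha> = {g. \<exists>g' \<in> Lip_circle \<alpha>.
     \<forall>t. ((\<lambda>s. g (cis s)) has_vector_derivative g' (cis t)) (at t)}"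

end

theory Submission
  imports Defs "HOL-Complex_Analysis.Complex_Analysis"
begin

text \<open>Write \<open>q = f\<^sup>2\<close>. By density of trigonometric polynomials and boundedness of the shifts, \<open>q\<close> is cyclic
as soon as the closed span \<open>S\<close> of the \<open>\<zeta>\<^sup>n q\<close>, \<open>n \<ge> 0\<close>, contains \<open>\<zeta>\<^sup>-\<^sup>1 q\<close> (then \<open>S\<close> is invariant under
both shifts) and \<open>1\<close>. The two conditions of the theorem correspond to these two requirements. After a
change of \<open>f\<close> on a null set its modulus is everywhere a nonnegative function \<open>g\<close>.

Necessity. If \<open>log \<bar>f\<bar>\<close> is integrable, Szego's theorem gives a positive lower bound for the distance in
\<open>L\<^sup>2\<close> of \<open>\<zeta>\<^sup>-\<^sup>1 q\<close> from \<open>S\<close> (\<open>cyclic_imp_log_not_integrable\<close>). If the zero set carries a measure \<open>\<mu>\<close> of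
finite energy, then integration of Poisson means against \<open>\<mu>\<close> yields in the limit a bounded functional
that annihilates \<open>S\<close> but not \<open>1\<close> (\<open>cyclic_imp_infinite_energy\<close>).

Sufficiency, inverse shift. Let \<open>F = exp Q\<close> be nearly outer with modulus \<open>g + \<epsilon>\<close>. The function
\<open>\<zeta>\<^sup>-\<^sup>1 q (1 - F(0) / F)\<close> belongs to \<open>S\<close>, since \<open>1 - F(0) / F\<close> vanishes at \<open>0\<close>. So it must be shown that
\<open>F(0) q / F\<close> is small. Carleson's formula expresses the Dirichlet integral of \<open>F\<close> by a double integral
of \<open>g\<close>. For a nonnegative function of class \<open>C\<^sup>1\<^sup>+\<^sup>\<alpha>\<close> the values at two points at distance \<open>d\<close> are
comparable up to an error of order \<open>d\<^sup>1\<^sup>+\<^sup>\<alpha>\<close>, and this makes the integral grow at most linearly in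
\<open>l = \<integral> log (1 / (g + \<epsilon>))\<close>. As \<open>\<bar>F(0)\<bar>\<^sup>2\<close> decays exponentially in \<open>l\<close>, and \<open>l\<close> is unbounded
because \<open>log \<bar>f\<bar>\<close> is not integrable, the product is arbitrarily small (\<open>approximable_inverse_shift\<close>).
Here \<open>q / F = f\<^sup>2 / F\<close> has an energy bounded by those of \<open>f\<close> and \<open>F\<close> because \<open>\<bar>f\<bar>\<close> is at most a constant
times \<open>\<bar>F\<bar>\<close>; this is where the square is needed.

Sufficiency, constants. With both shifts available \<open>S\<close> is a module over the bounded functions of the
space. It therefore contains every bounded function of the space vanishing where \<open>g < c\<close> for some
\<open>c > 0\<close>, because \<open>g\<^sup>-\<^sup>1\<close> can be modified there to a Lipschitz function. It remains to find functions of
small norm equal to \<open>1\<close> near the zeros of \<open>g\<close>. If there were none, the functions of nearly minimal norm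
among those that are at least \<open>1\<close> where \<open>g < 1/k\<close> would have nearly nonnegative inner products with all
functions nonnegative there. These inner products are the integrals against measures which, after
normalization, have a weak limit point: a probability measure of finite energy on the zeros of
\<open>g\<close> (\<open>cutoffs_if_infinite_energy\<close>), contradicting capacity zero.\<close>

section \<open>Arc length\<close>

abbreviation ds :: "complex measure" where "ds \<equiv> arc_length"

abbreviation ds2 :: "(complex \<times> complex) measure" where "ds2 \<equiv> ds \<Otimes>\<^sub>M ds"

abbreviation wt :: "int \<Rightarrow> real" where "wt n \<equiv> 1 + \<bar>real_of_int n\<bar>"

abbreviation win :: "nat \<Rightarrow> int set" where "win N \<equiv> {- int N..int N}"

abbreviation meas :: "(complex \<Rightarrow> 'a::topological_space) set" where "meas \<equiv> borel_measurable ds"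

abbreviation HD :: "(complex \<Rightarrow> complex) set" where "HD \<equiv> harmonic_dirichlet"

abbreviation fc :: "(complex \<Rightarrow> complex) \<Rightarrow> int \<Rightarrow> complex" where "fc \<equiv> fourier_coeff"

abbreviation dnorm :: "(complex \<Rightarrow> complex) \<Rightarrow> real" where "dnorm \<equiv> dirichlet_norm"

text \<open>Before completion, so that integrals can be transferred to the parameter interval.\<close>

definition arc_param :: "complex measure" where
 "arc_param = distr (restrict_space lborel {0..<2*pi}) (restrict_space borel circle) cis"

lemma arc_length_eq: "ds = completion arc_param"
 by (simp add: arc_length_def arc_param_def)

lemma borel_measurable_cis [measurable]: "cis \<in> borel_measurable borel"
 by (intro borel_measurable_continuous_onI continuous_intros)

lemma measurable_cis_arc [measurable]:
 "cis \<in> restrict_space lborel {0..<2*pi} \<rightarrow>\<^sub>M restrict_space borel circle"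
 by (intro measurable_restrict_space3) (auto intro: measurable_lborel1 borel_measurable_cis)

lemma space_arc_param [simp]: "space arc_param = circle"
 by (simp add: arc_param_def space_restrict_space)

lemma sets_arc_param [measurable_cong]: "sets arc_param = sets (restrict_space borel circle)"
 by (simp add: arc_param_def)

lemma space_arc_length [simp]: "space ds = circle"
 by (simp add: arc_length_eq)

lemma borel_measurable_arc_param:
 "F \<in> borel \<rightarrow>\<^sub>M N ==> F \<in> arc_param \<rightarrow>\<^sub>M N"
 by (subst measurable_cong_sets[OF sets_arc_param refl]) (rule measurable_restrict_space1)

lemma borel_measurable_arc_length:
 "F \<in> borel \<rightarrow>\<^sub>M N ==> F \<in> ds \<rightarrow>\<^sub>M N"
 unfolding arc_length_eq by (intro measurable_completion borel_measurable_arc_param)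

lemma nn_integral_arc_param:
 assumes F: "F \<in> borel_measurable borel"
 shows "(\<integral>\<^sup>+z. F z \<partial>arc_param) = (\<integral>\<^sup>+t. F (cis t) * indicator {0..<2*pi} t \<partial>lborel)"
proof -
 have "(\<integral>\<^sup>+z. F z \<partial>arc_param) = (\<integral>\<^sup>+t. F (cis t) \<partial>restrict_space lborel {0..<2*pi})"
  unfolding arc_param_def
  by (intro nn_integral_distr measurable_cis_arc) (simp add: F measurable_restrict_space1)
 also have "\<dots> = (\<integral>\<^sup>+t. F (cis t) * indicator {0..<2*pi} t \<partial>lborel)"
  by (subst nn_integral_restrict_space) auto
 finally show ?thesis .
qed

lemma nn_integral_arc_length:
 assumes F: "F \<in> borel_measurable borel"
 shows "(\<integral>\<^sup>+z. F z \<partial>ds) = (\<integral>\<^sup>+t. F (cis t) * indicator {0..<2*pi} t \<partial>lborel)"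
 by (simp add: arc_length_eq nn_integral_completion nn_integral_arc_param[OF F])

lemma nn_integral_arc_param_rotate:
 assumes F[measurable]: "F \<in> borel_measurable borel" and c: "c \<in> circle"
 shows "(\<integral>\<^sup>+z. F (c * z) \<partial>arc_param) = (\<integral>\<^sup>+z. F z \<partial>arc_param)"
proof -
 obtain s where s: "0 \<le> s" "s < 2*pi" "c = cis s"
  using Arg2pi[of c] c by (intro that[of "Arg2pi c"]) (auto simp: cis_conv_exp is_Arg_def)
 have [measurable]: "(\<lambda>x. F (cis x)) \<in> borel_measurable borel" by measurable
 have "(\<integral>\<^sup>+z. F (c * z) \<partial>arc_param) = (\<integral>\<^sup>+t. F (c * cis t) * indicator {0..<2*pi} t \<partial>lborel)"
  by (rule nn_integral_arc_param) measurable
 also have "\<dots> = (\<integral>\<^sup>+t. F (cis (s + t)) * indicator {s..<2*pi+s} (s + t) \<partial>lborel)"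
  by (intro nn_integral_cong) (auto simp: s cis_mult indicator_def)
 also have "\<dots> = (\<integral>\<^sup>+u. F (cis u) * indicator {s..<2*pi+s} u \<partial>lborel)"
  by (subst nn_integral_real_affine[where c=1 and t=s]) auto
 also have "\<dots> = (\<integral>\<^sup>+u. F (cis u) * indicator {s..<2*pi} u + F (cis u) * indicator {2*pi..<2*pi+s} u \<partial>lborel)"
  using s by (intro nn_integral_cong) (auto simp: indicator_def)
 also have "\<dots> = (\<integral>\<^sup>+u. F (cis u) * indicator {s..<2*pi} u \<partial>lborel) + (\<integral>\<^sup>+u. F (cis u) * indicator {2*pi..<2*pi+s} u \<partial>lborel)"
  by (intro nn_integral_add) auto
 also have "(\<integral>\<^sup>+u. F (cis u) * indicator {2*pi..<2*pi+s} u \<partial>lborel) = (\<integral>\<^sup>+u. F (cis (2*pi+1*u)) * indicator {2*pi..<2*pi+s} (2*pi+1*u) \<partial>lborel)"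
  by (subst nn_integral_real_affine[where c=1 and t="2*pi"]) auto
 also have "\<dots> = (\<integral>\<^sup>+u. F (cis u) * indicator {0..<s} u \<partial>lborel)"
  by (intro nn_integral_cong) (auto simp: indicator_def simp flip: cis_mult)
 also have "(\<integral>\<^sup>+u. F (cis u) * indicator {s..<2*pi} u \<partial>lborel) + \<dots> = (\<integral>\<^sup>+u. F (cis u) * indicator {s..<2*pi} u + F (cis u) * indicator {0..<s} u \<partial>lborel)"
  by (intro nn_integral_add[symmetric]) auto
 also have "\<dots> = (\<integral>\<^sup>+u. F (cis u) * indicator {0..<2*pi} u \<partial>lborel)"
  using s by (intro nn_integral_cong) (auto simp: indicator_def)
 also have "\<dots> = (\<integral>\<^sup>+z. F z \<partial>arc_param)"
  by (rule nn_integral_arc_param[symmetric]) measurable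
 finally show ?thesis .
qed

lemma measurable_rotate_arc_param:
 "c \<in> circle ==> (*) c \<in> arc_param \<rightarrow>\<^sub>M arc_param"
 by (subst measurable_cong_sets[OF sets_arc_param sets_arc_param])
   (intro measurable_restrict_space3, auto simp: norm_mult)

lemma distr_arc_param_rotate:
 assumes c: "c \<in> circle"
 shows "distr arc_param arc_param ((*) c) = arc_param"
proof (rule measure_eqI)
 fix X assume X: "X \<in> sets (distr arc_param arc_param ((*) c))"
 then have "X \<in> sets (restrict_space borel circle)" by (simp add: sets_arc_param)
 then have Xb: "X \<in> sets borel" by (subst (asm) sets_restrict_space_iff) auto
 have XA: "X \<in> sets arc_param" using X by simp
 have "emeasure (distr arc_param arc_param ((*) c)) X = (\<integral>\<^sup>+z. indicator X z \<partial>distr arc_param arc_param ((*) c))"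
  using X by simp
 also have "\<dots> = (\<integral>\<^sup>+z. indicator X (c * z) \<partial>arc_param)"
  using XA by (intro nn_integral_distr measurable_rotate_arc_param c) auto
 also have "\<dots> = (\<integral>\<^sup>+z. indicator X z \<partial>arc_param)"
  using Xb by (intro nn_integral_arc_param_rotate c) auto
 also have "\<dots> = emeasure arc_param X" using XA by simp
 finally show "emeasure (distr arc_param arc_param ((*) c)) X = emeasure arc_param X" .
qed simp

lemma measurable_rotate:
 assumes c: "c \<in> circle"
 shows "(*) c \<in> ds \<rightarrow>\<^sub>M ds"
 unfolding arc_length_eq
proof (rule completion.measurable_completion2)
 show "(*) c \<in> completion arc_param \<rightarrow>\<^sub>M arc_param"
  by (intro measurable_completion measurable_rotate_arc_param c)
 show "null_sets arc_param \<subseteq> null_sets (distr (completion arc_param) arc_param ((*) c))"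
  by (simp add: distr_completion measurable_rotate_arc_param[OF c] distr_arc_param_rotate[OF c])
qed

lemma distr_rotate:
 assumes c: "c \<in> circle"
 shows "distr ds ds ((*) c) = ds"
proof -
 have eq: "distr (completion arc_param) arc_param ((*) c) = arc_param"
  by (simp add: distr_completion measurable_rotate_arc_param[OF c] distr_arc_param_rotate[OF c])
 have "completion (distr (completion arc_param) arc_param ((*) c)) = distr (completion arc_param) (completion arc_param) ((*) c)"
  by (rule completion.completion_distr_eq)
    (auto simp: eq intro: measurable_completion measurable_rotate_arc_param c)
 then show ?thesis unfolding arc_length_eq eq by simp
qed

lemma emeasure_arc_length_circle: "emeasure ds circle = ennreal (2*pi)"
proof -
 have "emeasure ds circle = (\<integral>\<^sup>+z. 1 \<partial>ds)"
  by (metis space_arc_length nn_integral_const mult_1)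
 also have "\<dots> = (\<integral>\<^sup>+t. 1 * indicator {0..<2*pi} t \<partial>lborel)"
  by (rule nn_integral_arc_length) simp
 also have "\<dots> = ennreal (2*pi)" by simp
 finally show ?thesis .
qed

interpretation arc: finite_measure ds
 by standard (simp add: emeasure_arc_length_circle)

interpretation arc2: pair_sigma_finite ds ds
 by standard

lemma measure_arc_length: "measure ds circle = 2*pi"
 by (simp add: measure_def emeasure_arc_length_circle)

lemma nn_integral_rotate:
 assumes F: "F \<in> meas" and c: "c \<in> circle"
 shows "(\<integral>\<^sup>+z. F (c * z) \<partial>ds) = (\<integral>\<^sup>+z. F z \<partial>ds)"
 by (subst (2) distr_rotate[OF c, symmetric]) (simp add: nn_integral_distr[OF measurable_rotate[OF c]] F)

lemma integral_rotate:
 fixes F :: "complex \<Rightarrow> 'b::{banach, second_countable_topology}"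
 assumes F: "F \<in> meas" and c: "c \<in> circle"
 shows "(LINT z|ds. F (c * z)) = (LINT z|ds. F z)"
 by (subst (2) distr_rotate[OF c, symmetric]) (simp add: integral_distr[OF measurable_rotate[OF c]] F)

lemma measurable_rotate_comp:
 assumes "F \<in> ds \<rightarrow>\<^sub>M N" "c \<in> circle"
 shows "(\<lambda>z. F (c * z)) \<in> ds \<rightarrow>\<^sub>M N"
 using measurable_comp[OF measurable_rotate[OF assms(2)] assms(1)] by (simp add: comp_def)

lemma null_singleton: "{a} \<in> null_sets ds" if "a \<in> circle"
proof -
 have *: "(\<integral>\<^sup>+z. indicator {a} z \<partial>ds) = (\<integral>\<^sup>+t. indicator {a} (cis t) * indicator {0..<2*pi} t \<partial>lborel)"
  by (rule nn_integral_arc_length) simp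
 have s: "t = Arg2pi a" if "t \<in> {0..<2*pi}" "cis t = a" for t
  using Arg2pi_unique[of 1 t a] that by (simp add: cis_conv_exp)
 let ?s = "Arg2pi a"
 have "(\<integral>\<^sup>+t. indicator {a} (cis t) * indicator {0..<2*pi} t \<partial>lborel) \<le> (\<integral>\<^sup>+t. indicator {?s} t \<partial>lborel)"
 proof (intro nn_integral_mono)
  fix t :: real
  show "indicator {a} (cis t) * indicator {0..<2*pi} t \<le> (indicator {?s} t :: ennreal)"
  proof (cases "t \<in> {0..<2*pi} \<and> cis t = a")
   case True then have "t = ?s" by (intro s) auto
   then show ?thesis by (simp add: indicator_def)
  qed (auto simp: indicator_def)
 qed
 also have "\<dots> = 0" by simp
 finally have 0: "(\<integral>\<^sup>+z. indicator {a} z \<partial>ds) = 0" using * by simp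
 have "{a} \<in> sets arc_param" using that by (simp add: sets_arc_param sets_restrict_space_iff)
 then have "{a} \<in> sets ds" by (simp add: arc_length_eq)
 with 0 show ?thesis by (auto simp: null_sets_def)
qed

lemma AE_neq: "AE z in ds. z \<noteq> a"
proof (cases "a \<in> circle")
 case True from AE_not_in[OF null_singleton[OF this]] show ?thesis by simp
next
 case False then show ?thesis by (intro AE_I2) auto
qed

lemma id_arc_measurable: "(\<lambda>z. z) \<in> meas"
 by (rule borel_measurable_arc_length) simp

lemma borel_measurable_arc_AE:
 fixes f g :: "complex \<Rightarrow> 'b::{second_countable_topology, topological_space}"
 assumes f: "f \<in> meas" and ae: "AE z in ds. f z = g z"
 shows "g \<in> meas"
proof (rule measurableI)
 fix X :: "'b set" assume X: "X \<in> sets borel"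
 have fX: "f -` X \<inter> space ds \<in> sets ds" using f X by (rule measurable_sets)
 show "g -` X \<inter> space ds \<in> sets ds"
  using ae fX unfolding arc_length_eq
  by (intro completion.in_sets_AE[OF _ fX[unfolded arc_length_eq]]) auto
qed auto

lemma borel_version_arc_length:
 assumes "S \<in> sets ds"
 obtains T where "T \<in> sets borel" "T \<subseteq> circle" "AE z in ds. z \<in> S \<longleftrightarrow> z \<in> T"
proof -
 have S: "S \<in> completion arc_param" using assms by (simp add: arc_length_eq)
 have "AE z in ds. z \<in> main_part arc_param S \<longleftrightarrow> z \<in> S"
  unfolding arc_length_eq by (rule AE_completion[OF AE_in_main_part[OF S]])
 moreover have "main_part arc_param S \<in> sets arc_param" using S by simp
 then have "main_part arc_param S \<in> sets borel \<and> main_part arc_param S \<subseteq> circle"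
  by (simp add: sets_arc_param sets_restrict_space_iff)
 ultimately show ?thesis by (intro that[of "main_part arc_param S"]) auto
qed

section \<open>Integrals of powers of the coordinate\<close>

lemma circle_nonzero: "z \<in> circle ==> z \<noteq> 0" by auto

lemma circle_mult_cnj: "z \<in> circle ==> z * cnj z = 1"
 by (simp add: complex_norm_square[symmetric])

lemma cnj_circle: "z \<in> circle ==> cnj z = inverse z"
 by (metis circle_mult_cnj inverse_unique)

lemma cnj_powi: "cnj (z powi n) = cnj z powi n"
 by (simp add: power_int_def)

lemma circle_cnj_powi: "z \<in> circle ==> cnj z powi n = z powi (-n)"
 by (simp add: cnj_circle power_int_minus power_int_inverse)

lemma circle_cmod_powi: "z \<in> circle ==> cmod (z powi n) = 1"
 by (simp add: norm_power_int)

lemma circle_powi_add: "z \<in> circle ==> z powi m * z powi n = z powi (m + n)"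
 by (subst power_int_add) auto

lemma circle_mult: "z \<in> circle ==> w \<in> circle ==> z * w \<in> circle"
 by (simp add: norm_mult)

lemma circle_cnj: "z \<in> circle ==> cnj z \<in> circle" by simp

lemma measurable_powi [measurable]: "(\<lambda>z::complex. z powi n) \<in> borel_measurable borel"
 unfolding power_int_def by measurable

lemma measurable_powi_arc: "(\<lambda>z::complex. z powi n) \<in> meas"
 by (rule borel_measurable_arc_length) measurable

lemma integrable_arc_bounded:
 fixes h :: "complex \<Rightarrow> 'b::{banach, second_countable_topology}"
 assumes "h \<in> meas" "\<And>z. z \<in> circle ==> norm (h z) \<le> B"
 shows "integrable ds h"
 using assms by (intro arc.integrable_const_bound[where B=B]) auto

lemma integrable_mult_bounded:
 fixes h k :: "complex \<Rightarrow> complex"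
 assumes h: "integrable ds h" and k: "k \<in> meas"
  and B: "\<And>z. z \<in> circle ==> norm (k z) \<le> B"
 shows "integrable ds (\<lambda>z. k z * h z)"
proof (rule Bochner_Integration.integrable_bound)
 show "integrable ds (\<lambda>z. B * norm (h z))" using h by auto
 show "(\<lambda>z. k z * h z) \<in> meas" using h k by measurable
 show "AE z in ds. norm (k z * h z) \<le> norm (B * norm (h z))"
 proof (rule AE_I2)
  fix z assume "z \<in> space ds"
  then have "norm (k z) * norm (h z) \<le> B * norm (h z)" by (intro mult_right_mono B) auto
  then show "norm (k z * h z) \<le> norm (B * norm (h z))" by (simp add: norm_mult)
 qed
qed

lemma norm_integral_arc_le:
 fixes h :: "complex \<Rightarrow> 'b::{banach, second_countable_topology}"
 assumes "h \<in> meas" and B: "\<And>z. z \<in> circle ==> norm (h z) \<le> B"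
 shows "norm (LINT z|ds. h z) \<le> 2 * pi * B"
proof -
 have "norm (LINT z|ds. h z) \<le> (LINT z|ds. norm (h z))" by (rule integral_norm_bound)
 also have "\<dots> \<le> (LINT z|ds. B)"
  using assms by (intro integral_mono) (auto intro!: integrable_arc_bounded[where B=B])
 also have "\<dots> = 2 * pi * B" by (simp add: measure_arc_length)
 finally show ?thesis .
qed

lemma integral_powi: "(LINT z|ds. z powi n) = (if n = 0 then 2 * pi else 0)"
proof (cases "n = 0")
 case True then show ?thesis by (simp add: measure_arc_length scaleR_conv_of_real)
next
 case False
 let ?c = "cis (pi / of_int n)"
 have c: "?c \<in> circle" by simp
 have cn: "?c powi n = -1" using False by (simp add: cis_power_int)
 have "(LINT z|ds. z powi n) = (LINT z|ds. (?c * z) powi n)"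
  by (rule integral_rotate[OF _ c, symmetric]) (rule measurable_powi_arc)
 also have "\<dots> = (LINT z|ds. - (z powi n))" by (simp add: power_int_mult_distrib cn)
 also have "\<dots> = - (LINT z|ds. z powi n)" by simp
 finally show ?thesis using False by simp
qed

lemma integrable_powi: "integrable ds (\<lambda>z. z powi n)"
 by (rule integrable_arc_bounded[where B=1]) (auto simp: measurable_powi_arc circle_cmod_powi)

section \<open>Convolution with positive kernels\<close>

definition trig_sum :: "(int \<Rightarrow> complex) \<Rightarrow> nat \<Rightarrow> complex \<Rightarrow> complex" where
 "trig_sum c N z = (\<Sum>n\<in>win N. c n * z powi n)"

lemma measurable_trig_sum [measurable]: "trig_sum c N \<in> borel_measurable borel"
 unfolding trig_sum_def[abs_def] by measurable

lemma measurable_trig_sum_arc: "trig_sum c N \<in> meas"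
 by (rule borel_measurable_arc_length) measurable

lemma trig_sum_bound: "z \<in> circle ==> cmod (trig_sum c N z) \<le> (\<Sum>n\<in>win N. cmod (c n))"
 unfolding trig_sum_def
 by (rule order_trans[OF norm_sum]) (simp add: norm_mult circle_cmod_powi)

text \<open>The requirements that the Fejer and Poisson kernels have in common: \<open>\<kappa>\<close> is the multiplier sequence,
\<open>k\<close> the kernel, a nonnegative function of mean \<open>1\<close> with uniformly convergent Fourier series.\<close>

definition is_kernel :: "(int \<Rightarrow> real) \<Rightarrow> (complex \<Rightarrow> real) \<Rightarrow> bool" where
 "is_kernel \<kappa> k \<longleftrightarrow> k \<in> borel_measurable borel \<and> (\<forall>\<tau>\<in>circle. 0 \<le> k \<tau>) \<and> \<kappa> 0 = 1 \<and> (\<forall>n. \<kappa> (-n) = \<kappa> n) \<and>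
  (\<exists>e. e \<longlonglongrightarrow> 0 \<and> (\<forall>N. \<forall>\<tau>\<in>circle. cmod (of_real (k \<tau>) - trig_sum (\<lambda>n. of_real (\<kappa> n)) N \<tau>) \<le> e N))"

definition conv :: "(complex \<Rightarrow> real) \<Rightarrow> (complex \<Rightarrow> complex) \<Rightarrow> complex \<Rightarrow> complex" where
 "conv k h z = (LINT \<xi>|ds. of_real (k (z * cnj \<xi>)) * h \<xi>) / (2 * pi)"

lemma kernel_measurable: "is_kernel \<kappa> k ==> k \<in> borel_measurable borel"
 and kernel_nonneg: "is_kernel \<kappa> k ==> \<tau> \<in> circle ==> 0 \<le> k \<tau>"
 by (auto simp: is_kernel_def)

lemma kernel_bounded:
 assumes "is_kernel \<kappa> k" obtains B where "\<And>\<tau>. \<tau> \<in> circle ==> \<bar>k \<tau>\<bar> \<le> B"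
proof -
 from assms obtain e where e: "\<And>N \<tau>. \<tau> \<in> circle ==> cmod (of_real (k \<tau>) - trig_sum (\<lambda>n. of_real (\<kappa> n)) N \<tau>) \<le> e N"
  unfolding is_kernel_def by blast
 have "\<bar>k \<tau>\<bar> \<le> e 0 + \<bar>\<kappa> 0\<bar>" if "\<tau> \<in> circle" for \<tau>
  using e[OF that, of 0] norm_triangle_sub[of "of_real (k \<tau>)" "trig_sum (\<lambda>n. of_real (\<kappa> n)) 0 \<tau> :: complex"]
  by (simp add: trig_sum_def)
 then show ?thesis by (rule that)
qed

lemma measurable_kernel_arc:
 assumes k: "is_kernel \<kappa> k"
 shows "(\<lambda>\<xi>. k (z * cnj \<xi>)) \<in> meas"
proof (rule borel_measurable_arc_length)
 note [measurable] = kernel_measurable[OF k]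
 have [measurable]: "cnj \<in> borel_measurable borel"
  by (intro borel_measurable_continuous_onI continuous_intros)
 show "(\<lambda>\<xi>. k (z * cnj \<xi>)) \<in> borel_measurable borel" by measurable
qed

lemma integrable_conv:
 assumes k: "is_kernel \<kappa> k" and h: "integrable ds h" and z: "z \<in> circle"
 shows "integrable ds (\<lambda>\<xi>. complex_of_real (k (z * cnj \<xi>)) * h \<xi>)"
proof -
 obtain B where "\<And>\<tau>. \<tau> \<in> circle ==> \<bar>k \<tau>\<bar> \<le> B" using kernel_bounded[OF k] by blast
 moreover have "(\<lambda>\<xi>. complex_of_real (k (z * cnj \<xi>))) \<in> meas"
  using measurable_kernel_arc[OF k, of z] by measurable
 ultimately show ?thesis using z
  by (intro integrable_mult_bounded[OF h, where B=B]) (auto simp: norm_mult)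
qed

lemma fourier_coeff_integrable:
 assumes "integrable ds h"
 shows "integrable ds (\<lambda>\<xi>. h \<xi> * cnj \<xi> powi n)"
proof -
 have "integrable ds (\<lambda>\<xi>. cnj \<xi> powi n * h \<xi>)"
 proof (rule integrable_mult_bounded[OF assms, where B=1])
  have [measurable]: "cnj \<in> borel_measurable borel"
   by (intro borel_measurable_continuous_onI continuous_intros)
  show "(\<lambda>\<xi>. cnj \<xi> powi n) \<in> meas"
   by (rule borel_measurable_arc_length) measurable
 qed (simp add: circle_cmod_powi circle_cnj)
 then show ?thesis by (simp add: mult.commute)
qed

lemma trig_sum_conv:
 assumes h: "integrable ds h"
 shows "(LINT \<xi>|ds. trig_sum c N (z * cnj \<xi>) * h \<xi>) / (2 * pi) = trig_sum (\<lambda>n. c n * fc h n) N z"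
proof -
 have "(LINT \<xi>|ds. trig_sum c N (z * cnj \<xi>) * h \<xi>)
   = (LINT \<xi>|ds. (\<Sum>n\<in>win N. (c n * z powi n) * (h \<xi> * cnj \<xi> powi n)))"
  unfolding trig_sum_def sum_distrib_right
  by (intro Bochner_Integration.integral_cong sum.cong refl) (simp add: power_int_mult_distrib mult_ac)
 also have "\<dots> = (\<Sum>n\<in>win N. (c n * z powi n) * (LINT \<xi>|ds. h \<xi> * cnj \<xi> powi n))"
  by (subst Bochner_Integration.integral_sum) (auto intro: fourier_coeff_integrable[OF h])
 finally show ?thesis by (simp add: trig_sum_def fourier_coeff_def sum_divide_distrib mult_ac)
qed

lemma conv_limit:
 assumes k: "is_kernel \<kappa> k" and h: "integrable ds h"
 obtains e where "e \<longlonglongrightarrow> 0"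
  "\<And>N z. z \<in> circle ==> cmod (conv k h z - trig_sum (\<lambda>n. of_real (\<kappa> n) * fc h n) N z) \<le> e N"
proof -
 from k obtain e where e: "e \<longlonglongrightarrow> 0" "\<And>N \<tau>. \<tau> \<in> circle ==> cmod (of_real (k \<tau>) - trig_sum (\<lambda>n. of_real (\<kappa> n)) N \<tau>) \<le> e N"
  unfolding is_kernel_def by blast
 let ?I = "(LINT \<xi>|ds. cmod (h \<xi>)) / (2*pi)"
 let ?T = "trig_sum (\<lambda>n. complex_of_real (\<kappa> n))"
 show ?thesis
 proof (rule that[of "\<lambda>N. e N * ?I"])
  show "(\<lambda>N. e N * ?I) \<longlonglongrightarrow> 0" by (rule tendsto_mult_left_zero[OF e(1)])
  fix N z assume z: "z \<in> circle"
  have m: "(\<lambda>\<xi>. ?T N (z * cnj \<xi>)) \<in> meas"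
  proof (rule borel_measurable_arc_length)
   have [measurable]: "cnj \<in> borel_measurable borel"
    by (intro borel_measurable_continuous_onI continuous_intros)
   show "(\<lambda>\<xi>. ?T N (z * cnj \<xi>)) \<in> borel_measurable borel" by measurable
  qed
  have i1: "integrable ds (\<lambda>\<xi>. ?T N (z * cnj \<xi>) * h \<xi>)"
   by (rule integrable_mult_bounded[OF h m]) (rule trig_sum_bound[OF circle_mult[OF z circle_cnj]])
  note i2 = integrable_conv[OF k h z]
  have "conv k h z - trig_sum (\<lambda>n. of_real (\<kappa> n) * fc h n) N z
    = (LINT \<xi>|ds. (of_real (k (z * cnj \<xi>)) - ?T N (z * cnj \<xi>)) * h \<xi>) / (2*pi)"
   unfolding conv_def trig_sum_conv[OF h, symmetric]
   by (simp add: left_diff_distrib Bochner_Integration.integral_diff[OF i2 i1] diff_divide_distrib)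
  also have "cmod \<dots> \<le> (LINT \<xi>|ds. cmod ((of_real (k (z * cnj \<xi>)) - ?T N (z * cnj \<xi>)) * h \<xi>)) / (2*pi)"
   by (simp add: norm_divide integral_norm_bound divide_right_mono)
  also have "\<dots> \<le> (LINT \<xi>|ds. e N * cmod (h \<xi>)) / (2*pi)"
  proof (intro divide_right_mono integral_mono)
   show "integrable ds (\<lambda>\<xi>. cmod ((of_real (k (z * cnj \<xi>)) - ?T N (z * cnj \<xi>)) * h \<xi>))"
    using Bochner_Integration.integrable_diff[OF i2 i1] by (simp add: left_diff_distrib)
   show "integrable ds (\<lambda>\<xi>. e N * cmod (h \<xi>))" using h by auto
  qed (auto simp: norm_mult intro!: mult_right_mono e(2) circle_mult z[simplified])
  finally show "cmod (conv k h z - trig_sum (\<lambda>n. of_real (\<kappa> n) * fc h n) N z) \<le> e N * ?I"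
   by simp
 qed
qed

lemma conv_tendsto:
 assumes k: "is_kernel \<kappa> k" and h: "integrable ds h" and z: "z \<in> circle"
 shows "(\<lambda>N. trig_sum (\<lambda>n. of_real (\<kappa> n) * fc h n) N z) \<longlonglongrightarrow> conv k h z"
proof -
 obtain e where e: "e \<longlonglongrightarrow> 0"
  "\<And>N z. z \<in> circle ==> cmod (conv k h z - trig_sum (\<lambda>n. of_real (\<kappa> n) * fc h n) N z) \<le> e N"
  using conv_limit[OF k h] by blast
 have "(\<lambda>N. trig_sum (\<lambda>n. of_real (\<kappa> n) * fc h n) N z - conv k h z) \<longlonglongrightarrow> 0"
  by (rule Lim_null_comparison[OF _ e(1)]) (use e(2)[OF z] in \<open>auto simp: norm_minus_commute\<close>)
 then show ?thesis by (simp add: LIM_zero_cancel)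
qed

lemma fourier_coeff_powi: "fc (\<lambda>z. z powi m) n = (if m = n then 1 else 0)"
proof -
 have "(LINT z|ds. z powi m * cnj z powi n) = (LINT z|ds. z powi (m - n))"
  by (rule Bochner_Integration.integral_cong) (auto simp: circle_cnj_powi circle_powi_add)
 then show ?thesis by (simp add: fourier_coeff_def integral_powi)
qed

lemma conv_powi:
 assumes k: "is_kernel \<kappa> k" and z: "z \<in> circle"
 shows "conv k (\<lambda>z. z powi m) z = of_real (\<kappa> m) * z powi m"
proof (rule LIMSEQ_unique[OF conv_tendsto[OF k integrable_powi z]])
 show "(\<lambda>N. trig_sum (\<lambda>n. of_real (\<kappa> n) * fc (\<lambda>z. z powi m) n) N z) \<longlonglongrightarrow> of_real (\<kappa> m) * z powi m"
 proof (rule tendsto_eventually, rule eventually_sequentiallyI[of "nat \<bar>m\<bar>"])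
  fix N assume "nat \<bar>m\<bar> \<le> N"
  then have "m \<in> win N" by auto
  then show "trig_sum (\<lambda>n. of_real (\<kappa> n) * fc (\<lambda>z. z powi m) n) N z = of_real (\<kappa> m) * z powi m"
   by (simp add: trig_sum_def fourier_coeff_powi if_distrib if_distribR sum.delta cong: if_cong)
 qed
qed

lemma kernel_integral:
 assumes k: "is_kernel \<kappa> k" and z: "z \<in> circle"
 shows "(LINT \<xi>|ds. k (z * cnj \<xi>)) = 2 * pi"
proof -
 have "conv k (\<lambda>z. z powi 0) z = 1" using conv_powi[OF k z, of 0] k by (simp add: is_kernel_def)
 then have "complex_of_real (LINT \<xi>|ds. k (z * cnj \<xi>)) = of_real (2*pi)"
  by (simp add: conv_def divide_eq_1_iff split: if_splits)
 then show ?thesis by (simp only: of_real_eq_iff)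
qed

lemma kernel_integrable:
 assumes k: "is_kernel \<kappa> k" and z: "z \<in> circle"
 shows "integrable ds (\<lambda>\<xi>. k (z * cnj \<xi>))"
proof -
 obtain B where "\<And>\<tau>. \<tau> \<in> circle ==> \<bar>k \<tau>\<bar> \<le> B" using kernel_bounded[OF k] by blast
 then show ?thesis using z
  by (intro integrable_arc_bounded[where B=B] measurable_kernel_arc[OF k]) (auto simp: norm_mult)
qed

lemma cmod_diff_circle_sq:
 assumes "z \<in> circle" "w \<in> circle"
 shows "(cmod (z - w))^2 = 2 - 2 * Re (z * cnj w)"
proof -
 have "(Re z)^2 + (Im z)^2 = 1" "(Re w)^2 + (Im w)^2 = 1"
  using assms by (auto simp flip: cmod_power2)
 then show ?thesis by (simp add: cmod_power2 power2_diff algebra_simps)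
qed

lemma kernel_second_moment:
 assumes k: "is_kernel \<kappa> k" and z: "z \<in> circle"
 shows "(LINT \<xi>|ds. k (z * cnj \<xi>) * (cmod (\<xi> - z))^2) = 2 * pi * (2 - 2 * \<kappa> 1)"
proof -
 have i: "integrable ds (\<lambda>\<xi>. of_real (k (z * cnj \<xi>)) * \<xi> powi 1)"
  by (rule integrable_conv[OF k integrable_powi z])
 have "(LINT \<xi>|ds. of_real (k (z * cnj \<xi>)) * \<xi> powi 1) = 2 * pi * (of_real (\<kappa> 1) * z)"
  using conv_powi[OF k z, of 1] by (simp add: conv_def field_simps)
 then have 1: "(LINT \<xi>|ds. cnj z * (of_real (k (z * cnj \<xi>)) * \<xi>)) = cnj z * (2 * pi * (of_real (\<kappa> 1) * z))"
  by simp
 have i': "integrable ds (\<lambda>\<xi>. cnj z * (of_real (k (z * cnj \<xi>)) * \<xi>))"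
  using integrable_mult_right[OF i, of "cnj z"] by simp
 define H where "H = (\<lambda>\<xi>. cnj z * (complex_of_real (k (z * cnj \<xi>)) * \<xi>))"
 have iH: "integrable ds H" using i' by (simp add: H_def)
 have "(LINT \<xi>|ds. k (z * cnj \<xi>) * (cmod (\<xi> - z))^2)
   = (LINT \<xi>|ds. 2 * k (z * cnj \<xi>) - 2 * Re (H \<xi>))"
  using z by (intro Bochner_Integration.integral_cong refl) (subst cmod_diff_circle_sq, auto simp: algebra_simps H_def)
 also have "\<dots> = 2 * (LINT \<xi>|ds. k (z * cnj \<xi>)) - 2 * Re (LINT \<xi>|ds. H \<xi>)"
  using kernel_integrable[OF k z] iH
  by (subst Bochner_Integration.integral_diff) (auto simp: integral_Re)
 also have "\<dots> = 2 * (2 * pi) - 2 * (2 * pi * \<kappa> 1 * Re (cnj z * z))"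
  unfolding H_def 1 kernel_integral[OF k z] by (simp add: algebra_simps)
 also have "cnj z * z = 1" using circle_mult_cnj[OF z] by (simp add: mult.commute)
 finally show ?thesis by (simp add: algebra_simps)
qed

lemma conv_abs_le:
 assumes k: "is_kernel \<kappa> k" and h: "integrable ds h" and z: "z \<in> circle"
  and h': "integrable ds h'" and le: "\<And>w. w \<in> circle ==> cmod (h w) \<le> h' w"
 shows "cmod (conv k h z) \<le> Re (conv k (\<lambda>w. of_real (h' w)) z)"
proof -
 have eq: "conv k (\<lambda>w. of_real (h' w)) z = of_real ((LINT \<xi>|ds. k (z * cnj \<xi>) * h' \<xi>) / (2*pi))"
  unfolding conv_def by (simp flip: of_real_mult)
 have i': "integrable ds (\<lambda>\<xi>. of_real (k (z * cnj \<xi>)) * complex_of_real (h' \<xi>))"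
  using integrable_conv[OF k _ z, of "\<lambda>w. of_real (h' w)"] h' by auto
 have i: "integrable ds (\<lambda>\<xi>. k (z * cnj \<xi>) * h' \<xi>)"
  using integrable_Re[OF i'] by simp
 have "cmod (conv k h z) \<le> (LINT \<xi>|ds. cmod (of_real (k (z * cnj \<xi>)) * h \<xi>)) / (2*pi)"
  unfolding conv_def by (simp add: norm_divide integral_norm_bound divide_right_mono)
 also have "\<dots> \<le> (LINT \<xi>|ds. k (z * cnj \<xi>) * h' \<xi>) / (2*pi)"
 proof (intro divide_right_mono integral_mono i)
  show "integrable ds (\<lambda>\<xi>. cmod (of_real (k (z * cnj \<xi>)) * h \<xi>))"
   using integrable_conv[OF k h z] by auto
  fix \<xi> assume "\<xi> \<in> space ds"
  then have x: "\<xi> \<in> circle" by simp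
  have "0 \<le> k (z * cnj \<xi>)" using kernel_nonneg[OF k circle_mult[OF z circle_cnj[OF x]]] .
  then show "cmod (of_real (k (z * cnj \<xi>)) * h \<xi>) \<le> k (z * cnj \<xi>) * h' \<xi>"
   using le[OF x] by (simp add: norm_mult mult_left_mono)
 qed auto
 finally show ?thesis by (simp add: eq)
qed

lemma conv_const: "is_kernel \<kappa> k ==> z \<in> circle ==> conv k (\<lambda>_. c) z = c"
proof -
 assume "is_kernel \<kappa> k" "z \<in> circle"
 then have "(LINT \<xi>|ds. complex_of_real (k (z * cnj \<xi>))) = 2*pi"
  by (simp add: kernel_integral)
 then show ?thesis by (simp add: conv_def)
qed

lemma conv_bound:
 assumes k: "is_kernel \<kappa> k" and h: "h \<in> meas" and z: "z \<in> circle"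
  and M: "\<And>w. w \<in> circle ==> cmod (h w) \<le> M"
 shows "cmod (conv k h z) \<le> M"
 using conv_abs_le[OF k integrable_arc_bounded[OF h M] z, of "\<lambda>_. M"] M conv_const[OF k z]
 by (simp add: arc.integrable_const)

lemma conv_diff:
 assumes k: "is_kernel \<kappa> k" and h: "integrable ds h" "integrable ds h'" and z: "z \<in> circle"
 shows "conv k (\<lambda>w. h w - h' w) z = conv k h z - conv k h' z"
 using integrable_conv[OF k h(1) z] integrable_conv[OF k h(2) z]
 by (simp add: conv_def right_diff_distrib diff_divide_distrib)

text \<open>Since the second moment of a positive kernel around \<open>1\<close> is \<open>2 - 2 \<kappa>(1)\<close>, the
 Cauchy--Schwarz inequality bounds the mean of \<open>\<bar>\<tau> - 1\<bar>\<close> by the root of that number.\<close>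

lemma conv_lipschitz_at:
 assumes k: "is_kernel \<kappa> k" and h: "h \<in> meas" and z: "z \<in> circle" and L: "0 \<le> L"
  and lip: "\<And>w. w \<in> circle ==> cmod (h w - h z) \<le> L * cmod (w - z)" and s: "2 - 2 * \<kappa> 1 \<le> s^2" "0 < s"
 shows "cmod (conv k h z - h z) \<le> L * s"
proof -
 have hb: "integrable ds (\<lambda>w. h w - h z)"
 proof (rule integrable_arc_bounded[where B="L * 2"])
  fix w assume w: "w \<in> circle"
  have "cmod (w - z) \<le> 2" using norm_triangle_ineq4[of w z] w z by simp
  then have "L * cmod (w - z) \<le> L * 2" using L by (intro mult_left_mono)
  then show "cmod (h w - h z) \<le> L * 2" using lip[OF w] by simp
 qed (use h in measurable)
 have hi: "integrable ds h"
  using Bochner_Integration.integrable_add[OF hb arc.integrable_const[of "h z"]] by simp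
 let ?h' = "\<lambda>w. L * (s / 2 + (cmod (w - z))^2 / (2 * s))"
 have m2: "(\<lambda>w. (cmod (w - z))^2) \<in> meas"
  by (rule borel_measurable_arc_length) measurable
 have b2: "(cmod (w - z))^2 \<le> 4" if "w \<in> circle" for w
 proof -
  have "cmod (w - z) \<le> 2" using norm_triangle_ineq4[of w z] that z by simp
  then show ?thesis using power_mono[of "cmod (w-z)" 2 2] by simp
 qed
 have h2: "integrable ds (\<lambda>w. (cmod (w - z))^2)"
  using b2 m2 by (intro integrable_arc_bounded[where B=4]) auto
 have h'i: "integrable ds ?h'" using h2 by auto
 have i1: "integrable ds (\<lambda>\<xi>. k (z * cnj \<xi>))" by (rule kernel_integrable[OF k z])
 have i2: "integrable ds (\<lambda>\<xi>. k (z * cnj \<xi>) * (cmod (\<xi> - z))^2)"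
  using integrable_Re[OF integrable_conv[OF k _ z, of "\<lambda>w. of_real ((cmod (w - z))^2)"]] h2
  by (auto simp flip: of_real_mult of_real_power)
 have "conv k h z - h z = conv k (\<lambda>w. h w - h z) z"
  using conv_diff[OF k hi arc.integrable_const z, of "h z"] conv_const[OF k z] by simp
 also have "cmod \<dots> \<le> Re (conv k (\<lambda>w. of_real (?h' w)) z)"
 proof (rule conv_abs_le[OF k hb z h'i])
  fix w assume w: "w \<in> circle"
  have "0 \<le> (cmod (w - z) - s)^2" by simp
  then have "cmod (w - z) * (2 * s) \<le> s * s + (cmod (w - z))^2" by (simp add: power2_diff power2_eq_square algebra_simps)
  then have "cmod (w - z) \<le> s / 2 + (cmod (w - z))^2 / (2 * s)" using s(2) by (simp add: field_simps)
  then show "cmod (h w - h z) \<le> ?h' w" using lip[OF w] mult_left_mono[OF _ L] by (meson order_trans)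
 qed
 also have "conv k (\<lambda>w. of_real (?h' w)) z = of_real ((LINT \<xi>|ds. k (z * cnj \<xi>) * ?h' \<xi>) / (2*pi))"
  unfolding conv_def by (simp flip: of_real_mult of_real_divide of_real_add of_real_power)
 also have "(LINT \<xi>|ds. k (z * cnj \<xi>) * ?h' \<xi>) = (LINT \<xi>|ds. L * s / 2 * k (z * cnj \<xi>) + L / (2 * s) * (k (z * cnj \<xi>) * (cmod (\<xi> - z))^2))"
  by (intro Bochner_Integration.integral_cong) (auto simp: field_simps)
 also have "\<dots> = L * s / 2 * (2*pi) + L / (2 * s) * (2 * pi * (2 - 2 * \<kappa> 1))"
  using i1 i2 by (simp add: kernel_integral[OF k z] kernel_second_moment[OF k z])
 also have "Re (of_real (\<dots> / (2*pi))) = L * s / 2 + L / (2 * s) * (2 - 2 * \<kappa> 1)"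
  by (simp add: field_simps)
 also have "\<dots> \<le> L * s / 2 + L / (2 * s) * s^2"
  using L s by (intro add_left_mono mult_left_mono) auto
 also have "\<dots> = L * s" using s(2) by (simp add: field_simps power2_eq_square)
 finally show ?thesis by simp
qed

lemma conv_rotate:
 assumes k: "is_kernel \<kappa> k" and h: "h \<in> meas" and c: "c \<in> circle"
 shows "conv k h (c * z) = conv k (\<lambda>w. h (c * w)) z"
proof -
 have "(\<lambda>\<xi>. of_real (k (c * z * cnj \<xi>)) * h \<xi>) \<in> meas"
  using measurable_kernel_arc[OF k, of "c * z"] h by measurable
 from integral_rotate[OF this c]
 have 1: "(LINT \<xi>|ds. of_real (k (c * z * cnj \<xi>)) * h \<xi>) = (LINT \<xi>|ds. of_real (k (c * z * cnj (c * \<xi>))) * h (c * \<xi>))" by simp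
 have 2: "c * z * cnj (c * \<xi>) = z * cnj \<xi>" for \<xi>
 proof -
  have "c * z * cnj (c * \<xi>) = (c * cnj c) * (z * cnj \<xi>)" by (simp add: mult_ac)
  then show ?thesis by (simp only: circle_mult_cnj[OF c] mult_1)
 qed
 show ?thesis unfolding conv_def 1 2 ..
qed

lemma conv_lipschitz:
 assumes k: "is_kernel \<kappa> k" and h: "h \<in> meas" and zw: "z \<in> circle" "w \<in> circle"
  and hi: "integrable ds h"
  and lip: "\<And>z w. z \<in> circle ==> w \<in> circle ==> cmod (h z - h w) \<le> L * cmod (z - w)"
 shows "cmod (conv k h z - conv k h w) \<le> L * cmod (z - w)"
proof -
 let ?c = "z * cnj w"
 have c: "?c \<in> circle" using zw by (intro circle_mult circle_cnj)
 have cw: "?c * w = z" using circle_mult_cnj[OF zw(2)] by (simp add: mult_ac)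
 have m: "(\<lambda>v. h (?c * v)) \<in> meas" by (rule measurable_rotate_comp[OF h c])
 have i: "integrable ds (\<lambda>v. h (?c * v))"
  using hi integrable_distr[OF measurable_rotate[OF c], of h] by (simp add: distr_rotate[OF c])
 have eq: "cmod (?c * v - v) = cmod (z - w)" if "v \<in> circle" for v
 proof -
  have "(?c - 1) * w = z - w" by (simp only: left_diff_distrib mult_1 cw)
  then have "cmod (z - w) = cmod ((?c - 1) * w)" by (simp only:)
  also have "\<dots> = cmod ((?c - 1) * v)" using zw that by (simp add: norm_mult)
  finally show ?thesis by (simp only: left_diff_distrib mult_1)
 qed
 have "conv k h z - conv k h w = conv k (\<lambda>v. h (?c * v)) w - conv k h w"
  using conv_rotate[OF k h c, of w] cw by simp
 also have "\<dots> = conv k (\<lambda>v. h (?c * v) - h v) w" by (rule conv_diff[OF k i hi zw(2), symmetric])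
 also have "cmod \<dots> \<le> L * cmod (z - w)"
 proof (rule conv_bound[OF k _ zw(2)])
  show "(\<lambda>v. h (?c * v) - h v) \<in> meas" using m h by measurable
  fix v assume v: "v \<in> circle"
  show "cmod (h (?c * v) - h v) \<le> L * cmod (z - w)"
   using lip[OF circle_mult[OF c v] v] by (simp add: eq[OF v])
 qed
 finally show ?thesis .
qed

section \<open>The Fejer and Poisson kernels\<close>

definition fejer :: "nat \<Rightarrow> complex \<Rightarrow> real" where
 "fejer N \<tau> = (cmod (\<Sum>k\<le>N. \<tau> ^ k))^2 / (N + 1)"

definition fejer_mult :: "nat \<Rightarrow> int \<Rightarrow> real" where
 "fejer_mult N n = max 0 (1 - \<bar>real_of_int n\<bar> / (N + 1))"

lemma sum_int_Suc:
 fixes f :: "int \<Rightarrow> 'a::comm_monoid_add"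
 shows "(\<Sum>n\<in>{-int (Suc N)..int (Suc N)}. f n) = f (int (Suc N)) + f (- int (Suc N)) + (\<Sum>n\<in>win N. f n)"
proof -
 have "{-int (Suc N)..int (Suc N)} = insert (int (Suc N)) (insert (- int (Suc N)) (win N))" by auto
 then show ?thesis by (simp add: add.assoc)
qed

lemma norm_square_geometric_sum:
 assumes t: "\<tau> \<in> circle"
 shows "complex_of_real ((cmod (\<Sum>k\<le>N. \<tau> ^ k))^2) = (\<Sum>n\<in>win N. of_real (N + 1 - \<bar>real_of_int n\<bar>) * \<tau> powi n)"
proof (induction N)
 case 0 show ?case by simp
next
 case (Suc N)
 let ?D = "\<Sum>k\<le>N. \<tau> ^ k"
 have tN: "\<tau> ^ Suc N * cnj (\<tau> ^ Suc N) = 1"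
  using t by (intro circle_mult_cnj) (simp add: norm_power norm_mult)
 have sums: "(\<Sum>n\<in>win M. \<tau> powi n) = 1 + (\<Sum>k<M. \<tau> ^ Suc k) + (\<Sum>k<M. cnj \<tau> ^ Suc k)" for M
 proof (induction M)
  case (Suc M)
  have "\<tau> powi (- int (Suc M)) = cnj \<tau> ^ Suc M" using circle_cnj_powi[OF t, of "int (Suc M)"] by (simp only: power_int_of_nat)
  moreover have "\<tau> powi (int (Suc M)) = \<tau> ^ Suc M" by (rule power_int_of_nat)
  ultimately show ?case unfolding sum_int_Suc Suc by simp
 qed simp
 have cD: "cnj (\<tau> ^ Suc N) * ?D = (\<Sum>k<Suc N. cnj \<tau> ^ Suc k)"
 proof -
  have "cnj (\<tau> ^ Suc N) * ?D = (\<Sum>k\<le>N. cnj \<tau> ^ Suc (N - k))"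
   unfolding sum_distrib_left
  proof (rule sum.cong)
   fix k assume "k \<in> {..N}"
   then have "Suc N = Suc (N - k) + k" by auto
   then have "cnj (\<tau> ^ Suc N) * \<tau> ^ k = cnj \<tau> ^ Suc (N - k) * (cnj \<tau> * \<tau>) ^ k"
    by (simp add: power_mult_distrib power_add[of _ "N - k" k, symmetric] flip: mult.assoc)
   then show "cnj (\<tau> ^ Suc N) * \<tau> ^ k = cnj \<tau> ^ Suc (N - k)" using circle_mult_cnj[OF t] by (simp add: mult.commute)
  qed simp
  also have "\<dots> = (\<Sum>k\<le>N. cnj \<tau> ^ Suc k)"
   by (rule sum.reindex_bij_witness[where i="\<lambda>k. N - k" and j="\<lambda>k. N - k"]) auto
  finally show ?thesis by (simp add: lessThan_Suc_atMost)
 qed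
 have cD': "\<tau> ^ Suc N * cnj ?D = (\<Sum>k<Suc N. \<tau> ^ Suc k)"
  using arg_cong[OF cD, of cnj] by simp
 have "complex_of_real ((cmod (\<Sum>k\<le>Suc N. \<tau> ^ k))^2) = (?D + \<tau> ^ Suc N) * cnj (?D + \<tau> ^ Suc N)"
  by (simp only: complex_norm_square sum.atMost_Suc)
 also have "\<dots> = ?D * cnj ?D + (\<tau> ^ Suc N * cnj (\<tau> ^ Suc N) + \<tau> ^ Suc N * cnj ?D + cnj (\<tau> ^ Suc N) * ?D)"
  by (simp only: complex_cnj_add) algebra
 also have "\<dots> = of_real ((cmod ?D)^2) + (\<Sum>n\<in>{-int (Suc N)..int (Suc N)}. \<tau> powi n)"
  by (simp only: tN cD cD' sums complex_norm_square)
 also have "\<dots> = (\<Sum>n\<in>win N. of_real (N + 1 - \<bar>real_of_int n\<bar>) * \<tau> powi n + \<tau> powi n) + (\<tau> powi (int (Suc N)) + \<tau> powi (- int (Suc N)))"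
  by (simp only: Suc sum_int_Suc sum.distrib add_ac of_nat_add of_nat_1)
 also have "\<dots> = (\<Sum>n\<in>{-int (Suc N)..int (Suc N)}. of_real (Suc N + 1 - \<bar>real_of_int n\<bar>) * \<tau> powi n)"
  unfolding sum_int_Suc by (simp add: algebra_simps)
 finally show ?case by (simp only: of_nat_add of_nat_1)
qed

lemma fejer_eq_trig_sum:
 assumes t: "\<tau> \<in> circle" and NM: "N \<le> M"
 shows "complex_of_real (fejer N \<tau>) = trig_sum (\<lambda>n. of_real (fejer_mult N n)) M \<tau>"
proof -
 have "complex_of_real (fejer N \<tau>) = (\<Sum>n\<in>win N. of_real (fejer_mult N n) * \<tau> powi n)"
 proof -
  have "complex_of_real (fejer N \<tau>) = (\<Sum>n\<in>win N. of_real (N + 1 - \<bar>real_of_int n\<bar>) * \<tau> powi n) / (N + 1)"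
   using norm_square_geometric_sum[OF t, of N] by (simp add: fejer_def add_ac)
  also have "\<dots> = (\<Sum>n\<in>win N. of_real (N + 1 - \<bar>real_of_int n\<bar>) * \<tau> powi n / (N + 1))"
   by (rule sum_divide_distrib)
  also have "\<dots> = (\<Sum>n\<in>win N. of_real (fejer_mult N n) * \<tau> powi n)"
  proof (rule sum.cong)
   fix n assume "n \<in> win N"
   then have "\<bar>real_of_int n\<bar> \<le> N" by auto
   then have "fejer_mult N n = (N + 1 - \<bar>real_of_int n\<bar>) / (N + 1)"
    unfolding fejer_mult_def by (simp add: field_simps max_def)
   then show "of_real (N + 1 - \<bar>real_of_int n\<bar>) * \<tau> powi n / (N + 1) = of_real (fejer_mult N n) * \<tau> powi n"
    by simp
  qed simp
  finally show ?thesis .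
 qed
 also have "\<dots> = (\<Sum>n\<in>win M. of_real (fejer_mult N n) * \<tau> powi n)"
 proof (rule sum.mono_neutral_left)
  show "\<forall>n\<in>win M - win N. complex_of_real (fejer_mult N n) * \<tau> powi n = 0"
  proof
   fix n assume "n \<in> win M - win N"
   then have "real N + 1 \<le> \<bar>real_of_int n\<bar>" by auto
   then have "fejer_mult N n = 0" unfolding fejer_mult_def by (simp add: field_simps max_def)
   then show "complex_of_real (fejer_mult N n) * \<tau> powi n = 0" by simp
  qed
 qed (use NM in auto)
 finally show ?thesis by (simp add: trig_sum_def)
qed

lemma fejer_kernel: "is_kernel (fejer_mult N) (fejer N)"
 unfolding is_kernel_def
proof (intro conjI)
 show "fejer N \<in> borel_measurable borel" unfolding fejer_def[abs_def] by measurable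
 let ?B = "\<Sum>n\<in>win N. \<bar>fejer_mult N n\<bar>"
 define e where "e M = (if N \<le> M then 0 else 2 * ?B)" for M
 show "\<exists>e. e \<longlonglongrightarrow> 0 \<and> (\<forall>M. \<forall>\<tau>\<in>circle. cmod (of_real (fejer N \<tau>) - trig_sum (\<lambda>n. of_real (fejer_mult N n)) M \<tau>) \<le> e M)"
 proof (intro exI[of _ e] conjI allI ballI)
  show "e \<longlonglongrightarrow> 0" by (rule tendsto_eventually, rule eventually_sequentiallyI[of N]) (simp add: e_def)
  fix M \<tau> assume t: "\<tau> \<in> circle"
  have b: "cmod (trig_sum (\<lambda>n. of_real (fejer_mult N n)) K \<tau>) \<le> ?B" if "K \<le> N" for K
  proof -
   have "cmod (trig_sum (\<lambda>n. of_real (fejer_mult N n)) K \<tau>) \<le> (\<Sum>n\<in>win K. \<bar>fejer_mult N n\<bar>)"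
    using trig_sum_bound[OF t, of "\<lambda>n. of_real (fejer_mult N n)" K] by simp
   also have "\<dots> \<le> ?B" using that by (intro sum_mono2) auto
   finally show ?thesis .
  qed
  show "cmod (of_real (fejer N \<tau>) - trig_sum (\<lambda>n. of_real (fejer_mult N n)) M \<tau>) \<le> e M"
  proof (cases "N \<le> M")
   case True then show ?thesis using fejer_eq_trig_sum[OF t True] by (simp add: e_def)
  next
   case False
   have "cmod (of_real (fejer N \<tau>) - trig_sum (\<lambda>n. of_real (fejer_mult N n)) M \<tau>)
    \<le> cmod (of_real (fejer N \<tau>)) + cmod (trig_sum (\<lambda>n. of_real (fejer_mult N n)) M \<tau>)" by (rule norm_triangle_ineq4)
   also have "\<dots> \<le> ?B + ?B"
    using b[of N] b[of M] False fejer_eq_trig_sum[OF t, of N N] by (intro add_mono) auto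
   finally show ?thesis using False by (simp add: e_def)
  qed
 qed
qed (auto simp: fejer_def fejer_mult_def)

definition fejer_mean :: "nat \<Rightarrow> (complex \<Rightarrow> complex) \<Rightarrow> complex \<Rightarrow> complex" where
 "fejer_mean N h = trig_sum (\<lambda>n. of_real (fejer_mult N n) * fc h n) N"

lemma fejer_mean_eq_conv:
 assumes h: "integrable ds h" and z: "z \<in> circle"
 shows "fejer_mean N h z = conv (fejer N) h z"
proof -
 have "conv (fejer N) h z = (LINT \<xi>|ds. trig_sum (\<lambda>n. of_real (fejer_mult N n)) N (z * cnj \<xi>) * h \<xi>) / (2 * pi)"
  unfolding conv_def
  by (intro arg_cong2[of _ _ _ _ "(/)"] Bochner_Integration.integral_cong refl)
    (use z in \<open>simp add: fejer_eq_trig_sum[OF circle_mult[OF _ circle_cnj]]\<close>)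
 also have "\<dots> = fejer_mean N h z" by (simp only: trig_sum_conv[OF h] fejer_mean_def)
 finally show ?thesis ..
qed

definition poisson_kernel :: "real \<Rightarrow> complex \<Rightarrow> real" where
 "poisson_kernel r \<tau> = (1 - r^2) / (cmod (1 - of_real r * \<tau>))^2"

lemma poisson_kernel_trig_sum:
 assumes t: "\<tau> \<in> circle" and r: "0 \<le> r" "r < 1"
 shows "cmod (of_real (poisson_kernel r \<tau>) - trig_sum (\<lambda>n. of_real (r ^ nat \<bar>n\<bar>)) N \<tau>) \<le> 2 * r ^ Suc N / (1 - r)"
proof -
 define z where "z = of_real r * \<tau>"
 have cz: "cmod z = r" using t r by (simp add: z_def norm_mult)
 have z1: "z \<noteq> 1" using cz r by auto
 have z1': "1 - z \<noteq> 0" "1 - cnj z \<noteq> 0" using z1 by (auto simp: complex_eq_iff)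
 have T: "trig_sum (\<lambda>n. of_real (r ^ nat \<bar>n\<bar>)) N \<tau> = 1 + (\<Sum>k<N. z ^ Suc k) + (\<Sum>k<N. cnj z ^ Suc k)"
  unfolding trig_sum_def
 proof (induction N)
  case (Suc M)
  have "\<tau> powi (- int (Suc M)) = cnj \<tau> ^ Suc M" using circle_cnj_powi[OF t, of "int (Suc M)"] by (simp only: power_int_of_nat)
  moreover have "\<tau> powi (int (Suc M)) = \<tau> ^ Suc M" by (rule power_int_of_nat)
  moreover have "nat \<bar>int (Suc M)\<bar> = Suc M" "nat \<bar>- int (Suc M)\<bar> = Suc M" by auto
  ultimately show ?case unfolding sum_int_Suc Suc z_def
   by (simp only:) (simp add: power_mult_distrib)
 qed simp
 have geo: "(\<Sum>k<N. w ^ Suc k) = (w - w ^ Suc N) / (1 - w)" if "w \<noteq> 1" for w :: complex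
 proof -
  have "(\<Sum>k<N. w ^ Suc k) = w * (\<Sum>k<N. w ^ k)" by (simp add: sum_distrib_left)
  also have "\<dots> = w * ((1 - w ^ N) / (1 - w))" using that by (simp add: sum_gp_strict)
  finally show ?thesis by (simp add: algebra_simps)
 qed
 have P: "of_real (poisson_kernel r \<tau>) = 1 + z / (1 - z) + cnj z / (1 - cnj z)"
 proof -
  have "of_real (poisson_kernel r \<tau>) = (1 - of_real (r^2)) / complex_of_real ((cmod (1 - z))^2)"
   by (simp add: poisson_kernel_def z_def)
  also have "\<dots> = (1 - z * cnj z) / ((1 - z) * (1 - cnj z))"
   using complex_norm_square[of z] complex_norm_square[of "1 - z"] by (simp only: cz complex_cnj_diff complex_cnj_one)
  also have "\<dots> = 1 + z / (1 - z) + cnj z / (1 - cnj z)"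
   using z1' by (simp add: field_simps)
  finally show ?thesis .
 qed
 have cnjz: "cnj z \<noteq> 1" using z1'(2) by auto
 have "of_real (poisson_kernel r \<tau>) - trig_sum (\<lambda>n. of_real (r ^ nat \<bar>n\<bar>)) N \<tau> = z ^ Suc N / (1 - z) + cnj z ^ Suc N / (1 - cnj z)"
  unfolding T P geo[OF z1] geo[OF cnjz] by (simp add: diff_divide_distrib)
 also have "\<dots> = z ^ Suc N / (1 - z) + cnj (z ^ Suc N / (1 - z))" by simp
 also have "cmod \<dots> \<le> cmod (z ^ Suc N / (1 - z)) + cmod (z ^ Suc N / (1 - z))"
  by (metis complex_mod_cnj norm_triangle_ineq)
 also have "\<dots> = 2 * (r ^ Suc N / cmod (1 - z))" by (simp add: norm_divide norm_mult norm_power cz)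
 also have "\<dots> \<le> 2 * (r ^ Suc N / (1 - r))"
 proof -
  have "1 - r \<le> cmod (1 - z)" using norm_triangle_ineq2[of 1 z] by (simp add: cz)
  then show ?thesis using r by (intro mult_left_mono divide_left_mono mult_pos_pos) auto
 qed
 finally show ?thesis by simp
qed

lemma poisson_is_kernel:
 assumes r: "0 \<le> r" "r < 1"
 shows "is_kernel (\<lambda>n. r ^ nat \<bar>n\<bar>) (poisson_kernel r)"
 unfolding is_kernel_def
proof (intro conjI)
 show "poisson_kernel r \<in> borel_measurable borel" unfolding poisson_kernel_def[abs_def] by measurable
 show "\<forall>\<tau>\<in>circle. 0 \<le> poisson_kernel r \<tau>"
  using r by (auto simp: poisson_kernel_def power_le_one intro!: divide_nonneg_nonneg)
 have "(\<lambda>N. 2 * r ^ Suc N / (1 - r)) \<longlonglongrightarrow> 2 * 0 / (1 - r)"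
  using r by (intro tendsto_intros LIMSEQ_Suc LIMSEQ_realpow_zero) auto
 then show "\<exists>e. e \<longlonglongrightarrow> 0 \<and> (\<forall>N. \<forall>\<tau>\<in>circle. cmod (of_real (poisson_kernel r \<tau>) - trig_sum (\<lambda>n. of_real (r ^ nat \<bar>n\<bar>)) N \<tau>) \<le> e N)"
  using poisson_kernel_trig_sum[OF _ r] by (intro exI[of _ "\<lambda>N. 2 * r ^ Suc N / (1 - r)"]) auto
qed auto

lemma poisson_integral_eq_conv:
 assumes z: "z \<in> circle"
 shows "poisson_integral h (of_real r * z) = conv (poisson_kernel r) h z"
proof -
 have "(cmod (\<xi> - of_real r * z))^2 = (cmod (1 - of_real r * (z * cnj \<xi>)))^2" if "\<xi> \<in> circle" for \<xi>
 proof -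
  have "\<xi> * (1 - of_real r * (z * cnj \<xi>)) = \<xi> - of_real r * z * (\<xi> * cnj \<xi>)" by (simp add: algebra_simps)
  then have "cmod (\<xi> - of_real r * z) = cmod (\<xi> * (1 - of_real r * (z * cnj \<xi>)))"
   by (simp only: circle_mult_cnj[OF that] mult_1_right)
  then show ?thesis using that by (simp add: norm_mult)
 qed
 then show ?thesis using z
  unfolding poisson_integral_def conv_def poisson_kernel_def
  by (intro arg_cong2[of _ _ _ _ "(/)"] Bochner_Integration.integral_cong refl) (simp add: norm_mult)
qed

section \<open>Square integrable functions\<close>

lemma measurable_cnj [measurable]: "cnj \<in> borel_measurable borel"
 by (intro borel_measurable_continuous_onI continuous_intros)

definition L2sq :: "(complex \<Rightarrow> complex) \<Rightarrow> ennreal" where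
 "L2sq h = (\<integral>\<^sup>+z. ennreal ((cmod (h z))^2) \<partial>ds)"

lemma L2_circle_iff: "h \<in> L2_circle \<longleftrightarrow> h \<in> meas \<and> L2sq h < \<infinity>"
 unfolding L2_circle_def L2sq_def by (auto simp: integrable_iff_bounded)

lemma L2_circle_measurable: "h \<in> L2_circle ==> h \<in> meas"
 by (simp add: L2_circle_def)

lemma L2_circle_integrable:
 assumes "h \<in> L2_circle" shows "integrable ds h"
proof (rule Bochner_Integration.integrable_bound)
 show "integrable ds (\<lambda>z. 1 + (cmod (h z))^2)"
  using assms by (auto simp: L2_circle_def)
 show "AE z in ds. cmod (h z) \<le> norm (1 + (cmod (h z))^2)"
 proof (rule AE_I2)
  fix z
  have "0 \<le> (cmod (h z) - 1)^2" by simp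
  then show "cmod (h z) \<le> norm (1 + (cmod (h z))^2)"
   by (simp add: power2_diff) (smt (verit) norm_ge_zero)
 qed
qed (use assms in \<open>simp add: L2_circle_def\<close>)

lemma cmod_sq_add_le: "(cmod (a + b))^2 \<le> 2 * (cmod a)^2 + 2 * (cmod b)^2"
proof -
 have "(cmod (a + b))^2 \<le> (cmod a + cmod b)^2" by (intro power_mono norm_triangle_ineq) auto
 also have "\<dots> \<le> 2 * (cmod a)^2 + 2 * (cmod b)^2"
  using sum_squares_bound[of "cmod a" "cmod b"] by (simp add: power2_sum)
 finally show ?thesis .
qed

lemma L2sq_add_le:
 assumes [measurable]: "h \<in> meas" "k \<in> meas"
 shows "L2sq (\<lambda>z. h z + k z) \<le> 2 * L2sq h + 2 * L2sq k"
proof -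
 have "L2sq (\<lambda>z. h z + k z) \<le> (\<integral>\<^sup>+z. 2 * ennreal ((cmod (h z))^2) + 2 * ennreal ((cmod (k z))^2) \<partial>ds)"
  unfolding L2sq_def
 proof (intro nn_integral_mono)
  fix z
  have "2 * ennreal ((cmod (h z))^2) + 2 * ennreal ((cmod (k z))^2) = ennreal (2 * (cmod (h z))^2 + 2 * (cmod (k z))^2)"
   by (simp add: ennreal_mult ennreal_plus)
  then show "ennreal ((cmod (h z + k z))^2) \<le> 2 * ennreal ((cmod (h z))^2) + 2 * ennreal ((cmod (k z))^2)"
   by (simp only:) (intro ennreal_leI cmod_sq_add_le)
 qed
 also have "\<dots> = 2 * L2sq h + 2 * L2sq k"
  unfolding L2sq_def by (subst nn_integral_add) (auto simp: nn_integral_cmult)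
 finally show ?thesis .
qed

lemma L2sq_cmult:
 assumes [measurable]: "h \<in> meas"
 shows "L2sq (\<lambda>z. c * h z) = ennreal ((cmod c)^2) * L2sq h"
 unfolding L2sq_def by (simp add: norm_mult power_mult_distrib ennreal_mult nn_integral_cmult)

lemma L2sq_bounded:
 assumes "\<And>z. z \<in> circle ==> cmod (h z) \<le> B"
 shows "L2sq h \<le> ennreal (2 * pi * B^2)"
proof -
 have "L2sq h \<le> (\<integral>\<^sup>+z. ennreal (B^2) \<partial>ds)"
  unfolding L2sq_def using assms by (intro nn_integral_mono ennreal_leI power_mono) auto
 also have "\<dots> = ennreal (2 * pi * B^2)"
  by (simp add: emeasure_arc_length_circle ennreal_mult[symmetric] mult.commute)
 finally show ?thesis .
qed

lemma L2_circle_bounded: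
 assumes "h \<in> meas" "\<And>z. z \<in> circle ==> cmod (h z) \<le> B"
 shows "h \<in> L2_circle"
 unfolding L2_circle_iff using assms(1) L2sq_bounded[of h B, OF assms(2)]
 by (auto simp: le_less_trans)

lemma trig_sum_L2: "trig_sum c N \<in> L2_circle"
 by (rule L2_circle_bounded[OF measurable_trig_sum_arc trig_sum_bound])

lemma L2_circle_add: "h \<in> L2_circle ==> k \<in> L2_circle ==> (\<lambda>z. h z + k z) \<in> L2_circle"
 using L2sq_add_le[of h k] unfolding L2_circle_iff
 by (auto simp: ennreal_mult_less_top intro: le_less_trans)

lemma L2_circle_cmult: "h \<in> L2_circle ==> (\<lambda>z. c * h z) \<in> L2_circle"
 unfolding L2_circle_iff by (auto simp: L2sq_cmult ennreal_mult_less_top)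

lemma L2_circle_diff: "h \<in> L2_circle ==> k \<in> L2_circle ==> (\<lambda>z. h z - k z) \<in> L2_circle"
 using L2_circle_add[of h "\<lambda>z. - 1 * k z"] L2_circle_cmult[of k "-1"] by simp

lemma fourier_coeff_cong_AE:
 assumes "h \<in> meas" "AE z in ds. h z = k z"
 shows "fc h n = fc k n"
proof -
 have [measurable]: "(\<lambda>z. cnj z powi n) \<in> meas"
  by (rule borel_measurable_arc_length) measurable
 note [measurable] = assms(1) borel_measurable_arc_AE[OF assms]
 show ?thesis unfolding fourier_coeff_def
  by (intro arg_cong2[of _ _ _ _ "(/)"] integral_cong_AE refl) (use assms(2) in \<open>auto\<close>)
qed

lemma fourier_coeff_add:
 "integrable ds h ==> integrable ds k ==>
  fc (\<lambda>z. h z + k z) n = fc h n + fc k n"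
 unfolding fourier_coeff_def
 by (simp add: distrib_right fourier_coeff_integrable add_divide_distrib)

lemma fourier_coeff_cmult: "fc (\<lambda>z. c * h z) n = c * fc h n"
 unfolding fourier_coeff_def by (simp add: mult.assoc)

lemma fourier_coeff_diff:
 "integrable ds h ==> integrable ds k ==>
  fc (\<lambda>z. h z - k z) n = fc h n - fc k n"
 unfolding fourier_coeff_def
 by (simp add: left_diff_distrib fourier_coeff_integrable diff_divide_distrib)

lemma fourier_coeff_trig_sum:
 "fc (trig_sum c N) n = (if n \<in> win N then c n else 0)"
proof -
 have "fc (trig_sum c N) n = (\<Sum>m\<in>win N. c m * fc (\<lambda>z. z powi m) n)"
 proof -
  have "(LINT z|ds. trig_sum c N z * cnj z powi n)
   = (LINT z|ds. (\<Sum>m\<in>win N. c m * (z powi m * cnj z powi n)))"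
   by (simp add: trig_sum_def sum_distrib_right mult.assoc)
  also have "\<dots> = (\<Sum>m\<in>win N. c m * (LINT z|ds. z powi m * cnj z powi n))"
   by (subst Bochner_Integration.integral_sum) (auto intro: fourier_coeff_integrable[OF integrable_powi])
  finally show ?thesis by (simp add: fourier_coeff_def sum_divide_distrib)
 qed
 then show ?thesis by (simp add: fourier_coeff_powi if_distrib sum.delta cong: if_cong)
qed

lemma L2_dist_trig_sum:
 assumes h: "h \<in> L2_circle"
 shows "(LINT z|ds. (cmod (h z - trig_sum c N z))^2) = (LINT z|ds. (cmod (h z))^2)
   + 2 * pi * (\<Sum>n\<in>win N. (cmod (fc h n - c n))^2 - (cmod (fc h n))^2)"
proof -
 let ?T = "trig_sum c N"
 let ?I = "win N"
 note hi = L2_circle_integrable[OF h]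
 have ex: "(cmod (a - b))^2 = (cmod a)^2 - 2 * Re (a * cnj b) + (cmod b)^2" for a b
  by (simp add: cmod_power2 power2_diff algebra_simps)
 have quad: "(LINT z|ds. a z - 2 * b z + c z) = (LINT z|ds. a z) - 2 * (LINT z|ds. b z) + (LINT z|ds. c z)"
  if "integrable ds a" "integrable ds b" "integrable ds c" for a b c :: "complex \<Rightarrow> real"
  using that by simp
 have cT: "cnj (?T z) = (\<Sum>n\<in>?I. cnj (c n) * cnj z powi n)" for z
  by (simp add: trig_sum_def cnj_powi)
 have cross: "(LINT z|ds. g z * cnj (?T z)) = 2 * pi * (\<Sum>n\<in>?I. fc g n * cnj (c n))"
  and icross: "integrable ds (\<lambda>z. g z * cnj (?T z))" if g: "integrable ds g" for g
 proof -
  have eq: "(\<lambda>z. g z * cnj (?T z)) = (\<lambda>z. \<Sum>n\<in>?I. cnj (c n) * (g z * cnj z powi n))"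
   by (auto simp: cT sum_distrib_left mult_ac)
  show "integrable ds (\<lambda>z. g z * cnj (?T z))"
   unfolding eq by (intro Bochner_Integration.integrable_sum integrable_mult_right fourier_coeff_integrable[OF g])
  show "(LINT z|ds. g z * cnj (?T z)) = 2 * pi * (\<Sum>n\<in>?I. fc g n * cnj (c n))"
   unfolding eq by (subst Bochner_Integration.integral_sum)
    (auto intro!: integrable_mult_right fourier_coeff_integrable[OF g] sum.cong simp: fourier_coeff_def sum_distrib_left)
 qed
 have iT: "integrable ds ?T" by (rule L2_circle_integrable[OF trig_sum_L2])
 have hT: "(LINT z|ds. Re (h z * cnj (?T z))) = 2 * pi * (\<Sum>n\<in>?I. Re (fc h n * cnj (c n)))"
  using cross[OF hi] integral_Re[OF icross[OF hi]] by simp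
 have "(LINT z|ds. ?T z * cnj (?T z)) = 2 * pi * (\<Sum>n\<in>?I. c n * cnj (c n))"
  using cross[OF iT] by (simp add: fourier_coeff_trig_sum)
 also have "\<dots> = of_real (2 * pi * (\<Sum>n\<in>?I. (cmod (c n))^2))" by (simp flip: complex_norm_square)
 finally have TT: "(LINT z|ds. (cmod (?T z))^2) = 2 * pi * (\<Sum>n\<in>?I. (cmod (c n))^2)"
  unfolding complex_norm_square[symmetric] integral_complex_of_real of_real_eq_iff .
 have i1: "integrable ds (\<lambda>z. (cmod (h z))^2)" using h by (simp add: L2_circle_def)
 have i2: "integrable ds (\<lambda>z. Re (h z * cnj (?T z)))" by (rule integrable_Re[OF icross[OF hi]])
 have i3: "integrable ds (\<lambda>z. (cmod (?T z))^2)" using trig_sum_L2[of c N] by (simp add: L2_circle_def)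
 have "(LINT z|ds. (cmod (h z - ?T z))^2) = (LINT z|ds. (cmod (h z))^2) - 2 * (LINT z|ds. Re (h z * cnj (?T z))) + (LINT z|ds. (cmod (?T z))^2)"
  unfolding ex
  using quad[OF i1 i2 i3] .
 also have "\<dots> = (LINT z|ds. (cmod (h z))^2) + 2 * pi * (\<Sum>n\<in>?I. (cmod (c n))^2 - 2 * Re (fc h n * cnj (c n)))"
  unfolding hT TT by (simp add: sum_subtractf sum_distrib_left algebra_simps)
 finally show ?thesis by (simp only: ex) (simp add: algebra_simps)
qed

lemma L2sq_eq_integral:
 assumes "h \<in> L2_circle" shows "L2sq h = ennreal (LINT z|ds. (cmod (h z))^2)"
 using assms unfolding L2sq_def L2_circle_def by (auto intro!: nn_integral_eq_integral)

section \<open>Completeness of the trigonometric system\<close>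

definition trig_approx :: "(complex \<Rightarrow> complex) \<Rightarrow> bool" where
 "trig_approx h \<longleftrightarrow> h \<in> meas \<and> (\<forall>\<epsilon>>0. \<exists>c N. L2sq (\<lambda>z. h z - trig_sum c N z) < ennreal \<epsilon>)"

lemma trig_sum_pad:
 assumes "N \<le> M"
 shows "trig_sum c N = trig_sum (\<lambda>n. if n \<in> win N then c n else 0) M"
proof
 fix z
 have "(\<Sum>n\<in>win M. (if n \<in> win N then c n else 0) * z powi n) = (\<Sum>n\<in>win N. c n * z powi n)"
  using assms by (intro sum.mono_neutral_cong_right) auto
 then show "trig_sum c N z = trig_sum (\<lambda>n. if n \<in> win N then c n else 0) M z" by (simp add: trig_sum_def)
qed

lemma trig_sum_add_ex: "\<exists>e K. \<forall>z. trig_sum c N z + trig_sum d M z = trig_sum e K z"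
proof -
 have *: "trig_sum c K z + trig_sum d K z = trig_sum (\<lambda>n. c n + d n) K z" for c d K z
  by (simp add: trig_sum_def sum.distrib distrib_right)
 show ?thesis
  unfolding trig_sum_pad[OF max.cobounded1[of N M], of c] trig_sum_pad[OF max.cobounded2[of M N], of d] * by blast
qed

lemma ennreal_quarters: "0 < \<epsilon> ==> 2 * ennreal (\<epsilon>/4) + 2 * ennreal (\<epsilon>/4) = ennreal \<epsilon>"
proof -
 assume e: "0 < \<epsilon>"
 have "2 * ennreal (\<epsilon>/4) = ennreal (\<epsilon>/2)" using e ennreal_mult[of 2 "\<epsilon>/4"] by simp
 then show ?thesis using e ennreal_plus[of "\<epsilon>/2" "\<epsilon>/2"] by simp
qed

lemma trig_approx_closed:
 assumes m: "h \<in> meas"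
  and a: "\<And>\<epsilon>. \<epsilon> > 0 ==> \<exists>k. trig_approx k \<and> L2sq (\<lambda>z. h z - k z) < ennreal \<epsilon>"
 shows "trig_approx h"
 unfolding trig_approx_def
proof (intro conjI m allI impI)
 fix \<epsilon> :: real assume e: "\<epsilon> > 0"
 obtain k where k: "trig_approx k" "L2sq (\<lambda>z. h z - k z) < ennreal (\<epsilon>/4)" using a[of "\<epsilon>/4"] e by auto
 then obtain c N where c: "L2sq (\<lambda>z. k z - trig_sum c N z) < ennreal (\<epsilon>/4)" using e unfolding trig_approx_def by (meson divide_pos_pos zero_less_numeral)
 have "L2sq (\<lambda>z. h z - trig_sum c N z) = L2sq (\<lambda>z. (h z - k z) + (k z - trig_sum c N z))" by simp
 also have "\<dots> \<le> 2 * L2sq (\<lambda>z. h z - k z) + 2 * L2sq (\<lambda>z. k z - trig_sum c N z)"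
  using m k(1) measurable_trig_sum_arc[of c N] by (intro L2sq_add_le) (auto simp: trig_approx_def)
 also have "\<dots> < 2 * ennreal (\<epsilon>/4) + 2 * ennreal (\<epsilon>/4)"
  using k(2) c by (intro add_strict_mono ennreal_mult_strict_left_mono) auto
 also have "\<dots> = ennreal \<epsilon>" by (rule ennreal_quarters[OF e])
 finally show "\<exists>c N. L2sq (\<lambda>z. h z - trig_sum c N z) < ennreal \<epsilon>" by blast
qed

lemma trig_approx_add:
 assumes h: "trig_approx h" and k: "trig_approx k"
 shows "trig_approx (\<lambda>z. h z + k z)"
 unfolding trig_approx_def
proof (intro conjI allI impI)
 note [measurable] = measurable_trig_sum_arc
 have [measurable]: "h \<in> meas" "k \<in> meas" using h k by (auto simp: trig_approx_def)
 show "(\<lambda>z. h z + k z) \<in> meas" by measurable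
 fix \<epsilon> :: real assume e: "\<epsilon> > 0"
 then have e4: "\<epsilon>/4 > 0" by simp
 obtain c N where c: "L2sq (\<lambda>z. h z - trig_sum c N z) < ennreal (\<epsilon>/4)" using h e4 unfolding trig_approx_def by blast
 obtain d M where d: "L2sq (\<lambda>z. k z - trig_sum d M z) < ennreal (\<epsilon>/4)" using k e4 unfolding trig_approx_def by blast
 obtain b K where b: "\<And>z. trig_sum c N z + trig_sum d M z = trig_sum b K z" using trig_sum_add_ex by blast
 have "L2sq (\<lambda>z. h z + k z - trig_sum b K z) = L2sq (\<lambda>z. (h z - trig_sum c N z) + (k z - trig_sum d M z))"
  by (simp add: algebra_simps flip: b)
 also have "\<dots> \<le> 2 * L2sq (\<lambda>z. h z - trig_sum c N z) + 2 * L2sq (\<lambda>z. k z - trig_sum d M z)"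
  by (intro L2sq_add_le) measurable
 also have "\<dots> < 2 * ennreal (\<epsilon>/4) + 2 * ennreal (\<epsilon>/4)"
  using c d by (intro add_strict_mono ennreal_mult_strict_left_mono) auto
 also have "\<dots> = ennreal \<epsilon>" by (rule ennreal_quarters[OF e])
 finally show "\<exists>c N. L2sq (\<lambda>z. h z + k z - trig_sum c N z) < ennreal \<epsilon>" by blast
qed

lemma trig_approx_cmult:
 assumes h: "trig_approx h"
 shows "trig_approx (\<lambda>z. a * h z)"
 unfolding trig_approx_def
proof (intro conjI allI impI)
 note [measurable] = measurable_trig_sum_arc
 have [measurable]: "h \<in> meas" using h by (auto simp: trig_approx_def)
 show "(\<lambda>z. a * h z) \<in> meas" by measurable
 fix \<epsilon> :: real assume e: "\<epsilon> > 0"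
 have "\<epsilon> / ((cmod a)^2 + 1) > 0" using e by (intro divide_pos_pos add_nonneg_pos) auto
 then obtain c N where c: "L2sq (\<lambda>z. h z - trig_sum c N z) < ennreal (\<epsilon> / ((cmod a)^2 + 1))"
  using h unfolding trig_approx_def by blast
 have "a * trig_sum c N z = trig_sum (\<lambda>n. a * c n) N z" for z
  by (simp add: trig_sum_def sum_distrib_left mult_ac)
 then have "L2sq (\<lambda>z. a * h z - trig_sum (\<lambda>n. a * c n) N z) = L2sq (\<lambda>z. a * (h z - trig_sum c N z))"
  by (simp add: right_diff_distrib)
 also have "\<dots> = ennreal ((cmod a)^2) * L2sq (\<lambda>z. h z - trig_sum c N z)" by (rule L2sq_cmult) measurable
 also have "\<dots> \<le> ennreal ((cmod a)^2) * ennreal (\<epsilon> / ((cmod a)^2 + 1))" using c by (intro mult_left_mono) auto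
 also have "\<dots> = ennreal ((cmod a)^2 * (\<epsilon> / ((cmod a)^2 + 1)))" using e by (intro ennreal_mult[symmetric]) (auto intro!: divide_nonneg_nonneg)
 also have "\<dots> < ennreal \<epsilon>"
 proof (intro ennreal_lessI e)
  have "(cmod a)^2 + 1 > 0" by (intro add_nonneg_pos) auto
  then show "(cmod a)^2 * (\<epsilon> / ((cmod a)^2 + 1)) < \<epsilon>" using e by (simp add: field_simps)
 qed
 finally show "\<exists>c N. L2sq (\<lambda>z. a * h z - trig_sum c N z) < ennreal \<epsilon>" by blast
qed

lemma trig_approx_sum:
 "finite I ==> (\<And>i. i \<in> I ==> trig_approx (h i)) ==> trig_approx (\<lambda>z. \<Sum>i\<in>I. h i z)"
proof (induction I rule: finite_induct)
 case empty
 have "L2sq (\<lambda>z. 0 - trig_sum (\<lambda>_. 0) 0 z) = 0" by (simp add: L2sq_def trig_sum_def)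
 then show ?case by (auto simp: trig_approx_def intro!: exI[of _ "\<lambda>_. 0"] exI[of _ 0])
next
 case (insert i I) then show ?case by (simp add: trig_approx_add)
qed

lemma trig_approx_AE:
 assumes h: "trig_approx h" and ae: "AE z in ds. h z = k z"
 shows "trig_approx k"
proof -
 have "L2sq (\<lambda>z. k z - trig_sum c N z) = L2sq (\<lambda>z. h z - trig_sum c N z)" for c N
  unfolding L2sq_def using ae by (intro nn_integral_cong_AE) auto
 moreover have "k \<in> meas" using h ae by (auto simp: trig_approx_def intro: borel_measurable_arc_AE)
 ultimately show ?thesis using h by (simp add: trig_approx_def)
qed

lemma lipschitz_circle_measurable:
 fixes h :: "complex \<Rightarrow> 'b::{second_countable_topology, real_normed_vector}"
 assumes "\<And>z w. z \<in> circle ==> w \<in> circle ==> norm (h z - h w) \<le> L * cmod (z - w)"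
 shows "h \<in> meas"
proof -
 have L: "norm (h z - h w) \<le> \<bar>L\<bar> * cmod (z - w)" if "z \<in> circle" "w \<in> circle" for z w
  using assms[OF that] abs_ge_self[of L] by (meson mult_right_mono norm_ge_zero order_trans)
 have "\<bar>L\<bar>-lipschitz_on circle h" by (intro lipschitz_onI) (auto simp: dist_norm L)
 then have "continuous_on circle h" by (rule lipschitz_on_continuous_on)
 then have "h \<in> borel_measurable (restrict_space borel circle)" by (rule borel_measurable_continuous_on_restrict)
 then have "h \<in> borel_measurable arc_param" by (subst measurable_cong_sets[OF sets_arc_param refl])
 then show ?thesis unfolding arc_length_eq by (rule measurable_completion)
qed

lemma lipschitz_circle_bounded:
 fixes h :: "complex \<Rightarrow> 'b::real_normed_vector"
 assumes "\<And>z w. z \<in> circle ==> w \<in> circle ==> norm (h z - h w) \<le> L * cmod (z - w)" and z: "z \<in> circle"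
 shows "norm (h z) \<le> norm (h 1) + 2 * \<bar>L\<bar>"
proof -
 have "cmod (z - 1) \<le> 2" using norm_triangle_ineq4[of z 1] z by simp
 have "norm (h z - h 1) \<le> L * cmod (z - 1)" using assms by simp
 also have "\<dots> \<le> \<bar>L\<bar> * cmod (z - 1)" by (intro mult_right_mono) auto
 also have "\<dots> \<le> \<bar>L\<bar> * 2" using \<open>cmod (z - 1) \<le> 2\<close> by (intro mult_left_mono) auto
 finally show ?thesis using norm_triangle_ineq2[of "h z" "h 1"] by linarith
qed

text \<open>The second moment of the Fejer kernel is \<open>2 / (N + 1)\<close>, so the Fejer means of a Lipschitz
 function converge uniformly.\<close>

lemma fejer_mean_lipschitz_close:
 assumes lip: "\<And>z w. z \<in> circle ==> w \<in> circle ==> cmod (h z - h w) \<le> L * cmod (z - w)" and z: "z \<in> circle" and L: "0 \<le> L"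
 shows "cmod (fejer_mean N h z - h z) \<le> L * sqrt (2 / (N + 1))"
proof -
 have m: "h \<in> meas" by (rule lipschitz_circle_measurable[OF lip])
 have i: "integrable ds h"
  using integrable_arc_bounded[OF m lipschitz_circle_bounded[OF lip]] by blast
 have "1 \<le> real N + 1" by simp
 then have "fejer_mult N 1 = 1 - 1 / (N + 1)" unfolding fejer_mult_def by (simp add: max_def field_simps)
 then show ?thesis unfolding fejer_mean_eq_conv[OF i z]
  by (intro conv_lipschitz_at[OF fejer_kernel m z L lip[OF _ z]]) (auto simp: add.commute)
qed

lemma trig_approx_lipschitz:
 assumes lip: "\<And>z w. z \<in> circle ==> w \<in> circle ==> cmod (h z - h w) \<le> L * cmod (z - w)"
 shows "trig_approx h"
 unfolding trig_approx_def
proof (intro conjI allI impI)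
 show "h \<in> meas" by (rule lipschitz_circle_measurable[OF lip])
 have lip': "cmod (h z - h w) \<le> \<bar>L\<bar> * cmod (z - w)" if "z \<in> circle" "w \<in> circle" for z w
  using lip[OF that] abs_ge_self[of L] by (meson mult_right_mono norm_ge_zero order_trans)
 fix \<epsilon> :: real assume e: "\<epsilon> > 0"
 have "(\<lambda>N. 2 * pi * (\<bar>L\<bar> * sqrt (2 * inverse (real (Suc N))))^2) \<longlonglongrightarrow> 2 * pi * (\<bar>L\<bar> * sqrt (2 * 0))^2"
  by (intro tendsto_intros LIMSEQ_inverse_real_of_nat)
 then have "\<forall>\<^sub>F N in sequentially. 2 * pi * (\<bar>L\<bar> * sqrt (2 * inverse (real (Suc N))))^2 < \<epsilon>"
  using e by (intro order_tendstoD(2)) auto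
 then obtain N where N: "2 * pi * (\<bar>L\<bar> * sqrt (2 * inverse (real (Suc N))))^2 < \<epsilon>" by (auto simp: eventually_sequentially)
 have "L2sq (\<lambda>z. h z - fejer_mean N h z) \<le> ennreal (2 * pi * (\<bar>L\<bar> * sqrt (2 / (N + 1)))^2)"
  using fejer_mean_lipschitz_close[OF lip' _ abs_ge_zero, of _ N]
  by (intro L2sq_bounded) (auto simp: norm_minus_commute add.commute)
 also have "\<dots> < ennreal \<epsilon>" using N e by (intro ennreal_lessI) (auto simp: divide_inverse add.commute)
 finally show "\<exists>c N. L2sq (\<lambda>z. h z - trig_sum c N z) < ennreal \<epsilon>"
  unfolding fejer_mean_def by blast
qed

lemma L2sq_dominated:
 assumes m: "\<And>n. s n \<in> meas" "h \<in> meas" "g \<in> meas"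
  and lim: "AE z in ds. (\<lambda>n. s n z) \<longlonglongrightarrow> h z"
  and dom: "\<And>n. AE z in ds. cmod (h z - s n z) \<le> g z" and g: "(\<integral>\<^sup>+z. ennreal ((g z)^2) \<partial>ds) < \<infinity>"
 shows "(\<lambda>n. L2sq (\<lambda>z. h z - s n z)) \<longlonglongrightarrow> 0"
proof -
 note [measurable] = m
 have "(\<lambda>n. \<integral>\<^sup>+z. ennreal ((cmod (h z - s n z))^2) \<partial>ds) \<longlonglongrightarrow> (\<integral>\<^sup>+z. 0 \<partial>ds)"
 proof (rule nn_integral_dominated_convergence)
  show "AE z in ds. ennreal ((cmod (h z - s n z))^2) \<le> ennreal ((g z)^2)" for n
   using dom[of n] by eventually_elim (intro ennreal_leI power_mono, auto)
  show "AE z in ds. (\<lambda>n. ennreal ((cmod (h z - s n z))^2)) \<longlonglongrightarrow> 0"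
   using lim
  proof eventually_elim
   case (elim z)
   have "(\<lambda>n. ennreal ((cmod (h z - s n z))^2)) \<longlonglongrightarrow> ennreal ((cmod (h z - h z))^2)"
    by (intro tendsto_intros elim)
   then show ?case by simp
  qed
 qed (use g in auto)
 then show ?thesis by (simp add: L2sq_def)
qed

lemma tendsto_zero_ennreal_ex:
 fixes a :: "nat \<Rightarrow> ennreal"
 assumes "a \<longlonglongrightarrow> 0" "\<epsilon> > 0" shows "\<exists>n. a n < \<epsilon>"
 using order_tendstoD(2)[OF assms] by (auto simp: eventually_sequentially)

lemma trig_approx_indicator_compact:
 assumes K: "compact K"
 shows "trig_approx (indicator K)"
proof (cases "K = {}")
 case True
 then show ?thesis using trig_approx_sum[of "{}"] by (simp add: indicator_def[abs_def])
next
 case False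
 define s where "s n z = complex_of_real (max 0 (1 - real n * infdist z K))" for n z
 have sa: "trig_approx (s n)" for n
 proof (rule trig_approx_lipschitz)
  fix z w
  have "cmod (s n z - s n w) = \<bar>max 0 (1 - real n * infdist z K) - max 0 (1 - real n * infdist w K)\<bar>"
   unfolding s_def by (metis norm_of_real of_real_diff)
  also have "\<dots> \<le> \<bar>real n * infdist z K - real n * infdist w K\<bar>" by linarith
  also have "\<dots> = real n * \<bar>infdist z K - infdist w K\<bar>" by (simp add: abs_mult flip: right_diff_distrib)
  also have "\<dots> \<le> real n * cmod (z - w)"
   using infdist_triangle_abs[of z K w] by (intro mult_left_mono) (auto simp: dist_norm)
  finally show "cmod (s n z - s n w) \<le> real n * cmod (z - w)" .
 qed
 have lim: "(\<lambda>n. s n z) \<longlonglongrightarrow> indicator K z" for z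
 proof (cases "z \<in> K")
  case True then show ?thesis by (simp add: s_def infdist_zero)
 next
  case False
  then have p: "infdist z K > 0" using K \<open>K \<noteq> {}\<close> by (metis compact_imp_closed in_closed_iff_infdist_zero infdist_nonneg less_eq_real_def)
  obtain n0 where n0: "real n0 * infdist z K > 1" using reals_Archimedean3[OF p] by blast
  have "s n z = 0" if "n \<ge> n0" for n
  proof -
   have "real n0 * infdist z K \<le> real n * infdist z K" using that p by (intro mult_right_mono) auto
   then show ?thesis using n0 by (simp add: s_def max_def)
  qed
  then show ?thesis using False by (intro tendsto_eventually) (auto simp: eventually_sequentially)
 qed
 have Km: "indicator K \<in> meas"
  by (intro borel_measurable_arc_length borel_measurable_indicator borel_compact K)
 have bd: "cmod (indicator K z - s n z) \<le> 2" for n z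
 proof -
  have "0 \<le> real n * infdist z K" by (simp add: infdist_nonneg)
  then have "cmod (s n z) \<le> 1" unfolding s_def norm_of_real by (simp add: max_def)
  moreover have "cmod (indicator K z) \<le> 1" by (simp add: indicator_def)
  ultimately show ?thesis using norm_triangle_ineq4[of "indicator K z" "s n z"] by linarith
 qed
 show ?thesis
 proof (rule trig_approx_closed[OF Km])
  fix \<epsilon> :: real assume "\<epsilon> > 0"
  have "(\<lambda>n. L2sq (\<lambda>z. indicator K z - s n z)) \<longlonglongrightarrow> 0"
   using sa Km lim bd
   by (intro L2sq_dominated[where g="\<lambda>_. 2"]) (auto simp: trig_approx_def emeasure_arc_length_circle ennreal_mult_less_top)
  then obtain n where "L2sq (\<lambda>z. indicator K z - s n z) < ennreal \<epsilon>"
   using tendsto_zero_ennreal_ex[of _ "ennreal \<epsilon>"] \<open>\<epsilon> > 0\<close> by auto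
  then show "\<exists>k. trig_approx k \<and> L2sq (\<lambda>z. indicator K z - k z) < ennreal \<epsilon>" using sa by blast
 qed
qed

lemma trig_approx_indicator_borel:
 assumes T: "T \<in> sets borel"
 shows "trig_approx (indicator T)"
proof -
 define M where "M = distr ds borel (\<lambda>z. z)"
 have idm: "(\<lambda>z. z) \<in> ds \<rightarrow>\<^sub>M borel" by (rule borel_measurable_arc_length) simp
 have fin: "emeasure M (space M) \<noteq> \<infinity>" unfolding M_def
  by (simp add: emeasure_distr idm emeasure_arc_length_circle)
 interpret M: finite_measure M by standard (rule fin)
 have Tm: "indicator T \<in> meas" using T by (intro borel_measurable_arc_length) auto
 show ?thesis
 proof (rule trig_approx_closed[OF Tm])
  fix \<epsilon> :: real assume e: "\<epsilon> > 0"
  have reg: "emeasure M T = (SUP K \<in> {K. K \<subseteq> T \<and> compact K}. emeasure M K)"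
   by (rule inner_regular) (use fin T in \<open>auto simp: M_def\<close>)
  have fT: "emeasure M T \<noteq> \<infinity>" using fin emeasure_space[of M T] by (metis infinity_ennreal_def top.extremum_unique)
  obtain K where K: "K \<subseteq> T" "compact K" "emeasure M T < emeasure M K + ennreal \<epsilon>"
  proof (cases "emeasure M T < ennreal \<epsilon>")
   case True then show ?thesis by (intro that[of "{}"]) auto
  next
   case False
   then have "emeasure M T - ennreal \<epsilon> < emeasure M T"
    using e fT by (intro ennreal_between) (auto simp: not_less less_top[symmetric] intro: less_le_trans[of 0 "ennreal \<epsilon>"])
   then obtain K where "K \<subseteq> T" "compact K" "emeasure M T - ennreal \<epsilon> < emeasure M K"
    unfolding reg less_SUP_iff by (metis (mono_tags, lifting) mem_Collect_eq less_SUP_iff)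
   then show ?thesis using e False
    by (intro that[of K]) (auto simp: not_less M.emeasure_eq_measure ennreal_minus ennreal_less_iff simp flip: ennreal_plus split: if_splits)
  qed
  have Kb: "K \<in> sets borel" using K(2) by (rule borel_compact)
  have "L2sq (\<lambda>z. indicator T z - indicator K z) = (\<integral>\<^sup>+z. indicator (T - K) z \<partial>ds)"
   unfolding L2sq_def using K(1) by (intro nn_integral_cong) (auto simp: indicator_def)
  also have "\<dots> = (\<integral>\<^sup>+z. indicator (T - K) z \<partial>M)"
   unfolding M_def using T Kb by (intro nn_integral_distr[OF idm, symmetric]) auto
  also have "\<dots> = emeasure M (T - K)" using T Kb by (simp add: M_def)
  also have "\<dots> = emeasure M T - emeasure M K"
   using K(1) T Kb fT emeasure_mono[of K T M] by (intro emeasure_Diff) (auto simp: M_def top_unique)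
  also have "\<dots> < ennreal \<epsilon>"
   using K(3) e by (auto simp: M.emeasure_eq_measure ennreal_minus ennreal_less_iff simp flip: ennreal_plus intro!: ennreal_lessI)
  finally show "\<exists>k. trig_approx k \<and> L2sq (\<lambda>z. indicator T z - k z) < ennreal \<epsilon>"
   using trig_approx_indicator_compact[OF K(2)] by blast
 qed
qed

text \<open>From Lipschitz functions, which are uniform limits of their Fejer means, through indicators of compact
sets, inner regularity and simple functions.\<close>

lemma trig_approx_L2:
 assumes h: "h \<in> L2_circle"
 shows "trig_approx h"
proof -
 have hm: "h \<in> meas" using h by (rule L2_circle_measurable)
 from borel_measurable_implies_sequence_metric[OF hm, of 0]
 obtain s where s0: "\<forall>i. simple_function ds (s i)" "\<forall>x\<in>circle. (\<lambda>i. s i x) \<longlonglongrightarrow> h x"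
  "\<forall>i. \<forall>x\<in>circle. cmod (s i x) \<le> 2 * cmod (h x)" unfolding space_arc_length dist_norm diff_0_right by blast
 have s: "\<And>i. simple_function ds (s i)" "\<And>x. x \<in> circle ==> (\<lambda>i. s i x) \<longlonglongrightarrow> h x"
  "\<And>i x. x \<in> circle ==> cmod (s i x) \<le> 2 * cmod (h x)" using s0 by blast+
 have sm: "s i \<in> meas" for i by (rule borel_measurable_simple_function[OF s(1)])
 have sa: "trig_approx (s i)" for i
 proof (rule trig_approx_AE)
  let ?S = "\<lambda>y. s i -` {y} \<inter> circle"
  have fin: "finite (s i ` circle)" using simple_functionD(1)[OF s(1)] by simp
  show "trig_approx (\<lambda>z. \<Sum>y\<in>s i ` circle. y * indicator (?S y) z)"
  proof (intro trig_approx_sum fin trig_approx_cmult)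
   fix y
   have "?S y \<in> sets ds" using simple_functionD(2)[OF s(1), of i "{y}"] by simp
   then obtain T where T: "T \<in> sets borel" "AE z in ds. z \<in> ?S y \<longleftrightarrow> z \<in> T"
    using borel_version_arc_length by metis
   from T(2) show "trig_approx (indicator (?S y))"
    by (intro trig_approx_AE[OF trig_approx_indicator_borel[OF T(1)]]) (auto simp: indicator_def elim: eventually_mono)
  qed
  show "AE z in ds. (\<Sum>y\<in>s i ` circle. y * indicator (?S y) z) = s i z"
  proof (rule AE_I2)
   fix z assume z: "z \<in> space ds"
   have "(\<Sum>y\<in>s i ` circle. y * indicator (?S y) z) = (\<Sum>y\<in>s i ` circle. if y = s i z then y else 0)"
    using z by (intro sum.cong) (auto simp: indicator_def)
   also have "\<dots> = s i z" using z fin by (subst sum.delta) auto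
   finally show "(\<Sum>y\<in>s i ` circle. y * indicator (?S y) z) = s i z" .
  qed
 qed
 show ?thesis
 proof (rule trig_approx_closed[OF hm])
  fix \<epsilon> :: real assume e: "\<epsilon> > 0"
  have "(\<lambda>n. L2sq (\<lambda>z. h z - s n z)) \<longlonglongrightarrow> 0"
  proof (rule L2sq_dominated[where g="\<lambda>z. 3 * cmod (h z)"])
   show "AE z in ds. cmod (h z - s n z) \<le> 3 * cmod (h z)" for n
   proof (rule AE_I2)
    fix z assume "z \<in> space ds"
    then have "cmod (s n z) \<le> 2 * cmod (h z)" using s(3) by simp
    then show "cmod (h z - s n z) \<le> 3 * cmod (h z)" using norm_triangle_ineq4[of "h z" "s n z"] by linarith
   qed
   have "(\<integral>\<^sup>+z. ennreal ((3 * cmod (h z))^2) \<partial>ds) = L2sq (\<lambda>z. 3 * h z)"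
    by (simp add: L2sq_def norm_mult)
   also have "\<dots> < \<infinity>" using L2_circle_cmult[OF h, of 3] by (simp add: L2_circle_iff)
   finally show "(\<integral>\<^sup>+z. ennreal ((3 * cmod (h z))^2) \<partial>ds) < \<infinity>" .
  qed (use hm sm s(2) in auto)
  then obtain n where "L2sq (\<lambda>z. h z - s n z) < ennreal \<epsilon>"
   using tendsto_zero_ennreal_ex[of _ "ennreal \<epsilon>"] e by auto
  then show "\<exists>k. trig_approx k \<and> L2sq (\<lambda>z. h z - k z) < ennreal \<epsilon>" using sa by blast
 qed
qed

lemma nn_integral_int_SUP:
 fixes f :: "int \<Rightarrow> ennreal"
 shows "(\<integral>\<^sup>+n. f n \<partial>count_space UNIV) = (SUP N. \<Sum>n\<in>win N. f n)"
proof -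
 have ex: "\<exists>N. n \<in> win N" for n by (intro exI[of _ "nat \<bar>n\<bar>"]) auto
 have "(\<integral>\<^sup>+n. f n \<partial>count_space UNIV) = (\<integral>\<^sup>+n. (SUP N. f n * indicator (win N) n) \<partial>count_space UNIV)"
 proof (intro nn_integral_cong antisym)
  fix n :: int
  obtain N where "n \<in> win N" using ex by blast
  then show "f n \<le> (SUP N. f n * indicator (win N) n)"
   by (intro SUP_upper2[of N]) auto
  show "(SUP N. f n * indicator (win N) n) \<le> f n" by (intro SUP_least) (auto simp: indicator_def)
 qed
 also have "\<dots> = (SUP N. \<integral>\<^sup>+n. f n * indicator (win N) n \<partial>count_space UNIV)"
  by (rule nn_integral_monotone_convergence_SUP) (auto simp: incseq_def le_fun_def indicator_def)
 also have "(\<lambda>N. \<integral>\<^sup>+n. f n * indicator (win N) n \<partial>count_space UNIV) = (\<lambda>N. \<Sum>n\<in>win N. f n)"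
  by (auto simp flip: nn_integral_count_space_indicator simp: nn_integral_count_space_finite)
 finally show ?thesis .
qed

theorem parseval:
 assumes h: "h \<in> L2_circle"
 shows "L2sq h = ennreal (2 * pi) * (\<integral>\<^sup>+n. ennreal ((cmod (fc h n))^2) \<partial>count_space UNIV)"
proof -
 let ?S = "\<lambda>N. \<Sum>n\<in>win N. (cmod (fc h n))^2"
 let ?I = "LINT z|ds. (cmod (h z))^2"
 have le: "2 * pi * ?S N \<le> ?I" for N
 proof -
  have "0 \<le> (LINT z|ds. (cmod (h z - trig_sum (fc h) N z))^2)" by simp
  then show ?thesis unfolding L2_dist_trig_sum[OF h] by (simp add: sum_negf)
 qed
 have ge: "?I \<le> \<epsilon> + 2 * pi * ?S N" if "L2sq (\<lambda>z. h z - trig_sum c N z) < ennreal \<epsilon>" for c N \<epsilon>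
 proof -
  have "L2sq (\<lambda>z. h z - trig_sum c N z) = ennreal (LINT z|ds. (cmod (h z - trig_sum c N z))^2)"
   by (intro L2sq_eq_integral L2_circle_diff h trig_sum_L2)
  then have "(LINT z|ds. (cmod (h z - trig_sum c N z))^2) < \<epsilon>" using that by (simp add: ennreal_less_iff)
  then have "?I + 2 * pi * (\<Sum>n\<in>win N. (cmod (fc h n - c n))^2 - (cmod (fc h n))^2) < \<epsilon>"
   unfolding L2_dist_trig_sum[OF h] .
  moreover have "0 \<le> 2 * pi * (\<Sum>n\<in>win N. (cmod (fc h n - c n))^2)" by (intro mult_nonneg_nonneg sum_nonneg) auto
  ultimately show ?thesis by (simp add: sum_subtractf right_diff_distrib)
 qed
 have "(SUP N. ennreal (2 * pi) * (\<Sum>n\<in>win N. ennreal ((cmod (fc h n))^2))) = L2sq h"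
 proof (rule antisym)
  show "(SUP N. ennreal (2 * pi) * (\<Sum>n\<in>win N. ennreal ((cmod (fc h n))^2))) \<le> L2sq h"
   unfolding L2sq_eq_integral[OF h] using le
   by (intro SUP_least) (simp add: ennreal_mult[symmetric] sum_nonneg)
  show "L2sq h \<le> (SUP N. ennreal (2 * pi) * (\<Sum>n\<in>win N. ennreal ((cmod (fc h n))^2)))"
  proof (rule ennreal_le_epsilon)
   fix e :: real assume "0 < e"
   then obtain c N where c: "L2sq (\<lambda>z. h z - trig_sum c N z) < ennreal e"
    using trig_approx_L2[OF h] unfolding trig_approx_def by blast
   have "L2sq h \<le> ennreal (e + 2 * pi * ?S N)" unfolding L2sq_eq_integral[OF h] using ge[OF c] by (rule ennreal_leI)
   also have "\<dots> = ennreal (2 * pi) * (\<Sum>n\<in>win N. ennreal ((cmod (fc h n))^2)) + ennreal e"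
    using \<open>0 < e\<close> by (simp add: ennreal_mult[symmetric] sum_nonneg ennreal_plus add.commute)
   also have "\<dots> \<le> (SUP N. ennreal (2 * pi) * (\<Sum>n\<in>win N. ennreal ((cmod (fc h n))^2))) + ennreal e"
    by (intro add_right_mono SUP_upper) auto
   finally show "L2sq h \<le> (SUP N. ennreal (2 * pi) * (\<Sum>n\<in>win N. ennreal ((cmod (fc h n))^2))) + ennreal e" .
  qed
 qed
 then show ?thesis by (simp add: nn_integral_int_SUP SUP_mult_left_ennreal)
qed

section \<open>The Dirichlet energy as a double integral\<close>

definition dirE :: "(complex \<Rightarrow> complex) \<Rightarrow> ennreal" where
 "dirE h = (\<integral>\<^sup>+p. ennreal ((cmod (h (fst p) - h (snd p)) / cmod (fst p - snd p))^2) \<partial>ds2)"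

declare id_arc_measurable [measurable]

lemma measurable_arc_diff [measurable]:
 "(\<lambda>p. fst p - snd p) \<in> borel_measurable ds2"
 using measurable_compose[OF measurable_fst id_arc_measurable] measurable_compose[OF measurable_snd id_arc_measurable]
 by (rule borel_measurable_diff)

lemma measurable_dirE_integrand:
 assumes [measurable]: "h \<in> meas"
 shows "(\<lambda>p. ennreal ((cmod (h (fst p) - h (snd p)) / cmod (fst p - snd p))^2)) \<in> borel_measurable ds2"
 by measurable

lemma dirE_iterated:
 assumes h: "h \<in> meas"
 shows "dirE h = (\<integral>\<^sup>+x. \<integral>\<^sup>+y. ennreal ((cmod (h x - h y) / cmod (x - y))^2) \<partial>ds \<partial>ds)"
 unfolding dirE_def arc.nn_integral_fst[OF measurable_dirE_integrand[OF h], symmetric] by simp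

lemma dirE_cong_AE:
 assumes h: "h \<in> meas" and ae: "AE z in ds. h z = k z"
 shows "dirE h = dirE k"
 unfolding dirE_iterated[OF h] dirE_iterated[OF borel_measurable_arc_AE[OF h ae]]
proof (rule nn_integral_cong_AE, use ae in eventually_elim)
 case (elim x)
 show ?case by (rule nn_integral_cong_AE, use ae in eventually_elim) (simp add: elim)
qed

lemma L2sq_cong_AE: "AE z in ds. h z = k z ==> L2sq h = L2sq k"
 unfolding L2sq_def by (intro nn_integral_cong_AE) auto

lemma borel_version_function:
 fixes h :: "complex \<Rightarrow> complex"
 assumes h: "h \<in> meas"
 obtains h' where "h' \<in> borel_measurable borel" "AE z in ds. h z = h' z"
proof -
 have real: "\<exists>g\<in>borel_measurable borel. AE z in ds. f z = g z" if f: "f \<in> meas" for f :: "complex \<Rightarrow> real"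
 proof -
  obtain g where g: "g \<in> borel_measurable arc_param" "AE z in arc_param. f z = g z"
   using completion_ex_borel_measurable_real[OF f[unfolded arc_length_eq]] by blast
  have "g \<in> borel_measurable (restrict_space borel circle)"
   using g(1) by (subst (asm) measurable_cong_sets[OF sets_arc_param refl])
  then have "(\<lambda>z. indicator circle z *\<^sub>R g z) \<in> borel_measurable borel"
   by (subst (asm) borel_measurable_restrict_space_iff) auto
  moreover have "AE z in ds. f z = indicator circle z *\<^sub>R g z"
  proof -
   have "AE z in ds. f z = g z" unfolding arc_length_eq by (rule AE_completion[OF g(2)])
   then show ?thesis using AE_space by eventually_elim simp
  qed
  ultimately show ?thesis by (intro bexI[of _ "\<lambda>z. indicator circle z *\<^sub>R g z"])
 qed
 have "(\<lambda>z. Re (h z)) \<in> meas" "(\<lambda>z. Im (h z)) \<in> meas"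
  using h by measurable
 from real[OF this(1)] real[OF this(2)] obtain a b where
  ab: "a \<in> borel_measurable borel" "b \<in> borel_measurable borel"
  and ae: "AE z in ds. Re (h z) = a z" "AE z in ds. Im (h z) = b z" by (elim bexE)
 show ?thesis
 proof (rule that[of "\<lambda>z. of_real (a z) + \<i> * of_real (b z)"])
  show "(\<lambda>z. of_real (a z) + \<i> * of_real (b z)) \<in> borel_measurable borel" using ab by measurable
  show "AE z in ds. h z = of_real (a z) + \<i> * of_real (b z)"
   using ae by eventually_elim (simp add: complex_eq_iff)
 qed
qed

lemma L2_circle_cong_AE:
 assumes "h \<in> L2_circle" "AE z in ds. h z = k z"
 shows "k \<in> L2_circle"
 using assms borel_measurable_arc_AE[of h k] L2sq_cong_AE[of h k] by (simp add: L2_circle_iff)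

lemma fourier_coeff_rotate:
 assumes h: "h \<in> meas" and c: "c \<in> circle"
 shows "fc (\<lambda>z. h (c * z)) n = c powi n * fc h n"
proof -
 have cc: "c powi n * cnj c powi n = 1"
  using circle_cmod_powi[OF c, of n] circle_mult_cnj[of "c powi n"] by (simp add: cnj_powi)
 have m: "(\<lambda>y. h y * cnj y powi n) \<in> meas"
 proof -
  have [measurable]: "(\<lambda>z. cnj z powi n) \<in> meas"
   by (rule borel_measurable_arc_length) measurable
  show ?thesis using h by measurable
 qed
 have "(LINT z|ds. h (c * z) * cnj z powi n) = (LINT z|ds. c powi n * (h (c * z) * cnj (c * z) powi n))"
 proof (intro Bochner_Integration.integral_cong refl)
  fix z
  have "c powi n * (h (c * z) * cnj (c * z) powi n) = (c powi n * cnj c powi n) * (h (c * z) * cnj z powi n)"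
   by (simp add: power_int_mult_distrib mult_ac)
  then show "h (c * z) * cnj z powi n = c powi n * (h (c * z) * cnj (c * z) powi n)" by (simp only: cc mult_1)
 qed
 also have "\<dots> = c powi n * (LINT z|ds. h z * cnj z powi n)"
  using integral_rotate[OF m c] by simp
 finally show ?thesis by (simp add: fourier_coeff_def)
qed

lemma nn_integral_dirichlet_kernel:
 "(\<integral>\<^sup>+\<tau>. ennreal ((cmod (1 - \<tau> powi n) / cmod (1 - \<tau>))^2) \<partial>ds) = ennreal (2 * pi * \<bar>real_of_int n\<bar>)"
proof (cases "n = 0")
 case False
 define m where "m = nat \<bar>n\<bar>"
 have m: "m > 0" "real m = \<bar>real_of_int n\<bar>" using False by (auto simp: m_def)
 have eq: "(cmod (1 - \<tau> powi n) / cmod (1 - \<tau>))^2 = real m * fejer (m - 1) (1 * cnj \<tau>)"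
  if t: "\<tau> \<in> circle" "\<tau> \<noteq> 1" for \<tau>
 proof -
  have "cmod (1 - \<tau> powi n) = cmod (1 - \<tau> ^ m)"
  proof (cases "n \<ge> 0")
   case True then show ?thesis by (simp add: m_def power_int_def)
  next
   case False
   have n: "n = - int m" using False by (simp add: m_def)
   have "\<tau> powi n * \<tau> powi (int m) = 1" using t(1) by (subst circle_powi_add) (auto simp: n)
   then have "(1 - \<tau> powi n) * \<tau> ^ m = - (1 - \<tau> ^ m)" by (simp add: left_diff_distrib)
   then have "cmod (1 - \<tau> powi n) * cmod (\<tau> ^ m) = cmod (1 - \<tau> ^ m)" by (metis norm_minus_cancel norm_mult)
   then show ?thesis using t(1) by (simp add: norm_power)
  qed
  moreover have "1 - \<tau> ^ m = (1 - \<tau>) * (\<Sum>k\<le>m - 1. \<tau> ^ k)"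
   using m(1) one_diff_power_eq'[of \<tau> m] one_diff_power_eq[of \<tau> m] by (cases m) (auto simp: lessThan_Suc_atMost)
  ultimately have "cmod (1 - \<tau> powi n) / cmod (1 - \<tau>) = cmod (\<Sum>k\<le>m - 1. \<tau> ^ k)"
   using t(2) by (simp add: norm_mult)
  moreover have "(\<Sum>k\<le>m - 1. (cnj \<tau>) ^ k) = cnj (\<Sum>k\<le>m - 1. \<tau> ^ k)" by simp
  then have "real m * fejer (m - 1) (cnj \<tau>) = (cmod (\<Sum>k\<le>m - 1. \<tau> ^ k))^2"
   using m(1) unfolding fejer_def by (simp only: complex_mod_cnj) (simp add: of_nat_diff)
  ultimately show ?thesis by simp
 qed
 have "(\<integral>\<^sup>+\<tau>. ennreal ((cmod (1 - \<tau> powi n) / cmod (1 - \<tau>))^2) \<partial>ds) = (\<integral>\<^sup>+\<tau>. ennreal (real m * fejer (m - 1) (1 * cnj \<tau>)) \<partial>ds)"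
 proof (rule nn_integral_cong_AE)
  show "AE \<tau> in ds. ennreal ((cmod (1 - \<tau> powi n) / cmod (1 - \<tau>))^2) = ennreal (real m * fejer (m - 1) (1 * cnj \<tau>))"
   using AE_neq[of 1] AE_space by eventually_elim (subst eq, auto)
 qed
 also have "\<dots> = ennreal (LINT \<tau>|ds. real m * fejer (m - 1) (1 * cnj \<tau>))"
 proof (rule nn_integral_eq_integral)
  show "integrable ds (\<lambda>\<tau>. real m * fejer (m - 1) (1 * cnj \<tau>))"
   by (intro integrable_mult_right kernel_integrable[OF fejer_kernel]) simp
 qed (simp add: fejer_def)
 also have "\<dots> = ennreal (2 * pi * \<bar>real_of_int n\<bar>)"
  using kernel_integral[OF fejer_kernel, of 1 "m - 1"] m(2) by (simp add: mult_ac)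
 finally show ?thesis .
qed simp

text \<open>Douglas' formula. After the substitution \<open>y = x \<tau>\<close> the inner integral is by Parseval's identity
 a sum over the Fourier coefficients, and the integral over \<open>\<tau>\<close> of the weight of the \<open>n\<close>-th
 one is that of the Fejer kernel.\<close>

theorem douglas:
 assumes h: "h \<in> L2_circle"
 shows "dirE h = ennreal (4 * pi^2) * (\<integral>\<^sup>+n. ennreal (\<bar>real_of_int n\<bar> * (cmod (fc h n))^2) \<partial>count_space UNIV)"
proof -
 have hm: "h \<in> meas" using h by (rule L2_circle_measurable)
 obtain k where k: "k \<in> borel_measurable borel" and ae: "AE z in ds. h z = k z"
  using borel_version_function[OF hm] by blast
 have kL: "k \<in> L2_circle" by (rule L2_circle_cong_AE[OF h ae])
 have km: "k \<in> meas" using kL by (rule L2_circle_measurable)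
 let ?c = "\<lambda>n. (cmod (fc k n))^2"
 have [measurable]: "(\<lambda>z. z powi n) \<in> meas" for n by (rule measurable_powi_arc)
 have mult_m: "(\<lambda>p. snd p * fst p) \<in> borel_measurable ds2"
  by (intro borel_measurable_times measurable_compose[OF measurable_fst id_arc_measurable]
    measurable_compose[OF measurable_snd id_arc_measurable])
 have sm: "(\<lambda>p. snd p) \<in> borel_measurable ds2"
  by (rule measurable_compose[OF measurable_snd id_arc_measurable])
 have fm: "(\<lambda>p. fst p) \<in> borel_measurable ds2"
  by (rule measurable_compose[OF measurable_fst id_arc_measurable])
 have "dirE h = dirE k" by (rule dirE_cong_AE[OF hm ae])
 also have "\<dots> = (\<integral>\<^sup>+x. \<integral>\<^sup>+y. ennreal ((cmod (k x - k y) / cmod (x - y))^2) \<partial>ds \<partial>ds)"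
  by (rule dirE_iterated[OF km])
 also have "\<dots> = (\<integral>\<^sup>+x. \<integral>\<^sup>+\<tau>. ennreal ((cmod (k x - k (x * \<tau>)) / cmod (1 - \<tau>))^2) \<partial>ds \<partial>ds)"
 proof (rule nn_integral_cong)
  fix x assume "x \<in> space ds" then have x: "x \<in> circle" by simp
  have "(\<integral>\<^sup>+y. ennreal ((cmod (k x - k y) / cmod (x - y))^2) \<partial>ds) = (\<integral>\<^sup>+\<tau>. ennreal ((cmod (k x - k (x * \<tau>)) / cmod (x - x * \<tau>))^2) \<partial>ds)"
   using nn_integral_rotate[of "\<lambda>y. ennreal ((cmod (k x - k y) / cmod (x - y))^2)" x] x km by simp
  moreover have "cmod (x - x * \<tau>) = cmod (1 - \<tau>)" for \<tau>
   using x norm_mult[of x "1 - \<tau>"] by (simp add: right_diff_distrib)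
  ultimately show "(\<integral>\<^sup>+y. ennreal ((cmod (k x - k y) / cmod (x - y))^2) \<partial>ds) = (\<integral>\<^sup>+\<tau>. ennreal ((cmod (k x - k (x * \<tau>)) / cmod (1 - \<tau>))^2) \<partial>ds)" by simp
 qed
 also have "\<dots> = (\<integral>\<^sup>+\<tau>. \<integral>\<^sup>+x. ennreal ((cmod (k x - k (x * \<tau>)) / cmod (1 - \<tau>))^2) \<partial>ds \<partial>ds)"
 proof (rule arc2.Fubini'[where f="\<lambda>\<tau> x. ennreal ((cmod (k x - k (x * \<tau>)) / cmod (1 - \<tau>))^2)"])
  have "(\<lambda>p. k (snd p)) \<in> borel_measurable ds2" by (rule measurable_compose[OF sm k])
  moreover have "(\<lambda>p. k (snd p * fst p)) \<in> borel_measurable ds2" by (rule measurable_compose[OF mult_m k])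
  ultimately show "(\<lambda>(\<tau>, x). ennreal ((cmod (k x - k (x * \<tau>)) / cmod (1 - \<tau>))^2)) \<in> borel_measurable ds2"
   using fm unfolding split_beta' by measurable
 qed
 also have "\<dots> = (\<integral>\<^sup>+\<tau>. \<integral>\<^sup>+n. ennreal (2 * pi) * (ennreal (?c n) * ennreal ((cmod (1 - \<tau> powi n) / cmod (1 - \<tau>))^2)) \<partial>count_space UNIV \<partial>ds)"
 proof (rule nn_integral_cong)
  fix \<tau> assume "\<tau> \<in> space ds" then have t: "\<tau> \<in> circle" by simp
  have rm: "(\<lambda>x. k (\<tau> * x)) \<in> meas" by (rule measurable_rotate_comp[OF km t])
  have rL: "(\<lambda>x. k (\<tau> * x)) \<in> L2_circle"
  proof -
   have "(\<lambda>x. ennreal ((cmod (k x))^2)) \<in> meas" using km by measurable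
   from nn_integral_rotate[OF this t] show ?thesis
    using kL rm by (simp add: L2_circle_iff L2sq_def)
  qed
  have "(\<integral>\<^sup>+x. ennreal ((cmod (k x - k (x * \<tau>)) / cmod (1 - \<tau>))^2) \<partial>ds)
   = (\<integral>\<^sup>+x. ennreal (1 / (cmod (1 - \<tau>))^2) * ennreal ((cmod (k x - k (\<tau> * x)))^2) \<partial>ds)"
   by (intro nn_integral_cong) (simp add: power_divide mult.commute flip: ennreal_mult')
  also have "\<dots> = ennreal (1 / (cmod (1 - \<tau>))^2) * L2sq (\<lambda>x. k x - k (\<tau> * x))"
   unfolding L2sq_def using km rm by (intro nn_integral_cmult) simp
  also have "\<dots> = ennreal (1 / (cmod (1 - \<tau>))^2) * (ennreal (2 * pi) * (\<integral>\<^sup>+n. ennreal ((cmod (1 - \<tau> powi n))^2 * ?c n) \<partial>count_space UNIV))"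
  proof -
   have "fc (\<lambda>x. k x - k (\<tau> * x)) n = (1 - \<tau> powi n) * fc k n" for n
    using fourier_coeff_diff[OF L2_circle_integrable[OF kL] L2_circle_integrable[OF rL]] fourier_coeff_rotate[OF km t]
    by (simp add: left_diff_distrib)
   then show ?thesis unfolding parseval[OF L2_circle_diff[OF kL rL]] by (simp add: norm_mult power_mult_distrib)
  qed
  also have "\<dots> = (\<integral>\<^sup>+n. ennreal (2 * pi) * (ennreal (?c n) * ennreal ((cmod (1 - \<tau> powi n) / cmod (1 - \<tau>))^2)) \<partial>count_space UNIV)"
   by (subst nn_integral_cmult[symmetric], simp, subst nn_integral_cmult[symmetric], simp)
     (intro nn_integral_cong, simp add: power_divide mult_ac flip: ennreal_mult')
  finally show "(\<integral>\<^sup>+x. ennreal ((cmod (k x - k (x * \<tau>)) / cmod (1 - \<tau>))^2) \<partial>ds) = \<dots>" .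
 qed
 also have "\<dots> = (\<integral>\<^sup>+n. \<integral>\<^sup>+\<tau>. ennreal (2 * pi) * (ennreal (?c n) * ennreal ((cmod (1 - \<tau> powi n) / cmod (1 - \<tau>))^2)) \<partial>ds \<partial>count_space UNIV)"
  by (rule nn_integral_count_space_nn_integral) (auto intro!: countableI_type)
 also have "\<dots> = (\<integral>\<^sup>+n. ennreal (4 * pi^2) * ennreal (\<bar>real_of_int n\<bar> * ?c n) \<partial>count_space UNIV)"
 proof (rule nn_integral_cong)
  fix n :: int
  let ?k = "\<lambda>\<tau>. ennreal ((cmod (1 - \<tau> powi n) / cmod (1 - \<tau>))^2)"
  have km: "?k \<in> meas" by measurable
  have "(\<integral>\<^sup>+\<tau>. ennreal (2 * pi) * (ennreal (?c n) * ?k \<tau>) \<partial>ds) = ennreal (2 * pi) * (ennreal (?c n) * (\<integral>\<^sup>+\<tau>. ?k \<tau> \<partial>ds))"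
   unfolding nn_integral_cmult[OF km, symmetric] using km by (intro nn_integral_cmult) simp
  also have "\<dots> = ennreal (4 * pi^2) * ennreal (\<bar>real_of_int n\<bar> * ?c n)"
   unfolding nn_integral_dirichlet_kernel by (simp add: power2_eq_square mult_ac flip: ennreal_mult')
  finally show "(\<integral>\<^sup>+\<tau>. ennreal (2 * pi) * (ennreal (?c n) * ?k \<tau>) \<partial>ds) = ennreal (4 * pi^2) * ennreal (\<bar>real_of_int n\<bar> * ?c n)" .
 qed
 also have "\<dots> = ennreal (4 * pi^2) * (\<integral>\<^sup>+n. ennreal (\<bar>real_of_int n\<bar> * ?c n) \<partial>count_space UNIV)"
  by (rule nn_integral_cmult) simp
 finally show ?thesis by (simp add: fourier_coeff_cong_AE[OF hm ae])
qed

definition sob :: "(complex \<Rightarrow> complex) \<Rightarrow> ennreal" where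
 "sob h = (\<integral>\<^sup>+n. ennreal (wt n * (cmod (fc h n))^2) \<partial>count_space UNIV)"

text \<open>Equivalent to the square of the norm, but visibly not increased by contractions such as \<open>\<bar>h\<bar>\<close> or truncations,
and valued in the extended reals, so that finiteness need not be known in advance.\<close>

definition DN :: "(complex \<Rightarrow> complex) \<Rightarrow> ennreal" where
 "DN h = L2sq h + dirE h"

lemma sob_bounds:
 assumes h: "h \<in> L2_circle"
 shows "sob h \<le> DN h" and "DN h \<le> ennreal (4 * pi^2) * sob h"
proof -
 let ?a = "\<integral>\<^sup>+n. ennreal ((cmod (fc h n))^2) \<partial>count_space UNIV"
 let ?b = "\<integral>\<^sup>+n. ennreal (\<bar>real_of_int n\<bar> * (cmod (fc h n))^2) \<partial>count_space UNIV"
 have sob: "sob h = ?a + ?b"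
  unfolding sob_def by (subst nn_integral_add[symmetric]) (auto simp: distrib_right ennreal_plus)
 have pi1: "1 \<le> 2 * pi" "1 \<le> 4 * pi^2" "2 * pi \<le> 4 * pi^2"
  using pi_gt3 power_mono[of 1 pi 2] mult_mono[of 1 pi 2 "4 * pi"] by (auto simp: power2_eq_square)
 have "?a \<le> ennreal (2 * pi) * ?a" "?b \<le> ennreal (4 * pi^2) * ?b"
  using mult_right_mono[of 1 "ennreal (2*pi)" ?a] mult_right_mono[of 1 "ennreal (4 * pi^2)" ?b] pi1 by auto
 then show "sob h \<le> DN h" unfolding DN_def sob parseval[OF h] douglas[OF h] by (rule add_mono)
 show "DN h \<le> ennreal (4 * pi^2) * sob h"
  unfolding DN_def sob parseval[OF h] douglas[OF h] distrib_left
  using pi1 by (intro add_mono mult_right_mono ennreal_leI) auto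
qed

lemma sob_summable:
 "(\<lambda>n::int. wt n * (cmod (fc h n))^2) summable_on UNIV \<longleftrightarrow> sob h < \<infinity>"
proof -
 let ?f = "\<lambda>n::int. wt n * (cmod (fc h n))^2"
 have "?f summable_on UNIV \<longleftrightarrow> Infinite_Set_Sum.abs_summable_on ?f UNIV"
  using summable_on_iff_abs_summable_on_real[of ?f UNIV] abs_summable_equivalent[of ?f UNIV] by blast
 also have "\<dots> \<longleftrightarrow> sob h < \<infinity>"
  by (simp add: abs_summable_on_def integrable_iff_bounded sob_def)
 finally show ?thesis .
qed

lemma harmonic_dirichlet_iff: "h \<in> HD \<longleftrightarrow> h \<in> meas \<and> DN h < \<infinity>"
proof
 assume "h \<in> HD"
 then have L: "h \<in> L2_circle" and "sob h < \<infinity>" by (auto simp: harmonic_dirichlet_def sob_summable)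
 then have "ennreal (4 * pi^2) * sob h < \<infinity>" by (simp add: ennreal_mult_less_top)
 then show "h \<in> meas \<and> DN h < \<infinity>"
  using sob_bounds(2)[OF L] L by (auto simp: L2_circle_measurable)
next
 assume h: "h \<in> meas \<and> DN h < \<infinity>"
 then have "L2sq h < \<infinity>" unfolding DN_def by (auto simp: less_top)
 then have L: "h \<in> L2_circle" using h by (simp add: L2_circle_iff)
 then show "h \<in> HD" using sob_bounds(1)[OF L] h by (auto simp: harmonic_dirichlet_def sob_summable)
qed

lemma harmonic_L2: "h \<in> HD ==> h \<in> L2_circle"
 by (simp add: harmonic_dirichlet_def)

lemma harmonic_measurable: "h \<in> HD ==> h \<in> meas"
 by (simp add: harmonic_dirichlet_iff)

lemma dirichlet_norm_sq:
 assumes "h \<in> HD"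
 shows "ennreal ((dnorm h)^2) = sob h"
proof -
 let ?f = "\<lambda>n::int. wt n * (cmod (fc h n))^2"
 have s: "?f summable_on UNIV" using assms by (simp add: harmonic_dirichlet_def)
 then have a: "Infinite_Set_Sum.abs_summable_on ?f UNIV" using summable_on_iff_abs_summable_on_real[of ?f UNIV] abs_summable_equivalent[of ?f UNIV] by blast
 have "0 \<le> infsum ?f UNIV" by (intro infsum_nonneg) simp
 then have "(dnorm h)^2 = infsum ?f UNIV" unfolding dirichlet_norm_def by (rule real_sqrt_pow2)
 also have "\<dots> = infsetsum ?f UNIV" by (rule infsetsum_infsum[OF a, symmetric])
 also have "ennreal \<dots> = sob h" unfolding infsetsum_def sob_def
  using a by (intro nn_integral_eq_integral[symmetric]) (auto simp: abs_summable_on_def)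
 finally show ?thesis .
qed

lemma dirichlet_norm_nonneg: "0 \<le> dnorm h"
 by (simp add: dirichlet_norm_def infsum_nonneg)

lemma dirichlet_norm_le_DN:
 assumes "h \<in> HD" shows "ennreal ((dnorm h)^2) \<le> DN h"
 unfolding dirichlet_norm_sq[OF assms] by (rule sob_bounds(1)[OF harmonic_L2[OF assms]])

lemma DN_le_dirichlet_norm:
 assumes "h \<in> HD" shows "DN h \<le> ennreal (4 * pi^2 * (dnorm h)^2)"
 using sob_bounds(2)[OF harmonic_L2[OF assms]] by (simp add: dirichlet_norm_sq[OF assms, symmetric] ennreal_mult')

lemma sum_dirichlet_le:
 assumes "h \<in> HD"
 shows "(\<Sum>n\<in>win N. wt n * (cmod (fc h n))^2) \<le> (dnorm h)^2"
proof -
 have "ennreal (\<Sum>n\<in>win N. wt n * (cmod (fc h n))^2) \<le> ennreal ((dnorm h)^2)"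
  unfolding dirichlet_norm_sq[OF assms] sob_def nn_integral_int_SUP
  by (intro SUP_upper2[of N]) (auto simp: sum_ennreal[symmetric] simp del: sum_ennreal)
 then show ?thesis by (simp add: ennreal_le_iff)
qed

section \<open>Estimates of the Dirichlet energy\<close>

lemma weighted_square_sum_le: "(a * x + b * y)^2 \<le> 2 * a^2 * x^2 + 2 * b^2 * (y::real)^2"
 using sum_squares_bound[of "a * x" "b * y"] by (simp add: power2_sum power_mult_distrib)

lemma dirE_add_le:
 assumes [measurable]: "h \<in> meas" "k \<in> meas" "u \<in> meas"
  and le: "\<And>x y. x \<in> circle ==> y \<in> circle ==> cmod (u x - u y) \<le> a * cmod (h x - h y) + b * cmod (k x - k y)"
  and ab: "0 \<le> a" "0 \<le> b"
 shows "dirE u \<le> ennreal (2 * a^2) * dirE h + ennreal (2 * b^2) * dirE k"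
proof -
 let ?q = "\<lambda>h p. (cmod (h (fst p) - h (snd p)) / cmod (fst p - snd p))^2"
 have "dirE u \<le> (\<integral>\<^sup>+p. ennreal (2 * a^2) * ennreal (?q h p) + ennreal (2 * b^2) * ennreal (?q k p) \<partial>ds2)"
  unfolding dirE_def
 proof (intro nn_integral_mono)
  fix p assume "p \<in> space ds2"
  then have p: "fst p \<in> circle" "snd p \<in> circle" by (auto simp: space_pair_measure)
  let ?d = "cmod (fst p - snd p)"
  have "cmod (u (fst p) - u (snd p)) / ?d \<le> (a * cmod (h (fst p) - h (snd p)) + b * cmod (k (fst p) - k (snd p))) / ?d"
   by (intro divide_right_mono le p) auto
  then have "?q u p \<le> (a * (cmod (h (fst p) - h (snd p)) / ?d) + b * (cmod (k (fst p) - k (snd p)) / ?d))^2"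
   by (intro power_mono) (auto simp: add_divide_distrib)
  also have "\<dots> \<le> 2 * a^2 * ?q h p + 2 * b^2 * ?q k p"
   by (rule weighted_square_sum_le)
  finally have "ennreal (?q u p) \<le> ennreal (2 * a^2 * ?q h p + 2 * b^2 * ?q k p)" by (rule ennreal_leI)
  also have "\<dots> = ennreal (2 * a^2) * ennreal (?q h p) + ennreal (2 * b^2) * ennreal (?q k p)"
   by (subst ennreal_plus) (auto simp: ennreal_mult)
  finally show "ennreal (?q u p) \<le> \<dots>" .
 qed
 also have "\<dots> = ennreal (2 * a^2) * dirE h + ennreal (2 * b^2) * dirE k"
  unfolding dirE_def by (subst nn_integral_add) (auto simp: nn_integral_cmult)
 finally show ?thesis .
qed

lemma dirE_contraction:
 assumes "\<And>x y. x \<in> circle ==> y \<in> circle ==> cmod (u x - u y) \<le> cmod (h x - h y)"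
 shows "dirE u \<le> dirE h"
 unfolding dirE_def
 by (intro nn_integral_mono ennreal_leI power_mono divide_right_mono assms)
   (auto simp: space_pair_measure)

lemma emeasure_PP: "emeasure ds2 (space ds2) = ennreal (4 * pi^2)"
proof -
 have "circle \<in> sets ds" using sets.top[of ds] by simp
 then show ?thesis
  by (simp add: space_pair_measure arc.emeasure_pair_measure_Times emeasure_arc_length_circle power2_eq_square flip: ennreal_mult)
qed

lemma dirE_lipschitz:
 assumes "\<And>x y. x \<in> circle ==> y \<in> circle ==> cmod (u x - u y) \<le> L * cmod (x - y)"
 shows "dirE u \<le> ennreal (4 * pi^2 * L^2)"
proof -
 have "dirE u \<le> (\<integral>\<^sup>+p. ennreal (L^2) \<partial>ds2)"
  unfolding dirE_def
 proof (intro nn_integral_mono ennreal_leI)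
  fix p assume "p \<in> space ds2"
  then have "cmod (u (fst p) - u (snd p)) \<le> L * cmod (fst p - snd p)" by (intro assms) (auto simp: space_pair_measure)
  then have "cmod (u (fst p) - u (snd p)) / cmod (fst p - snd p) \<le> \<bar>L\<bar>"
   by (cases "fst p = snd p") (auto simp: field_simps intro: order_trans[OF _ mult_right_mono])
  then have "(cmod (u (fst p) - u (snd p)) / cmod (fst p - snd p))^2 \<le> \<bar>L\<bar>^2" by (intro power_mono) auto
  then show "(cmod (u (fst p) - u (snd p)) / cmod (fst p - snd p))^2 \<le> L^2" by simp
 qed
 also have "\<dots> = ennreal (4 * pi^2 * L^2)" by (simp add: emeasure_PP mult.commute flip: ennreal_mult)
 finally show ?thesis .
qed

lemma DN_lipschitz:
 assumes "\<And>x y. x \<in> circle ==> y \<in> circle ==> cmod (u x - u y) \<le> L * cmod (x - y)"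
  "\<And>x. x \<in> circle ==> cmod (u x) \<le> B"
 shows "DN u \<le> ennreal (2 * pi * B^2 + 4 * pi^2 * L^2)"
 unfolding DN_def using add_mono[OF L2sq_bounded[of u B, OF assms(2)] dirE_lipschitz[of u L, OF assms(1)]]
 by (simp add: ennreal_plus)

lemma lipschitz_harmonic:
 assumes "\<And>x y. x \<in> circle ==> y \<in> circle ==> cmod (u x - u y) \<le> L * cmod (x - y)"
 shows "u \<in> HD"
 unfolding harmonic_dirichlet_iff
 using DN_lipschitz[of u L, OF assms lipschitz_circle_bounded[OF assms]] lipschitz_circle_measurable[OF assms]
 by (auto simp: le_less_trans)

lemma DN_add_le:
 assumes "h \<in> meas" "k \<in> meas"
 shows "DN (\<lambda>z. h z + k z) \<le> 2 * DN h + 2 * DN k"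
proof -
 have "cmod (h x + k x - (h y + k y)) \<le> 1 * cmod (h x - h y) + 1 * cmod (k x - k y)" for x y
  using norm_triangle_ineq[of "h x - h y" "k x - k y"] by (simp add: algebra_simps)
 then have "dirE (\<lambda>z. h z + k z) \<le> 2 * dirE h + 2 * dirE k"
  using dirE_add_le[OF assms borel_measurable_add[OF assms], of 1 1] by simp
 then have "DN (\<lambda>z. h z + k z) \<le> (2 * L2sq h + 2 * L2sq k) + (2 * dirE h + 2 * dirE k)"
  unfolding DN_def by (intro add_mono L2sq_add_le assms)
 also have "\<dots> = 2 * DN h + 2 * DN k" by (simp add: DN_def distrib_left add_ac)
 finally show ?thesis .
qed

lemma DN_cmult:
 assumes [measurable]: "h \<in> meas"
 shows "DN (\<lambda>z. c * h z) = ennreal ((cmod c)^2) * DN h"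
proof -
 have "dirE (\<lambda>z. c * h z) = (\<integral>\<^sup>+p. ennreal ((cmod c)^2) * ennreal ((cmod (h (fst p) - h (snd p)) / cmod (fst p - snd p))^2) \<partial>ds2)"
  unfolding dirE_def
  by (intro nn_integral_cong) (simp add: norm_mult power_mult_distrib flip: ennreal_mult' right_diff_distrib times_divide_eq_right)
 also have "\<dots> = ennreal ((cmod c)^2) * dirE h" unfolding dirE_def by (rule nn_integral_cmult) measurable
 finally show ?thesis by (simp add: DN_def L2sq_cmult distrib_left)
qed

lemma harmonic_add: "h \<in> HD ==> k \<in> HD ==> (\<lambda>z. h z + k z) \<in> HD"
 unfolding harmonic_dirichlet_iff using DN_add_le[of h k]
 by (auto intro!: le_less_trans[of "DN (\<lambda>z. h z + k z)"] simp: ennreal_mult_less_top)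

lemma harmonic_cmult: "h \<in> HD ==> (\<lambda>z. c * h z) \<in> HD"
 unfolding harmonic_dirichlet_iff by (auto simp: DN_cmult ennreal_mult_less_top)

lemma harmonic_diff: "h \<in> HD ==> k \<in> HD ==> (\<lambda>z. h z - k z) \<in> HD"
 using harmonic_add[of h "\<lambda>z. - 1 * k z"] harmonic_cmult[of k "-1"] by simp

lemma harmonic_bounded_iff:
 assumes "h \<in> meas" "\<And>z. z \<in> circle ==> cmod (h z) \<le> B"
 shows "h \<in> HD \<longleftrightarrow> dirE h < \<infinity>"
 unfolding harmonic_dirichlet_iff DN_def using assms L2sq_bounded[of h B, OF assms(2)]
 by (auto simp: less_top[symmetric] top_unique)

lemma harmonic_cong_AE:
 assumes "h \<in> HD" "AE z in ds. h z = k z"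
 shows "k \<in> HD"
 using assms borel_measurable_arc_AE[of h k] L2sq_cong_AE[of h k] dirE_cong_AE[of h k]
 by (simp add: harmonic_dirichlet_iff DN_def)

lemma DN_cong_AE:
 "h \<in> meas ==> AE z in ds. h z = k z ==> DN h = DN k"
 by (simp add: DN_def L2sq_cong_AE dirE_cong_AE)

lemma harmonic_dirE: "h \<in> HD ==> dirE h < \<infinity>"
 unfolding harmonic_dirichlet_iff DN_def by (auto simp: less_top)

lemma harmonic_comp_bounded:
 assumes m: "u \<in> meas" "\<And>z. z \<in> circle ==> cmod (u z) \<le> B"
  and hk: "h \<in> HD" "k \<in> HD"
  and le: "\<And>x y. x \<in> circle ==> y \<in> circle ==> cmod (u x - u y) \<le> a * cmod (h x - h y) + b * cmod (k x - k y)"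
  and ab: "0 \<le> a" "0 \<le> b"
 shows "u \<in> HD"
proof -
 have "dirE u \<le> ennreal (2 * a^2) * dirE h + ennreal (2 * b^2) * dirE k"
  using hk by (intro dirE_add_le m le ab harmonic_measurable)
 also have "\<dots> < \<infinity>" using hk by (auto simp: ennreal_mult_less_top harmonic_dirE[simplified])
 finally show ?thesis using harmonic_bounded_iff[OF m] by blast
qed

lemma cmod_mult_diff_le:
 assumes "cmod b \<le> B" "cmod c \<le> C"
 shows "cmod (a * b - c * d) \<le> B * cmod (a - c) + C * cmod (b - d)"
proof -
 have "a * b - c * d = b * (a - c) + c * (b - d)" by (simp add: algebra_simps)
 then have "cmod (a * b - c * d) \<le> cmod b * cmod (a - c) + cmod c * cmod (b - d)"
  by (metis norm_mult norm_triangle_ineq)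
 also have "\<dots> \<le> B * cmod (a - c) + C * cmod (b - d)" using assms by (intro add_mono mult_right_mono) auto
 finally show ?thesis .
qed

lemma harmonic_mult:
 assumes hk: "h \<in> HD" "k \<in> HD"
  and B: "\<And>z. z \<in> circle ==> cmod (h z) \<le> B" and C: "\<And>z. z \<in> circle ==> cmod (k z) \<le> C"
 shows "(\<lambda>z. h z * k z) \<in> HD"
proof (rule harmonic_comp_bounded[OF _ _ hk, where a=C and b=B and B="B * C"])
 have B0: "0 \<le> B" "0 \<le> C" using order_trans[OF norm_ge_zero B[of 1]] order_trans[OF norm_ge_zero C[of 1]] by auto
 then show "0 \<le> C" "0 \<le> B" by auto
 show "(\<lambda>z. h z * k z) \<in> meas" using hk by (intro borel_measurable_times harmonic_measurable)
 show "cmod (h z * k z) \<le> B * C" if "z \<in> circle" for z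
  unfolding norm_mult using B0 by (intro mult_mono B C that) auto
 show "cmod (h x * k x - h y * k y) \<le> C * cmod (h x - h y) + B * cmod (k x - k y)" if "x \<in> circle" "y \<in> circle" for x y
  using cmod_mult_diff_le[OF C[OF that(1)] B[OF that(2)]] .
qed

text \<open>A Lipschitz factor is controlled without any bound on the other one, since then the energy
 of the product costs only the \<open>L^2\<close> norm.\<close>

lemma DN_lipschitz_mult:
 assumes hk: "h \<in> meas" and M: "\<And>z. z \<in> circle ==> cmod (h z) \<le> M"
  and lip: "\<And>x y. x \<in> circle ==> y \<in> circle ==> cmod (u x - u y) \<le> L * cmod (x - y)"
  and B: "\<And>x. x \<in> circle ==> cmod (u x) \<le> B"
 shows "DN (\<lambda>z. u z * h z) \<le> ennreal (2 * B^2) * DN h + ennreal (8 * pi^2 * L^2 * M^2)"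
proof -
 have B0: "0 \<le> B" "0 \<le> M" using order_trans[OF norm_ge_zero B[of 1]] order_trans[OF norm_ge_zero M[of 1]] by auto
 have um: "u \<in> meas" by (rule lipschitz_circle_measurable[OF lip])
 have "dirE (\<lambda>z. u z * h z) \<le> ennreal (2 * M^2) * dirE u + ennreal (2 * B^2) * dirE h"
  using cmod_mult_diff_le[OF M B]
  by (intro dirE_add_le um hk borel_measurable_times B0) blast+
 also have "\<dots> \<le> ennreal (2 * M^2) * ennreal (4 * pi^2 * L^2) + ennreal (2 * B^2) * dirE h"
  by (intro add_right_mono mult_left_mono dirE_lipschitz lip) auto
 also have "ennreal (2 * M^2) * ennreal (4 * pi^2 * L^2) = ennreal (8 * pi^2 * L^2 * M^2)"
  by (simp add: mult_ac flip: ennreal_mult)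
 finally have 1: "dirE (\<lambda>z. u z * h z) \<le> ennreal (8 * pi^2 * L^2 * M^2) + ennreal (2 * B^2) * dirE h" .
 have "L2sq (\<lambda>z. u z * h z) \<le> (\<integral>\<^sup>+z. ennreal (2 * B^2) * ennreal ((cmod (h z))^2) \<partial>ds)"
  unfolding L2sq_def
 proof (intro nn_integral_mono)
  fix z assume "z \<in> space ds"
  then have "(cmod (u z))^2 \<le> B^2" by (intro power_mono B) auto
  then have "(cmod (u z))^2 \<le> 2 * B^2" using zero_le_power2[of B] by linarith
  then have "(cmod (u z * h z))^2 \<le> 2 * B^2 * (cmod (h z))^2"
   unfolding norm_mult power_mult_distrib by (intro mult_right_mono) auto
  then show "ennreal ((cmod (u z * h z))^2) \<le> ennreal (2 * B^2) * ennreal ((cmod (h z))^2)"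
   by (simp flip: ennreal_mult)
 qed
 also have "\<dots> = ennreal (2 * B^2) * L2sq h" unfolding L2sq_def using hk by (intro nn_integral_cmult) simp
 finally have "DN (\<lambda>z. u z * h z) \<le> ennreal (2 * B^2) * L2sq h + (ennreal (8 * pi^2 * L^2 * M^2) + ennreal (2 * B^2) * dirE h)"
  unfolding DN_def using 1 by (rule add_mono)
 then show ?thesis by (simp add: DN_def distrib_left add_ac)
qed

lemma powi_lipschitz:
 assumes "x \<in> circle" "y \<in> circle"
 shows "cmod (x powi n - y powi n) \<le> \<bar>real_of_int n\<bar> * cmod (x - y)"
proof -
 have pos: "cmod (x ^ m - y ^ m) \<le> real m * cmod (x - y)" if "cmod x = 1" "cmod y = 1" for m x y
  using norm_power_diff[of x y m] that by simp
 show ?thesis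
 proof (cases "n \<ge> 0")
  case True then show ?thesis using pos[of x y "nat n"] assms by (simp add: power_int_def)
 next
  case False
  have "x powi n = cnj x ^ nat (-n)" "y powi n = cnj y ^ nat (-n)"
   using assms False by (auto simp: power_int_def cnj_circle)
  moreover have "cmod (cnj x - cnj y) = cmod (x - y)" by (metis complex_cnj_diff complex_mod_cnj)
  ultimately show ?thesis using pos[of "cnj x" "cnj y" "nat (-n)"] assms False by simp
 qed
qed

lemma trig_sum_lipschitz:
 assumes "x \<in> circle" "y \<in> circle"
 shows "cmod (trig_sum c N x - trig_sum c N y) \<le> (\<Sum>n\<in>win N. cmod (c n) * \<bar>real_of_int n\<bar>) * cmod (x - y)"
proof -
 have "trig_sum c N x - trig_sum c N y = (\<Sum>n\<in>win N. c n * (x powi n - y powi n))"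
  by (simp add: trig_sum_def sum_subtractf right_diff_distrib)
 also have "cmod \<dots> \<le> (\<Sum>n\<in>win N. cmod (c n) * \<bar>real_of_int n\<bar> * cmod (x - y))"
  using powi_lipschitz[OF assms] by (intro sum_norm_le) (auto simp: norm_mult mult.assoc intro: mult_left_mono)
 finally show ?thesis by (simp add: sum_distrib_right)
qed

lemma trig_sum_harmonic: "trig_sum c N \<in> HD"
 by (rule lipschitz_harmonic[OF trig_sum_lipschitz])

lemma fejer_mean_harmonic: "fejer_mean N h \<in> HD"
 unfolding fejer_mean_def by (rule trig_sum_harmonic)

lemma fejer_mean_bound:
 assumes "h \<in> meas" "\<And>w. w \<in> circle ==> cmod (h w) \<le> M" "z \<in> circle"
 shows "cmod (fejer_mean N h z) \<le> M"
 using conv_bound[OF fejer_kernel assms(1,3,2)] fejer_mean_eq_conv[OF integrable_arc_bounded[OF assms(1,2)] assms(3)] by simp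

lemma fejer_mult_bounds: "0 \<le> fejer_mult N n" "fejer_mult N n \<le> 1"
 by (auto simp: fejer_mult_def)

lemma fejer_mult_tendsto: "(\<lambda>N. fejer_mult N n) \<longlonglongrightarrow> 1"
proof -
 have "(\<lambda>N. max 0 (1 - \<bar>real_of_int n\<bar> * inverse (real (Suc N)))) \<longlonglongrightarrow> max 0 (1 - \<bar>real_of_int n\<bar> * 0)"
  by (intro tendsto_intros LIMSEQ_inverse_real_of_nat)
 then show ?thesis by (simp add: fejer_mult_def[abs_def] divide_inverse add.commute)
qed

lemma fourier_coeff_fejer_mean: "fc (fejer_mean N h) n = of_real (fejer_mult N n) * fc h n"
proof (cases "n \<in> win N")
 case False
 then have "real N + 1 \<le> \<bar>real_of_int n\<bar>" by auto
 then have "fejer_mult N n = 0" unfolding fejer_mult_def by (simp add: field_simps max_def)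
 then show ?thesis by (simp add: fejer_mean_def fourier_coeff_trig_sum)
qed (simp add: fejer_mean_def fourier_coeff_trig_sum)

lemma fejer_mean_tendsto:
 assumes h: "h \<in> HD"
 shows "(\<lambda>N. DN (\<lambda>z. h z - fejer_mean N h z)) \<longlonglongrightarrow> 0"
proof -
 have hi: "integrable ds h" by (intro L2_circle_integrable harmonic_L2 h)
 have fi: "integrable ds (fejer_mean N h)" for N by (intro L2_circle_integrable harmonic_L2 fejer_mean_harmonic)
 have c: "fc (\<lambda>z. h z - fejer_mean N h z) n = of_real (1 - fejer_mult N n) * fc h n" for N n
  using fourier_coeff_diff[OF hi fi] by (simp add: fourier_coeff_fejer_mean left_diff_distrib)
 have "(\<lambda>N. sob (\<lambda>z. h z - fejer_mean N h z)) \<longlonglongrightarrow> (\<integral>\<^sup>+n. 0 \<partial>count_space (UNIV :: int set))"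
  unfolding sob_def c
 proof (rule nn_integral_dominated_convergence)
  show "(\<integral>\<^sup>+n. ennreal (wt n * (cmod (fc h n))^2) \<partial>count_space UNIV) < \<infinity>"
   using h by (simp add: harmonic_dirichlet_def sob_summable flip: sob_def)
  show "AE n in count_space UNIV. ennreal (wt n * (cmod (of_real (1 - fejer_mult N n) * fc h n))^2)
    \<le> ennreal (wt n * (cmod (fc h n))^2)" for N
  proof (intro AE_I2 ennreal_leI mult_left_mono power_mono)
   fix n
   have "cmod (complex_of_real (1 - fejer_mult N n)) \<le> 1" unfolding norm_of_real using fejer_mult_bounds[of N n] by linarith
   then show "cmod (of_real (1 - fejer_mult N n) * fc h n) \<le> cmod (fc h n)"
    unfolding norm_mult by (simp add: mult_left_le_one_le)
  qed auto
  show "AE n in count_space UNIV. (\<lambda>N. ennreal (wt n * (cmod (of_real (1 - fejer_mult N n) * fc h n))^2)) \<longlonglongrightarrow> 0"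
  proof (rule AE_I2)
   fix n :: int
   have "(\<lambda>N. ennreal (wt n * (cmod (of_real (1 - fejer_mult N n) * fc h n))^2))
    \<longlonglongrightarrow> ennreal (wt n * (cmod (of_real (1 - 1) * fc h n))^2)"
    by (intro tendsto_intros fejer_mult_tendsto)
   then show "(\<lambda>N. ennreal (wt n * (cmod (of_real (1 - fejer_mult N n) * fc h n))^2)) \<longlonglongrightarrow> 0" by simp
  qed
 qed auto
 then have s0: "(\<lambda>N. sob (\<lambda>z. h z - fejer_mean N h z)) \<longlonglongrightarrow> 0" by simp
 have s1: "(\<lambda>N. ennreal (4 * pi^2) * sob (\<lambda>z. h z - fejer_mean N h z)) \<longlonglongrightarrow> 0"
  using ennreal_tendsto_cmult[OF _ s0, of "ennreal (4 * pi^2)"] by simp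
 show ?thesis
  by (rule tendsto_sandwich[OF _ _ tendsto_const s1])
    (auto intro!: always_eventually sob_bounds(2) L2_circle_diff harmonic_L2[OF h] harmonic_L2[OF fejer_mean_harmonic])
qed

section \<open>Analytic completions of real trigonometric sums\<close>

lemma fourier_coeff_real:
 assumes "\<And>z. z \<in> circle ==> cnj (h z) = h z"
 shows "fc h (-n) = cnj (fc h n)"
proof -
 have "cnj (LINT z|ds. h z * cnj z powi n) = (LINT z|ds. cnj (h z * cnj z powi n))"
  by (rule Bochner_Integration.integral_cnj[symmetric])
 also have "\<dots> = (LINT z|ds. h z * cnj z powi (-n))"
  by (intro Bochner_Integration.integral_cong refl) (auto simp: assms cnj_powi circle_cnj_powi)
 finally show ?thesis by (simp add: fourier_coeff_def)
qed

definition herm :: "(int \<Rightarrow> complex) \<Rightarrow> bool" where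
 "herm c \<longleftrightarrow> (\<forall>n. c (-n) = cnj (c n))"

text \<open>A polynomial whose real part on the circle is the real trigonometric sum with coefficients \<open>c\<close>.\<close>

definition Qp :: "(int \<Rightarrow> complex) \<Rightarrow> nat \<Rightarrow> complex \<Rightarrow> complex" where
 "Qp c N z = c 0 + 2 * (\<Sum>n=1..N. c (int n) * z ^ n)"

lemma Re_Qp:
 assumes c: "herm c" and z: "z \<in> circle"
 shows "complex_of_real (Re (Qp c N z)) = trig_sum c N z"
proof (induction N)
 case 0
 have "cnj (c 0) = c 0" using c unfolding herm_def by (metis minus_zero)
 then have "of_real (Re (c 0)) = c 0" by (simp add: complex_eq_iff)
 then show ?case by (simp add: Qp_def trig_sum_def)
next
 case (Suc N)
 define w where "w = c (int (Suc N)) * z ^ Suc N"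
 have 1: "c (- int (Suc N)) * z powi (- int (Suc N)) = cnj w"
  unfolding w_def using c circle_cnj_powi[OF z, of "int (Suc N)"] by (simp only: herm_def complex_cnj_mult complex_cnj_power power_int_of_nat)
 have 2: "c (int (Suc N)) * z powi (int (Suc N)) = w" unfolding w_def by (simp only: power_int_of_nat)
 have "trig_sum c (Suc N) z = w + cnj w + trig_sum c N z"
  unfolding trig_sum_def sum_int_Suc 1 2 ..
 also have "w + cnj w = of_real (2 * Re w)" by (simp add: complex_eq_iff)
 also have "trig_sum c N z = of_real (Re (Qp c N z))" by (rule Suc[symmetric])
 also have "of_real (2 * Re w) + of_real (Re (Qp c N z)) = complex_of_real (Re (Qp c (Suc N) z))"
  by (simp add: Qp_def w_def distrib_left)
 finally show ?case ..
qed

lemma Qp_deriv: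
 "(Qp c N has_field_derivative (2 * (\<Sum>n=1..N. c (int n) * (of_nat n * z ^ (n - 1))))) (at z)"
 unfolding Qp_def[abs_def] by (auto intro!: derivative_eq_intros sum.cong simp: mult_ac)

lemma z_Qp_deriv:
 "z * (2 * (\<Sum>n=1..N. c (int n) * (of_nat n * z ^ (n - 1)))) = Qp (\<lambda>n. complex_of_real \<bar>real_of_int n\<bar> * c n) N z"
proof -
 have "z * (c (int n) * (of_nat n * z ^ (n - 1))) = complex_of_real \<bar>real_of_int (int n)\<bar> * c (int n) * z ^ n" if "n \<in> {1..N}" for n
  using that by (cases n) auto
 then have "(\<Sum>n=1..N. z * (c (int n) * (of_nat n * z ^ (n - 1)))) = (\<Sum>n=1..N. complex_of_real \<bar>real_of_int (int n)\<bar> * c (int n) * z ^ n)"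
  by (rule sum.cong[OF refl])
 then have 1: "z * (\<Sum>n=1..N. c (int n) * (of_nat n * z ^ (n - 1))) = (\<Sum>n=1..N. complex_of_real \<bar>real_of_int (int n)\<bar> * c (int n) * z ^ n)"
  unfolding sum_distrib_left .
 show ?thesis unfolding Qp_def mult.left_commute[of z 2] 1 by simp
qed

section \<open>Entire functions on the circle\<close>

lemma entire_series:
 assumes F: "F holomorphic_on UNIV"
 obtains a where "\<And>z. (\<lambda>n. a n * z ^ n) sums F z" "\<And>z. (\<lambda>n. of_nat n * a n * z ^ n) sums (z * deriv F z)"
  "summable (\<lambda>n. real (Suc n) * cmod (a n))"
proof -
 define a where "a n = (deriv ^^ n) F 0 / fact n" for n
 have s: "(\<lambda>n. a n * z ^ n) sums F z" for z
  using holomorphic_power_series[of F 0 "cmod z + 1" z] F unfolding a_def by (auto intro: holomorphic_on_subset)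
 have F_eq: "F = (\<lambda>z. \<Sum>n. a n * z ^ n)" using sums_unique[OF s] by auto
 have sd: "summable (\<lambda>n. diffs a n * z ^ n)" for z
  by (rule termdiff_converges[of z "cmod z + 1"]) (auto intro: sums_summable[OF s])
 have d: "(F has_field_derivative (\<Sum>n. diffs a n * z ^ n)) (at z)" for z
  unfolding F_eq
  by (rule termdiffs_strong[of a "of_real (cmod z + 1)"]) (auto intro: sums_summable[OF s])
 have s2: "(\<lambda>n. of_nat n * a n * z ^ n) sums (z * deriv F z)" for z
 proof -
  have "(\<lambda>n. z * (of_nat n * a n * z ^ (n - Suc 0))) sums (z * (\<Sum>n. diffs a n * z ^ n))"
   by (intro sums_mult diffs_equiv sd)
  also have "(\<lambda>n. z * (of_nat n * a n * z ^ (n - Suc 0))) = (\<lambda>n. of_nat n * a n * z ^ n)"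
  proof
   fix n show "z * (of_nat n * a n * z ^ (n - Suc 0)) = of_nat n * a n * z ^ n" by (cases n) auto
  qed
  finally show ?thesis using DERIV_imp_deriv[OF d] by simp
 qed
 have "summable (\<lambda>n. cmod (diffs a n * 1 ^ n))" "summable (\<lambda>n. cmod (a n * 1 ^ n))"
  by (rule powser_insidea[OF sd[of 2]], simp, rule powser_insidea[OF sums_summable[OF s[of 2]]], simp)
 then have s3: "summable (\<lambda>n. real (Suc n) * cmod (a (Suc n)))" and s4: "summable (\<lambda>n. cmod (a n))"
  by (simp_all add: diffs_def norm_mult del: of_nat_Suc)
 have "summable (\<lambda>n. real n * cmod (a n))" by (subst summable_Suc_iff[symmetric]) (rule s3)
 from summable_add[OF this s4] have "summable (\<lambda>n. real (Suc n) * cmod (a n))" by (simp add: algebra_simps)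
 then show ?thesis using s s2 by (rule that[rotated 2])
qed

lemma integral_power_series:
 assumes a: "summable (\<lambda>n. cmod (a n))" and F: "\<And>z. z \<in> circle ==> (\<lambda>n. a n * z ^ n) sums F z"
  and h: "integrable ds h"
 shows "(\<lambda>n. a n * (LINT z|ds. z ^ n * h z)) sums (LINT z|ds. F z * h z)"
proof -
 let ?f = "\<lambda>n z. a n * (z ^ n * h z)"
 have i: "integrable ds (\<lambda>z. z ^ n * h z)" for n
  by (rule integrable_mult_bounded[OF h, where B=1]) (auto simp: norm_power)
 have n: "(LINT z|ds. norm (?f n z)) = cmod (a n) * (LINT z|ds. cmod (h z))" for n
 proof -
  have "(LINT z|ds. norm (?f n z)) = (LINT z|ds. cmod (a n) * cmod (h z))"
   by (intro Bochner_Integration.integral_cong refl) (auto simp: norm_mult norm_power)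
  then show ?thesis by simp
 qed
 have "(\<lambda>n. LINT z|ds. ?f n z) sums (LINT z|ds. (\<Sum>n. ?f n z))"
 proof (rule sums_integral)
  show "integrable ds (?f n)" for n by (intro integrable_mult_right i)
  show "AE z in ds. summable (\<lambda>n. norm (?f n z))"
  proof (rule AE_I2)
   fix z assume "z \<in> space ds"
   then have "(\<lambda>n. norm (?f n z)) = (\<lambda>n. cmod (a n) * cmod (h z))" by (auto simp: norm_mult norm_power)
   then show "summable (\<lambda>n. norm (?f n z))" using a by (simp add: summable_mult2)
  qed
  show "summable (\<lambda>n. LINT z|ds. norm (?f n z))" unfolding n using a by (rule summable_mult2)
 qed
 also have "(LINT z|ds. (\<Sum>n. ?f n z)) = (LINT z|ds. F z * h z)"
 proof (intro Bochner_Integration.integral_cong refl)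
  fix z assume "z \<in> space ds"
  then have "(\<lambda>n. a n * z ^ n * h z) sums (F z * h z)" by (intro sums_mult2 F) simp
  then show "(\<Sum>n. ?f n z) = F z * h z" by (simp add: sums_iff mult.assoc)
 qed
 finally show ?thesis by simp
qed

lemma continuous_on_circle_measurable:
 fixes F :: "complex \<Rightarrow> 'b::{second_countable_topology, real_normed_vector}"
 assumes "continuous_on circle F" shows "F \<in> meas"
proof -
 have "F \<in> borel_measurable (restrict_space borel circle)" by (rule borel_measurable_continuous_on_restrict[OF assms])
 then have "F \<in> borel_measurable arc_param" by (subst measurable_cong_sets[OF sets_arc_param refl])
 then show ?thesis unfolding arc_length_eq by (rule measurable_completion)
qed

lemma entire_fourier:
 assumes a: "summable (\<lambda>n. cmod (a n))" and F: "\<And>z. z \<in> circle ==> (\<lambda>n. a n * z ^ n) sums F z"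
 shows "fc F m = (if m \<ge> 0 then a (nat m) else 0)"
proof -
 have i: "integrable ds (\<lambda>z. cnj z powi m)"
  using fourier_coeff_integrable[of "\<lambda>_. 1" m] arc.integrable_const[of 1] by simp
 have e: "(LINT z|ds. z ^ n * cnj z powi m) = (if int n = m then complex_of_real (2 * pi) else 0)" for n
  using fourier_coeff_powi[of "int n" m] by (simp add: fourier_coeff_def field_simps split: if_splits)
 have "(\<lambda>n. a n * (if int n = m then complex_of_real (2 * pi) else 0)) sums (2 * pi * fc F m)"
  using integral_power_series[OF a F i] by (simp add: e fourier_coeff_def)
 moreover have "(\<lambda>n. a n * (if int n = m then complex_of_real (2 * pi) else 0)) sums (2 * pi * (if m \<ge> 0 then a (nat m) else 0))"
 proof (cases "m \<ge> 0")
  case True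
  have "(\<lambda>n. if n = nat m then a n * (2 * pi) else 0) sums (a (nat m) * (2 * pi))" by (rule sums_single)
  moreover have "(\<lambda>n. a n * (if int n = m then complex_of_real (2 * pi) else 0)) = (\<lambda>n. if n = nat m then a n * (2 * pi) else 0)"
   using True by (auto simp: fun_eq_iff)
  ultimately show ?thesis using True by (simp add: mult_ac)
 next
  case False
  then have "(\<lambda>n. a n * (if int n = m then complex_of_real (2 * pi) else 0)) = (\<lambda>n. 0)" by auto
  then show ?thesis using False by simp
 qed
 ultimately have "2 * pi * fc F m = 2 * pi * (if m \<ge> 0 then a (nat m) else 0)" by (rule sums_unique2)
 then show ?thesis by (simp split: if_splits)
qed

lemma entire_mean:
 fixes F :: "complex \<Rightarrow> complex"
 assumes "F holomorphic_on UNIV"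
 shows "(LINT z|ds. F z) = 2 * pi * F 0"
proof -
 obtain a where a: "\<And>z. (\<lambda>n. a n * z ^ n) sums F z" "summable (\<lambda>n. real (Suc n) * cmod (a n))"
  using entire_series[OF assms] by metis
 have s: "summable (\<lambda>n. cmod (a n))"
  by (rule summable_comparison_test'[OF a(2), of 0]) (simp add: mult_le_cancel_right1)
 have "F 0 = a 0" using sums_unique2[OF a(1)[of 0]] powser_sums_zero[of a] by metis
 moreover have "fc F 0 = a 0" using entire_fourier[OF s a(1)] by simp
 ultimately show ?thesis by (simp add: fourier_coeff_def field_simps)
qed

text \<open>Both sides are a multiple of \<open>\<Sum> n \<bar>a n\<bar>^2\<close>, with \<open>a\<close> the Taylor coefficients.\<close>

lemma dirE_entire:
 assumes F: "F holomorphic_on UNIV"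
 shows "dirE F = ennreal (2 * pi * Re (LINT z|ds. z * deriv F z * cnj (F z)))"
proof -
 obtain a where a: "\<And>z. (\<lambda>n. a n * z ^ n) sums F z" "\<And>z. (\<lambda>n. of_nat n * a n * z ^ n) sums (z * deriv F z)"
  "summable (\<lambda>n. real (Suc n) * cmod (a n))"
  using entire_series[OF F] by metis
 have s: "summable (\<lambda>n. cmod (a n))"
  by (rule summable_comparison_test'[OF a(3), of 0]) (simp add: mult_le_cancel_right1)
 have s': "summable (\<lambda>n. cmod (of_nat n * a n))"
  by (rule summable_comparison_test'[OF a(3), of 0]) (simp add: norm_mult mult_right_mono)
 have cont: "continuous_on circle F" by (rule continuous_on_subset[OF holomorphic_on_imp_continuous_on[OF F]]) simp
 have m: "F \<in> meas" by (rule continuous_on_circle_measurable[OF cont])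
 obtain B where "\<forall>z\<in>circle. cmod (F z) \<le> B"
  using compact_imp_bounded[OF compact_continuous_image[OF cont compact_sphere]] by (auto simp: bounded_iff)
 then have B: "\<And>z. z \<in> circle ==> cmod (F z) \<le> B" by blast
 have L2: "F \<in> L2_circle" by (rule L2_circle_bounded[OF m B])
 have ic: "integrable ds (\<lambda>z. cnj (F z))" using L2_circle_integrable[OF L2] by simp
 have c: "(LINT z|ds. z ^ n * cnj (F z)) = 2 * pi * cnj (a n)" for n
 proof -
  have "(LINT z|ds. z ^ n * cnj (F z)) = (LINT z|ds. cnj (F z * cnj z powi int n))"
   by (intro Bochner_Integration.integral_cong refl) (simp add: cnj_powi)
  also have "\<dots> = cnj (2 * pi * fc F (int n))" by (simp only: Bochner_Integration.integral_cnj) (simp add: fourier_coeff_def)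
  also have "\<dots> = 2 * pi * cnj (a n)" by (simp add: entire_fourier[OF s a(1)])
  finally show ?thesis .
 qed
 let ?J = "LINT z|ds. z * deriv F z * cnj (F z)"
 have "(\<lambda>n. of_nat n * a n * (2 * pi * cnj (a n))) sums ?J"
  using integral_power_series[OF s' a(2) ic] unfolding c .
 then have "(\<lambda>n. Re (of_nat n * a n * (2 * pi * cnj (a n)))) sums Re ?J" by (rule sums_Re)
 also have "(\<lambda>n. Re (of_nat n * a n * (2 * pi * cnj (a n)))) = (\<lambda>n. 2 * pi * (real n * (cmod (a n))^2))"
 proof
  fix n
  have "of_nat n * a n * (2 * pi * cnj (a n)) = of_real (2 * pi * (real n * (cmod (a n))^2))"
   by (simp only: of_real_mult complex_norm_square of_real_of_nat_eq of_real_numeral mult_ac)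
  then show "Re (of_nat n * a n * (2 * pi * cnj (a n))) = 2 * pi * (real n * (cmod (a n))^2)" by (simp only: Re_complex_of_real)
 qed
 finally have S: "(\<lambda>n. 2 * pi * (2 * pi * (real n * (cmod (a n))^2))) sums (2 * pi * Re ?J)" by (rule sums_mult)
 have part: "(\<Sum>m\<in>win N. ennreal (\<bar>real_of_int m\<bar> * (cmod (fc F m))^2)) = ennreal (\<Sum>n\<le>N. real n * (cmod (a n))^2)" for N
 proof (induction N)
  case (Suc N)
  then show ?case unfolding sum_int_Suc
   by (simp add: entire_fourier[OF s a(1)] nat_add_distrib sum_nonneg ennreal_plus[symmetric] add.commute del: ennreal_plus of_nat_Suc)
 qed simp
 have lim: "(\<lambda>N. ennreal (4 * pi^2) * ennreal (\<Sum>n\<le>N. real n * (cmod (a n))^2)) \<longlonglongrightarrow> ennreal (2 * pi * Re ?J)"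
 proof -
  have "(\<lambda>N. \<Sum>n\<le>N. 2 * pi * (2 * pi * (real n * (cmod (a n))^2))) \<longlonglongrightarrow> 2 * pi * Re ?J"
   using S by (simp add: sums_def_le)
  then have "(\<lambda>N. ennreal (\<Sum>n\<le>N. 2 * pi * (2 * pi * (real n * (cmod (a n))^2)))) \<longlonglongrightarrow> ennreal (2 * pi * Re ?J)"
   by (rule tendsto_ennrealI)
  also have "(\<lambda>N. ennreal (\<Sum>n\<le>N. 2 * pi * (2 * pi * (real n * (cmod (a n))^2)))) = (\<lambda>N. ennreal (4 * pi^2) * ennreal (\<Sum>n\<le>N. real n * (cmod (a n))^2))"
   by (auto simp: sum_distrib_left sum_nonneg power2_eq_square mult_ac simp flip: ennreal_mult intro!: arg_cong[of _ _ ennreal] sum.cong)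
  finally show ?thesis .
 qed
 have "(\<lambda>N. ennreal (4 * pi^2) * ennreal (\<Sum>n\<le>N. real n * (cmod (a n))^2)) \<longlonglongrightarrow> (SUP N. ennreal (4 * pi^2) * ennreal (\<Sum>n\<le>N. real n * (cmod (a n))^2))"
  by (rule LIMSEQ_SUP) (auto simp: incseq_def intro!: mult_left_mono ennreal_leI sum_mono2)
 from LIMSEQ_unique[OF this lim] show ?thesis
  unfolding douglas[OF L2] nn_integral_int_SUP part by (simp add: SUP_mult_left_ennreal)
qed

section \<open>Carleson's formula\<close>

lemma dirE_limit:
 assumes h: "h \<in> HD"
 shows "(\<lambda>M. 4 * pi^2 * (\<Sum>n\<in>win M. \<bar>real_of_int n\<bar> * (cmod (fc h n))^2)) \<longlonglongrightarrow> enn2real (dirE h)"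
proof -
 let ?s = "\<lambda>M. \<Sum>n\<in>win M. \<bar>real_of_int n\<bar> * (cmod (fc h n))^2"
 have inc: "?s M \<le> ?s M'" if "M \<le> M'" for M M' using that by (intro sum_mono2) auto
 have "(\<lambda>M. ennreal (4 * pi^2 * ?s M)) \<longlonglongrightarrow> (SUP M. ennreal (4 * pi^2 * ?s M))"
  by (rule LIMSEQ_SUP) (auto simp: incseq_def intro!: mult_left_mono ennreal_leI inc)
 also have "(SUP M. ennreal (4 * pi^2 * ?s M)) = dirE h"
 proof -
  have "ennreal (4 * pi^2 * ?s M) = ennreal (4 * pi^2) * (\<Sum>n\<in>win M. ennreal (\<bar>real_of_int n\<bar> * (cmod (fc h n))^2))" for M
   by (subst sum_ennreal) (auto simp: sum_nonneg intro!: ennreal_mult)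
  then show ?thesis
   unfolding douglas[OF harmonic_L2[OF h]] nn_integral_int_SUP by (simp only: SUP_mult_left_ennreal)
 qed
 finally have "(\<lambda>M. enn2real (ennreal (4 * pi^2 * ?s M))) \<longlonglongrightarrow> enn2real (dirE h)"
  using harmonic_dirE[OF h] by (intro tendsto_enn2real) (auto simp: sum_nonneg)
 then show ?thesis by (simp add: sum_nonneg)
qed

lemma dirE_integrable:
 assumes h: "h \<in> HD"
 shows "integrable ds2 (\<lambda>p. (cmod (h (fst p) - h (snd p)) / cmod (fst p - snd p))^2)"
  and "(LINT p|ds2. (cmod (h (fst p) - h (snd p)) / cmod (fst p - snd p))^2) = enn2real (dirE h)"
proof -
 have [measurable]: "h \<in> meas" by (rule harmonic_measurable[OF h])
 have m: "(\<lambda>p. (cmod (h (fst p) - h (snd p)) / cmod (fst p - snd p))^2) \<in> borel_measurable ds2" by measurable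
 show "integrable ds2 (\<lambda>p. (cmod (h (fst p) - h (snd p)) / cmod (fst p - snd p))^2)"
  using harmonic_dirE[OF h] m by (intro integrableI_bounded) (auto simp: dirE_def)
 show "(LINT p|ds2. (cmod (h (fst p) - h (snd p)) / cmod (fst p - snd p))^2) = enn2real (dirE h)"
  unfolding dirE_def by (rule integral_eq_nn_integral[OF m]) simp
qed

lemma douglas_polarized:
 fixes u G :: "complex \<Rightarrow> real"
 assumes u: "(\<lambda>z. complex_of_real (u z)) \<in> HD"
  and G: "\<And>z. z \<in> circle ==> complex_of_real (G z) = trig_sum c N z"
 shows "(LINT p|ds2. (u (fst p) - u (snd p)) * (G (fst p) - G (snd p)) / (cmod (fst p - snd p))^2)
  = 4 * pi^2 * Re (\<Sum>n\<in>win N. of_real \<bar>real_of_int n\<bar> * fc (\<lambda>z. complex_of_real (u z)) n * cnj (c n))"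
proof -
 let ?u = "\<lambda>z. complex_of_real (u z)"
 let ?T = "trig_sum c N"
 let ?p = "\<lambda>z. ?u z + ?T z" and ?m = "\<lambda>z. ?u z - ?T z"
 let ?q = "\<lambda>h p. (cmod (h (fst p) - h (snd p)) / cmod (fst p - snd p))^2"
 let ?d = "\<lambda>n. if n \<in> win N then c n else 0"
 have hp: "?p \<in> HD" by (rule harmonic_add[OF u trig_sum_harmonic])
 have hm: "?m \<in> HD" by (rule harmonic_diff[OF u trig_sum_harmonic])
 note ui = L2_circle_integrable[OF harmonic_L2[OF u]] and Ti = L2_circle_integrable[OF trig_sum_L2[of c N]]
 have fp: "fc ?p n = fc ?u n + ?d n" and fm: "fc ?m n = fc ?u n - ?d n" for n
  using fourier_coeff_add[OF ui Ti] fourier_coeff_diff[OF ui Ti] by (simp_all add: fourier_coeff_trig_sum)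
 let ?R = "\<Sum>n\<in>win N. \<bar>real_of_int n\<bar> * Re (fc ?u n * cnj (c n))"
 have pol: "(cmod (x + y))^2 - (cmod (x - y))^2 = 4 * Re (x * cnj y)" for x y
  by (simp add: cmod_power2 power2_sum power2_diff algebra_simps)
 have "enn2real (dirE ?p) - enn2real (dirE ?m) = 16 * pi^2 * ?R"
 proof (rule LIMSEQ_unique[OF tendsto_diff[OF dirE_limit[OF hp] dirE_limit[OF hm]]])
  show "(\<lambda>M. 4 * pi^2 * (\<Sum>n\<in>win M. \<bar>real_of_int n\<bar> * (cmod (fc ?p n))^2)
    - 4 * pi^2 * (\<Sum>n\<in>win M. \<bar>real_of_int n\<bar> * (cmod (fc ?m n))^2)) \<longlonglongrightarrow> 16 * pi^2 * ?R"
  proof (rule tendsto_eventually, rule eventually_sequentiallyI[of N])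
   fix M assume M: "N \<le> M"
   have "(\<Sum>n\<in>win M. \<bar>real_of_int n\<bar> * (cmod (fc ?p n))^2) - (\<Sum>n\<in>win M. \<bar>real_of_int n\<bar> * (cmod (fc ?m n))^2)
    = (\<Sum>n\<in>win M. \<bar>real_of_int n\<bar> * (4 * Re (fc ?u n * cnj (?d n))))"
    unfolding fp fm sum_subtractf[symmetric] right_diff_distrib[symmetric] pol ..
   also have "\<dots> = (\<Sum>n\<in>win N. \<bar>real_of_int n\<bar> * (4 * Re (fc ?u n * cnj (?d n))))"
    using M by (intro sum.mono_neutral_right) auto
   also have "\<dots> = 4 * ?R" unfolding sum_distrib_left by (intro sum.cong) auto
   finally show "4 * pi^2 * (\<Sum>n\<in>win M. \<bar>real_of_int n\<bar> * (cmod (fc ?p n))^2)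
    - 4 * pi^2 * (\<Sum>n\<in>win M. \<bar>real_of_int n\<bar> * (cmod (fc ?m n))^2) = 16 * pi^2 * ?R"
    unfolding right_diff_distrib[symmetric] by simp
  qed
 qed
 moreover have "enn2real (dirE ?p) - enn2real (dirE ?m) = (LINT p|ds2. ?q ?p p - ?q ?m p)"
  unfolding dirE_integrable(2)[OF hp, symmetric] dirE_integrable(2)[OF hm, symmetric]
  by (rule Bochner_Integration.integral_diff[OF dirE_integrable(1)[OF hp] dirE_integrable(1)[OF hm], symmetric])
 moreover have "(LINT p|ds2. ?q ?p p - ?q ?m p)
   = (LINT p|ds2. 4 * ((u (fst p) - u (snd p)) * (G (fst p) - G (snd p)) / (cmod (fst p - snd p))^2))"
 proof (intro Bochner_Integration.integral_cong refl)
  fix p assume "p \<in> space ds2"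
  then have p: "fst p \<in> circle" "snd p \<in> circle" by (auto simp: space_pair_measure)
  define U V where "U = complex_of_real (u (fst p) - u (snd p))" and "V = complex_of_real (G (fst p) - G (snd p))"
  have TV: "?T (fst p) = ?T (snd p) + V" unfolding V_def of_real_diff G[OF p(1)] G[OF p(2)] by simp
  have 1: "?p (fst p) - ?p (snd p) = U + V" "?m (fst p) - ?m (snd p) = U - V" by (simp_all add: U_def TV)
  have "?q ?p p - ?q ?m p = ((cmod (U + V))^2 - (cmod (U - V))^2) / (cmod (fst p - snd p))^2"
   unfolding 1 by (simp add: power_divide diff_divide_distrib)
  also have "\<dots> = 4 * ((u (fst p) - u (snd p)) * (G (fst p) - G (snd p)) / (cmod (fst p - snd p))^2)"
   unfolding pol by (simp add: U_def V_def)
  finally show "?q ?p p - ?q ?m p = \<dots>" .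
 qed
 moreover have "(LINT p|ds2. 4 * ((u (fst p) - u (snd p)) * (G (fst p) - G (snd p)) / (cmod (fst p - snd p))^2))
   = 4 * (LINT p|ds2. (u (fst p) - u (snd p)) * (G (fst p) - G (snd p)) / (cmod (fst p - snd p))^2)"
  by (rule integral_mult_right_zero)
 ultimately have "4 * (LINT p|ds2. (u (fst p) - u (snd p)) * (G (fst p) - G (snd p)) / (cmod (fst p - snd p))^2) = 16 * pi^2 * ?R"
  by linarith
 moreover have "Re (\<Sum>n\<in>win N. of_real \<bar>real_of_int n\<bar> * fc ?u n * cnj (c n)) = ?R"
  unfolding Re_sum by (intro sum.cong refl) (simp add: mult.assoc)
 ultimately show ?thesis by simp
qed

text \<open>Up to normalization this is the Dirichlet integral of a function with boundary modulus \<open>exp G\<close> that is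
analytic without zeros.\<close>

definition carleson :: "(complex \<Rightarrow> real) \<Rightarrow> real" where
 "carleson G = (LINT p|ds2.
   (exp (2 * G (fst p)) - exp (2 * G (snd p))) * (G (fst p) - G (snd p)) / (cmod (fst p - snd p))^2)"

lemma exp_diff_le:
 fixes s t :: real assumes "s \<le> B" "t \<le> B"
 shows "\<bar>exp (2 * s) - exp (2 * t)\<bar> \<le> 2 * exp (2 * B) * \<bar>s - t\<bar>"
proof -
 have *: "exp (2 * s) - exp (2 * t) \<le> 2 * exp (2 * B) * (s - t)" if "t \<le> s" "s \<le> B" for s t
 proof -
  have "1 + (2 * t - 2 * s) \<le> exp (2 * t - 2 * s)" by (rule exp_ge_add_one_self)
  then have "exp (2 * s) * (1 + (2 * t - 2 * s)) \<le> exp (2 * s) * exp (2 * t - 2 * s)" by (intro mult_left_mono) auto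
  also have "\<dots> = exp (2 * t)" by (simp flip: exp_add)
  finally have "exp (2 * s) - exp (2 * t) \<le> exp (2 * s) * (2 * (s - t))" by (simp add: algebra_simps)
  also have "\<dots> \<le> exp (2 * B) * (2 * (s - t))" using that by (intro mult_right_mono) auto
  finally show ?thesis by (simp add: algebra_simps)
 qed
 show ?thesis using *[of t s] *[of s t] assms by (cases "t \<le> s") (auto simp: abs_if algebra_simps)
qed

lemma of_real_lipschitz_cmod:
 "\<bar>(G x :: real) - G y\<bar> = cmod (complex_of_real (G x) - complex_of_real (G y))"
 by (metis norm_of_real of_real_diff)

lemma exp_lipschitz_harmonic:
 fixes G :: "complex \<Rightarrow> real"
 assumes lip: "\<And>x y. x \<in> circle ==> y \<in> circle ==> \<bar>G x - G y\<bar> \<le> L * cmod (x - y)"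
  and B: "\<And>x. x \<in> circle ==> G x \<le> B"
 shows "(\<lambda>z. complex_of_real (exp (2 * G z))) \<in> HD"
proof (rule lipschitz_harmonic)
 fix x y assume xy: "x \<in> circle" "y \<in> circle"
 have "cmod (complex_of_real (exp (2 * G x)) - complex_of_real (exp (2 * G y))) = \<bar>exp (2 * G x) - exp (2 * G y)\<bar>"
  by (metis norm_of_real of_real_diff)
 also have "\<dots> \<le> 2 * exp (2 * B) * \<bar>G x - G y\<bar>" by (intro exp_diff_le B xy)
 also have "\<dots> \<le> 2 * exp (2 * B) * (L * cmod (x - y))" by (intro mult_left_mono lip xy) auto
 finally show "cmod (complex_of_real (exp (2 * G x)) - complex_of_real (exp (2 * G y))) \<le> (2 * exp (2 * B) * L) * cmod (x - y)"
  by (simp add: mult.assoc)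
qed

text \<open>Carleson's formula for \<open>F = exp Q\<close>, \<open>G = Re Q\<close>: the energy of a holomorphic \<open>F\<close> is a multiple
 of the boundary integral of \<open>\<zeta> F'(\<zeta>) cnj (F \<zeta>)\<close>, which is \<open>\<bar>F\<bar>^2 \<zeta> Q'(\<zeta>)\<close>; its real part is
 \<open>exp (2 G)\<close> times the normal derivative of \<open>G\<close>, and Douglas' formula turns this back into
 a double integral.\<close>

lemma carleson_formula:
 assumes c: "herm c" and G: "\<And>z. z \<in> circle ==> complex_of_real (G z) = trig_sum c N z"
 shows "dirE (\<lambda>z. exp (Qp c N z)) = ennreal (carleson G)"
proof -
 let ?F = "\<lambda>z. exp (Qp c N z)"
 let ?c' = "\<lambda>n. complex_of_real \<bar>real_of_int n\<bar> * c n"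
 let ?u = "\<lambda>z. exp (2 * G z)"
 have c': "herm ?c'" using c by (simp add: herm_def complex_eq_iff)
 have ReQ: "Re (Qp c N z) = G z" if "z \<in> circle" for z
  using Re_Qp[OF c that, of N] G[OF that] by (metis of_real_eq_iff)
 have lip: "\<bar>G x - G y\<bar> \<le> (\<Sum>n\<in>win N. cmod (c n) * \<bar>real_of_int n\<bar>) * cmod (x - y)" if "x \<in> circle" "y \<in> circle" for x y
  using trig_sum_lipschitz[OF that] G that by (simp add: of_real_lipschitz_cmod)
 have bd: "G x \<le> (\<Sum>n\<in>win N. cmod (c n))" if "x \<in> circle" for x
  using trig_sum_bound[OF that, of c N] G[OF that] by (metis abs_le_D1 norm_of_real)
 have uh: "(\<lambda>z. complex_of_real (?u z)) \<in> HD" by (rule exp_lipschitz_harmonic[OF lip bd])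
 have d: "(?F has_field_derivative ?F z * (2 * (\<Sum>n=1..N. c (int n) * (of_nat n * z ^ (n - 1))))) (at z)" for z
  using Qp_deriv by (rule DERIV_fun_exp)
 have hol: "?F holomorphic_on UNIV" using d by (auto simp: holomorphic_on_open)
 have zd: "z * deriv ?F z = ?F z * Qp ?c' N z" for z
  unfolding DERIV_imp_deriv[OF d] z_Qp_deriv[symmetric] by (simp add: mult_ac)
 have int_eq: "Re (z * deriv ?F z * cnj (?F z)) = Re (of_real (?u z) * trig_sum ?c' N z)" if z: "z \<in> circle" for z
 proof -
  have "z * deriv ?F z * cnj (?F z) = (?F z * cnj (?F z)) * Qp ?c' N z" unfolding zd by (simp add: mult_ac)
  also have "?F z * cnj (?F z) = of_real ((cmod (?F z))^2)" by (rule complex_norm_square[symmetric])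
  also have "(cmod (?F z))^2 = ?u z" by (simp add: norm_exp_eq_Re ReQ[OF z] power2_eq_square flip: exp_add)
  finally have "Re (z * deriv ?F z * cnj (?F z)) = ?u z * Re (Qp ?c' N z)" by simp
  also have "\<dots> = Re (of_real (?u z) * trig_sum ?c' N z)" unfolding Re_Qp[OF c' z, symmetric] by simp
  finally show ?thesis .
 qed
 have ui: "integrable ds (\<lambda>z. complex_of_real (?u z))" by (rule L2_circle_integrable[OF harmonic_L2[OF uh]])
 have ucoef: "(LINT z|ds. of_real (?u z) * z powi n) = 2 * pi * cnj (fc (\<lambda>z. of_real (?u z)) n)" for n
 proof -
  have "(LINT z|ds. of_real (?u z) * z powi n) = (LINT z|ds. of_real (?u z) * cnj z powi (-n))"
   by (intro Bochner_Integration.integral_cong refl) (auto simp: circle_cnj_powi)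
  also have "\<dots> = 2 * pi * fc (\<lambda>z. of_real (?u z)) (-n)" by (simp add: fourier_coeff_def)
  also have "\<dots> = 2 * pi * cnj (fc (\<lambda>z. of_real (?u z)) n)" by (subst fourier_coeff_real) auto
  finally show ?thesis .
 qed
 have iu: "integrable ds (\<lambda>z. of_real (?u z) * z powi n)" for n
 proof -
  have "integrable ds (\<lambda>z. z powi n * of_real (?u z))"
   by (rule integrable_mult_bounded[OF ui, where B=1]) (auto simp: measurable_powi_arc circle_cmod_powi)
  then show ?thesis by (simp add: mult.commute)
 qed
 have eq: "(\<lambda>z. of_real (?u z) * trig_sum ?c' N z) = (\<lambda>z. \<Sum>n\<in>win N. ?c' n * (of_real (?u z) * z powi n))"
  by (auto simp: trig_sum_def sum_distrib_left mult_ac)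
 have iT: "integrable ds (\<lambda>z. of_real (?u z) * trig_sum ?c' N z)"
  unfolding eq by (intro Bochner_Integration.integrable_sum integrable_mult_right iu)
 have I: "(LINT z|ds. of_real (?u z) * trig_sum ?c' N z) = 2 * pi * (\<Sum>n\<in>win N. ?c' n * cnj (fc (\<lambda>z. of_real (?u z)) n))"
  unfolding eq by (subst Bochner_Integration.integral_sum) (auto intro!: integrable_mult_right iu sum.cong simp: ucoef sum_distrib_left)
 have Fm: "integrable ds (\<lambda>z. z * deriv ?F z * cnj (?F z))"
 proof -
  have "continuous_on circle (\<lambda>z. z * deriv ?F z * cnj (?F z))"
   unfolding zd unfolding Qp_def by (intro continuous_intros)
  then show ?thesis
   using compact_imp_bounded[OF compact_continuous_image[OF _ compact_sphere]] continuous_on_circle_measurable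
   by (metis (no_types, lifting) bounded_iff image_eqI integrable_arc_bounded)
 qed
 have "Re (LINT z|ds. z * deriv ?F z * cnj (?F z)) = (LINT z|ds. Re (z * deriv ?F z * cnj (?F z)))"
  by (rule integral_Re[OF Fm, symmetric])
 also have "\<dots> = (LINT z|ds. Re (of_real (?u z) * trig_sum ?c' N z))"
  by (intro Bochner_Integration.integral_cong refl int_eq) simp
 also have "\<dots> = Re (LINT z|ds. of_real (?u z) * trig_sum ?c' N z)" by (rule integral_Re[OF iT])
 also have "\<dots> = 2 * pi * Re (\<Sum>n\<in>win N. of_real \<bar>real_of_int n\<bar> * fc (\<lambda>z. of_real (?u z)) n * cnj (c n))"
  unfolding I by (simp add: Re_sum sum_distrib_left algebra_simps)
 finally have 1: "Re (LINT z|ds. z * deriv ?F z * cnj (?F z)) = 2 * pi * Re (\<Sum>n\<in>win N. of_real \<bar>real_of_int n\<bar> * fc (\<lambda>z. of_real (?u z)) n * cnj (c n))" .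
 have "carleson G = 4 * pi^2 * Re (\<Sum>n\<in>win N. of_real \<bar>real_of_int n\<bar> * fc (\<lambda>z. of_real (?u z)) n * cnj (c n))"
  unfolding carleson_def by (rule douglas_polarized[OF uh G])
 then have "2 * pi * Re (LINT z|ds. z * deriv ?F z * cnj (?F z)) = carleson G"
  unfolding 1 by (simp only: power2_eq_square mult_ac)
 then show ?thesis unfolding dirE_entire[OF hol] by simp
qed

lemma carleson_integrand_bound:
 fixes G :: "complex \<Rightarrow> real"
 assumes lip: "\<bar>G x - G y\<bar> \<le> L * cmod (x - y)" and B: "G x \<le> B" "G y \<le> B"
 shows "\<bar>(exp (2 * G x) - exp (2 * G y)) * (G x - G y) / (cmod (x - y))^2\<bar> \<le> 2 * exp (2 * B) * L^2"
proof (cases "x = y")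
 case False
 then have p: "cmod (x - y) > 0" by simp
 have "\<bar>(exp (2 * G x) - exp (2 * G y)) * (G x - G y)\<bar> \<le> (2 * exp (2 * B) * \<bar>G x - G y\<bar>) * \<bar>G x - G y\<bar>"
  unfolding abs_mult by (intro mult_right_mono exp_diff_le B) auto
 also have "\<dots> = 2 * exp (2 * B) * \<bar>G x - G y\<bar>^2" by (simp add: power2_eq_square)
 also have "\<dots> \<le> 2 * exp (2 * B) * (L * cmod (x - y))^2" using lip by (intro mult_left_mono power_mono) auto
 finally show ?thesis using p by (simp add: abs_divide power_mult_distrib field_simps)
qed simp

lemma carleson_integrable:
 fixes G :: "complex \<Rightarrow> real"
 assumes lip: "\<And>x y. x \<in> circle ==> y \<in> circle ==> \<bar>G x - G y\<bar> \<le> L * cmod (x - y)"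
  and B: "\<And>x. x \<in> circle ==> G x \<le> B"
 shows "integrable ds2 (\<lambda>p. (exp (2 * G (fst p)) - exp (2 * G (snd p))) * (G (fst p) - G (snd p)) / (cmod (fst p - snd p))^2)"
proof -
 interpret PP: finite_measure "ds2" by standard (simp add: emeasure_PP)
 have [measurable]: "G \<in> meas"
  by (rule lipschitz_circle_measurable) (use lip in simp)
 show ?thesis
 proof (rule PP.integrable_const_bound)
  show "AE p in ds2. norm ((exp (2 * G (fst p)) - exp (2 * G (snd p))) * (G (fst p) - G (snd p)) / (cmod (fst p - snd p))^2) \<le> 2 * exp (2 * B) * L^2"
   unfolding real_norm_def
   by (intro AE_I2 carleson_integrand_bound lip B) (auto simp: space_pair_measure)
  show "(\<lambda>p. (exp (2 * G (fst p)) - exp (2 * G (snd p))) * (G (fst p) - G (snd p)) / (cmod (fst p - snd p))^2) \<in> borel_measurable ds2"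
   by measurable
 qed
qed

text \<open>A polynomial substitute for the outer function with modulus \<open>exp G\<close>: the exponential of the
 analytic completion of a Fejer mean of \<open>G\<close>.\<close>

theorem outer_approximation:
 fixes G :: "complex \<Rightarrow> real"
 assumes lip: "\<And>x y. x \<in> circle ==> y \<in> circle ==> \<bar>G x - G y\<bar> \<le> L * cmod (x - y)" and \<eta>: "\<eta> > 0"
 obtains Q where "Q holomorphic_on UNIV" "\<And>z. z \<in> circle ==> \<bar>Re (Q z) - G z\<bar> \<le> \<eta>"
  "Re (Q 0) = (LINT z|ds. G z) / (2 * pi)" "dirE (\<lambda>z. exp (Q z)) \<le> ennreal (carleson G + \<eta>)"
proof -
 let ?h = "\<lambda>z. complex_of_real (G z)"
 have L0: "0 \<le> L" using lip[of 1 "-1"] abs_ge_zero[of "G 1 - G (-1)"] by simp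
 have lip': "cmod (?h x - ?h y) \<le> L * cmod (x - y)" if "x \<in> circle" "y \<in> circle" for x y
  using lip[OF that] by (simp add: of_real_lipschitz_cmod)
 have hm: "?h \<in> meas" by (rule lipschitz_circle_measurable[OF lip'])
 define B where "B = cmod (?h 1) + 2 * \<bar>L\<bar>"
 have hB: "cmod (?h z) \<le> B" if "z \<in> circle" for z unfolding B_def by (rule lipschitz_circle_bounded[OF lip' that])
 have hi: "integrable ds ?h" by (rule integrable_arc_bounded[OF hm hB])
 define c where "c N n = of_real (fejer_mult N n) * fc ?h n" for N n
 have herm: "herm (c N)" for N
  unfolding herm_def c_def using fourier_coeff_real[of ?h] by (simp add: fejer_mult_def)
 define H where "H N z = Re (fejer_mean N ?h z)" for N z
 have fm: "fejer_mean N ?h = trig_sum (c N) N" for N by (simp add: fejer_mean_def c_def[abs_def])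
 have Htrig: "complex_of_real (H N z) = trig_sum (c N) N z" if "z \<in> circle" for N z
  unfolding H_def fm Re_Qp[OF herm that, symmetric] by simp
 have HQ: "Re (Qp (c N) N z) = H N z" if "z \<in> circle" for N z
  using Re_Qp[OF herm that, of N N] Htrig[OF that, of N] by (metis of_real_eq_iff)
 have HB: "\<bar>H N z\<bar> \<le> B" if "z \<in> circle" for N z
  using fejer_mean_bound[OF hm hB that, of N] abs_Re_le_cmod[of "fejer_mean N ?h z"] unfolding H_def by linarith
 have Hlip: "\<bar>H N x - H N y\<bar> \<le> L * cmod (x - y)" if "x \<in> circle" "y \<in> circle" for N x y
 proof -
  have "\<bar>H N x - H N y\<bar> \<le> cmod (fejer_mean N ?h x - fejer_mean N ?h y)"
   unfolding H_def by (metis abs_Re_le_cmod minus_complex.simps(1))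
  also have "\<dots> \<le> L * cmod (x - y)"
   unfolding fejer_mean_eq_conv[OF hi that(1)] fejer_mean_eq_conv[OF hi that(2)]
   by (rule conv_lipschitz[OF fejer_kernel hm that hi lip'])
  finally show ?thesis .
 qed
 have Hclose: "\<bar>H N z - G z\<bar> \<le> L * sqrt (2 / (real N + 1))" if "z \<in> circle" for N z
 proof -
  have "\<bar>H N z - G z\<bar> \<le> cmod (fejer_mean N ?h z - ?h z)"
   unfolding H_def by (metis Re_complex_of_real abs_Re_le_cmod minus_complex.simps(1))
  also have "\<dots> \<le> L * sqrt (2 / (real N + 1))"
   using fejer_mean_lipschitz_close[OF lip' that L0, of N] by (simp add: add.commute)
  finally show ?thesis .
 qed
 have e0: "(\<lambda>N. L * sqrt (2 / (real N + 1))) \<longlonglongrightarrow> 0"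
 proof -
  have "(\<lambda>N. L * sqrt (2 * inverse (real (Suc N)))) \<longlonglongrightarrow> L * sqrt (2 * 0)"
   by (intro tendsto_intros LIMSEQ_inverse_real_of_nat)
  then show ?thesis by (simp add: divide_inverse add.commute)
 qed
 have Hlim: "(\<lambda>N. H N z) \<longlonglongrightarrow> G z" if "z \<in> circle" for z
 proof -
  have "(\<lambda>N. H N z - G z) \<longlonglongrightarrow> 0"
   by (rule Lim_null_comparison[OF _ e0]) (use Hclose[OF that] in auto)
  then show ?thesis by (simp add: LIM_zero_cancel)
 qed
 interpret PP: finite_measure "ds2" by standard (simp add: emeasure_PP)
 have [measurable]: "G \<in> meas"
  by (rule lipschitz_circle_measurable) (use lip in simp)
 have [measurable]: "H N \<in> meas" for N
  by (rule lipschitz_circle_measurable) (use Hlip in simp)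
 have HB': "H N z \<le> B" if "z \<in> circle" for N z using HB[OF that, of N] by linarith
 have clim: "(\<lambda>N. carleson (H N)) \<longlonglongrightarrow> carleson G"
  unfolding carleson_def
 proof (rule integral_dominated_convergence[where w="\<lambda>_. 2 * exp (2 * B) * L^2"])
  show "AE p in ds2. (\<lambda>N. (exp (2 * H N (fst p)) - exp (2 * H N (snd p))) * (H N (fst p) - H N (snd p)) / (cmod (fst p - snd p))^2)
   \<longlonglongrightarrow> (exp (2 * G (fst p)) - exp (2 * G (snd p))) * (G (fst p) - G (snd p)) / (cmod (fst p - snd p))^2"
  proof (rule AE_I2)
   fix p assume "p \<in> space ds2"
   then have p: "fst p \<in> circle" "snd p \<in> circle" by (auto simp: space_pair_measure)
   show "(\<lambda>N. (exp (2 * H N (fst p)) - exp (2 * H N (snd p))) * (H N (fst p) - H N (snd p)) / (cmod (fst p - snd p))^2)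
   \<longlonglongrightarrow> (exp (2 * G (fst p)) - exp (2 * G (snd p))) * (G (fst p) - G (snd p)) / (cmod (fst p - snd p))^2"
    unfolding divide_inverse by (intro tendsto_intros Hlim p)
  qed
  show "AE p in ds2. norm ((exp (2 * H N (fst p)) - exp (2 * H N (snd p))) * (H N (fst p) - H N (snd p)) / (cmod (fst p - snd p))^2) \<le> 2 * exp (2 * B) * L^2" for N
   unfolding real_norm_def
   by (intro AE_I2 carleson_integrand_bound Hlip HB') (auto simp: space_pair_measure)
 qed (auto intro: PP.integrable_const)
 have "\<forall>\<^sub>F N in sequentially. carleson (H N) < carleson G + \<eta> \<and> L * sqrt (2 / (real N + 1)) < \<eta>"
  using \<eta> by (intro eventually_conj order_tendstoD(2)[OF clim] order_tendstoD(2)[OF e0]) auto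
 then obtain N where N: "carleson (H N) < carleson G + \<eta>" "L * sqrt (2 / (real N + 1)) < \<eta>"
  by (auto simp: eventually_sequentially)
 show ?thesis
 proof (rule that[of "Qp (c N) N"])
  show "Qp (c N) N holomorphic_on UNIV" unfolding Qp_def[abs_def] by (intro holomorphic_intros)
  show "\<bar>Re (Qp (c N) N z) - G z\<bar> \<le> \<eta>" if "z \<in> circle" for z
   using Hclose[OF that, of N] N(2) HQ[OF that] by (simp add: add.commute)
  have "Qp (c N) N 0 = c N 0" by (simp add: Qp_def)
  also have "\<dots> = (LINT z|ds. ?h z) / (2 * pi)" by (simp add: c_def fejer_mult_def fourier_coeff_def)
  also have "\<dots> = of_real ((LINT z|ds. G z) / (2 * pi))" by simp
  finally show "Re (Qp (c N) N 0) = (LINT z|ds. G z) / (2 * pi)" by (simp only: Re_complex_of_real)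
  have cf: "dirE (\<lambda>z. exp (Qp (c N) N z)) = ennreal (carleson (H N))" by (rule carleson_formula[OF herm Htrig])
  show "dirE (\<lambda>z. exp (Qp (c N) N z)) \<le> ennreal (carleson G + \<eta>)"
   unfolding cf using N(1) by (intro ennreal_leI) simp
 qed
qed

declare id_arc_measurable [measurable del]

section \<open>Jensen's inequality and integrability of the logarithm\<close>

lemma entire_partial_sums:
 assumes F: "F holomorphic_on UNIV"
 obtains a e where "F 0 = a 0" "e \<longlonglongrightarrow> 0" "\<And>K. 0 \<le> e K"
  "\<And>K z. z \<in> circle ==> cmod (F z - (\<Sum>n<K. a n * z ^ n)) \<le> e K"
  "\<And>K x y. x \<in> circle ==> y \<in> circle ==> cmod ((F x - (\<Sum>n<K. a n * x ^ n)) - (F y - (\<Sum>n<K. a n * y ^ n))) \<le> e K * cmod (x - y)"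
proof -
 obtain a where a: "\<And>z. (\<lambda>n. a n * z ^ n) sums F z" "summable (\<lambda>n. real (Suc n) * cmod (a n))"
  using entire_series[OF F] by metis
 define e where "e K = (\<Sum>n. real (Suc (n + K)) * cmod (a (n + K)))" for K
 have es: "summable (\<lambda>n. real (Suc (n + K)) * cmod (a (n + K)))" for K
  using summable_ignore_initial_segment[OF a(2), of K] .
 have "(\<lambda>K. (\<Sum>n. real (Suc n) * cmod (a n)) - (\<Sum>n<K. real (Suc n) * cmod (a n))) \<longlonglongrightarrow> (\<Sum>n. real (Suc n) * cmod (a n)) - (\<Sum>n. real (Suc n) * cmod (a n))"
  by (intro tendsto_diff tendsto_const summable_LIMSEQ a(2))
 moreover have "e = (\<lambda>K. (\<Sum>n. real (Suc n) * cmod (a n)) - (\<Sum>n<K. real (Suc n) * cmod (a n)))"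
  unfolding e_def by (rule ext, rule suminf_minus_initial_segment[OF a(2)])
 ultimately have e0: "e \<longlonglongrightarrow> 0" by (simp only: diff_self)
 have epos: "0 \<le> e K" for K unfolding e_def by (intro suminf_nonneg es) auto
 have tail: "(\<lambda>n. a (n + K) * z ^ (n + K)) sums (F z - (\<Sum>n<K. a n * z ^ n))" for K z
  using sums_split_initial_segment[OF a(1)] .
 have bd: "cmod s \<le> B" if "t sums s" "\<And>n. cmod (t n) \<le> u n" "u sums B" for t s u B
  using that by (metis norm_suminf_le sums_iff)
 show ?thesis
 proof (rule that[of a e])
  show "F 0 = a 0" using sums_unique2[OF a(1)[of 0]] powser_sums_zero[of a] by metis
  fix K
  show "cmod (F z - (\<Sum>n<K. a n * z ^ n)) \<le> e K" if z: "z \<in> circle" for z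
  proof (rule bd[OF tail])
   show "cmod (a (n + K) * z ^ (n + K)) \<le> real (Suc (n + K)) * cmod (a (n + K))" for n
    using z by (simp add: norm_mult norm_power mult_le_cancel_right1)
   show "(\<lambda>n. real (Suc (n + K)) * cmod (a (n + K))) sums e K" unfolding e_def using es by (rule summable_sums)
  qed
  show "cmod ((F x - (\<Sum>n<K. a n * x ^ n)) - (F y - (\<Sum>n<K. a n * y ^ n))) \<le> e K * cmod (x - y)" if xy: "x \<in> circle" "y \<in> circle" for x y
  proof (rule bd[OF sums_diff[OF tail tail]])
   fix n
   have "cmod (x ^ (n + K) - y ^ (n + K)) \<le> real (n + K) * cmod (x - y)"
    using norm_power_diff[of x y "n + K"] xy by simp
   also have "\<dots> \<le> real (Suc (n + K)) * cmod (x - y)" by (intro mult_right_mono) auto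
   finally have "cmod (a (n + K)) * cmod (x ^ (n + K) - y ^ (n + K)) \<le> cmod (a (n + K)) * (real (Suc (n + K)) * cmod (x - y))"
    by (intro mult_left_mono) auto
   then show "cmod (a (n + K) * x ^ (n + K) - a (n + K) * y ^ (n + K)) \<le> real (Suc (n + K)) * cmod (a (n + K)) * cmod (x - y)"
    by (simp add: norm_mult mult_ac flip: right_diff_distrib)
   show "(\<lambda>n. real (Suc (n + K)) * cmod (a (n + K)) * cmod (x - y)) sums (e K * cmod (x - y))"
    unfolding e_def using es by (intro sums_mult2 summable_sums)
  qed
 qed (use e0 epos in auto)
qed

lemma entire_lipschitz:
 assumes "F holomorphic_on UNIV"
 obtains L where "\<And>x y. x \<in> circle ==> y \<in> circle ==> cmod (F x - F y) \<le> L * cmod (x - y)"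
proof (rule entire_partial_sums[OF assms])
 fix a e
 assume *: "\<And>K x y. x \<in> circle ==> y \<in> circle ==> cmod ((F x - (\<Sum>n<K. a n * x ^ n)) - (F y - (\<Sum>n<K. a n * y ^ n))) \<le> e K * cmod (x - y)"
 from *[where K=0] show thesis by (intro that[of "e 0"]) auto
qed

lemma ln_diff_le:
 fixes s t :: real assumes "\<delta> \<le> s" "\<delta> \<le> t" "0 < \<delta>"
 shows "\<bar>ln s - ln t\<bar> \<le> \<bar>s - t\<bar> / \<delta>"
proof -
 have *: "ln s - ln t \<le> (s - t) / \<delta>" if "\<delta> \<le> t" "t \<le> s" for s t
 proof -
  have t: "0 < t" "0 < s" using that assms by auto
  have "ln s - ln t = ln (s / t)" using t by (simp add: ln_div)
  also have "\<dots> \<le> s / t - 1" using t by (intro ln_le_minus_one) auto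
  also have "\<dots> = (s - t) / t" using t by (simp add: field_simps)
  also have "\<dots> \<le> (s - t) / \<delta>" using that assms by (intro divide_left_mono mult_pos_pos) auto
  finally show ?thesis .
 qed
 show ?thesis
 proof (cases "t \<le> s")
  case True then have "ln t \<le> ln s" using assms by simp
  then show ?thesis using *[OF assms(2) True] True by simp
 next
  case False then have "ln s \<le> ln t" using assms by simp
  then show ?thesis using *[OF assms(1)] False by simp
 qed
qed

text \<open>Jensen's inequality, obtained without factoring \<open>P\<close>: if \<open>exp Q\<close> is nearly outer with modulus
 \<open>sqrt (\<bar>P\<bar>^2 + \<delta>)\<close> then \<open>P exp (- Q)\<close> is nearly bounded by \<open>1\<close>, also in its mean \<open>exp (- Q(0))\<close>.\<close>

lemma mean_log_nonneg:
 assumes P: "P holomorphic_on UNIV" "P 0 = 1" and \<delta>: "\<delta> > 0"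
 shows "0 \<le> (LINT z|ds. ln ((cmod (P z))^2 + \<delta>))"
proof -
 let ?G = "\<lambda>z. ln ((cmod (P z))^2 + \<delta>) / 2"
 obtain L where L: "\<And>x y. x \<in> circle ==> y \<in> circle ==> cmod (P x - P y) \<le> L * cmod (x - y)"
  using entire_lipschitz[OF P(1)] by blast
 define B where "B = cmod (P 1) + 2 * \<bar>L\<bar>"
 have B: "cmod (P x) \<le> B" if "x \<in> circle" for x unfolding B_def by (rule lipschitz_circle_bounded[OF L that])
 have B0: "0 \<le> B" by (simp add: B_def)
 have lip: "\<bar>?G x - ?G y\<bar> \<le> (B * L / \<delta>) * cmod (x - y)" if xy: "x \<in> circle" "y \<in> circle" for x y
 proof -
  have "\<bar>(cmod (P x))^2 - (cmod (P y))^2\<bar> = \<bar>cmod (P x) - cmod (P y)\<bar> * (cmod (P x) + cmod (P y))"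
   by (simp add: power2_eq_square square_diff_square_factored abs_mult)
  also have "\<dots> \<le> (L * cmod (x - y)) * (2 * B)"
   using order_trans[OF norm_triangle_ineq3 L[OF xy]] B[OF xy(1)] B[OF xy(2)] order_trans[OF norm_ge_zero L[OF xy]]
   by (intro mult_mono) auto
  finally have 1: "\<bar>(cmod (P x))^2 - (cmod (P y))^2\<bar> \<le> 2 * (B * L * cmod (x - y))" by (simp add: mult_ac)
  have "\<bar>?G x - ?G y\<bar> = \<bar>ln ((cmod (P x))^2 + \<delta>) - ln ((cmod (P y))^2 + \<delta>)\<bar> / 2" by (simp flip: diff_divide_distrib)
  also have "\<dots> \<le> (\<bar>(cmod (P x))^2 - (cmod (P y))^2\<bar> / \<delta>) / 2"
   using ln_diff_le[of \<delta> "(cmod (P x))^2 + \<delta>" "(cmod (P y))^2 + \<delta>"] \<delta> by (intro divide_right_mono) auto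
  also have "\<dots> \<le> (2 * (B * L * cmod (x - y)) / \<delta>) / 2" using 1 \<delta> by (intro divide_right_mono) auto
  finally show ?thesis by simp
 qed
 have low: "- \<eta> \<le> (LINT z|ds. ?G z) / (2 * pi)" if \<eta>: "\<eta> > 0" for \<eta>
 proof -
  obtain Q where Q: "Q holomorphic_on UNIV" "\<And>z. z \<in> circle ==> \<bar>Re (Q z) - ?G z\<bar> \<le> \<eta>"
   "Re (Q 0) = (LINT z|ds. ?G z) / (2 * pi)"
   using outer_approximation[where G="?G", OF lip \<eta>] by metis
  have hol: "(\<lambda>z. P z * exp (- Q z)) holomorphic_on UNIV" by (intro holomorphic_intros P Q)
  have bd: "cmod (P z * exp (- Q z)) \<le> exp \<eta>" if z: "z \<in> circle" for z
  proof -
   have "cmod (P z) = sqrt ((cmod (P z))^2)" by simp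
   also have "\<dots> \<le> sqrt ((cmod (P z))^2 + \<delta>)" using \<delta> by (intro real_sqrt_le_mono) simp
   also have "\<dots> = exp (?G z)"
   proof -
    have p: "(cmod (P z))^2 + \<delta> > 0" using \<delta> by (intro add_nonneg_pos) auto
    have "(exp (?G z))^2 = exp (2 * ?G z)" by (simp add: power2_eq_square flip: exp_add)
    also have "\<dots> = (cmod (P z))^2 + \<delta>" using p by simp
    finally show ?thesis by (metis abs_of_pos exp_gt_zero real_sqrt_abs)
   qed
   finally have "cmod (P z * exp (- Q z)) \<le> exp (?G z) * exp (- Re (Q z))"
    unfolding norm_mult norm_exp_eq_Re by (intro mult_mono) auto
   also have "\<dots> = exp (?G z - Re (Q z))" by (simp flip: exp_add)
   also have "\<dots> \<le> exp \<eta>" using Q(2)[OF z] by simp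
   finally show ?thesis .
  qed
  have m: "(\<lambda>z. P z * exp (- Q z)) \<in> meas"
   by (intro continuous_on_circle_measurable continuous_on_subset[OF holomorphic_on_imp_continuous_on[OF hol]]) simp
  have "2 * pi * exp (- Re (Q 0)) = cmod (2 * pi * (P 0 * exp (- Q 0)))" by (simp add: P(2) norm_mult norm_exp_eq_Re)
  also have "\<dots> = cmod (LINT z|ds. P z * exp (- Q z))" by (simp only: entire_mean[OF hol])
  also have "\<dots> \<le> 2 * pi * exp \<eta>" by (rule norm_integral_arc_le[OF m bd])
  finally have "- Re (Q 0) \<le> \<eta>" by simp
  then show ?thesis using Q(3) by simp
 qed
 have "0 \<le> (LINT z|ds. ?G z) / (2 * pi)"
 proof (rule field_le_epsilon)
  fix \<eta> :: real assume "0 < \<eta>"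
  from low[OF this] show "0 \<le> (LINT z|ds. ?G z) / (2 * pi) + \<eta>" by linarith
 qed
 then show ?thesis using pi_gt_zero by (auto simp: zero_le_divide_iff)
qed

text \<open>The lower bound in Szego's theorem, by Jensen's inequality for the exponential.\<close>

lemma szego_lower_bound:
 assumes P: "P holomorphic_on UNIV" "P 0 = 1" and w: "w \<in> meas"
  and wM: "\<And>z. z \<in> circle ==> w z \<le> M" and pos: "AE z in ds. 0 < w z"
  and int: "integrable ds (\<lambda>z. ln (w z))"
 shows "2 * pi * exp ((LINT z|ds. ln (w z)) / (2 * pi)) \<le> (LINT z|ds. (cmod (P z))^2 * w z)"
proof -
 let ?m = "(LINT z|ds. ln (w z)) / (2 * pi)"
 have cont: "continuous_on circle P" by (rule continuous_on_subset[OF holomorphic_on_imp_continuous_on[OF P(1)]]) simp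
 have Pm [measurable]: "P \<in> meas" by (rule continuous_on_circle_measurable[OF cont])
 obtain B where "\<forall>z\<in>circle. cmod (P z) \<le> B"
  using compact_imp_bounded[OF compact_continuous_image[OF cont compact_sphere]] by (auto simp: bounded_iff)
 then have B: "\<And>z. z \<in> circle ==> cmod (P z) \<le> B" by blast
 have B2: "(cmod (P z))^2 \<le> B^2" if "z \<in> circle" for z using B[OF that] by (intro power_mono) auto
 note [measurable] = w
 have pos': "AE z in ds. 0 < w z \<and> z \<in> circle" using pos AE_space by eventually_elim simp
 have wi: "integrable ds w"
 proof (rule arc.integrable_const_bound[OF _ w])
  show "AE z in ds. norm (w z) \<le> M" using pos' by eventually_elim (use wM in auto)
 qed
 have Pwi: "integrable ds (\<lambda>z. (cmod (P z))^2 * w z)"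
 proof (rule Bochner_Integration.integrable_bound[OF integrable_mult_right[OF wi, of "B^2"]])
  show "AE z in ds. norm ((cmod (P z))^2 * w z) \<le> norm (B^2 * w z)"
   using pos' by eventually_elim (auto simp: abs_mult intro!: mult_right_mono B2)
 qed measurable
 have step: "2 * pi * exp ?m \<le> (LINT z|ds. (cmod (P z))^2 * w z) + \<delta> * (LINT z|ds. w z)" if \<delta>: "\<delta> > 0" for \<delta>
 proof -
  let ?X = "\<lambda>z. ln ((cmod (P z))^2 + \<delta>) + ln (w z)"
  have li: "integrable ds (\<lambda>z. ln ((cmod (P z))^2 + \<delta>))"
  proof (rule integrable_arc_bounded[where B="\<bar>ln \<delta>\<bar> + \<bar>ln (B^2 + \<delta>)\<bar>"])
   fix z assume z: "z \<in> circle"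
   have "ln \<delta> \<le> ln ((cmod (P z))^2 + \<delta>)" using \<delta> by (subst ln_le_cancel_iff) (auto intro: add_nonneg_pos)
   moreover have "ln ((cmod (P z))^2 + \<delta>) \<le> ln (B^2 + \<delta>)" using \<delta> B2[OF z] by (subst ln_le_cancel_iff) (auto intro: add_nonneg_pos)
   ultimately show "norm (ln ((cmod (P z))^2 + \<delta>)) \<le> \<bar>ln \<delta>\<bar> + \<bar>ln (B^2 + \<delta>)\<bar>" by auto
  qed measurable
  have "2 * pi * exp ?m \<le> exp ?m * (2 * pi + (LINT z|ds. ?X z) - 2 * pi * ?m)"
   using mean_log_nonneg[OF P \<delta>] li int by simp
  also have "\<dots> = (LINT z|ds. exp ?m * (1 + (?X z - ?m)))"
   using li int by (simp add: measure_arc_length algebra_simps)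
  also have "\<dots> \<le> (LINT z|ds. (cmod (P z))^2 * w z + \<delta> * w z)"
  proof (rule integral_mono_AE)
   show "AE z in ds. exp ?m * (1 + (?X z - ?m)) \<le> (cmod (P z))^2 * w z + \<delta> * w z"
    using pos
   proof eventually_elim
    case (elim z)
    have p: "(cmod (P z))^2 + \<delta> > 0" using \<delta> by (intro add_nonneg_pos) auto
    have "exp ?m * (1 + (?X z - ?m)) \<le> exp ?m * exp (?X z - ?m)" by (intro mult_left_mono exp_ge_add_one_self) auto
    also have "\<dots> = exp (?X z)" by (simp flip: exp_add)
    also have "\<dots> = ((cmod (P z))^2 + \<delta>) * w z" using p elim by (simp add: exp_add)
    finally show ?case by (simp add: distrib_right)
   qed
   show "integrable ds (\<lambda>z. exp ?m * (1 + (?X z - ?m)))"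
    using li int by (intro integrable_mult_right Bochner_Integration.integrable_add Bochner_Integration.integrable_diff arc.integrable_const)
   show "integrable ds (\<lambda>z. (cmod (P z))^2 * w z + \<delta> * w z)" using Pwi wi by auto
  qed
  also have "\<dots> = (LINT z|ds. (cmod (P z))^2 * w z) + \<delta> * (LINT z|ds. w z)" using Pwi wi by simp
  finally show ?thesis .
 qed
 have "(\<lambda>n. (LINT z|ds. (cmod (P z))^2 * w z) + inverse (real (Suc n)) * (LINT z|ds. w z)) \<longlonglongrightarrow> (LINT z|ds. (cmod (P z))^2 * w z) + 0 * (LINT z|ds. w z)"
  by (intro tendsto_intros LIMSEQ_inverse_real_of_nat)
 then have "2 * pi * exp ?m \<le> (LINT z|ds. (cmod (P z))^2 * w z) + 0 * (LINT z|ds. w z)"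
  by (rule LIMSEQ_le_const) (auto intro!: exI[of _ 0] step)
 then show ?thesis by simp
qed

lemma harmonic_lipschitz_mult:
 assumes h: "h \<in> HD" and M: "\<And>z. z \<in> circle ==> cmod (h z) \<le> M"
  and lip: "\<And>x y. x \<in> circle ==> y \<in> circle ==> cmod (u x - u y) \<le> L * cmod (x - y)"
 shows "(\<lambda>z. u z * h z) \<in> HD"
 by (rule harmonic_mult[OF lipschitz_harmonic[OF lip] h lipschitz_circle_bounded[OF lip] M])

lemma shift_span_harmonic:
 assumes g: "g \<in> HD" and M: "\<And>z. z \<in> circle ==> cmod (g z) \<le> M" and p: "p \<in> shift_span g"
 shows "p \<in> HD"
proof -
 obtain N a where pe: "p = (\<lambda>z. \<Sum>n<N. a n * (z ^ n * g z))" using p by (auto simp: shift_span_def)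
 have "(\<lambda>z. \<Sum>n<N. a n * (z ^ n * g z)) = (\<lambda>z. (\<Sum>n<N. a n * z ^ n) * g z)" by (auto simp: sum_distrib_right mult.assoc)
 moreover have "(\<lambda>z. (\<Sum>n<N. a n * z ^ n) * g z) \<in> HD"
 proof -
  have "(\<lambda>z. \<Sum>n<N. a n * z ^ n) holomorphic_on UNIV" by (intro holomorphic_intros)
  then obtain L where L: "\<And>x y. x \<in> circle ==> y \<in> circle ==> cmod ((\<Sum>n<N. a n * x ^ n) - (\<Sum>n<N. a n * y ^ n)) \<le> L * cmod (x - y)"
   using entire_lipschitz by blast
  show ?thesis by (rule harmonic_lipschitz_mult[OF g M L])
 qed
 ultimately show ?thesis using pe by simp
qed

lemma cmod_cnj_diff: "cmod (cnj x - cnj y) = cmod (x - y)"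
 by (metis complex_cnj_diff complex_mod_cnj)

text \<open>A polynomial combination of the shifts differs from \<open>\<zeta>\<^sup>-\<^sup>1 f\<^sup>2\<close> in modulus by \<open>\<bar>P\<bar> \<bar>f\<bar>^2\<close> with \<open>P(0) = 1\<close>,
so that Szego's lower bound for the weight \<open>\<bar>f\<bar>^4\<close> excludes convergence already in \<open>L^2\<close>.\<close>

theorem cyclic_imp_log_not_integrable:
 assumes fm: "f \<in> meas" and M: "\<And>z. z \<in> circle ==> cmod (f z) \<le> M"
  and cyc: "cyclic_dirichlet (\<lambda>z. (f z)^2)"
 shows "\<not> log_modulus_integrable f"
proof
 assume log: "log_modulus_integrable f"
 let ?g = "\<lambda>z. (f z)^2"
 let ?w = "\<lambda>z. (cmod (f z)) ^ 4"
 have g: "?g \<in> HD" using cyc by (simp add: cyclic_dirichlet_def)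
 have gM: "cmod (?g z) \<le> M^2" if "z \<in> circle" for z
  using power_mono[OF M[OF that], of 2] by (simp add: norm_power)
 let ?h = "\<lambda>z. cnj z * ?g z"
 have h: "?h \<in> HD"
  by (rule harmonic_lipschitz_mult[OF g gM, where L=1]) (auto simp: cmod_cnj_diff)
 have wM: "?w z \<le> M ^ 4" if "z \<in> circle" for z using power_mono[OF M[OF that], of 4] by simp
 have wpos: "AE z in ds. 0 < ?w z" using log by (auto simp: log_modulus_integrable_def elim: eventually_mono)
 have lw: "ln (?w z) = 4 * ln (cmod (f z))" for z by (cases "f z = 0") (simp_all add: ln_realpow)
 have wi: "integrable ds (\<lambda>z. ln (?w z))" unfolding lw using log by (simp add: log_modulus_integrable_def)
 define \<delta> where "\<delta> = 2 * pi * exp ((LINT z|ds. ln (?w z)) / (2 * pi))"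
 have \<delta>: "\<delta> > 0" by (simp add: \<delta>_def)
 define \<epsilon> where "\<epsilon> = sqrt (\<delta> / (4 * pi^2))"
 have \<epsilon>: "\<epsilon> > 0" using \<delta> by (simp add: \<epsilon>_def)
 have "?h \<in> shift_closure ?g" using cyc h by (simp add: cyclic_dirichlet_def)
 then obtain p where p: "p \<in> shift_span ?g" "dnorm (\<lambda>z. ?h z - p z) < \<epsilon>" using \<epsilon> by (auto simp: shift_closure_def)
 obtain N a where pe: "p = (\<lambda>z. \<Sum>n<N. a n * (z ^ n * ?g z))" using p(1) by (auto simp: shift_span_def)
 define P where "P z = 1 - z * (\<Sum>n<N. a n * z ^ n)" for z
 have Ph: "P holomorphic_on UNIV" "P 0 = 1" unfolding P_def by (auto intro!: holomorphic_intros)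
 have hp: "(\<lambda>z. ?h z - p z) \<in> HD" by (intro harmonic_diff h shift_span_harmonic[OF g gM p(1)])
 have eq: "(cmod (?h z - p z))^2 = (cmod (P z))^2 * ?w z" if z: "z \<in> circle" for z
 proof -
  have "p z = (cnj z * z) * ((\<Sum>n<N. a n * z ^ n) * ?g z)"
   using circle_mult_cnj[OF z] by (simp add: pe sum_distrib_left mult_ac)
  then have "?h z - p z = cnj z * P z * ?g z" by (simp add: P_def algebra_simps)
  then show ?thesis using z by (simp add: norm_mult norm_power power_mult_distrib flip: power_mult)
 qed
 have "\<delta> \<le> (LINT z|ds. (cmod (P z))^2 * ?w z)"
  unfolding \<delta>_def using fm by (intro szego_lower_bound[OF Ph _ wM wpos wi]) measurable
 also have "\<dots> = (LINT z|ds. (cmod (?h z - p z))^2)"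
  by (intro Bochner_Integration.integral_cong refl) (simp add: eq)
 finally have "ennreal \<delta> \<le> L2sq (\<lambda>z. ?h z - p z)"
  by (simp add: L2sq_eq_integral[OF harmonic_L2[OF hp]] ennreal_leI)
 also have "\<dots> \<le> DN (\<lambda>z. ?h z - p z)" by (simp add: DN_def)
 also have "\<dots> \<le> ennreal (4 * pi^2 * (dnorm (\<lambda>z. ?h z - p z))^2)" by (rule DN_le_dirichlet_norm[OF hp])
 also have "\<dots> < ennreal \<delta>"
 proof (intro ennreal_lessI \<delta>)
  have "(dnorm (\<lambda>z. ?h z - p z))^2 < \<epsilon>^2" using p(2) dirichlet_norm_nonneg by (intro power_strict_mono) auto
  also have "\<epsilon>^2 = \<delta> / (4 * pi^2)" using \<delta> by (simp add: \<epsilon>_def)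
  finally show "4 * pi^2 * (dnorm (\<lambda>z. ?h z - p z))^2 < \<delta>" by (simp add: field_simps)
 qed
 finally show False by simp
qed

section \<open>Logarithmic energy and Fourier coefficients of measures\<close>

lemma ennreal_add_le: "0 \<le> a ==> ennreal (a + b) \<le> ennreal a + ennreal b"
 by (cases "0 \<le> b") (auto simp: ennreal_plus ennreal_neg intro!: ennreal_leI)

text \<open>With the sign of the exponent opposite to the usual one.\<close>

definition mu_hat :: "complex measure \<Rightarrow> int \<Rightarrow> complex" where
 "mu_hat \<mu> n = (LINT z|\<mu>. z powi n)"

definition circle_prob :: "complex measure \<Rightarrow> bool" where
 "circle_prob \<mu> \<longleftrightarrow> sets \<mu> = sets borel \<and> prob_space \<mu> \<and> (AE z in \<mu>. z \<in> circle)"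

lemma prob_on_AE:
 assumes "\<mu> \<in> prob_on E"
 obtains K where "compact K" "K \<subseteq> E" "AE z in \<mu>. z \<in> K"
proof -
 obtain K where K: "compact K" "K \<subseteq> E" "emeasure \<mu> (- K) = 0" and s: "sets \<mu> = sets borel"
  using assms by (auto simp: prob_on_def)
 have "- K \<in> sets \<mu>" using borel_compact[OF K(1)] by (simp add: s)
 then have "- K \<in> null_sets \<mu>" using K(3) by (simp add: null_sets_def)
 from AE_not_in[OF this] show ?thesis using K by (intro that[of K]) auto
qed

lemma prob_on_circle:
 assumes "\<mu> \<in> prob_on E" "E \<subseteq> circle" shows "circle_prob \<mu>"
proof -
 obtain K where "K \<subseteq> E" "AE z in \<mu>. z \<in> K" using prob_on_AE[OF assms(1)] by metis
 then have "AE z in \<mu>. z \<in> circle" using assms(2) by (auto elim!: eventually_mono)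
 then show ?thesis using assms(1) by (simp add: circle_prob_def prob_on_def)
qed

text \<open>The logarithmic kernel smoothed by a Poisson kernel: on the circle it is the real part of the power
series \<open>\<Sum> r\<^sup>n x\<^sup>n / n\<close> at \<open>x = \<zeta> cnj \<zeta>'\<close>, which makes its energy a sum over Fourier coefficients.\<close>

definition log_r :: "real \<Rightarrow> complex \<times> complex \<Rightarrow> real" where
 "log_r r p = - ln (cmod (1 - of_real r * (fst p * cnj (snd p))))"

lemma cmod_one_minus_mult_cnj:
 assumes "w \<in> circle" shows "cmod (1 - z * cnj w) = cmod (z - w)"
proof -
 have "(1 - z * cnj w) * w = w - z * (w * cnj w)" by (simp add: algebra_simps)
 also have "\<dots> = w - z" by (simp only: circle_mult_cnj[OF assms] mult_1_right)
 finally have "cmod (1 - z * cnj w) * cmod w = cmod (w - z)" by (metis norm_mult)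
 then show ?thesis using assms by (simp add: norm_minus_commute)
qed

lemma cmod_one_minus_ge:
 assumes "cmod x \<le> 1" "0 \<le> r" "r < 1"
 shows "1 - r \<le> cmod (1 - of_real r * x)" "cmod (1 - of_real r * x) \<le> 2" "cmod (1 - x) \<le> 2 * cmod (1 - of_real r * x)"
proof -
 have rx: "cmod (of_real r * x) \<le> r" using assms by (simp add: norm_mult mult_left_le)
 then show 1: "1 - r \<le> cmod (1 - of_real r * x)" using norm_triangle_ineq2[of 1 "of_real r * x"] by simp
 show "cmod (1 - of_real r * x) \<le> 2" using norm_triangle_ineq4[of 1 "of_real r * x"] rx assms by simp
 have "1 - x = (1 - of_real r * x) - of_real (1 - r) * x" by (simp add: algebra_simps)
 then have "cmod (1 - x) \<le> cmod (1 - of_real r * x) + cmod (of_real (1 - r) * x)" by (simp only: norm_triangle_ineq4)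
 also have "cmod (of_real (1 - r) * x) \<le> 1 - r" using assms by (simp add: norm_mult mult_left_le del: of_real_diff)
 finally show "cmod (1 - x) \<le> 2 * cmod (1 - of_real r * x)" using 1 by simp
qed

lemma log_r_bounds:
 assumes "fst p \<in> circle" "snd p \<in> circle" "0 \<le> r" "r < 1"
 shows "- ln 2 \<le> log_r r p" "log_r r p \<le> - ln (1 - r)"
proof -
 have c: "cmod (fst p * cnj (snd p)) \<le> 1" using assms by (simp add: norm_mult)
 note b = cmod_one_minus_ge[OF c assms(3,4)]
 have pos: "0 < cmod (1 - of_real r * (fst p * cnj (snd p)))" using b(1) assms(4) by linarith
 show "- ln 2 \<le> log_r r p" "log_r r p \<le> - ln (1 - r)"
  using b assms(4) pos ln_mono[of "cmod (1 - of_real r * (fst p * cnj (snd p)))" 2] ln_mono[of "1 - r" "cmod (1 - of_real r * (fst p * cnj (snd p)))"]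
  by (auto simp: log_r_def)
qed

lemma log_r_sums:
 assumes "fst p \<in> circle" "snd p \<in> circle" "0 \<le> r" "r < 1"
 shows "(\<lambda>n. r ^ n / real n * Re ((fst p * cnj (snd p)) ^ n)) sums log_r r p"
proof -
 let ?x = "of_real r * (fst p * cnj (snd p))"
 have cx: "cmod (- ?x) < 1" using assms by (simp add: norm_mult)
 have nz: "1 + - ?x \<noteq> 0"
 proof
  assume "1 + - ?x = 0"
  then have "?x = 1" by (simp only: add_uminus_conv_diff eq_iff_diff_eq_0[symmetric])
  with cx show False by (simp only: norm_minus_cancel norm_one)
 qed
 have "(\<lambda>n. Re (- ((- (- ?x)) ^ n) / of_nat n)) sums Re (Ln (1 + - ?x))"
  by (intro sums_Re Ln_series' cx)
 then have "(\<lambda>n. - Re (- ((- (- ?x)) ^ n) / of_nat n)) sums - Re (Ln (1 + - ?x))" by (rule sums_minus)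
 also have "- Re (Ln (1 + - ?x)) = log_r r p" using nz by (simp add: log_r_def)
 also have "(\<lambda>n. - Re (- ((- (- ?x)) ^ n) / of_nat n)) = (\<lambda>n. r ^ n / real n * Re ((fst p * cnj (snd p)) ^ n))"
 proof
  fix n
  have "(of_real r * (fst p * cnj (snd p))) ^ n = complex_of_real (r ^ n) * (fst p * cnj (snd p)) ^ n" by (simp add: power_mult_distrib)
  then show "- Re (- ((- (- ?x)) ^ n) / of_nat n) = r ^ n / real n * Re ((fst p * cnj (snd p)) ^ n)"
   by (simp add: Re_divide_of_nat del: of_real_power)
 qed
 finally show ?thesis .
qed

lemma measurable_conv:
 assumes k: "is_kernel \<kappa> k" and h: "h \<in> meas"
 shows "conv k h \<in> borel_measurable borel"
proof -
 have km: "k \<in> borel_measurable borel" by (rule kernel_measurable[OF k])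
 have "(\<lambda>p. complex_of_real (k (fst p * cnj (snd p))) * h (snd p)) \<in> borel_measurable (borel \<Otimes>\<^sub>M ds)"
 proof -
  have a: "(\<lambda>p. fst p) \<in> borel_measurable (borel \<Otimes>\<^sub>M ds)" by (rule measurable_fst)
  have b: "(\<lambda>p. snd p) \<in> borel_measurable (borel \<Otimes>\<^sub>M ds)" by (rule measurable_compose[OF measurable_snd id_arc_measurable])
  have c: "(\<lambda>p. cnj (snd p)) \<in> borel_measurable (borel \<Otimes>\<^sub>M ds)" by (rule measurable_compose[OF b measurable_cnj])
  have d: "(\<lambda>p. k (fst p * cnj (snd p))) \<in> borel_measurable (borel \<Otimes>\<^sub>M ds)"
   by (rule measurable_compose[OF borel_measurable_times[OF a c] km])
  have e: "(\<lambda>p. h (snd p)) \<in> borel_measurable (borel \<Otimes>\<^sub>M ds)" by (rule measurable_compose[OF measurable_snd h])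
  have "(\<lambda>p. complex_of_real (k (fst p * cnj (snd p)))) \<in> borel_measurable (borel \<Otimes>\<^sub>M ds)"
   using d by measurable
  then show ?thesis using e by (rule borel_measurable_times)
 qed
 then have "(\<lambda>z. LINT \<xi>|ds. of_real (k (z * cnj \<xi>)) * h \<xi>) \<in> borel_measurable borel"
  by (intro arc.borel_measurable_lebesgue_integral) (simp add: split_beta')
 then show ?thesis unfolding conv_def[abs_def] by measurable
qed

context
 fixes \<mu> :: "complex measure"
 assumes \<mu>: "circle_prob \<mu>"
begin

lemma sets_mu [measurable_cong]: "sets \<mu> = sets borel"
 using \<mu> by (simp add: circle_prob_def)

lemma space_mu: "space \<mu> = UNIV"
 using sets_eq_imp_space_eq[OF sets_mu] by simp

lemma prob_mu: "prob_space \<mu>"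
 using \<mu> by (simp add: circle_prob_def)

lemma AE_mu: "AE z in \<mu>. z \<in> circle"
 using \<mu> by (simp add: circle_prob_def)

interpretation M: prob_space \<mu> by (rule prob_mu)
interpretation MM: pair_prob_space \<mu> \<mu> ..

lemma integrable_mu_bounded:
 fixes h :: "complex \<Rightarrow> 'b::{banach, second_countable_topology}"
 assumes "h \<in> borel_measurable borel" "\<And>z. z \<in> circle ==> norm (h z) \<le> B"
 shows "integrable \<mu> h"
proof (rule M.integrable_const_bound[where B=B])
 show "AE z in \<mu>. norm (h z) \<le> B" using AE_mu by eventually_elim (rule assms(2))
qed (use assms(1) in measurable)

lemma AE_MM: "AE p in \<mu> \<Otimes>\<^sub>M \<mu>. fst p \<in> circle \<and> snd p \<in> circle"
proof (rule MM.AE_pair_measure)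
 have "circle \<in> sets borel" by (simp add: borel_compact)
 then show "{p \<in> space (\<mu> \<Otimes>\<^sub>M \<mu>). fst p \<in> circle \<and> snd p \<in> circle} \<in> sets (\<mu> \<Otimes>\<^sub>M \<mu>)" by measurable
 show "AE x in \<mu>. AE y in \<mu>. fst (x, y) \<in> circle \<and> snd (x, y) \<in> circle"
  using AE_mu by eventually_elim (use AE_mu in \<open>eventually_elim\<close>, simp)
qed

lemma mu_hat_minus: "mu_hat \<mu> (- n) = cnj (mu_hat \<mu> n)"
proof -
 have "cnj (mu_hat \<mu> n) = (LINT z|\<mu>. cnj (z powi n))"
  unfolding mu_hat_def by (rule Bochner_Integration.integral_cnj[symmetric])
 also have "\<dots> = mu_hat \<mu> (- n)"
  unfolding mu_hat_def
 proof (rule integral_cong_AE)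
  show "AE z in \<mu>. cnj (z powi n) = z powi - n"
   using AE_mu by eventually_elim (metis cnj_powi circle_cnj_powi)
 qed measurable
 finally show ?thesis ..
qed

lemma mu_hat_0: "mu_hat \<mu> 0 = 1"
 by (simp add: mu_hat_def M.prob_space)

lemma log_r_measurable: "log_r r \<in> borel_measurable (\<mu> \<Otimes>\<^sub>M \<mu>)"
 unfolding log_r_def[abs_def] by measurable

lemma integral_product_power:
 "(LINT p|(\<mu> \<Otimes>\<^sub>M \<mu>). Re ((fst p * cnj (snd p)) ^ n)) = (cmod (mu_hat \<mu> (int n)))^2"
 and integrable_product_power: "integrable (\<mu> \<Otimes>\<^sub>M \<mu>) (\<lambda>p. Re ((fst p * cnj (snd p)) ^ n))"
proof -
 have i: "integrable (\<mu> \<Otimes>\<^sub>M \<mu>) (\<lambda>p. (fst p * cnj (snd p)) ^ n)"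
 proof (rule MM.P.integrable_const_bound[where B=1])
  show "AE p in \<mu> \<Otimes>\<^sub>M \<mu>. cmod ((fst p * cnj (snd p)) ^ n) \<le> 1"
   using AE_MM by eventually_elim (simp add: norm_power norm_mult)
 qed measurable
 then show "integrable (\<mu> \<Otimes>\<^sub>M \<mu>) (\<lambda>p. Re ((fst p * cnj (snd p)) ^ n))" by (rule integrable_Re)
 have "(LINT p|(\<mu> \<Otimes>\<^sub>M \<mu>). (fst p * cnj (snd p)) ^ n) = (LINT x|\<mu>. LINT y|\<mu>. (fst (x, y) * cnj (snd (x, y))) ^ n)"
  by (rule MM.integral_fst'[OF i, symmetric])
 also have "\<dots> = (LINT x|\<mu>. LINT y|\<mu>. x ^ n * cnj (y ^ n))" by (simp add: power_mult_distrib)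
 also have "\<dots> = (LINT x|\<mu>. x ^ n) * (LINT y|\<mu>. cnj (y ^ n))" by simp
 also have "\<dots> = mu_hat \<mu> (int n) * cnj (mu_hat \<mu> (int n))"
  unfolding mu_hat_def power_int_of_nat Bochner_Integration.integral_cnj[symmetric] ..
 also have "\<dots> = of_real ((cmod (mu_hat \<mu> (int n)))^2)" by (rule complex_norm_square[symmetric])
 finally show "(LINT p|(\<mu> \<Otimes>\<^sub>M \<mu>). Re ((fst p * cnj (snd p)) ^ n)) = (cmod (mu_hat \<mu> (int n)))^2"
  unfolding integral_Re[OF i] by (simp only: Re_complex_of_real)
qed

lemma log_r_integrable:
 assumes r: "0 \<le> r" "r < 1"
 shows "integrable (\<mu> \<Otimes>\<^sub>M \<mu>) (log_r r)"
proof (rule MM.P.integrable_const_bound[where B="ln 2 + \<bar>ln (1 - r)\<bar>"])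
 show "AE p in \<mu> \<Otimes>\<^sub>M \<mu>. norm (log_r r p) \<le> ln 2 + \<bar>ln (1 - r)\<bar>"
  using AE_MM
 proof eventually_elim
  case (elim p)
  have "0 \<le> ln (2::real)" by simp
  then show ?case using log_r_bounds[of p r] elim r unfolding real_norm_def by (smt (verit))
 qed
qed (rule log_r_measurable)

lemma log_r_integral_sums:
 assumes r: "0 \<le> r" "r < 1"
 shows "(\<lambda>n. r ^ n / real n * (cmod (mu_hat \<mu> (int n)))^2) sums (LINT p|(\<mu> \<Otimes>\<^sub>M \<mu>). log_r r p)"
proof -
 let ?f = "\<lambda>n p. r ^ n / real n * Re ((fst p * cnj (snd p)) ^ n)"
 have i: "integrable (\<mu> \<Otimes>\<^sub>M \<mu>) (?f n)" for n by (intro integrable_mult_right integrable_product_power)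
 have b: "AE p in \<mu> \<Otimes>\<^sub>M \<mu>. norm (?f n p) \<le> r ^ n" for n
  using AE_MM
 proof eventually_elim
  case (elim p)
  have "\<bar>Re ((fst p * cnj (snd p)) ^ n)\<bar> \<le> 1"
   using abs_Re_le_cmod[of "(fst p * cnj (snd p)) ^ n"] elim by (simp add: norm_power norm_mult)
  moreover have "r ^ n / real n \<le> r ^ n" using r divide_left_mono[of 1 "real n" "r ^ n"] by (cases "n = 0") auto
  ultimately have "(r ^ n / real n) * \<bar>Re ((fst p * cnj (snd p)) ^ n)\<bar> \<le> r ^ n * 1" using r by (intro mult_mono) auto
  then show ?case using r by (simp add: abs_mult)
 qed
 have "(\<lambda>n. LINT p|(\<mu> \<Otimes>\<^sub>M \<mu>). ?f n p) sums (LINT p|(\<mu> \<Otimes>\<^sub>M \<mu>). (\<Sum>n. ?f n p))"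
 proof (rule sums_integral[OF i])
  have "AE p in \<mu> \<Otimes>\<^sub>M \<mu>. \<forall>n. norm (?f n p) \<le> r ^ n" using b by (simp add: AE_all_countable)
  then show "AE p in \<mu> \<Otimes>\<^sub>M \<mu>. summable (\<lambda>n. norm (?f n p))"
   by eventually_elim (rule summable_comparison_test'[OF summable_geometric[of r], of 0], use r in auto)
  show "summable (\<lambda>n. LINT p|(\<mu> \<Otimes>\<^sub>M \<mu>). norm (?f n p))"
  proof (rule summable_comparison_test'[OF summable_geometric[of r], of 0])
   fix n
   have "(LINT p|(\<mu> \<Otimes>\<^sub>M \<mu>). norm (?f n p)) \<le> (LINT p|(\<mu> \<Otimes>\<^sub>M \<mu>). r ^ n)"
    by (intro integral_mono_AE integrable_norm[OF i] b) simp
   then show "norm (LINT p|(\<mu> \<Otimes>\<^sub>M \<mu>). norm (?f n p)) \<le> r ^ n" by (simp add: MM.P.prob_space)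
  qed (use r in simp)
 qed
 also have "(LINT p|(\<mu> \<Otimes>\<^sub>M \<mu>). (\<Sum>n. ?f n p)) = (LINT p|(\<mu> \<Otimes>\<^sub>M \<mu>). log_r r p)"
 proof (rule integral_cong_AE)
  show "AE p in \<mu> \<Otimes>\<^sub>M \<mu>. (\<Sum>n. ?f n p) = log_r r p"
   using AE_MM by eventually_elim (use log_r_sums r in \<open>auto simp: sums_iff\<close>)
 qed (auto intro: log_r_measurable)
 finally show ?thesis by (simp add: integral_product_power)
qed

lemma log_energy_negative_part:
 "(\<integral>\<^sup>+(\<zeta>, \<zeta>'). e2ennreal (- log_kernel \<zeta> \<zeta>') \<partial>(\<mu> \<Otimes>\<^sub>M \<mu>)) \<le> ennreal (ln 2)"
proof -
 have "(\<integral>\<^sup>+(\<zeta>, \<zeta>'). e2ennreal (- log_kernel \<zeta> \<zeta>') \<partial>(\<mu> \<Otimes>\<^sub>M \<mu>)) \<le> (\<integral>\<^sup>+p. ennreal (ln 2) \<partial>(\<mu> \<Otimes>\<^sub>M \<mu>))"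
 proof (rule nn_integral_mono_AE, use AE_MM in eventually_elim)
  case (elim p)
  obtain z w where p: "p = (z, w)" by (cases p)
  show ?case
  proof (cases "z = w")
   case False
   have "cmod (z - w) \<le> 2" using norm_triangle_ineq4[of z w] elim p by simp
   then have "ln (cmod (z - w)) \<le> ln 2" using False by simp
   then have "e2ennreal (ereal (ln (cmod (z - w)))) \<le> ennreal (ln 2)" by (simp add: ennreal.rep_eq ennreal_leI e2ennreal_ereal)
   then show ?thesis using False by (simp add: p log_kernel_def ln_div)
  qed (simp add: p log_kernel_def e2ennreal_neg)
 qed
 then show ?thesis by (simp add: MM.P.emeasure_space_1)
qed

text \<open>The smoothed kernel is at most the logarithmic kernel plus a constant; then \<open>r\<close> tends to \<open>1\<close> in finite
partial sums.\<close>

lemma finite_energy_imp_bounded_sums: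
 assumes "log_energy \<mu> < \<infinity>"
 obtains C where "\<And>N. (\<Sum>n\<in>win N. (cmod (mu_hat \<mu> n))^2 / wt n) \<le> C"
proof -
 let ?P = "\<integral>\<^sup>+(\<zeta>, \<zeta>'). e2ennreal (log_kernel \<zeta> \<zeta>') \<partial>(\<mu> \<Otimes>\<^sub>M \<mu>)"
 let ?N = "\<integral>\<^sup>+(\<zeta>, \<zeta>'). e2ennreal (- log_kernel \<zeta> \<zeta>') \<partial>(\<mu> \<Otimes>\<^sub>M \<mu>)"
 have Nf: "?N \<le> ennreal (ln 2)" by (rule log_energy_negative_part)
 have Pf: "?P < \<infinity>"
 proof (rule ccontr)
  assume "\<not> ?P < \<infinity>"
  then have "?P = \<infinity>" by (simp add: less_top[symmetric])
  moreover have "enn2ereal ?N < \<infinity>" using Nf by (metis ennreal_less_top enn2ereal_top infinity_ennreal_def le_less_trans less_ennreal.rep_eq)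
  ultimately have "log_energy \<mu> = \<infinity>" unfolding log_energy_def by (cases "enn2ereal ?N") auto
  then show False using assms by simp
 qed
 have bd: "ennreal (LINT p|(\<mu> \<Otimes>\<^sub>M \<mu>). log_r r p + ln 2) \<le> ennreal (2 * ln 2) + ?P" if r: "0 \<le> r" "r < 1" for r
 proof -
  have "ennreal (LINT p|(\<mu> \<Otimes>\<^sub>M \<mu>). log_r r p + ln 2) = (\<integral>\<^sup>+p. ennreal (log_r r p + ln 2) \<partial>(\<mu> \<Otimes>\<^sub>M \<mu>))"
  proof (rule nn_integral_eq_integral[symmetric])
   show "integrable (\<mu> \<Otimes>\<^sub>M \<mu>) (\<lambda>p. log_r r p + ln 2)" using log_r_integrable[OF r] by auto
   show "AE p in \<mu> \<Otimes>\<^sub>M \<mu>. 0 \<le> log_r r p + ln 2"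
    using AE_MM by eventually_elim (use log_r_bounds(1) r in \<open>fastforce\<close>)
  qed
  also have "\<dots> \<le> (\<integral>\<^sup>+p. ennreal (2 * ln 2) + (case p of (\<zeta>, \<zeta>') \<Rightarrow> e2ennreal (log_kernel \<zeta> \<zeta>')) \<partial>(\<mu> \<Otimes>\<^sub>M \<mu>))"
  proof (rule nn_integral_mono_AE, use AE_MM in eventually_elim)
   case (elim p)
   obtain z w where p: "p = (z, w)" by (cases p)
   have zw: "z \<in> circle" "w \<in> circle" using elim p by auto
   show ?case
   proof (cases "z = w")
    case True then show ?thesis by (simp add: p log_kernel_def)
   next
    case False
    let ?x = "z * cnj w"
    have x1: "cmod (1 - ?x) = cmod (z - w)" by (rule cmod_one_minus_mult_cnj[OF zw(2)])
    have cx: "cmod ?x \<le> 1" using zw by (simp add: norm_mult)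
    note b = cmod_one_minus_ge[OF cx r]
    have pos: "cmod (z - w) > 0" using False by simp
    have "cmod (1 - of_real r * ?x) > 0" using b(1) r by linarith
    moreover have "cmod (z - w) / 2 \<le> cmod (1 - of_real r * ?x)" using b(3) x1 by simp
    ultimately have "ln (cmod (z - w) / 2) \<le> ln (cmod (1 - of_real r * ?x))" using pos by simp
    then have "log_r r p + ln 2 \<le> 2 * ln 2 + ln (1 / cmod (z - w))" using pos by (simp add: log_r_def p ln_div)
    then have "ennreal (log_r r p + ln 2) \<le> ennreal (2 * ln 2 + ln (1 / cmod (z - w)))" by (rule ennreal_leI)
    also have "\<dots> \<le> ennreal (2 * ln 2) + ennreal (ln (1 / cmod (z - w)))" by (rule ennreal_add_le) simp
    finally show ?thesis using False by (simp add: p log_kernel_def e2ennreal_ereal)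
   qed
  qed
  also have "\<dots> = ennreal (2 * ln 2) + ?P"
  proof (subst nn_integral_add)
   show "(\<lambda>p. case p of (\<zeta>, \<zeta>') \<Rightarrow> e2ennreal (log_kernel \<zeta> \<zeta>')) \<in> borel_measurable (\<mu> \<Otimes>\<^sub>M \<mu>)"
    unfolding log_kernel_def split_beta' by measurable
  qed (auto simp: MM.P.emeasure_space_1)
  finally show ?thesis .
 qed
 define B where "B = enn2real (ennreal (2 * ln 2) + ?P)"
 have BP: "ennreal (2 * ln 2) + ?P = ennreal B" unfolding B_def using Pf by (simp add: less_top)
 have B0: "0 \<le> B" by (simp add: B_def)
 have fin: "(\<Sum>n=1..N. (cmod (mu_hat \<mu> (int n)))^2 / real n) \<le> B" for N
 proof -
  have step: "(\<Sum>n=1..N. r ^ n / real n * (cmod (mu_hat \<mu> (int n)))^2) \<le> B" if r: "0 \<le> r" "r < 1" for r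
  proof -
   have "(\<Sum>n=1..N. r ^ n / real n * (cmod (mu_hat \<mu> (int n)))^2) \<le> (LINT p|(\<mu> \<Otimes>\<^sub>M \<mu>). log_r r p)"
    unfolding sums_unique[OF log_r_integral_sums[OF r]]
    using r by (intro sum_le_suminf sums_summable[OF log_r_integral_sums[OF r]]) auto
   also have "\<dots> \<le> (LINT p|(\<mu> \<Otimes>\<^sub>M \<mu>). log_r r p + ln 2)"
    using log_r_integrable[OF r] by (intro integral_mono) auto
   also have "\<dots> \<le> B" using bd[OF r] B0 unfolding BP by (simp add: ennreal_le_iff)
   finally show ?thesis .
  qed
  have "(\<lambda>k. \<Sum>n=1..N. (1 - inverse (real (Suc k))) ^ n / real n * (cmod (mu_hat \<mu> (int n)))^2) \<longlonglongrightarrow> (\<Sum>n=1..N. (1 - 0) ^ n / real n * (cmod (mu_hat \<mu> (int n)))^2)"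
   by (intro tendsto_intros LIMSEQ_inverse_real_of_nat) auto
  then have "(\<Sum>n=1..N. (1 - 0) ^ n / real n * (cmod (mu_hat \<mu> (int n)))^2) \<le> B"
  proof (rule LIMSEQ_le_const2)
   show "\<exists>K. \<forall>k\<ge>K. (\<Sum>n=1..N. (1 - inverse (real (Suc k))) ^ n / real n * (cmod (mu_hat \<mu> (int n)))^2) \<le> B"
    by (intro exI[of _ 0] allI impI step) (auto simp: inverse_le_1_iff)
  qed
  then show ?thesis by simp
 qed
 have "(\<Sum>n\<in>win N. (cmod (mu_hat \<mu> n))^2 / wt n) \<le> 1 + 2 * (\<Sum>n=1..N. (cmod (mu_hat \<mu> (int n)))^2 / real n)" for N
 proof (induction N)
  case 0 then show ?case by (simp add: mu_hat_0)
 next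
  case (Suc N)
  let ?a = "(cmod (mu_hat \<mu> (int (Suc N))))^2"
  have "?a / (1 + real (Suc N)) \<le> ?a / real (Suc N)" by (intro divide_left_mono) auto
  moreover have "(cmod (mu_hat \<mu> (- int (Suc N))))^2 = ?a" by (simp only: mu_hat_minus complex_mod_cnj)
  ultimately show ?case unfolding sum_int_Suc using Suc by (simp del: of_nat_Suc)
 qed
 then show ?thesis using fin by (intro that[of "1 + 2 * B"]) (smt (verit))
qed

text \<open>Cauchy--Schwarz for the pairing of the Fourier coefficients of \<open>\<mu>\<close> and \<open>h\<close>. The bound is uniform in the
kernel, hence survives the limit of the Poisson means.\<close>

lemma conv_mu_bound:
 assumes k: "is_kernel \<kappa> k" and h: "h \<in> HD" and \<kappa>: "\<And>n. \<bar>\<kappa> n\<bar> \<le> 1"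
  and C: "\<And>N. (\<Sum>n\<in>win N. (cmod (mu_hat \<mu> n))^2 / wt n) \<le> C"
 shows "cmod (LINT z|\<mu>. conv k h z) \<le> sqrt C * dnorm h" and "integrable \<mu> (conv k h)"
proof -
 have hi: "integrable ds h" by (rule L2_circle_integrable[OF harmonic_L2[OF h]])
 obtain e where e: "e \<longlonglongrightarrow> 0"
  "\<And>N z. z \<in> circle ==> cmod (conv k h z - trig_sum (\<lambda>n. of_real (\<kappa> n) * fc h n) N z) \<le> e N"
  using conv_limit[OF k hi] by blast
 let ?T = "trig_sum (\<lambda>n. of_real (\<kappa> n) * fc h n)"
 have iT: "integrable \<mu> (?T N)" for N by (rule integrable_mu_bounded[OF measurable_trig_sum trig_sum_bound])
 have cm: "conv k h \<in> borel_measurable borel" by (rule measurable_conv[OF k harmonic_measurable[OF h]])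
 have id: "integrable \<mu> (\<lambda>z. conv k h z - ?T N z)" for N
  by (rule integrable_mu_bounded[OF borel_measurable_diff[OF cm measurable_trig_sum] e(2)])
 from Bochner_Integration.integrable_add[OF id[of 0] iT[of 0]] show ci: "integrable \<mu> (conv k h)" by simp
 have T: "cmod (LINT z|\<mu>. ?T N z) \<le> sqrt C * dnorm h" for N
 proof -
  let ?I = "win N"
  let ?a = "\<lambda>n. sqrt (wt n) * cmod (fc h n)"
  let ?b = "\<lambda>n. cmod (mu_hat \<mu> n) / sqrt (wt n)"
  have ip: "integrable \<mu> (\<lambda>z. z powi n)" for n
   by (rule integrable_mu_bounded[where B=1]) (auto simp: circle_cmod_powi)
  have "(LINT z|\<mu>. ?T N z) = (\<Sum>n\<in>?I. of_real (\<kappa> n) * fc h n * mu_hat \<mu> n)"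
   unfolding trig_sum_def mu_hat_def using ip by (subst Bochner_Integration.integral_sum) auto
  also have "cmod \<dots> \<le> (\<Sum>n\<in>?I. ?a n * ?b n)"
  proof (rule sum_norm_le)
   fix n
   have "?a n * ?b n = 1 * (cmod (fc h n) * cmod (mu_hat \<mu> n))" by simp
   then show "cmod (of_real (\<kappa> n) * fc h n * mu_hat \<mu> n) \<le> ?a n * ?b n"
    using \<kappa>[of n] by (simp only: norm_mult norm_of_real mult.assoc) (intro mult_right_mono, auto)
  qed
  also have "\<dots> \<le> sqrt ((\<Sum>n\<in>?I. (?a n)^2) * (\<Sum>n\<in>?I. (?b n)^2))"
   by (intro real_le_rsqrt Cauchy_Schwarz_ineq_sum)
  also have "\<dots> = sqrt (\<Sum>n\<in>?I. (?a n)^2) * sqrt (\<Sum>n\<in>?I. (?b n)^2)" by (rule real_sqrt_mult)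
  also have "\<dots> \<le> dnorm h * sqrt C"
  proof (intro mult_mono)
   show "sqrt (\<Sum>n\<in>?I. (?a n)^2) \<le> dnorm h"
    using sum_dirichlet_le[OF h, of N] dirichlet_norm_nonneg by (intro real_le_lsqrt) (auto simp: power_mult_distrib sum_nonneg)
   show "sqrt (\<Sum>n\<in>?I. (?b n)^2) \<le> sqrt C" using C[of N] by (simp add: power_divide)
  qed (auto simp: dirichlet_norm_nonneg sum_nonneg)
  finally show ?thesis by (simp add: mult.commute)
 qed
 have le: "cmod (LINT z|\<mu>. conv k h z) \<le> e N + sqrt C * dnorm h" for N
 proof -
  have "(LINT z|\<mu>. conv k h z) = (LINT z|\<mu>. conv k h z - ?T N z) + (LINT z|\<mu>. ?T N z)"
   using ci iT[of N] by simp
  then have "cmod (LINT z|\<mu>. conv k h z) \<le> cmod (LINT z|\<mu>. conv k h z - ?T N z) + cmod (LINT z|\<mu>. ?T N z)"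
   by (metis norm_triangle_ineq)
  moreover have "cmod (LINT z|\<mu>. conv k h z - ?T N z) \<le> (LINT z|\<mu>. cmod (conv k h z - ?T N z))" by (rule integral_norm_bound)
  moreover have "(LINT z|\<mu>. cmod (conv k h z - ?T N z)) \<le> (LINT z|\<mu>. e N)"
  proof (rule integral_mono_AE)
   show "AE z in \<mu>. cmod (conv k h z - ?T N z) \<le> e N" using AE_mu by eventually_elim (rule e(2))
  qed (use id[of N] in auto)
  moreover have "(LINT z|\<mu>. e N) = e N" by (simp add: M.prob_space)
  ultimately show ?thesis using T[of N] by linarith
 qed
 have "(\<lambda>N. e N + sqrt C * dnorm h) \<longlonglongrightarrow> 0 + sqrt C * dnorm h" by (intro tendsto_intros e)
 then have "cmod (LINT z|\<mu>. conv k h z) \<le> 0 + sqrt C * dnorm h"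
  by (rule LIMSEQ_le_const) (auto intro: le)
 then show "cmod (LINT z|\<mu>. conv k h z) \<le> sqrt C * dnorm h" by simp
qed

end

section \<open>Measures of finite energy on the zero set\<close>

definition rad :: "nat \<Rightarrow> real" where "rad k = 1 - inverse (real (Suc k))"

lemma rad_bounds: "0 \<le> rad k" "rad k < 1"
 by (auto simp: rad_def inverse_le_1_iff)

lemma rad_tendsto: "rad \<longlonglongrightarrow> 1"
proof -
 have "(\<lambda>k. 1 - inverse (real (Suc k))) \<longlonglongrightarrow> 1 - 0" by (intro tendsto_intros LIMSEQ_inverse_real_of_nat)
 then show ?thesis by (simp add: rad_def[abs_def])
qed

abbreviation pker :: "nat \<Rightarrow> complex \<Rightarrow> real" where "pker k \<equiv> poisson_kernel (rad k)"

lemma pker_kernel: "is_kernel (\<lambda>n. rad k ^ nat \<bar>n\<bar>) (pker k)"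
 by (rule poisson_is_kernel[OF rad_bounds])

lemma zero_set_conv:
 assumes "z \<in> zero_set f" shows "(\<lambda>k. conv (pker k) f z) \<longlonglongrightarrow> 0"
proof -
 have z: "z \<in> circle" and lim: "((\<lambda>r. poisson_integral f (of_real r * z)) \<longlongrightarrow> 0) (at_left 1)"
  using assms by (auto simp: zero_set_def)
 have "filterlim rad (at_left 1) sequentially"
  unfolding filterlim_at using rad_tendsto by (auto simp: rad_bounds less_imp_neq)
 from filterlim_compose[OF lim this] show ?thesis by (simp add: poisson_integral_eq_conv[OF z])
qed

definition psd :: "nat \<Rightarrow> real" where "psd k = sqrt (2 * inverse (real (Suc k)))"

lemma psd_tendsto: "psd \<longlonglongrightarrow> 0"
proof -
 have "(\<lambda>k. sqrt (2 * inverse (real (Suc k)))) \<longlonglongrightarrow> sqrt (2 * 0)" by (intro tendsto_intros LIMSEQ_inverse_real_of_nat)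
 then show ?thesis by (simp add: psd_def[abs_def])
qed

lemma conv_pker_close:
 assumes "h \<in> meas" "z \<in> circle" "0 \<le> L"
  and "\<And>w. w \<in> circle ==> cmod (h w - h z) \<le> L * cmod (w - z)"
 shows "cmod (conv (pker k) h z - h z) \<le> L * psd k"
proof (rule conv_lipschitz_at[OF pker_kernel assms])
 show "2 - 2 * rad k ^ nat \<bar>1\<bar> \<le> (psd k)^2" by (simp add: rad_def psd_def)
 show "0 < psd k" by (simp add: psd_def)
qed

lemma conv_sum:
 assumes k: "is_kernel \<kappa> k" and h: "\<And>n. n < (N::nat) ==> integrable ds (h n)" and z: "z \<in> circle"
 shows "conv k (\<lambda>w. \<Sum>n<N. a n * h n w) z = (\<Sum>n<N. a n * conv k (h n) z)"
proof -
 have "(LINT \<xi>|ds. of_real (k (z * cnj \<xi>)) * (\<Sum>n<N. a n * h n \<xi>)) = (LINT \<xi>|ds. (\<Sum>n<N. a n * (of_real (k (z * cnj \<xi>)) * h n \<xi>)))"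
  by (intro Bochner_Integration.integral_cong refl) (simp add: sum_distrib_left mult_ac)
 also have "\<dots> = (\<Sum>n<N. a n * (LINT \<xi>|ds. of_real (k (z * cnj \<xi>)) * h n \<xi>))"
  by (subst Bochner_Integration.integral_sum) (auto intro!: integrable_mult_right integrable_conv[OF k h z])
 finally show ?thesis by (simp add: conv_def sum_divide_distrib)
qed

lemma DN_cmod_le:
 "DN (\<lambda>z. complex_of_real (cmod (h z))) \<le> DN h"
proof -
 have "cmod (complex_of_real (cmod x) - complex_of_real (cmod y)) \<le> cmod (x - y)" for x y
  by (metis norm_of_real of_real_diff norm_triangle_ineq3)
 then have "dirE (\<lambda>z. complex_of_real (cmod (h z))) \<le> dirE h" by (intro dirE_contraction) auto
 then show ?thesis unfolding DN_def by (intro add_mono) (simp_all add: L2sq_def)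
qed

lemma cmod_harmonic:
 assumes h: "h \<in> HD" shows "(\<lambda>z. complex_of_real (cmod (h z))) \<in> HD"
proof -
 have [measurable]: "h \<in> meas" by (rule harmonic_measurable[OF h])
 have "(\<lambda>z. complex_of_real (cmod (h z))) \<in> meas" by measurable
 then show ?thesis using h DN_cmod_le[of h] by (auto simp: harmonic_dirichlet_iff intro: le_less_trans)
qed

text \<open>For a measure of finite energy on the zero set the limit of the integrals of the Poisson
 means is a functional that is bounded on the space. It annihilates \<open>\<zeta>\<^sup>n f^2\<close>: the Poisson mean of
 the square is replaced by the square of the Poisson mean, with an error controlled by the
 energy of \<open>\<bar>f - s\<bar>\<close> for a Fejer mean \<open>s\<close> of \<open>f\<close>.\<close>

lemma annihilates:
 assumes \<mu>: "\<mu> \<in> prob_on (zero_set f)" and f: "f \<in> HD"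
  and M: "\<And>z. z \<in> circle ==> cmod (f z) \<le> M"
  and C: "\<And>N. (\<Sum>n\<in>win N. (cmod (mu_hat \<mu> n))^2 / wt n) \<le> C"
 shows "(\<lambda>k. LINT z|\<mu>. conv (pker k) (\<lambda>w. w ^ m * (f w)^2) z) \<longlonglongrightarrow> 0"
proof -
 have zc: "zero_set f \<subseteq> circle" by (auto simp: zero_set_def)
 have cp: "circle_prob \<mu>" by (rule prob_on_circle[OF \<mu> zc])
 interpret Mu: prob_space \<mu> by (rule prob_mu[OF cp])
 note [measurable_cong] = sets_mu[OF cp]
 have fm[measurable]: "f \<in> meas" by (rule harmonic_measurable[OF f])
 have fi: "integrable ds f" by (rule integrable_arc_bounded[OF fm M])
 have M0: "0 \<le> M" using order_trans[OF norm_ge_zero M[of 1]] by simp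
 have C0: "0 \<le> C" using order_trans[OF sum_nonneg C[of 0]] by simp
 have pm: "(\<lambda>w. w ^ m) \<in> meas" by (rule borel_measurable_arc_length) measurable
 note [measurable] = pm
 let ?q = "\<lambda>w. w ^ m * (f w)^2"
 have qm: "?q \<in> meas" by measurable
 have qb: "cmod (?q w) \<le> M^2" if "w \<in> circle" for w
  using power_mono[OF M[OF that], of 2] that by (simp add: norm_mult norm_power)
 have qi: "integrable ds ?q" by (rule integrable_arc_bounded[OF qm qb])
 have ae: "AE z in \<mu>. z \<in> zero_set f"
  using prob_on_AE[OF \<mu>] by (metis (mono_tags, lifting) eventually_mono subsetD)
 have cfm: "conv (pker k) f \<in> borel_measurable borel" for k by (rule measurable_conv[OF pker_kernel fm])
 have cfm': "conv (pker k) f \<in> borel_measurable \<mu>" for k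
  by (subst measurable_cong_sets[OF sets_mu[OF cp] refl]) (rule cfm)
 have sq0: "(\<lambda>k. LINT z|\<mu>. (cmod (conv (pker k) f z))^2) \<longlonglongrightarrow> 0"
 proof -
  have "(\<lambda>k. LINT z|\<mu>. (cmod (conv (pker k) f z))^2) \<longlonglongrightarrow> (LINT z|\<mu>. 0)"
  proof (rule integral_dominated_convergence[where w="\<lambda>_. M^2"])
   show "AE z in \<mu>. (\<lambda>k. (cmod (conv (pker k) f z))^2) \<longlonglongrightarrow> 0"
    using ae
   proof eventually_elim
    case (elim z)
    have "(\<lambda>k. (cmod (conv (pker k) f z))^2) \<longlonglongrightarrow> (cmod 0)^2" by (intro tendsto_intros zero_set_conv elim)
    then show ?case by simp
   qed
   show "AE z in \<mu>. norm ((cmod (conv (pker k) f z))^2) \<le> M^2" for k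
    using AE_mu[OF cp] by eventually_elim (auto intro!: power_mono conv_bound[OF pker_kernel fm _ M])
  qed (use cfm' in \<open>auto\<close>)
  then show ?thesis by simp
 qed
 show ?thesis
 proof (rule LIMSEQ_I)
  fix \<epsilon> :: real assume \<epsilon>: "0 < \<epsilon>"
  define \<delta> where "\<delta> = \<epsilon> / (2 * (4 * M * sqrt C + 1))"
  have den: "0 < 4 * M * sqrt C + 1" using M0 C0 by (intro add_nonneg_pos mult_nonneg_nonneg) auto
  have \<delta>: "0 < \<delta>" using \<epsilon> den by (simp add: \<delta>_def)
  have "\<exists>N. DN (\<lambda>z. f z - fejer_mean N f z) < ennreal (\<delta>^2)"
   using \<delta> by (intro tendsto_zero_ennreal_ex[OF fejer_mean_tendsto[OF f]]) simp
  then obtain N where N: "DN (\<lambda>z. f z - fejer_mean N f z) < ennreal (\<delta>^2)" by blast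
  define s where "s = fejer_mean N f"
  define h where "h z = cmod (f z - s z)" for z
  have sh: "s \<in> HD" unfolding s_def by (rule fejer_mean_harmonic)
  have sm[measurable]: "s \<in> meas" by (rule harmonic_measurable[OF sh])
  have sM: "cmod (s z) \<le> M" if "z \<in> circle" for z unfolding s_def by (rule fejer_mean_bound[OF fm M that])
  have si: "integrable ds s" by (rule integrable_arc_bounded[OF sm sM])
  obtain L0 where L0: "\<And>x y. x \<in> circle ==> y \<in> circle ==> cmod (s x - s y) \<le> L0 * cmod (x - y)"
   using trig_sum_lipschitz unfolding s_def fejer_mean_def by blast
  define L where "L = \<bar>L0\<bar>"
  have L: "cmod (s x - s y) \<le> L * cmod (x - y)" if "x \<in> circle" "y \<in> circle" for x y
   using L0[OF that] abs_ge_self[of L0] unfolding L_def by (meson mult_right_mono norm_ge_zero order_trans)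
  have Lp: "0 \<le> L" by (simp add: L_def)
  let ?t = "\<lambda>w. w ^ m * (s w)^2"
  define L' where "L' = M^2 * real m + 2 * M * L"
  have L'p: "0 \<le> L'" using M0 Lp by (simp add: L'_def)
  have tl: "cmod (?t x - ?t y) \<le> L' * cmod (x - y)" if xy: "x \<in> circle" "y \<in> circle" for x y
  proof -
   have a: "cmod ((s x)^2) \<le> M^2" using power_mono[OF sM[OF xy(1)], of 2] by (simp add: norm_power)
   have b: "cmod (x ^ m - y ^ m) \<le> real m * cmod (x - y)" using norm_power_diff[of x y m] xy by simp
   have c: "cmod ((s x)^2 - (s y)^2) \<le> 2 * M * (L * cmod (x - y))"
   proof -
    have "cmod (s x + s y) \<le> M + M" using norm_triangle_ineq[of "s x" "s y"] sM[OF xy(1)] sM[OF xy(2)] by linarith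
    then have "cmod (s x + s y) * cmod (s x - s y) \<le> (2 * M) * (L * cmod (x - y))"
     using L[OF xy] M0 by (intro mult_mono) auto
    moreover have "(s x)^2 - (s y)^2 = (s x + s y) * (s x - s y)" by (simp add: power2_eq_square algebra_simps)
    ultimately show ?thesis by (simp add: norm_mult)
   qed
   have "cmod (?t x - ?t y) \<le> M^2 * cmod (x ^ m - y ^ m) + 1 * cmod ((s x)^2 - (s y)^2)"
    using xy by (intro cmod_mult_diff_le a) (simp add: norm_power)
   also have "\<dots> \<le> M^2 * (real m * cmod (x - y)) + 1 * (2 * M * (L * cmod (x - y)))"
    using b c by (intro add_mono mult_left_mono) auto
   finally show ?thesis by (simp add: L'_def algebra_simps)
  qed
  have tm: "?t \<in> meas" by measurable
  have ti: "integrable ds ?t" by (rule integrable_arc_bounded[OF tm lipschitz_circle_bounded[OF tl]])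
  have hh: "(\<lambda>z. complex_of_real (h z)) \<in> HD"
   unfolding h_def by (intro cmod_harmonic harmonic_diff f sh)
  have hc: "(\<lambda>z. complex_of_real (2 * M * h z)) \<in> HD"
   using harmonic_cmult[OF hh, of "of_real (2 * M)"] by simp
  have hn: "dnorm (\<lambda>z. complex_of_real (h z)) \<le> \<delta>"
  proof -
   have "ennreal ((dnorm (\<lambda>z. complex_of_real (h z)))^2) \<le> DN (\<lambda>z. f z - s z)"
    using dirichlet_norm_le_DN[OF hh] DN_cmod_le[of "\<lambda>z. f z - s z"] unfolding h_def by (rule order_trans)
   also have "\<dots> \<le> ennreal (\<delta>^2)" using N unfolding s_def by simp
   finally have "(dnorm (\<lambda>z. complex_of_real (h z)))^2 \<le> \<delta>^2" by (simp add: ennreal_le_iff)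
   then show ?thesis by (rule power2_le_imp_le[OF _ less_imp_le[OF \<delta>]])
  qed
  have hint: "integrable ds h"
   using integrable_Re[OF L2_circle_integrable[OF harmonic_L2[OF hh]]] by simp
  have pt: "cmod (conv (pker k) ?q z) \<le> 4 * M * Re (conv (pker k) (\<lambda>w. complex_of_real (h w)) z) + (L' + 2 * M * L) * psd k + (cmod (conv (pker k) f z))^2"
   if z: "z \<in> circle" for z k
  proof -
   let ?c = "\<lambda>u. conv (pker k) u z"
   let ?H = "Re (?c (\<lambda>w. complex_of_real (h w)))"
   have 1: "cmod (?c ?q - ?c ?t) \<le> 2 * M * ?H"
   proof -
    have "?c ?q - ?c ?t = ?c (\<lambda>w. ?q w - ?t w)" by (rule conv_diff[OF pker_kernel qi ti z, symmetric])
    also have "cmod \<dots> \<le> Re (?c (\<lambda>w. complex_of_real (2 * M * h w)))"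
    proof (rule conv_abs_le[OF pker_kernel Bochner_Integration.integrable_diff[OF qi ti] z])
     show "integrable ds (\<lambda>w. 2 * M * h w)" using hint by simp
     fix w assume w: "w \<in> circle"
     have "cmod (f w + s w) \<le> 2 * M" using norm_triangle_ineq[of "f w" "s w"] sM[OF w] M[OF w] by linarith
     moreover have "?q w - ?t w = w ^ m * ((f w + s w) * (f w - s w))" by (simp add: power2_eq_square algebra_simps)
     ultimately show "cmod (?q w - ?t w) \<le> 2 * M * h w"
      using w by (simp add: norm_mult norm_power h_def mult_right_mono)
    qed
    also have "?c (\<lambda>w. complex_of_real (2 * M * h w)) = of_real (2 * M) * ?c (\<lambda>w. complex_of_real (h w))"
     by (simp add: conv_def mult.left_commute[of _ "complex_of_real (2*M)"] del: of_real_mult) (simp add: mult_ac)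
    finally show ?thesis by (simp only: times_complex.sel complex.sel Re_complex_of_real Im_complex_of_real mult_zero_left diff_zero)
   qed
   have 2: "cmod (?c ?t - ?t z) \<le> L' * psd k" by (rule conv_pker_close[OF tm z L'p tl[OF _ z]])
   have 3: "cmod (?c s - s z) \<le> L * psd k" by (rule conv_pker_close[OF sm z Lp L[OF _ z]])
   have 4: "cmod (?c f - ?c s) \<le> ?H"
    unfolding conv_diff[OF pker_kernel fi si z, symmetric]
    by (rule conv_abs_le[OF pker_kernel Bochner_Integration.integrable_diff[OF fi si] z hint]) (simp add: h_def)
   have bs: "cmod (?c s) \<le> M" by (rule conv_bound[OF pker_kernel sm z sM])
   have bf: "cmod (?c f) \<le> M" by (rule conv_bound[OF pker_kernel fm z M])
   have sqd: "cmod (a^2 - b^2) \<le> 2 * M * cmod (a - b)" if "cmod a \<le> M" "cmod b \<le> M" for a b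
   proof -
    have "cmod (a + b) \<le> 2 * M" using norm_triangle_ineq[of a b] that by linarith
    moreover have "a^2 - b^2 = (a + b) * (a - b)" by (simp add: power2_eq_square algebra_simps)
    ultimately show ?thesis by (simp add: norm_mult mult_right_mono)
   qed
   have "?c ?q = (?c ?q - ?c ?t) + (?c ?t - ?t z) + z ^ m * ((s z)^2 - (?c s)^2) + z ^ m * ((?c s)^2 - (?c f)^2) + z ^ m * (?c f)^2"
    by (simp add: algebra_simps)
   then have "cmod (?c ?q) \<le> cmod (?c ?q - ?c ?t) + cmod (?c ?t - ?t z) + cmod (z ^ m * ((s z)^2 - (?c s)^2)) + cmod (z ^ m * ((?c s)^2 - (?c f)^2)) + cmod (z ^ m * (?c f)^2)"
    by (smt (verit) norm_triangle_ineq)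
   also have "cmod (z ^ m * ((s z)^2 - (?c s)^2)) \<le> 2 * M * (L * psd k)"
   proof -
    have "cmod (z ^ m * ((s z)^2 - (?c s)^2)) \<le> 2 * M * cmod (s z - ?c s)" using z sqd[OF sM[OF z] bs] by (simp add: norm_mult norm_power)
    also have "\<dots> \<le> 2 * M * (L * psd k)" using 3 M0 by (intro mult_left_mono) (auto simp: norm_minus_commute)
    finally show ?thesis .
   qed
   also have "cmod (z ^ m * ((?c s)^2 - (?c f)^2)) \<le> 2 * M * ?H"
   proof -
    have "cmod (z ^ m * ((?c s)^2 - (?c f)^2)) \<le> 2 * M * cmod (?c s - ?c f)" using z sqd[OF bs bf] by (simp add: norm_mult norm_power)
    also have "\<dots> \<le> 2 * M * ?H" using 4 M0 by (intro mult_left_mono) (auto simp: norm_minus_commute)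
    finally show ?thesis .
   qed
   also have "cmod (z ^ m * (?c f)^2) = (cmod (?c f))^2" using z by (simp add: norm_mult norm_power)
   finally show ?thesis using 1 2 by (simp add: algebra_simps)
  qed
  have kb: "\<bar>rad k ^ nat \<bar>n\<bar>\<bar> \<le> 1" for k n using rad_bounds[of k] by (simp add: power_le_one)
  note J = conv_mu_bound[OF cp pker_kernel hh kb C]
  have iH: "integrable \<mu> (\<lambda>z. Re (conv (pker k) (\<lambda>w. complex_of_real (h w)) z))" for k by (rule integrable_Re[OF J(2)])
  have iF: "integrable \<mu> (\<lambda>z. (cmod (conv (pker k) f z))^2)" for k
  proof (rule Mu.integrable_const_bound[where B="M^2"])
   show "AE z in \<mu>. norm ((cmod (conv (pker k) f z))^2) \<le> M^2"
    using AE_mu[OF cp] by eventually_elim (auto intro!: power_mono conv_bound[OF pker_kernel fm _ M])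
  qed (use cfm' in simp)
  have est: "cmod (LINT z|\<mu>. conv (pker k) ?q z) \<le> 4 * M * (sqrt C * \<delta>) + (L' + 2 * M * L) * psd k + (LINT z|\<mu>. (cmod (conv (pker k) f z))^2)" for k
  proof -
   have "cmod (LINT z|\<mu>. conv (pker k) ?q z) \<le> (LINT z|\<mu>. cmod (conv (pker k) ?q z))" by (rule integral_norm_bound)
   also have "\<dots> \<le> (LINT z|\<mu>. 4 * M * Re (conv (pker k) (\<lambda>w. complex_of_real (h w)) z) + (L' + 2 * M * L) * psd k + (cmod (conv (pker k) f z))^2)"
   proof (rule integral_mono_AE)
    show "AE z in \<mu>. cmod (conv (pker k) ?q z) \<le> 4 * M * Re (conv (pker k) (\<lambda>w. complex_of_real (h w)) z) + (L' + 2 * M * L) * psd k + (cmod (conv (pker k) f z))^2"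
     using AE_mu[OF cp] by eventually_elim (rule pt)
    show "integrable \<mu> (\<lambda>z. cmod (conv (pker k) ?q z))"
     by (intro integrable_norm integrable_mu_bounded[OF cp measurable_conv[OF pker_kernel qm] conv_bound[OF pker_kernel qm _ qb]])
    show "integrable \<mu> (\<lambda>z. 4 * M * Re (conv (pker k) (\<lambda>w. complex_of_real (h w)) z) + (L' + 2 * M * L) * psd k + (cmod (conv (pker k) f z))^2)"
     by (intro Bochner_Integration.integrable_add integrable_mult_right iH iF Mu.integrable_const)
   qed
   also have "\<dots> = 4 * M * Re (LINT z|\<mu>. conv (pker k) (\<lambda>w. complex_of_real (h w)) z) + (L' + 2 * M * L) * psd k + (LINT z|\<mu>. (cmod (conv (pker k) f z))^2)"
    unfolding integral_Re[OF J(2), symmetric]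
    using iH[of k] iF[of k] by (simp add: Mu.prob_space)
   also have "Re (LINT z|\<mu>. conv (pker k) (\<lambda>w. complex_of_real (h w)) z) \<le> sqrt C * \<delta>"
    using order_trans[OF complex_Re_le_cmod J(1)] mult_left_mono[OF hn, of "sqrt C"] C0 by (meson order_trans real_sqrt_ge_zero)
   finally show ?thesis using M0 by (simp add: mult_left_mono)
  qed
  have "(\<lambda>k. (L' + 2 * M * L) * psd k + (LINT z|\<mu>. (cmod (conv (pker k) f z))^2)) \<longlonglongrightarrow> (L' + 2 * M * L) * 0 + 0"
   by (intro tendsto_intros psd_tendsto sq0)
  then have "\<forall>\<^sub>F k in sequentially. (L' + 2 * M * L) * psd k + (LINT z|\<mu>. (cmod (conv (pker k) f z))^2) < \<epsilon> / 2"
   using \<epsilon> by (intro order_tendstoD(2)) auto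
  then obtain K where K: "\<And>k. k \<ge> K ==> (L' + 2 * M * L) * psd k + (LINT z|\<mu>. (cmod (conv (pker k) f z))^2) < \<epsilon> / 2"
   by (auto simp: eventually_sequentially)
  have d2: "4 * M * (sqrt C * \<delta>) \<le> \<epsilon> / 2"
  proof -
   have "4 * M * (sqrt C * \<delta>) \<le> (4 * M * sqrt C + 1) * \<delta>" using \<delta> by (simp add: algebra_simps)
   also have "\<dots> = \<epsilon> / 2"
   proof -
    have "D * (\<epsilon> / (2 * D)) = \<epsilon> / 2" if "0 < D" for D :: real using that by simp
    from this[OF den] show ?thesis unfolding \<delta>_def .
   qed
   finally show ?thesis .
  qed
  show "\<exists>K. \<forall>k\<ge>K. norm ((LINT z|\<mu>. conv (pker k) ?q z) - 0) < \<epsilon>"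
  proof (intro exI allI impI)
   fix k assume "K \<le> k"
   from K[OF this] est[of k] d2 show "norm ((LINT z|\<mu>. conv (pker k) ?q z) - 0) < \<epsilon>" by simp
  qed
 qed
qed

text \<open>The functional in the limit is \<open>1\<close> at the constant function and \<open>0\<close> on the span of the shifts.\<close>

theorem cyclic_imp_infinite_energy:
 assumes f: "f \<in> HD" and M: "\<And>z. z \<in> circle ==> cmod (f z) \<le> M"
  and cyc: "cyclic_dirichlet (\<lambda>z. (f z)^2)" and \<mu>: "\<mu> \<in> prob_on (zero_set f)"
 shows "log_energy \<mu> = \<infinity>"
proof (rule ccontr)
 assume "log_energy \<mu> \<noteq> \<infinity>"
 then have "log_energy \<mu> < \<infinity>" by simp
 have cp: "circle_prob \<mu>" by (rule prob_on_circle[OF \<mu>]) (auto simp: zero_set_def)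
 interpret Mu: prob_space \<mu> by (rule prob_mu[OF cp])
 obtain C where C: "\<And>N. (\<Sum>n\<in>win N. (cmod (mu_hat \<mu> n))^2 / wt n) \<le> C"
  using finite_energy_imp_bounded_sums[OF cp \<open>log_energy \<mu> < \<infinity>\<close>] by metis
 have C1: "1 \<le> C" using C[of 0] by (simp add: mu_hat_0[OF cp])
 let ?g = "\<lambda>z. (f z)^2"
 have g: "?g \<in> HD" using cyc by (simp add: cyclic_dirichlet_def)
 have gM: "cmod (?g z) \<le> M^2" if "z \<in> circle" for z
  using power_mono[OF M[OF that], of 2] by (simp add: norm_power)
 have fm: "f \<in> meas" by (rule harmonic_measurable[OF f])
 have one: "(\<lambda>_. 1) \<in> HD" by (rule lipschitz_harmonic[where L=0]) simp
 define \<epsilon> where "\<epsilon> = 1 / (2 * sqrt C)"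
 have "\<epsilon> > 0" using C1 by (simp add: \<epsilon>_def)
 have "(\<lambda>_. 1) \<in> shift_closure ?g" using cyc one by (simp add: cyclic_dirichlet_def)
 then obtain p where p: "p \<in> shift_span ?g" "dnorm (\<lambda>z. 1 - p z) < \<epsilon>" using \<open>\<epsilon> > 0\<close> by (auto simp: shift_closure_def)
 obtain N a where pe: "p = (\<lambda>z. \<Sum>n<N. a n * (z ^ n * ?g z))" using p(1) by (auto simp: shift_span_def)
 have ph: "p \<in> HD" by (rule shift_span_harmonic[OF g gM p(1)])
 have dh: "(\<lambda>z. 1 - p z) \<in> HD" by (rule harmonic_diff[OF one ph])
 have kb: "\<bar>rad k ^ nat \<bar>n\<bar>\<bar> \<le> 1" for k n using rad_bounds[of k] by (simp add: power_le_one)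
 have qm: "(\<lambda>w. w ^ n * (f w)^2) \<in> meas" for n
 proof -
  have "(\<lambda>w. w ^ n) \<in> meas" by (rule borel_measurable_arc_length) measurable
  then show ?thesis using fm by measurable
 qed
 have qb: "cmod (w ^ n * (f w)^2) \<le> M^2" if "w \<in> circle" for w n
  using gM[OF that] that by (simp add: norm_mult norm_power)
 have qi: "integrable ds (\<lambda>w. w ^ n * (f w)^2)" for n by (rule integrable_arc_bounded[OF qm qb])
 have qmu: "integrable \<mu> (conv (pker k) (\<lambda>w. w ^ n * (f w)^2))" for k n
  by (rule integrable_mu_bounded[OF cp measurable_conv[OF pker_kernel qm] conv_bound[OF pker_kernel qm _ qb]])
 have pi: "integrable ds p" by (rule L2_circle_integrable[OF harmonic_L2[OF ph]])
 have pk: "(LINT z|\<mu>. conv (pker k) p z) = (\<Sum>n<N. a n * (LINT z|\<mu>. conv (pker k) (\<lambda>w. w ^ n * (f w)^2) z))" for k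
 proof -
  have "(LINT z|\<mu>. conv (pker k) p z) = (LINT z|\<mu>. (\<Sum>n<N. a n * conv (pker k) (\<lambda>w. w ^ n * (f w)^2) z))"
  proof (rule integral_cong_AE)
   show "AE z in \<mu>. conv (pker k) p z = (\<Sum>n<N. a n * conv (pker k) (\<lambda>w. w ^ n * (f w)^2) z)"
    using AE_mu[OF cp] by eventually_elim (simp add: pe conv_sum[OF pker_kernel qi])
   show "conv (pker k) p \<in> borel_measurable \<mu>" "(\<lambda>z. \<Sum>n<N. a n * conv (pker k) (\<lambda>w. w ^ n * (f w)^2) z) \<in> borel_measurable \<mu>"
    using qmu conv_mu_bound(2)[OF cp pker_kernel ph kb C] by auto
  qed
  also have "\<dots> = (\<Sum>n<N. a n * (LINT z|\<mu>. conv (pker k) (\<lambda>w. w ^ n * (f w)^2) z))"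
   using qmu by (subst Bochner_Integration.integral_sum) auto
  finally show ?thesis .
 qed
 have "(\<lambda>k. LINT z|\<mu>. conv (pker k) p z) \<longlonglongrightarrow> (\<Sum>n<N. a n * 0)"
  unfolding pk by (intro tendsto_intros annihilates[OF \<mu> f M C])
 then have "(\<lambda>k. cmod (LINT z|\<mu>. conv (pker k) p z)) \<longlonglongrightarrow> cmod (\<Sum>n<N. a n * 0)" by (rule tendsto_norm)
 then have lim: "(\<lambda>k. 1 / 2 + cmod (LINT z|\<mu>. conv (pker k) p z)) \<longlonglongrightarrow> 1 / 2 + 0" by (intro tendsto_intros) simp
 have "1 \<le> 1 / 2 + cmod (LINT z|\<mu>. conv (pker k) p z)" for k
 proof -
  have i1: "integrable \<mu> (conv (pker k) (\<lambda>z. 1 - p z))" by (rule conv_mu_bound(2)[OF cp pker_kernel dh kb C])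
  have i2: "integrable \<mu> (conv (pker k) p)" by (rule conv_mu_bound(2)[OF cp pker_kernel ph kb C])
  have "(LINT z|\<mu>. conv (pker k) (\<lambda>z. 1 - p z) z) + (LINT z|\<mu>. conv (pker k) p z) = (LINT z|\<mu>. conv (pker k) (\<lambda>z. 1 - p z) z + conv (pker k) p z)"
   by (rule Bochner_Integration.integral_add[OF i1 i2, symmetric])
  also have "\<dots> = (LINT z|\<mu>. 1)"
  proof (rule integral_cong_AE)
   show "AE z in \<mu>. conv (pker k) (\<lambda>z. 1 - p z) z + conv (pker k) p z = 1"
    using AE_mu[OF cp]
    by eventually_elim (simp add: conv_diff[OF pker_kernel arc.integrable_const pi] conv_const[OF pker_kernel])
  qed (use i1 i2 in auto)
  also have "\<dots> = 1" by (simp add: Mu.prob_space)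
  finally have "1 = cmod ((LINT z|\<mu>. conv (pker k) (\<lambda>z. 1 - p z) z) + (LINT z|\<mu>. conv (pker k) p z))" by simp
  also have "\<dots> \<le> cmod (LINT z|\<mu>. conv (pker k) (\<lambda>z. 1 - p z) z) + cmod (LINT z|\<mu>. conv (pker k) p z)" by (rule norm_triangle_ineq)
  also have "cmod (LINT z|\<mu>. conv (pker k) (\<lambda>z. 1 - p z) z) \<le> sqrt C * dnorm (\<lambda>z. 1 - p z)"
   by (rule conv_mu_bound(1)[OF cp pker_kernel dh kb C])
  also have "\<dots> \<le> sqrt C * \<epsilon>" using p(2) C1 by (intro mult_left_mono) auto
  also have "\<dots> = 1 / 2" using C1 by (simp add: \<epsilon>_def)
  finally show ?thesis by simp
 qed
 with LIMSEQ_le_const[OF lim, of 1] show False by auto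
qed

section \<open>The closed span of the shifts of a bounded function\<close>

lemma DN_cong: "(\<And>z. z \<in> circle ==> h z = k z) ==> DN h = DN k"
 unfolding DN_def L2sq_def dirE_def
 by (intro arg_cong2[of _ _ _ _ "(+)"] nn_integral_cong) (auto simp: space_pair_measure)

definition bounded_dirichlet :: "(complex \<Rightarrow> complex) \<Rightarrow> bool" where
 "bounded_dirichlet h \<longleftrightarrow> h \<in> HD \<and> (\<exists>B. \<forall>z\<in>circle. cmod (h z) \<le> B)"

lemma bounded_dirichletE:
 assumes "bounded_dirichlet h"
 obtains B where "h \<in> HD" "h \<in> meas" "\<And>z. z \<in> circle ==> cmod (h z) \<le> B" "0 \<le> B"
proof -
 obtain B where "h \<in> HD" and B: "\<forall>z\<in>circle. cmod (h z) \<le> B" using assms by (auto simp: bounded_dirichlet_def)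
 moreover have "0 \<le> B" using order_trans[OF norm_ge_zero, of "h 1" B] B by simp
 ultimately show ?thesis using harmonic_measurable by (intro that[of B]) auto
qed

lemma bounded_dirichlet_mult:
 assumes "bounded_dirichlet h" "bounded_dirichlet k" shows "bounded_dirichlet (\<lambda>z. h z * k z)"
proof -
 obtain B where B: "h \<in> HD" "\<And>z. z \<in> circle ==> cmod (h z) \<le> B" "0 \<le> B" using bounded_dirichletE[OF assms(1)] by metis
 obtain C where C: "k \<in> HD" "\<And>z. z \<in> circle ==> cmod (k z) \<le> C" "0 \<le> C" using bounded_dirichletE[OF assms(2)] by metis
 have "(\<lambda>z. h z * k z) \<in> HD" by (rule harmonic_mult[OF B(1) C(1) B(2) C(2)])
 moreover have "cmod (h z * k z) \<le> B * C" if "z \<in> circle" for z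
  unfolding norm_mult using B C that by (intro mult_mono) auto
 ultimately show ?thesis unfolding bounded_dirichlet_def by blast
qed

lemma bounded_dirichlet_lipschitz:
 assumes "\<And>x y. x \<in> circle ==> y \<in> circle ==> cmod (u x - u y) \<le> L * cmod (x - y)"
 shows "bounded_dirichlet u"
 unfolding bounded_dirichlet_def using lipschitz_harmonic[OF assms] lipschitz_circle_bounded[OF assms] by blast

text \<open>Membership in the closure of the span, with the equivalent norm.\<close>

definition approximable :: "(complex \<Rightarrow> complex) \<Rightarrow> (complex \<Rightarrow> complex) \<Rightarrow> bool" where
 "approximable q h \<longleftrightarrow> h \<in> HD \<and> (\<forall>\<epsilon>>0. \<exists>p\<in>shift_span q. DN (\<lambda>z. h z - p z) < ennreal \<epsilon>)"

context
 fixes q :: "complex \<Rightarrow> complex"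
 assumes q: "bounded_dirichlet q"
begin

lemma span_harmonic: "p \<in> shift_span q ==> p \<in> HD"
 using q shift_span_harmonic unfolding bounded_dirichlet_def by blast

lemma span_poly: "(\<lambda>z. (\<Sum>n<N. a n * z ^ n) * q z) \<in> shift_span q"
 unfolding shift_span_def by (auto simp: sum_distrib_right mult.assoc)

lemma approximable_in_closure:
 assumes "approximable q h" shows "h \<in> shift_closure q"
 unfolding shift_closure_def
proof (intro CollectI conjI allI impI)
 show h: "h \<in> HD" using assms by (simp add: approximable_def)
 fix \<epsilon> :: real assume \<epsilon>: "0 < \<epsilon>"
 then obtain p where p: "p \<in> shift_span q" "DN (\<lambda>z. h z - p z) < ennreal (\<epsilon>^2)"
  using assms unfolding approximable_def by (meson zero_less_power)
 have "ennreal ((dnorm (\<lambda>z. h z - p z))^2) < ennreal (\<epsilon>^2)"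
  using dirichlet_norm_le_DN[OF harmonic_diff[OF h span_harmonic[OF p(1)]]] p(2) by (rule le_less_trans)
 then have "dnorm (\<lambda>z. h z - p z) < \<epsilon>"
  using \<epsilon> by (simp add: ennreal_less_iff power_less_imp_less_base)
 then show "\<exists>p\<in>shift_span q. dnorm (\<lambda>z. h z - p z) < \<epsilon>" using p(1) by blast
qed

lemma approximable_harmonic: "approximable q h ==> h \<in> HD"
 by (simp add: approximable_def)

lemma approximable_closed:
 assumes h: "h \<in> HD"
  and a: "\<And>\<epsilon>. \<epsilon> > 0 ==> \<exists>k. approximable q k \<and> DN (\<lambda>z. h z - k z) < ennreal \<epsilon>"
 shows "approximable q h"
 unfolding approximable_def
proof (intro conjI h allI impI)
 fix \<epsilon> :: real assume e: "\<epsilon> > 0"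
 then have e4: "\<epsilon>/4 > 0" by simp
 obtain k where k: "approximable q k" "DN (\<lambda>z. h z - k z) < ennreal (\<epsilon>/4)" using a[OF e4] by blast
 then obtain p where p: "p \<in> shift_span q" "DN (\<lambda>z. k z - p z) < ennreal (\<epsilon>/4)" using e4 unfolding approximable_def by blast
 have "DN (\<lambda>z. h z - p z) = DN (\<lambda>z. (h z - k z) + (k z - p z))" by simp
 also have "\<dots> \<le> 2 * DN (\<lambda>z. h z - k z) + 2 * DN (\<lambda>z. k z - p z)"
  by (intro DN_add_le harmonic_measurable harmonic_diff h approximable_harmonic[OF k(1)] span_harmonic p(1))
 also have "\<dots> < 2 * ennreal (\<epsilon>/4) + 2 * ennreal (\<epsilon>/4)"
  using k(2) p(2) by (intro add_strict_mono ennreal_mult_strict_left_mono) auto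
 also have "\<dots> = ennreal \<epsilon>" by (rule ennreal_quarters[OF e])
 finally show "\<exists>p\<in>shift_span q. DN (\<lambda>z. h z - p z) < ennreal \<epsilon>" using p(1) by blast
qed

lemma approximable_limit:
 assumes h: "h \<in> HD" and k: "\<And>n::nat. approximable q (k n)"
  and lim: "(\<lambda>n. DN (\<lambda>z. h z - k n z)) \<longlonglongrightarrow> 0"
 shows "approximable q h"
proof (rule approximable_closed[OF h])
 fix \<epsilon> :: real assume "\<epsilon> > 0"
 then obtain n where "DN (\<lambda>z. h z - k n z) < ennreal \<epsilon>" using tendsto_zero_ennreal_ex[OF lim, of "ennreal \<epsilon>"] by auto
 then show "\<exists>k. approximable q k \<and> DN (\<lambda>z. h z - k z) < ennreal \<epsilon>" using k by blast
qed

lemma approximable_span: "p \<in> shift_span q ==> approximable q p"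
proof -
 assume p: "p \<in> shift_span q"
 have "DN (\<lambda>z. p z - p z) = 0" by (simp add: DN_def L2sq_def dirE_def)
 then show ?thesis using p span_harmonic[OF p] unfolding approximable_def by (auto intro!: bexI[of _ p])
qed

lemma approximable_cong_AE:
 assumes h: "approximable q h" and ae: "AE z in ds. h z = k z"
 shows "approximable q k"
proof -
 have hm: "h \<in> HD" by (rule approximable_harmonic[OF h])
 have "DN (\<lambda>z. k z - p z) = DN (\<lambda>z. h z - p z)" if "p \<in> shift_span q" for p
 proof (rule DN_cong_AE[symmetric])
  show "(\<lambda>z. h z - p z) \<in> meas"
   by (intro harmonic_measurable harmonic_diff hm span_harmonic that)
  show "AE z in ds. h z - p z = k z - p z" using ae by eventually_elim simp
 qed
 then show ?thesis using h harmonic_cong_AE[OF hm ae] unfolding approximable_def by metis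
qed

lemma approximable_cong: "approximable q h ==> (\<And>z. z \<in> circle ==> h z = k z) ==> approximable q k"
 by (rule approximable_cong_AE[of h]) (auto intro: AE_I2)

lemma span_add:
 assumes "p \<in> shift_span q" "r \<in> shift_span q" shows "(\<lambda>z. p z + r z) \<in> shift_span q"
proof -
 obtain N a where p: "p = (\<lambda>z. \<Sum>n<(N::nat). a n * (z ^ n * q z))" using assms(1) by (auto simp: shift_span_def)
 obtain M b where r: "r = (\<lambda>z. \<Sum>n<(M::nat). b n * (z ^ n * q z))" using assms(2) by (auto simp: shift_span_def)
 have pad: "(\<Sum>n<N. a n * (z ^ n * q z)) = (\<Sum>n<max N M. (if n < N then a n else 0) * (z ^ n * q z))" for N M a z
  by (rule sum.mono_neutral_cong_left) auto
 have eq: "(\<lambda>z. p z + r z) = (\<lambda>z. \<Sum>n<max N M. ((if n < N then a n else 0) + (if n < M then b n else 0)) * (z ^ n * q z))"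
  unfolding p r pad[where N=N and a=a and M=M] pad[where N=M and a=b and M=N] max.commute[of M N] by (simp add: sum.distrib[symmetric] distrib_right)
 show ?thesis unfolding shift_span_def mem_Collect_eq
  by (rule exI[of _ "max N M"], rule exI[of _ "\<lambda>n. (if n < N then a n else 0) + (if n < M then b n else 0)"]) (simp only: eq simp_thms)
qed

lemma approximable_add:
 assumes h: "approximable q h" and k: "approximable q k"
 shows "approximable q (\<lambda>z. h z + k z)"
 unfolding approximable_def
proof (intro conjI allI impI)
 note hk = approximable_harmonic[OF h] approximable_harmonic[OF k]
 show "(\<lambda>z. h z + k z) \<in> HD" by (intro harmonic_add hk)
 fix \<epsilon> :: real assume e: "\<epsilon> > 0"
 then have e4: "\<epsilon>/4 > 0" by simp
 obtain p where p: "p \<in> shift_span q" "DN (\<lambda>z. h z - p z) < ennreal (\<epsilon>/4)" using h e4 unfolding approximable_def by blast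
 obtain r where r: "r \<in> shift_span q" "DN (\<lambda>z. k z - r z) < ennreal (\<epsilon>/4)" using k e4 unfolding approximable_def by blast
 have "DN (\<lambda>z. h z + k z - (p z + r z)) = DN (\<lambda>z. (h z - p z) + (k z - r z))" by (simp add: algebra_simps)
 also have "\<dots> \<le> 2 * DN (\<lambda>z. h z - p z) + 2 * DN (\<lambda>z. k z - r z)"
  by (intro DN_add_le harmonic_measurable harmonic_diff hk span_harmonic p(1) r(1))
 also have "\<dots> < 2 * ennreal (\<epsilon>/4) + 2 * ennreal (\<epsilon>/4)"
  using p(2) r(2) by (intro add_strict_mono ennreal_mult_strict_left_mono) auto
 also have "\<dots> = ennreal \<epsilon>" by (rule ennreal_quarters[OF e])
 finally show "\<exists>p\<in>shift_span q. DN (\<lambda>z. h z + k z - p z) < ennreal \<epsilon>"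
  using span_add[OF p(1) r(1)] by (intro bexI[of _ "\<lambda>z. p z + r z"])
qed

lemma poly_span: "p \<in> shift_span q ==> \<exists>N a. p = (\<lambda>z. (\<Sum>n<N. a n * z ^ n) * q z)"
 unfolding shift_span_def by (auto simp: sum_distrib_right mult.assoc intro!: exI)

text \<open>Multiplication by a Lipschitz function is bounded, hence it preserves the closure as soon as
 it maps the span into it.\<close>

lemma approximable_lipschitz_mult:
 assumes h: "approximable q h"
  and lip: "\<And>x y. x \<in> circle ==> y \<in> circle ==> cmod (u x - u y) \<le> L * cmod (x - y)"
  and span: "\<And>p. p \<in> shift_span q ==> approximable q (\<lambda>z. u z * p z)"
  and bound: "\<And>h. h \<in> HD ==> DN (\<lambda>z. u z * h z) \<le> ennreal K * DN h" and K: "0 < K"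
 shows "approximable q (\<lambda>z. u z * h z)"
proof (rule approximable_closed)
 have hh: "h \<in> HD" by (rule approximable_harmonic[OF h])
 have um: "u \<in> meas" by (rule lipschitz_circle_measurable[OF lip])
 have "DN h < \<infinity>" using hh by (simp add: harmonic_dirichlet_iff)
 then have "ennreal K * DN h < \<infinity>" by (simp add: ennreal_mult_less_top)
 then show "(\<lambda>z. u z * h z) \<in> HD"
  unfolding harmonic_dirichlet_iff using bound[OF hh] um harmonic_measurable[OF hh] by auto
 fix \<epsilon> :: real assume e: "\<epsilon> > 0"
 then obtain p where p: "p \<in> shift_span q" "DN (\<lambda>z. h z - p z) < ennreal (\<epsilon> / K)"
  using h K unfolding approximable_def by (meson divide_pos_pos)
 have "DN (\<lambda>z. u z * h z - u z * p z) = DN (\<lambda>z. u z * (h z - p z))" by (simp add: right_diff_distrib)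
 also have "\<dots> \<le> ennreal K * DN (\<lambda>z. h z - p z)" by (intro bound harmonic_diff hh span_harmonic p(1))
 also have "\<dots> < ennreal K * ennreal (\<epsilon> / K)" using p(2) K by (intro ennreal_mult_strict_left_mono) auto
 also have "\<dots> = ennreal \<epsilon>" using K e by (simp flip: ennreal_mult)
 finally show "\<exists>k. approximable q k \<and> DN (\<lambda>z. u z * h z - k z) < ennreal \<epsilon>" using span[OF p(1)] by blast
qed

text \<open>The factor \<open>u\<close> contributes to the energy only through the \<open>L^2\<close> norm of \<open>h\<close>; in particular multiplication by
\<open>cnj \<zeta>\<close> is bounded.\<close>

lemma DN_unimodular:
 assumes h: "h \<in> HD"
  and lip: "\<And>x y. x \<in> circle ==> y \<in> circle ==> cmod (u x - u y) \<le> L * cmod (x - y)"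
  and B: "\<And>x. x \<in> circle ==> cmod (u x) = 1"
 shows "DN (\<lambda>z. u z * h z) \<le> ennreal (2 + 4 * pi * L^2) * DN h"
proof -
 have hm[measurable]: "h \<in> meas" by (rule harmonic_measurable[OF h])
 have um: "u \<in> meas" by (rule lipschitz_circle_measurable[OF lip])
 have 1: "L2sq (\<lambda>z. u z * h z) = L2sq h" unfolding L2sq_def by (intro nn_integral_cong) (simp add: norm_mult B)
 let ?d = "\<lambda>p. cmod (fst p - snd p)"
 have "dirE (\<lambda>z. u z * h z) \<le> (\<integral>\<^sup>+p. 2 * ennreal ((cmod (h (fst p) - h (snd p)) / ?d p)^2) + ennreal (2 * L^2) * ennreal ((cmod (h (snd p)))^2) \<partial>ds2)"
  unfolding dirE_def
 proof (rule nn_integral_mono)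
  fix p assume "p \<in> space ds2"
  then have p: "fst p \<in> circle" "snd p \<in> circle" by (auto simp: space_pair_measure)
  let ?a = "cmod (h (fst p) - h (snd p)) / ?d p"
  have "u (fst p) * h (fst p) - u (snd p) * h (snd p) = u (fst p) * (h (fst p) - h (snd p)) + (u (fst p) - u (snd p)) * h (snd p)"
   by (simp add: algebra_simps)
  then have "cmod (u (fst p) * h (fst p) - u (snd p) * h (snd p)) \<le> cmod (h (fst p) - h (snd p)) + cmod (u (fst p) - u (snd p)) * cmod (h (snd p))"
   using B[OF p(1)] by (metis mult_1 norm_mult norm_triangle_ineq)
  also have "\<dots> \<le> cmod (h (fst p) - h (snd p)) + L * ?d p * cmod (h (snd p))" by (intro add_left_mono mult_right_mono lip p) auto
  finally have "cmod (u (fst p) * h (fst p) - u (snd p) * h (snd p)) / ?d p \<le> ?a + (if ?d p = 0 then 0 else L * cmod (h (snd p)))"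
   by (auto simp: field_simps)
  then have "(cmod (u (fst p) * h (fst p) - u (snd p) * h (snd p)) / ?d p)^2 \<le> (?a + (if ?d p = 0 then 0 else L * cmod (h (snd p))))^2"
   by (intro power_mono) auto
  also have "\<dots> \<le> 2 * ?a^2 + 2 * (if ?d p = 0 then 0 else L * cmod (h (snd p)))^2"
   using weighted_square_sum_le[of 1 ?a 1 "if ?d p = 0 then 0 else L * cmod (h (snd p))"] by simp
  also have "\<dots> \<le> 2 * ?a^2 + 2 * L^2 * (cmod (h (snd p)))^2" by (auto simp: power_mult_distrib)
  finally have "ennreal ((cmod (u (fst p) * h (fst p) - u (snd p) * h (snd p)) / ?d p)^2) \<le> ennreal (2 * ?a^2 + 2 * L^2 * (cmod (h (snd p)))^2)" by (rule ennreal_leI)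
  also have "\<dots> = 2 * ennreal (?a^2) + ennreal (2 * L^2) * ennreal ((cmod (h (snd p)))^2)"
   by (subst ennreal_plus) (simp_all add: ennreal_mult)
  finally show "ennreal ((cmod (u (fst p) * h (fst p) - u (snd p) * h (snd p)) / ?d p)^2) \<le> \<dots>" .
 qed
 also have "\<dots> = 2 * dirE h + ennreal (2 * L^2) * (\<integral>\<^sup>+p. ennreal ((cmod (h (snd p)))^2) \<partial>ds2)"
  unfolding dirE_def by (subst nn_integral_add) (auto simp: nn_integral_cmult)
 also have "(\<integral>\<^sup>+p. ennreal ((cmod (h (snd p)))^2) \<partial>ds2) = ennreal (2 * pi) * L2sq h"
 proof -
  have "(\<integral>\<^sup>+p. ennreal ((cmod (h (snd p)))^2) \<partial>ds2) = (\<integral>\<^sup>+x. \<integral>\<^sup>+y. ennreal ((cmod (h y))^2) \<partial>ds \<partial>ds)"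
   by (subst arc.nn_integral_fst[symmetric]) auto
  then show ?thesis by (simp add: L2sq_def emeasure_arc_length_circle mult.commute)
 qed
 finally have "DN (\<lambda>z. u z * h z) \<le> L2sq h + (2 * dirE h + ennreal (2 * L^2) * (ennreal (2 * pi) * L2sq h))"
  unfolding DN_def 1 by (rule add_left_mono)
 also have "ennreal (2 * L^2) * (ennreal (2 * pi) * L2sq h) = ennreal (4 * pi * L^2) * L2sq h"
  by (simp add: mult.assoc[symmetric] flip: ennreal_mult) (simp add: mult_ac)
 also have "L2sq h + (2 * dirE h + ennreal (4 * pi * L^2) * L2sq h) \<le> 2 * L2sq h + 2 * dirE h + ennreal (4 * pi * L^2) * (L2sq h + dirE h)"
 proof -
  have "1 * L2sq h \<le> 2 * L2sq h" by (rule mult_right_mono) auto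
  then have "L2sq h \<le> 2 * L2sq h" by simp
  moreover have "ennreal (4 * pi * L^2) * L2sq h \<le> ennreal (4 * pi * L^2) * (L2sq h + dirE h)" by (intro mult_left_mono) auto
  ultimately show ?thesis unfolding add.assoc by (intro add_mono) auto
 qed
 also have "\<dots> = ennreal (2 + 4 * pi * L^2) * DN h"
  by (subst ennreal_plus) (simp_all add: DN_def distrib_left distrib_right)
 finally show ?thesis .
qed

lemma approximable_shift:
 assumes h: "approximable q h" shows "approximable q (\<lambda>z. z * h z)"
proof (rule approximable_lipschitz_mult[OF h, where L=1 and K="2 + 4 * pi * 1^2"])
 fix p assume "p \<in> shift_span q"
 then obtain N a where p: "p = (\<lambda>z. (\<Sum>n<N. a n * z ^ n) * q z)" using poly_span by blast
 have "(\<lambda>z. z * p z) = (\<lambda>z. (\<Sum>n<Suc N. (case n of 0 \<Rightarrow> 0 | Suc m \<Rightarrow> a m) * z ^ n) * q z)"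
  unfolding p sum.lessThan_Suc_shift by (auto simp: sum_distrib_left mult_ac)
 then show "approximable q (\<lambda>z. z * p z)" using approximable_span[OF span_poly] by metis
next
 show "DN (\<lambda>z. z * h z) \<le> ennreal (2 + 4 * pi * 1^2) * DN h" if "h \<in> HD" for h
  by (rule DN_unimodular[OF that]) auto
qed (auto intro!: add_pos_nonneg)

lemma approximable_mult_const:
 assumes h: "approximable q h" shows "approximable q (\<lambda>z. c * h z)"
proof (rule approximable_lipschitz_mult[OF h, where L=0 and K="(cmod c)^2 + 1"])
 fix p assume "p \<in> shift_span q"
 then obtain N a where p: "p = (\<lambda>z. (\<Sum>n<N. a n * z ^ n) * q z)" using poly_span by blast
 have "(\<lambda>z. c * p z) = (\<lambda>z. (\<Sum>n<N. (c * a n) * z ^ n) * q z)"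
  unfolding p by (auto simp: sum_distrib_left mult_ac)
 then show "approximable q (\<lambda>z. c * p z)" using approximable_span[OF span_poly] by metis
next
 show "DN (\<lambda>z. c * h z) \<le> ennreal ((cmod c)^2 + 1) * DN h" if "h \<in> HD" for h
  unfolding DN_cmult[OF harmonic_measurable[OF that]] by (intro mult_right_mono ennreal_leI) auto
qed (auto intro!: add_nonneg_pos)

lemma approximable_zero: "approximable q (\<lambda>_. 0)"
 using approximable_mult_const[OF approximable_span[OF span_poly[of "\<lambda>_. 0" 0]], of 0] by simp

lemma approximable_sum:
 "finite I ==> (\<And>i. i \<in> I ==> approximable q (h i)) ==> approximable q (\<lambda>z. \<Sum>i\<in>I. h i z)"
 by (induction I rule: finite_induct) (auto simp: approximable_zero approximable_add)

lemma approximable_q: "approximable q q"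
 using approximable_span[OF span_poly[of "\<lambda>_. 1" 1]] by simp

text \<open>The span is mapped into the closure: only the term with \<open>n = 0\<close> needs the assumption.\<close>

lemma approximable_backshift:
 assumes b: "approximable q (\<lambda>z. cnj z * q z)" and h: "approximable q h"
 shows "approximable q (\<lambda>z. cnj z * h z)"
proof (rule approximable_lipschitz_mult[OF h, where L=1 and K="2 + 4 * pi * 1^2"])
 have mono: "approximable q (\<lambda>z. z ^ n * (cnj z * q z))" for n
 proof (induction n)
  case 0 then show ?case using b by simp
 next
  case (Suc n) then show ?case using approximable_shift[OF Suc] by (simp add: mult.assoc)
 qed
 fix p assume "p \<in> shift_span q"
 then obtain N a where p: "p = (\<lambda>z. (\<Sum>n<N. a n * z ^ n) * q z)" using poly_span by blast
 have "approximable q (\<lambda>z. \<Sum>n<N. a n * (z ^ n * (cnj z * q z)))"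
  by (intro approximable_sum approximable_mult_const mono) auto
 then show "approximable q (\<lambda>z. cnj z * p z)" unfolding p by (simp add: sum_distrib_left sum_distrib_right mult_ac)
next
 show "DN (\<lambda>z. cnj z * h z) \<le> ennreal (2 + 4 * pi * 1^2) * DN h" if "h \<in> HD" for h
  by (rule DN_unimodular[OF that]) (auto simp: cmod_cnj_diff)
qed (auto intro!: add_pos_nonneg simp: cmod_cnj_diff)

lemma approximable_trig_sum:
 assumes b: "approximable q (\<lambda>z. cnj z * q z)" and h: "approximable q h"
 shows "approximable q (\<lambda>z. trig_sum c N z * h z)"
proof -
 have pos: "approximable q (\<lambda>z. z ^ n * h z)" for n
  by (induction n) (use h approximable_shift in \<open>auto simp: mult.assoc\<close>)
 have neg: "approximable q (\<lambda>z. cnj z ^ n * h z)" for n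
  by (induction n) (use h approximable_backshift[OF b] in \<open>auto simp: mult.assoc\<close>)
 have pw: "approximable q (\<lambda>z. z powi n * h z)" for n
 proof (cases "n \<ge> 0")
  case True then show ?thesis using pos[of "nat n"] by (simp add: power_int_def)
 next
  case False
  show ?thesis
   by (rule approximable_cong[OF neg[of "nat (-n)"]]) (use False in \<open>auto simp: power_int_def cnj_circle\<close>)
 qed
 have "approximable q (\<lambda>z. \<Sum>n\<in>win N. c n * (z powi n * h z))"
  by (intro approximable_sum approximable_mult_const pw) auto
 then show ?thesis by (simp add: trig_sum_def sum_distrib_right mult.assoc)
qed

text \<open>The Taylor polynomials of \<open>exp (- Q)\<close> converge to it together with their Lipschitz constants,
 and their value at \<open>0\<close> is that of \<open>exp (- Q)\<close>, so that the negative power cancels.\<close>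

lemma approximable_analytic_quotient:
 assumes Q: "Q holomorphic_on UNIV"
 shows "approximable q (\<lambda>z. cnj z * q z - exp (Q 0) * (cnj z * q z * exp (- Q z)))"
proof -
 have hol: "(\<lambda>z. exp (- Q z)) holomorphic_on UNIV" by (intro holomorphic_intros Q)
 obtain B where B: "q \<in> HD" "q \<in> meas" "\<And>z. z \<in> circle ==> cmod (q z) \<le> B" "0 \<le> B"
  using bounded_dirichletE[OF q] by metis
 have bz: "bounded_dirichlet (\<lambda>z. cnj z)" by (rule bounded_dirichlet_lipschitz[where L=1]) (simp add: cmod_cnj_diff)
 have bq: "bounded_dirichlet (\<lambda>z. cnj z * q z)" by (rule bounded_dirichlet_mult[OF bz q])
 have be: "bounded_dirichlet (\<lambda>z. exp (- Q z))"
  using entire_lipschitz[OF hol] bounded_dirichlet_lipschitz by metis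
 have hq: "(\<lambda>z. cnj z * q z) \<in> HD" using bq by (simp add: bounded_dirichlet_def)
 have hqB: "cmod (cnj z * q z) \<le> B" if "z \<in> circle" for z using B(3)[OF that] that by (simp add: norm_mult)
 have harm: "(\<lambda>z. cnj z * q z - exp (Q 0) * (cnj z * q z * exp (- Q z))) \<in> HD"
  using bounded_dirichlet_mult[OF bq be] by (intro harmonic_diff hq harmonic_cmult) (simp add: bounded_dirichlet_def)
 show ?thesis
 proof (rule entire_partial_sums[OF hol])
  fix a e
  assume a: "exp (- Q 0) = a 0" "e \<longlonglongrightarrow> 0" "\<And>K. 0 \<le> e K"
   and close: "\<And>K z. z \<in> circle ==> cmod (exp (- Q z) - (\<Sum>n<K. a n * z ^ n)) \<le> e K"
   and lip: "\<And>K x y. x \<in> circle ==> y \<in> circle ==> cmod ((exp (- Q x) - (\<Sum>n<K. a n * x ^ n)) - (exp (- Q y) - (\<Sum>n<K. a n * y ^ n))) \<le> e K * cmod (x - y)"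
  have a0: "exp (Q 0) * a 0 = 1" unfolding a(1)[symmetric] by (simp flip: exp_add)
  let ?p = "\<lambda>K z. (\<Sum>n<K. (- exp (Q 0) * a (Suc n)) * z ^ n) * q z"
  let ?u = "\<lambda>K z. exp (- Q z) - (\<Sum>n<K. a n * z ^ n)"
  show ?thesis
  proof (rule approximable_limit[OF harm])
   show "approximable q (?p K)" for K by (rule approximable_span[OF span_poly])
   have eq: "cnj z * q z - exp (Q 0) * (cnj z * q z * exp (- Q z)) - ?p K z = (- exp (Q 0)) * (?u (Suc K) z * (cnj z * q z))"
    if z: "z \<in> circle" for z K
   proof -
    have "(\<Sum>n<Suc K. a n * z ^ n) = a 0 + z * (\<Sum>n<K. a (Suc n) * z ^ n)"
     unfolding sum.lessThan_Suc_shift by (simp add: sum_distrib_left mult_ac)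
    then have "exp (Q 0) * (\<Sum>n<Suc K. a n * z ^ n) * (cnj z * q z) = (exp (Q 0) * a 0) * (cnj z * q z) + exp (Q 0) * (z * cnj z) * ((\<Sum>n<K. a (Suc n) * z ^ n) * q z)"
     by (simp only:) (simp add: algebra_simps)
    also have "\<dots> = cnj z * q z - ?p K z"
     unfolding a0 circle_mult_cnj[OF z] by (simp add: sum_distrib_left sum_distrib_right sum_negf mult_ac)
    finally show ?thesis by (simp add: algebra_simps)
   qed
   have le: "DN (\<lambda>z. cnj z * q z - exp (Q 0) * (cnj z * q z * exp (- Q z)) - ?p K z)
    \<le> ennreal ((cmod (exp (Q 0)))^2) * (ennreal (2 * (e (Suc K))^2) * DN (\<lambda>z. cnj z * q z) + ennreal (8 * pi^2 * (e (Suc K))^2 * B^2))" for K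
   proof -
    have um: "?u (Suc K) \<in> meas" by (rule lipschitz_circle_measurable[OF lip])
    have "DN (\<lambda>z. cnj z * q z - exp (Q 0) * (cnj z * q z * exp (- Q z)) - ?p K z) = DN (\<lambda>z. (- exp (Q 0)) * (?u (Suc K) z * (cnj z * q z)))"
     by (rule DN_cong) (rule eq)
    also have "\<dots> = ennreal ((cmod (- exp (Q 0)))^2) * DN (\<lambda>z. ?u (Suc K) z * (cnj z * q z))"
     by (rule DN_cmult) (intro borel_measurable_times um harmonic_measurable[OF hq])
    also have "\<dots> \<le> ennreal ((cmod (- exp (Q 0)))^2) * (ennreal (2 * (e (Suc K))^2) * DN (\<lambda>z. cnj z * q z) + ennreal (8 * pi^2 * (e (Suc K))^2 * B^2))"
     by (intro mult_left_mono DN_lipschitz_mult harmonic_measurable[OF hq] hqB lip close) auto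
    finally show ?thesis by (simp only: norm_minus_cancel)
   qed
   have e': "(\<lambda>K. e (Suc K)) \<longlonglongrightarrow> 0" by (rule LIMSEQ_Suc[OF a(2)])
   have DNf: "DN (\<lambda>z. cnj z * q z) < \<top>" using hq by (simp add: harmonic_dirichlet_iff)
   have t1: "(\<lambda>K. ennreal (2 * (e (Suc K))^2)) \<longlonglongrightarrow> ennreal (2 * 0^2)" by (intro tendsto_intros e')
   have t2: "(\<lambda>K. ennreal (8 * pi^2 * (e (Suc K))^2 * B^2)) \<longlonglongrightarrow> ennreal (8 * pi^2 * 0^2 * B^2)" by (intro tendsto_intros e')
   have t3: "(\<lambda>K. DN (\<lambda>z. cnj z * q z) * ennreal (2 * (e (Suc K))^2)) \<longlonglongrightarrow> DN (\<lambda>z. cnj z * q z) * ennreal (2 * 0^2)"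
    by (rule ennreal_tendsto_cmult[OF DNf t1])
   have "(\<lambda>K. ennreal ((cmod (exp (Q 0)))^2) * (ennreal (2 * (e (Suc K))^2) * DN (\<lambda>z. cnj z * q z) + ennreal (8 * pi^2 * (e (Suc K))^2 * B^2)))
     \<longlonglongrightarrow> ennreal ((cmod (exp (Q 0)))^2) * (ennreal (2 * 0^2) * DN (\<lambda>z. cnj z * q z) + ennreal (8 * pi^2 * 0^2 * B^2))"
    using tendsto_add[OF t3 t2] by (intro ennreal_tendsto_cmult) (simp_all add: mult.commute)
   then have lim: "(\<lambda>K. ennreal ((cmod (exp (Q 0)))^2) * (ennreal (2 * (e (Suc K))^2) * DN (\<lambda>z. cnj z * q z) + ennreal (8 * pi^2 * (e (Suc K))^2 * B^2))) \<longlonglongrightarrow> 0"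
    by simp
   show "(\<lambda>K. DN (\<lambda>z. cnj z * q z - exp (Q 0) * (cnj z * q z * exp (- Q z)) - ?p K z)) \<longlonglongrightarrow> 0"
   proof (rule tendsto_sandwich[OF _ _ tendsto_const lim])
    show "\<forall>\<^sub>F K in sequentially. DN (\<lambda>z. cnj z * q z - exp (Q 0) * (cnj z * q z * exp (- Q z)) - ?p K z)
     \<le> ennreal ((cmod (exp (Q 0)))^2) * (ennreal (2 * (e (Suc K))^2) * DN (\<lambda>z. cnj z * q z) + ennreal (8 * pi^2 * (e (Suc K))^2 * B^2))"
     by (intro always_eventually allI) (rule le)
   qed simp
  qed
 qed
qed

end

section \<open>Consequences of the regularity of the modulus\<close>

lemma sin_ge_half:
 assumes "0 \<le> x" "x \<le> pi / 2" shows "x / 2 \<le> sin x"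
proof (cases "x = 0")
 case False
 define y where "y = x / 2"
 have y: "0 < y" "y \<le> pi / 4" using assms False by (auto simp: y_def)
 have "\<exists>z. 0 < z \<and> z < y \<and> sin y - sin 0 = (y - 0) * cos z"
  by (rule MVT2[OF y(1)]) (auto intro!: derivative_eq_intros)
 then obtain z where z: "0 < z" "z < y" "sin y = y * cos z" by auto
 have "cos y \<le> cos z" using z y by (intro cos_monotone_0_pi_le) auto
 then have 1: "y * cos y \<le> sin y" unfolding z(3) using y by (intro mult_left_mono) auto
 have "cos (pi / 4) \<le> cos y" using y by (intro cos_monotone_0_pi_le) auto
 then have c: "sqrt 2 / 2 \<le> cos y" by (simp add: cos_45)
 then have c0: "0 \<le> cos y" using real_sqrt_ge_zero[of 2] by linarith
 have "(sqrt 2 / 2) * (sqrt 2 / 2) \<le> cos y * cos y" using c by (intro mult_mono c0) auto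
 then have "1 / 2 \<le> cos y * cos y" by simp
 then have "y * (1 / 2) \<le> y * (cos y * cos y)" using y by (intro mult_left_mono) auto
 also have "\<dots> \<le> sin y * cos y" using mult_right_mono[OF 1 c0] by (simp add: mult_ac)
 finally have "y \<le> 2 * sin y * cos y" by simp
 then show ?thesis using sin_double[of y] by (simp add: y_def)
qed simp

lemma cmod_cis_minus_one: "cmod (cis t - 1) = 2 * \<bar>sin (t / 2)\<bar>"
proof -
 have "(cmod (cis t - 1))^2 = 2 - 2 * cos t" by (subst cmod_diff_circle_sq) auto
 also have "\<dots> = (2 * \<bar>sin (t / 2)\<bar>)^2" using cos_double_sin[of "t / 2"] by (simp add: power_mult_distrib)
 finally show ?thesis by (rule power2_eq_imp_eq) auto
qed

lemma chord_bounds: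
 shows "\<bar>t\<bar> \<le> pi ==> \<bar>t\<bar> \<le> 2 * cmod (cis t - 1)" and "cmod (cis t - 1) \<le> \<bar>t\<bar>"
proof -
 show "cmod (cis t - 1) \<le> \<bar>t\<bar>" unfolding cmod_cis_minus_one using abs_sin_x_le_abs_x[of "t / 2"] by simp
 assume t: "\<bar>t\<bar> \<le> pi"
 have "\<bar>t\<bar> / 2 / 2 \<le> sin (\<bar>t\<bar> / 2)" using t by (intro sin_ge_half) auto
 also have "\<dots> \<le> \<bar>sin (t / 2)\<bar>" by (cases "t \<ge> 0") auto
 finally show "\<bar>t\<bar> \<le> 2 * cmod (cis t - 1)" unfolding cmod_cis_minus_one by simp
qed

lemma cmod_cis_diff_le: "cmod (cis a - cis b) \<le> \<bar>a - b\<bar>"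
proof -
 have "cis a - cis b = cis b * (cis (a - b) - 1)" by (simp add: right_diff_distrib cis_mult)
 then show ?thesis using chord_bounds(2)[of "a - b"] by (simp add: norm_mult)
qed

lemma circle_angles:
 assumes x: "x \<in> circle" and y: "y \<in> circle"
 obtains s t where "y = cis s" "x = cis (s + t)" "\<bar>t\<bar> \<le> 2 * cmod (x - y)"
proof -
 have c: "z = cis (Arg z)" if "z \<in> circle" for z
 proof -
  have "cis (Arg z) = sgn z" by (rule cis_Arg[OF circle_nonzero[OF that]])
  also have "\<dots> = z" using that by (simp add: sgn_eq)
  finally show ?thesis ..
 qed
 let ?w = "x * cnj y"
 have w: "?w \<in> circle" by (rule circle_mult[OF x circle_cnj[OF y]])
 have xw: "x = y * ?w" using circle_mult_cnj[OF y] by (simp add: mult_ac)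
 have "x - y = y * (?w - 1)" by (simp only: right_diff_distrib xw[symmetric] mult_1_right)
 then have "cmod (x - y) = cmod (?w - 1)" using y by (simp add: norm_mult)
 moreover have "\<bar>Arg ?w\<bar> \<le> 2 * cmod (cis (Arg ?w) - 1)" using Arg_bounded[of ?w] by (intro chord_bounds(1)) auto
 ultimately have "\<bar>Arg ?w\<bar> \<le> 2 * cmod (x - y)" by (simp only: c[OF w, symmetric])
 moreover have "x = cis (Arg y + Arg ?w)" unfolding cis_mult[symmetric] using xw by (simp only: c[OF y, symmetric] c[OF w, symmetric])
 ultimately show ?thesis using c[OF y] by (intro that) auto
qed

text \<open>The second difference of a \<open>C\<^sup>1\<^sup>+\<^sup>\<alpha>\<close> function is of order \<open>1 + \<alpha>\<close>. The point \<open>y * y * cnj x\<close>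
 is the reflection of \<open>x\<close> at \<open>y\<close>.\<close>

lemma C1_Lip_circle_estimates:
 fixes g :: "complex \<Rightarrow> real"
 assumes g: "g \<in> C1_Lip_circle \<alpha>" and \<alpha>: "0 < \<alpha>"
 obtains L C where "0 \<le> L" "0 \<le> C" "\<And>x y. x \<in> circle ==> y \<in> circle ==> \<bar>g x - g y\<bar> \<le> L * cmod (x - y)"
  "\<And>x y. x \<in> circle ==> y \<in> circle ==> g x + g (y * y * cnj x) - 2 * g y \<le> C * cmod (x - y) powr (1 + \<alpha>)"
proof -
 obtain g' where g': "g' \<in> Lip_circle \<alpha>" "\<And>t. ((\<lambda>s. g (cis s)) has_vector_derivative g' (cis t)) (at t)"
  using g by (auto simp: C1_Lip_circle_def)
 have d: "((\<lambda>s. g (cis s)) has_real_derivative g' (cis t)) (at t)" for t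
  using g'(2) by (simp add: has_real_derivative_iff_has_vector_derivative)
 have cont: "continuous_on circle g'" using g'(1) by (simp add: Lip_circle_def)
 obtain L where "\<forall>z\<in>circle. \<bar>g' z\<bar> \<le> L"
  using compact_imp_bounded[OF compact_continuous_image[OF cont compact_sphere]] by (auto simp: bounded_iff)
 then have L: "\<And>z. z \<in> circle ==> \<bar>g' z\<bar> \<le> L" by blast
 have L0: "0 \<le> L" using order_trans[OF abs_ge_zero L[of 1]] by simp
 let ?S = "{norm (g' \<zeta> - g' \<zeta>') / cmod (\<zeta> - \<zeta>') powr \<alpha> | \<zeta> \<zeta>'. \<zeta> \<in> circle \<and> \<zeta>' \<in> circle \<and> \<zeta> \<noteq> \<zeta>'}"
 have "bdd_above ?S" using g'(1) unfolding Lip_circle_def by (simp only: mem_Collect_eq)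
 then obtain C1 where C1': "\<forall>t\<in>?S. t \<le> C1" unfolding bdd_above_def by (rule exE)
 have C1: "\<bar>g' z - g' w\<bar> / cmod (z - w) powr \<alpha> \<le> C1" if "z \<in> circle" "w \<in> circle" "z \<noteq> w" for z w
 proof -
  have "norm (g' z - g' w) / cmod (z - w) powr \<alpha> \<in> ?S" using that by (intro CollectI exI[of _ z] exI[of _ w]) simp
  from bspec[OF C1' this] show ?thesis by simp
 qed
 define C where "C = \<bar>C1\<bar>"
 have C: "\<bar>g' z - g' w\<bar> \<le> C * cmod (z - w) powr \<alpha>" if "z \<in> circle" "w \<in> circle" for z w
 proof (cases "z = w")
  case False
  have "\<bar>g' z - g' w\<bar> / cmod (z - w) powr \<alpha> \<le> C" using C1[OF that False] unfolding C_def by linarith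
  then show ?thesis using False by (simp add: field_simps)
 qed simp
 have mvt: "\<exists>z. a < z \<and> z < b \<and> g (cis b) - g (cis a) = (b - a) * g' (cis z)" if "a < b" for a b
  using MVT2[OF that, of "\<lambda>s. g (cis s)" "\<lambda>s. g' (cis s)"] d by auto
 have lip: "\<bar>g (cis a) - g (cis b)\<bar> \<le> L * \<bar>a - b\<bar>" for a b
 proof -
  have *: "\<bar>g (cis b) - g (cis a)\<bar> \<le> L * (b - a)" if ab: "a < b" for a b
  proof -
   obtain z where "g (cis b) - g (cis a) = (b - a) * g' (cis z)" using mvt[OF ab] by blast
   then have "\<bar>g (cis b) - g (cis a)\<bar> = (b - a) * \<bar>g' (cis z)\<bar>" using ab by (simp add: abs_mult)
   also have "\<dots> \<le> (b - a) * L" using ab by (intro mult_left_mono L) auto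
   finally show ?thesis by (simp add: mult.commute)
  qed
  show ?thesis using *[of a b] *[of b a] by (cases a b rule: linorder_cases) (auto simp: abs_minus_commute)
 qed
 have second: "g (cis (s + u)) + g (cis (s - u)) - 2 * g (cis s) \<le> u * (C * (2 * u) powr \<alpha>)" if u: "0 < u" for s u
 proof -
  obtain z1 where z1: "s < z1" "z1 < s + u" "g (cis (s + u)) - g (cis s) = u * g' (cis z1)" using mvt[of s "s + u"] u by auto
  obtain z2 where z2: "s - u < z2" "z2 < s" "g (cis s) - g (cis (s - u)) = u * g' (cis z2)" using mvt[of "s - u" s] u by auto
  have "g (cis (s + u)) + g (cis (s - u)) - 2 * g (cis s) = u * (g' (cis z1) - g' (cis z2))"
   using z1(3) z2(3) by (simp add: right_diff_distrib)
  also have "g' (cis z1) - g' (cis z2) \<le> C * cmod (cis z1 - cis z2) powr \<alpha>"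
   using C[of "cis z1" "cis z2"] by simp
  also have "\<dots> \<le> C * (2 * u) powr \<alpha>"
  proof (intro mult_left_mono powr_mono2)
   show "cmod (cis z1 - cis z2) \<le> 2 * u" using cmod_cis_diff_le[of z1 z2] z1 z2 by linarith
  qed (use \<alpha> in \<open>auto simp: C_def\<close>)
  finally show ?thesis using u by (simp add: mult_left_mono)
 qed
 show ?thesis
 proof (rule that[of "2 * L" "C * 4 powr (1 + \<alpha>)"])
  show "\<bar>g x - g y\<bar> \<le> 2 * L * cmod (x - y)" if xy: "x \<in> circle" "y \<in> circle" for x y
  proof -
   obtain s t where st: "y = cis s" "x = cis (s + t)" "\<bar>t\<bar> \<le> 2 * cmod (x - y)" using circle_angles[OF xy] by blast
   have "\<bar>g x - g y\<bar> \<le> L * \<bar>t\<bar>" using lip[of "s + t" s] st by simp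
   also have "\<dots> \<le> L * (2 * cmod (x - y))" using st L0 by (intro mult_left_mono) auto
   finally show ?thesis by simp
  qed
  show "g x + g (y * y * cnj x) - 2 * g y \<le> C * 4 powr (1 + \<alpha>) * cmod (x - y) powr (1 + \<alpha>)" if xy: "x \<in> circle" "y \<in> circle" for x y
  proof -
   obtain s t where st: "y = cis s" "x = cis (s + t)" "\<bar>t\<bar> \<le> 2 * cmod (x - y)" using circle_angles[OF xy] by blast
   have y2: "y * y * cnj x = cis (s - t)" by (simp add: st(1,2) cis_mult cis_cnj)
   show ?thesis
   proof (cases "t = 0")
    case True then show ?thesis unfolding y2 using st by (simp add: C_def)
   next
    case False
    let ?u = "\<bar>t\<bar>"
    have "g x + g (y * y * cnj x) - 2 * g y = g (cis (s + ?u)) + g (cis (s - ?u)) - 2 * g (cis s)"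
     unfolding y2 unfolding st(1,2) by (cases "t \<ge> 0") auto
    also have "\<dots> \<le> ?u * (C * (2 * ?u) powr \<alpha>)" using False by (intro second) auto
    also have "\<dots> \<le> (2 * ?u) * (C * (2 * ?u) powr \<alpha>)" by (intro mult_right_mono) (auto simp: C_def)
    also have "\<dots> = C * (2 * ?u) powr (1 + \<alpha>)" using False by (simp add: powr_add)
    also have "\<dots> \<le> C * (4 * cmod (x - y)) powr (1 + \<alpha>)"
     using st(3) \<alpha> by (intro mult_left_mono powr_mono2) (auto simp: C_def)
    also have "\<dots> = C * 4 powr (1 + \<alpha>) * cmod (x - y) powr (1 + \<alpha>)" by (simp add: powr_mult)
    finally show ?thesis .
   qed
  qed
 qed (use L0 in \<open>auto simp: C_def\<close>)
qed

lemma chord_power_integral_finite: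
 assumes "0 < \<alpha>" "\<alpha> < 1"
 shows "(\<integral>\<^sup>+\<tau>. ennreal (cmod (1 - \<tau>) powr (\<alpha> - 1)) \<partial>ds) < \<infinity>"
proof -
 have I: "(\<integral>\<^sup>+t. ennreal (indicator {0..2*pi} t * (t powr (\<alpha> - 1))) \<partial>lborel) < \<infinity>"
 proof -
  have "((\<lambda>x. x powr (\<alpha> - 1)) has_integral ((2*pi) powr (\<alpha> - 1 + 1) / (\<alpha> - 1 + 1))) {0..2*pi}"
   using assms by (intro has_integral_powr_from_0) auto
  from nn_integral_has_integral_lebesgue[OF _ this] show ?thesis by simp
 qed
 let ?K = "2 powr (1 - \<alpha>)"
 have m: "(\<lambda>\<tau>. ennreal (cmod (1 - \<tau>) powr (\<alpha> - 1))) \<in> borel_measurable borel" by measurable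
 have half: "cmod (1 - cis t) powr (\<alpha> - 1) \<le> ?K * u powr (\<alpha> - 1)" if "0 < u" "u \<le> 2 * cmod (1 - cis t)" for t u
 proof -
  have "cmod (1 - cis t) powr (\<alpha> - 1) \<le> (u / 2) powr (\<alpha> - 1)" using that assms by (intro powr_mono2') auto
  also have "\<dots> = ?K * u powr (\<alpha> - 1)"
  proof -
   have e: "?K = inverse (2 powr (\<alpha> - 1))" using powr_minus[of 2 "\<alpha> - 1"] by (simp only: minus_diff_eq)
   have "(u / 2) powr (\<alpha> - 1) = u powr (\<alpha> - 1) / 2 powr (\<alpha> - 1)" using that by (intro powr_divide)
   then show ?thesis by (simp only: e divide_inverse mult.commute)
  qed
  finally show ?thesis .
 qed
 have "(\<integral>\<^sup>+\<tau>. ennreal (cmod (1 - \<tau>) powr (\<alpha> - 1)) \<partial>ds) = (\<integral>\<^sup>+t. ennreal (cmod (1 - cis t) powr (\<alpha> - 1)) * indicator {0..<2*pi} t \<partial>lborel)"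
  by (rule nn_integral_arc_length[OF m])
 also have "\<dots> \<le> (\<integral>\<^sup>+t. ennreal ?K * (ennreal (indicator {0..2*pi} t * (t powr (\<alpha> - 1))) + ennreal (indicator {0..2*pi} (2*pi + -1 * t) * ((2*pi + -1 * t) powr (\<alpha> - 1)))) \<partial>lborel)"
 proof (rule nn_integral_mono)
  fix t :: real
  show "ennreal (cmod (1 - cis t) powr (\<alpha> - 1)) * indicator {0..<2*pi} t \<le> ennreal ?K * (ennreal (indicator {0..2*pi} t * (t powr (\<alpha> - 1))) + ennreal (indicator {0..2*pi} (2*pi + -1 * t) * ((2*pi + -1 * t) powr (\<alpha> - 1))))"
  proof (cases "0 < t \<and> t < 2*pi")
   case True
   have "cmod (1 - cis t) powr (\<alpha> - 1) \<le> ?K * (t powr (\<alpha> - 1) + (2*pi - t) powr (\<alpha> - 1))"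
   proof (cases "t \<le> pi")
    case True': True
    have "cmod (1 - cis t) powr (\<alpha> - 1) \<le> ?K * t powr (\<alpha> - 1)"
     using chord_bounds(1)[of t] True True' by (intro half) (auto simp: norm_minus_commute)
    also have "\<dots> \<le> ?K * (t powr (\<alpha> - 1) + (2*pi - t) powr (\<alpha> - 1))" by (intro mult_left_mono) auto
    finally show ?thesis .
   next
    case False
    have "cis (t - 2 * pi) = cis t" by (simp flip: cis_divide)
    then have "cmod (1 - cis t) powr (\<alpha> - 1) \<le> ?K * (2*pi - t) powr (\<alpha> - 1)"
     using chord_bounds(1)[of "t - 2 * pi"] True False by (intro half) (auto simp: norm_minus_commute)
    also have "\<dots> \<le> ?K * (t powr (\<alpha> - 1) + (2*pi - t) powr (\<alpha> - 1))" by (intro mult_left_mono) auto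
    finally show ?thesis .
   qed
   then have "ennreal (cmod (1 - cis t) powr (\<alpha> - 1)) \<le> ennreal (?K * (t powr (\<alpha> - 1) + (2*pi - t) powr (\<alpha> - 1)))" by (rule ennreal_leI)
   also have "\<dots> = ennreal ?K * (ennreal (t powr (\<alpha> - 1)) + ennreal ((2*pi - t) powr (\<alpha> - 1)))"
    by (simp add: ennreal_mult ennreal_plus)
   finally show ?thesis using True by simp
  next
   case False
   then have "t = 0 \<or> t \<notin> {0..<2*pi}" by auto
   then show ?thesis by auto
  qed
 qed
 also have "\<dots> = ennreal ?K * ((\<integral>\<^sup>+t. ennreal (indicator {0..2*pi} t * (t powr (\<alpha> - 1))) \<partial>lborel) + (\<integral>\<^sup>+t. ennreal (indicator {0..2*pi} t * (t powr (\<alpha> - 1))) \<partial>lborel))"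
 proof -
  define f where "f t = ennreal (indicator {0..2*pi} t * (t powr (\<alpha> - 1)))" for t
  have f[measurable]: "f \<in> borel_measurable borel" unfolding f_def[abs_def] by measurable
  have f2: "(\<lambda>t. f (2*pi + -1 * t)) \<in> borel_measurable borel" by measurable
  have "(\<integral>\<^sup>+t. f t \<partial>lborel) = (\<integral>\<^sup>+t. f (2*pi + -1 * t) \<partial>lborel)"
   using nn_integral_real_affine[OF f, of "-1" "2*pi"] by simp
  moreover have "(\<integral>\<^sup>+t. ennreal ?K * (f t + f (2*pi + -1 * t)) \<partial>lborel) = ennreal ?K * (\<integral>\<^sup>+t. f t + f (2*pi + -1 * t) \<partial>lborel)"
   using f f2 by (intro nn_integral_cmult) simp
  moreover have "(\<integral>\<^sup>+t. f t + f (2*pi + -1 * t) \<partial>lborel) = (\<integral>\<^sup>+t. f t \<partial>lborel) + (\<integral>\<^sup>+t. f (2*pi + -1 * t) \<partial>lborel)"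
   using f f2 by (intro nn_integral_add) simp_all
  ultimately show ?thesis unfolding f_def by (simp only:)
 qed
 also have "\<dots> < \<infinity>" using I by (simp add: ennreal_mult_less_top)
 finally show ?thesis .
qed

text \<open>The pointwise estimate behind the bound on Carleson's integral: if the smaller value \<open>b\<close> is
 large compared to \<open>d\<^sup>1\<^sup>+\<^sup>\<alpha>\<close> then \<open>a\<close> and \<open>b\<close> are comparable and the integrand is of the order of
 \<open>(a - b)^2\<close>; otherwise \<open>a - b\<close> is of the order of \<open>d\<^sup>1\<^sup>+\<^sup>\<alpha>\<close> and only the logarithm is large.\<close>

lemma carleson_pointwise:
 fixes a b d L C M :: real
 assumes b: "0 < b" "b \<le> a" "a \<le> M" and d: "0 < d" and L: "a - b \<le> L * d"
  and C: "a \<le> 2 * b + C * d powr (1 + \<alpha>)" and C0: "0 \<le> C"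
 shows "(a^2 - b^2) * (ln a - ln b) / d^2 \<le> 4 * L^2 + 4 * M * C * d powr (\<alpha> - 1) * ln (M / b)"
proof -
 have lnM: "0 \<le> ln (M / b)" using b by simp
 have M0: "0 < M" using b by linarith
 have sq: "a^2 - b^2 = (a + b) * (a - b)" by (simp add: power2_eq_square algebra_simps)
 have ln0: "0 \<le> ln a - ln b" using b by simp
 show ?thesis
 proof (cases "C * d powr (1 + \<alpha>) \<le> b")
  case True
  have "ln a - ln b = ln (a / b)" using b by (simp add: ln_div)
  also have "\<dots> \<le> a / b - 1" using b by (intro ln_le_minus_one) auto
  also have "\<dots> = (a - b) / b" using b by (simp add: field_simps)
  finally have l: "ln a - ln b \<le> (a - b) / b" .
  have "(a^2 - b^2) * (ln a - ln b) \<le> ((a + b) * (a - b)) * ((a - b) / b)"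
   unfolding sq using b l by (intro mult_left_mono) auto
  also have "\<dots> = ((a + b) / b) * (a - b)^2" using b by (simp add: power2_eq_square field_simps)
  also have "\<dots> \<le> 4 * (a - b)^2"
  proof (intro mult_right_mono)
   have "a + b \<le> 4 * b" using C True by linarith
   then show "(a + b) / b \<le> 4" using b by (simp add: divide_le_eq)
  qed simp
  also have "\<dots> \<le> 4 * (L * d)^2" using L b by (intro mult_left_mono power_mono) auto
  finally have "(a^2 - b^2) * (ln a - ln b) / d^2 \<le> 4 * L^2" using d by (simp add: power_mult_distrib field_simps)
  moreover have "0 \<le> 4 * M * C * d powr (\<alpha> - 1) * ln (M / b)" using M0 C0 lnM by (intro mult_nonneg_nonneg) auto
  ultimately show ?thesis by linarith
 next
  case False
  have ab: "a - b \<le> 2 * (C * d powr (1 + \<alpha>))" using C False by linarith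
  have "ln a - ln b \<le> ln (M / b)" using b M0 by (simp add: ln_div)
  then have "(a^2 - b^2) * (ln a - ln b) \<le> ((2 * M) * (2 * (C * d powr (1 + \<alpha>)))) * ln (M / b)"
   unfolding sq using b M0 ab ln0 by (intro mult_mono) auto
  then have "(a^2 - b^2) * (ln a - ln b) / d^2 \<le> ((2 * M) * (2 * (C * d powr (1 + \<alpha>)))) * ln (M / b) / d^2"
   by (rule divide_right_mono) simp
  also have "\<dots> = 4 * M * C * (d powr (1 + \<alpha>) / d^2) * ln (M / b)" by simp
  also have "d powr (1 + \<alpha>) / d^2 = d powr (\<alpha> - 1)"
  proof -
   have "d powr (\<alpha> - 1) = d powr ((1 + \<alpha>) - 2)" by simp
   also have "\<dots> = d powr (1 + \<alpha>) / d powr 2" by (simp only: powr_diff)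
   also have "d powr 2 = d^2" using d by simp
   finally show ?thesis ..
  qed
  finally show ?thesis by (smt (verit) zero_le_power2)
 qed
qed

text \<open>What remains of the hypothesis on the modulus: a nonnegative function of class \<open>C\<^sup>1\<^sup>+\<^sup>\<alpha>\<close> satisfies
\<open>0 \<le> g x' \<le> 2 g y - g x + C d\<^sup>1\<^sup>+\<^sup>\<alpha>\<close>, where \<open>x'\<close> is the reflection of \<open>x\<close> at \<open>y\<close>.\<close>

definition admissible :: "real \<Rightarrow> real \<Rightarrow> real \<Rightarrow> real \<Rightarrow> (complex \<Rightarrow> real) \<Rightarrow> bool" where
 "admissible \<alpha> L C M g \<longleftrightarrow> 0 < \<alpha> \<and> \<alpha> < 1 \<and> 0 \<le> L \<and> 0 \<le> C \<and> 0 < M \<and>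
  (\<forall>x\<in>circle. 0 \<le> g x \<and> g x + 1 \<le> M) \<and>
  (\<forall>x\<in>circle. \<forall>y\<in>circle. \<bar>g x - g y\<bar> \<le> L * cmod (x - y) \<and> g x \<le> 2 * g y + C * cmod (x - y) powr (1 + \<alpha>))"

definition logM :: "real \<Rightarrow> (complex \<Rightarrow> real) \<Rightarrow> real \<Rightarrow> real" where
 "logM M g \<epsilon> = (LINT z|ds. ln (M / (g z + \<epsilon>)))"

context
 fixes \<alpha> L C M :: real and g :: "complex \<Rightarrow> real"
 assumes adm: "admissible \<alpha> L C M g"
begin

lemma adm_g: "z \<in> circle ==> 0 \<le> g z" "z \<in> circle ==> g z + 1 \<le> M"
 and adm_lip: "x \<in> circle ==> y \<in> circle ==> \<bar>g x - g y\<bar> \<le> L * cmod (x - y)"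
 and adm_C: "x \<in> circle ==> y \<in> circle ==> g x \<le> 2 * g y + C * cmod (x - y) powr (1 + \<alpha>)"
 and adm_pos: "0 < \<alpha>" "\<alpha> < 1" "0 \<le> L" "0 \<le> C" "0 < M"
 using adm by (auto simp: admissible_def)

lemma adm_measurable [measurable]: "g \<in> meas"
 by (rule lipschitz_circle_measurable) (use adm_lip in simp)

lemma log_reg_lipschitz:
 assumes \<epsilon>: "0 < \<epsilon>" and xy: "x \<in> circle" "y \<in> circle"
 shows "\<bar>ln (g x + \<epsilon>) - ln (g y + \<epsilon>)\<bar> \<le> (L / \<epsilon>) * cmod (x - y)"
proof -
 have "\<bar>ln (g x + \<epsilon>) - ln (g y + \<epsilon>)\<bar> \<le> \<bar>(g x + \<epsilon>) - (g y + \<epsilon>)\<bar> / \<epsilon>"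
  using adm_g(1)[OF xy(1)] adm_g(1)[OF xy(2)] \<epsilon> by (intro ln_diff_le) auto
 also have "\<dots> \<le> (L * cmod (x - y)) / \<epsilon>" using adm_lip[OF xy] \<epsilon> by (intro divide_right_mono) auto
 finally show ?thesis by simp
qed

lemma logM_nonneg: "z \<in> circle ==> 0 < \<epsilon> ==> \<epsilon> \<le> 1 ==> 0 \<le> ln (M / (g z + \<epsilon>))"
 using adm_g[of z] by simp

lemma logM_integrable:
 assumes \<epsilon>: "0 < \<epsilon>" "\<epsilon> \<le> 1"
 shows "integrable ds (\<lambda>z. ln (M / (g z + \<epsilon>)))"
proof (rule integrable_arc_bounded[where B="ln (M / \<epsilon>)"])
 fix z assume z: "z \<in> circle"
 have "M / (g z + \<epsilon>) \<le> M / \<epsilon>" using adm_g[OF z] adm_pos \<epsilon> by (intro divide_left_mono) (auto intro!: mult_pos_pos)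
 then have "ln (M / (g z + \<epsilon>)) \<le> ln (M / \<epsilon>)" using adm_g[OF z] adm_pos \<epsilon> by (intro ln_mono) (auto intro!: divide_pos_pos)
 then show "norm (ln (M / (g z + \<epsilon>))) \<le> ln (M / \<epsilon>)" using logM_nonneg[OF z \<epsilon>] by simp
qed measurable

text \<open>After the substitution \<open>y = x \<tau>\<close> the weight \<open>\<bar>x - y\<bar>\<^sup>\<alpha>\<^sup>-\<^sup>1\<close> left over in Carleson's integral integrates to this
constant.\<close>

definition kap :: real where
 "kap = enn2real (\<integral>\<^sup>+\<tau>. ennreal (cmod (1 - \<tau>) powr (\<alpha> - 1)) \<partial>ds)"

lemma carleson_bound:
 assumes \<epsilon>: "0 < \<epsilon>" "\<epsilon> \<le> 1"
 shows "carleson (\<lambda>z. ln (g z + \<epsilon>)) \<le> 16 * pi^2 * L^2 + 8 * M * C * kap * logM M g \<epsilon>"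
proof -
 let ?G = "\<lambda>z. ln (g z + \<epsilon>)"
 let ?l = "\<lambda>z. ln (M / (g z + \<epsilon>))"
 let ?PP = "ds2"
 let ?I = "\<lambda>p. (exp (2 * ?G (fst p)) - exp (2 * ?G (snd p))) * (?G (fst p) - ?G (snd p)) / (cmod (fst p - snd p))^2"
 let ?d = "\<lambda>p. cmod (fst p - snd p) powr (\<alpha> - 1)"
 have pw: "0 \<le> ?I p \<and> ?I p \<le> 4 * L^2 + 4 * M * C * ?d p * (?l (fst p) + ?l (snd p))" if p: "fst p \<in> circle" "snd p \<in> circle" for p
 proof -
  have e: "exp (2 * ?G z) = (g z + \<epsilon>)^2" if "z \<in> circle" for z
  proof -
   have "exp (2 * ?G z) = (exp (?G z))^2" by (simp add: power2_eq_square flip: exp_add)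
   then show ?thesis using adm_g(1)[OF that] \<epsilon> by simp
  qed
  have main: "((g x + \<epsilon>)^2 - (g y + \<epsilon>)^2) * (?G x - ?G y) / (cmod (x - y))^2 \<ge> 0 \<and>
   ((g x + \<epsilon>)^2 - (g y + \<epsilon>)^2) * (?G x - ?G y) / (cmod (x - y))^2 \<le> 4 * L^2 + 4 * M * C * cmod (x - y) powr (\<alpha> - 1) * (?l x + ?l y)"
   if xy: "x \<in> circle" "y \<in> circle" and le: "g y \<le> g x" for x y
  proof (cases "x = y")
   case True
   then show ?thesis using adm_pos logM_nonneg[OF xy(1) \<epsilon>] by simp
  next
   case False
   let ?b = "g y + \<epsilon>" and ?a = "g x + \<epsilon>" and ?D = "cmod (x - y)"
   have b: "0 < ?b" "?b \<le> ?a" "?a \<le> M" using adm_g[OF xy(1)] adm_g[OF xy(2)] \<epsilon> le by auto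
   have "(?a^2 - ?b^2) * (ln ?a - ln ?b) / ?D^2 \<le> 4 * L^2 + 4 * M * C * ?D powr (\<alpha> - 1) * ln (M / ?b)"
    using adm_lip[OF xy] adm_C[OF xy] adm_pos \<epsilon> False by (intro carleson_pointwise b) auto
   also have "\<dots> \<le> 4 * L^2 + 4 * M * C * ?D powr (\<alpha> - 1) * (?l x + ?l y)"
    using adm_pos logM_nonneg[OF xy(1) \<epsilon>] by (intro add_left_mono mult_left_mono) auto
   finally have 1: "(?a^2 - ?b^2) * (ln ?a - ln ?b) / ?D^2 \<le> 4 * L^2 + 4 * M * C * ?D powr (\<alpha> - 1) * (?l x + ?l y)" .
   have "?b^2 \<le> ?a^2" using b by (intro power_mono) auto
   then have "0 \<le> (?a^2 - ?b^2) * (ln ?a - ln ?b) / ?D^2" using b by (intro divide_nonneg_nonneg mult_nonneg_nonneg) auto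
   with 1 show ?thesis by blast
  qed
  show ?thesis
  proof (cases "g (snd p) \<le> g (fst p)")
   case True then show ?thesis using main[OF p True] by (simp only: e[OF p(1)] e[OF p(2)])
  next
   case False
   then have "g (fst p) \<le> g (snd p)" by simp
   from main[OF p(2,1) this] show ?thesis
    unfolding e[OF p(1)] e[OF p(2)] norm_minus_commute[of "fst p" "snd p"]
    by (simp add: algebra_simps)
  qed
 qed
 have sp: "fst p \<in> circle" "snd p \<in> circle" if "p \<in> space ?PP" for p using that by (auto simp: space_pair_measure)
 have int: "integrable ?PP ?I"
 proof (rule carleson_integrable[where B="\<bar>ln M\<bar>"])
  show "\<bar>?G x - ?G y\<bar> \<le> (L / \<epsilon>) * cmod (x - y)" if "x \<in> circle" "y \<in> circle" for x y by (rule log_reg_lipschitz[OF \<epsilon>(1) that])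
  show "?G x \<le> \<bar>ln M\<bar>" if "x \<in> circle" for x
  proof -
   have "?G x \<le> ln M" using adm_g[OF that] \<epsilon> adm_pos by simp
   then show ?thesis by linarith
  qed
 qed
 have lm: "(\<lambda>z. ennreal (?l z)) \<in> meas" by measurable
 have dm: "(\<lambda>p. ennreal (?d p)) \<in> borel_measurable ?PP" by measurable
 have mf: "(\<lambda>p. ennreal (?l (fst p))) \<in> borel_measurable ?PP" "(\<lambda>p. ennreal (?l (snd p))) \<in> borel_measurable ?PP"
  using measurable_compose[OF measurable_fst lm] measurable_compose[OF measurable_snd lm] by auto
 have kf: "(\<integral>\<^sup>+\<tau>. ennreal (cmod (1 - \<tau>) powr (\<alpha> - 1)) \<partial>ds) = ennreal kap"
  unfolding kap_def using chord_power_integral_finite[OF adm_pos(1,2)] by (simp add: less_top)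
 have kr: "(\<integral>\<^sup>+y. ennreal (cmod (x - y) powr (\<alpha> - 1)) \<partial>ds) = ennreal kap" if x: "x \<in> circle" for x
 proof -
  have "(\<lambda>y. ennreal (cmod (x - y) powr (\<alpha> - 1))) \<in> meas"
   by (rule borel_measurable_arc_length) measurable
  from nn_integral_rotate[OF this x, symmetric]
  have "(\<integral>\<^sup>+y. ennreal (cmod (x - y) powr (\<alpha> - 1)) \<partial>ds) = (\<integral>\<^sup>+\<tau>. ennreal (cmod (x - x * \<tau>) powr (\<alpha> - 1)) \<partial>ds)" .
  moreover have "cmod (x - x * \<tau>) = cmod (1 - \<tau>)" for \<tau>
   using x norm_mult[of x "1 - \<tau>"] by (simp add: right_diff_distrib)
  ultimately show ?thesis by (simp add: kf)
 qed
 have lint: "(\<integral>\<^sup>+z. ennreal (?l z) \<partial>ds) = ennreal (logM M g \<epsilon>)"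
  unfolding logM_def by (rule nn_integral_eq_integral[OF logM_integrable[OF \<epsilon>]]) (auto intro!: AE_I2 logM_nonneg \<epsilon>)
 have l0: "0 \<le> logM M g \<epsilon>" unfolding logM_def by (rule integral_nonneg_AE) (auto intro!: AE_I2 logM_nonneg \<epsilon>)
 have k0: "0 \<le> kap" by (simp add: kap_def)
 have I1: "(\<integral>\<^sup>+p. ennreal (?d p) * ennreal (?l (fst p)) \<partial>?PP) = ennreal (kap * logM M g \<epsilon>)"
 proof -
  have "(\<integral>\<^sup>+p. ennreal (?d p) * ennreal (?l (fst p)) \<partial>?PP) = (\<integral>\<^sup>+x. \<integral>\<^sup>+y. ennreal (cmod (x - y) powr (\<alpha> - 1)) * ennreal (?l x) \<partial>ds \<partial>ds)"
   using dm mf by (subst arc.nn_integral_fst[symmetric]) auto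
  also have "\<dots> = (\<integral>\<^sup>+x. ennreal kap * ennreal (?l x) \<partial>ds)"
  proof (rule nn_integral_cong)
   fix x assume "x \<in> space ds"
   then have x: "x \<in> circle" by simp
   have "(\<lambda>y. ennreal (cmod (x - y) powr (\<alpha> - 1))) \<in> meas"
    by (rule borel_measurable_arc_length) measurable
   then show "(\<integral>\<^sup>+y. ennreal (cmod (x - y) powr (\<alpha> - 1)) * ennreal (?l x) \<partial>ds) = ennreal kap * ennreal (?l x)"
    by (simp add: nn_integral_multc kr[OF x])
  qed
  also have "\<dots> = ennreal kap * ennreal (logM M g \<epsilon>)" using lm by (simp add: nn_integral_cmult lint)
  finally show ?thesis using k0 by (simp add: ennreal_mult')
 qed
 have I2: "(\<integral>\<^sup>+p. ennreal (?d p) * ennreal (?l (snd p)) \<partial>?PP) = ennreal (kap * logM M g \<epsilon>)"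
 proof -
  have "(\<integral>\<^sup>+p. ennreal (?d p) * ennreal (?l (snd p)) \<partial>?PP) = (\<integral>\<^sup>+y. \<integral>\<^sup>+x. ennreal (cmod (x - y) powr (\<alpha> - 1)) * ennreal (?l y) \<partial>ds \<partial>ds)"
   using dm mf by (subst arc2.nn_integral_snd[symmetric]) auto
  also have "\<dots> = (\<integral>\<^sup>+x. ennreal kap * ennreal (?l x) \<partial>ds)"
  proof (rule nn_integral_cong)
   fix y assume "y \<in> space ds"
   then have y: "y \<in> circle" by simp
   have "(\<lambda>x. ennreal (cmod (x - y) powr (\<alpha> - 1))) \<in> meas"
    by (rule borel_measurable_arc_length) measurable
   then show "(\<integral>\<^sup>+x. ennreal (cmod (x - y) powr (\<alpha> - 1)) * ennreal (?l y) \<partial>ds) = ennreal kap * ennreal (?l y)"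
    using kr[OF y] by (simp add: nn_integral_multc norm_minus_commute)
  qed
  also have "\<dots> = ennreal kap * ennreal (logM M g \<epsilon>)" using lm by (simp add: nn_integral_cmult lint)
  finally show ?thesis using k0 by (simp add: ennreal_mult')
 qed
 have "ennreal (carleson ?G) = (\<integral>\<^sup>+p. ennreal (?I p) \<partial>?PP)"
  unfolding carleson_def by (rule nn_integral_eq_integral[OF int, symmetric]) (use pw sp in \<open>auto intro!: AE_I2\<close>)
 also have "\<dots> \<le> (\<integral>\<^sup>+p. ennreal (4 * L^2) + ennreal (4 * M * C) * (ennreal (?d p) * ennreal (?l (fst p)) + ennreal (?d p) * ennreal (?l (snd p))) \<partial>?PP)"
 proof (rule nn_integral_mono)
  fix p assume "p \<in> space ?PP"
  note p = sp[OF this]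
  have ll: "0 \<le> ?l (fst p)" "0 \<le> ?l (snd p)" by (rule logM_nonneg[OF p(1) \<epsilon>], rule logM_nonneg[OF p(2) \<epsilon>])
  have "ennreal (?I p) \<le> ennreal (4 * L^2 + (4 * M * C) * (?d p * ?l (fst p) + ?d p * ?l (snd p)))"
   using pw[OF p] by (intro ennreal_leI) (simp add: algebra_simps)
  also have "\<dots> = ennreal (4 * L^2) + ennreal ((4 * M * C) * (?d p * ?l (fst p) + ?d p * ?l (snd p)))"
   using ll adm_pos by (intro ennreal_plus mult_nonneg_nonneg add_nonneg_nonneg) auto
  also have "ennreal ((4 * M * C) * (?d p * ?l (fst p) + ?d p * ?l (snd p))) = ennreal (4 * M * C) * ennreal (?d p * ?l (fst p) + ?d p * ?l (snd p))"
   using ll adm_pos by (intro ennreal_mult mult_nonneg_nonneg add_nonneg_nonneg) auto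
  also have "ennreal (?d p * ?l (fst p) + ?d p * ?l (snd p)) = ennreal (?d p) * ennreal (?l (fst p)) + ennreal (?d p) * ennreal (?l (snd p))"
   using ll by (subst ennreal_plus) (auto simp: ennreal_mult)
  finally show "ennreal (?I p) \<le> ennreal (4 * L^2) + ennreal (4 * M * C) * (ennreal (?d p) * ennreal (?l (fst p)) + ennreal (?d p) * ennreal (?l (snd p)))" .
 qed
 also have "\<dots> = ennreal (4 * L^2) * ennreal (4 * pi^2) + ennreal (4 * M * C) * (ennreal (kap * logM M g \<epsilon>) + ennreal (kap * logM M g \<epsilon>))"
  using dm mf by (subst nn_integral_add, simp, simp, subst nn_integral_cmult, simp, subst nn_integral_add, simp, simp) (simp add: I1 I2 emeasure_PP)
 also have "\<dots> = ennreal (16 * pi^2 * L^2 + 8 * M * C * kap * logM M g \<epsilon>)"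
  using k0 l0 adm_pos by (simp add: ennreal_mult[symmetric] ennreal_plus[symmetric] algebra_simps del: ennreal_plus)
 finally show ?thesis
  using k0 l0 adm_pos by (subst (asm) ennreal_le_iff) (auto intro!: add_nonneg_nonneg mult_nonneg_nonneg)
qed

text \<open>By Fatou's lemma a bound on the logarithmic means would make \<open>log g\<close> integrable.\<close>

lemma logM_unbounded:
 assumes f: "\<And>z. z \<in> circle ==> cmod (f z) = g z" and nl: "\<not> log_modulus_integrable f"
 shows "\<exists>\<epsilon>. 0 < \<epsilon> \<and> \<epsilon> \<le> 1 \<and> B < logM M g \<epsilon>"
proof (rule ccontr)
 assume "\<not> ?thesis"
 then have le: "logM M g \<epsilon> \<le> B" if "0 < \<epsilon>" "\<epsilon> \<le> 1" for \<epsilon> using that by force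
 define e where "e k = inverse (real (Suc k))" for k
 have e: "0 < e k" "e k \<le> 1" for k by (auto simp: e_def inverse_le_1_iff)
 have e0: "e \<longlonglongrightarrow> 0" unfolding e_def by (rule LIMSEQ_inverse_real_of_nat)
 let ?l = "\<lambda>k z. ln (M / (g z + e k))"
 let ?X = "\<lambda>z. if g z = 0 then \<infinity> else ennreal (ln (M / g z))"
 have fat: "(\<integral>\<^sup>+z. liminf (\<lambda>k. ennreal (?l k z)) \<partial>ds) \<le> liminf (\<lambda>k. \<integral>\<^sup>+z. ennreal (?l k z) \<partial>ds)"
  by (rule nn_integral_liminf) measurable
 have eq: "(\<integral>\<^sup>+z. ennreal (?l k z) \<partial>ds) = ennreal (logM M g (e k))" for k
  unfolding logM_def by (rule nn_integral_eq_integral[OF logM_integrable[OF e]]) (auto intro!: AE_I2 logM_nonneg e)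
 have "(\<integral>\<^sup>+z. ?X z \<partial>ds) = (\<integral>\<^sup>+z. liminf (\<lambda>k. ennreal (?l k z)) \<partial>ds)"
 proof (rule nn_integral_cong)
  fix z assume "z \<in> space ds"
  then have z: "z \<in> circle" by simp
  have "(\<lambda>k. ennreal (?l k z)) \<longlonglongrightarrow> ?X z"
  proof (cases "g z = 0")
   case True
   have "filterlim (\<lambda>k. ln (M * real (Suc k))) at_top sequentially"
    using adm_pos by (intro filterlim_compose[OF ln_at_top] filterlim_tendsto_pos_mult_at_top[OF tendsto_const]
     filterlim_compose[OF filterlim_real_sequentially filterlim_Suc]) auto
   then have "(\<lambda>k. ennreal (ln (M * real (Suc k)))) \<longlonglongrightarrow> \<top>" by (simp only: ennreal_tendsto_top_eq_at_top)
   moreover have "M / (0 + e k) = M * real (Suc k)" for k by (simp add: e_def field_simps)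
   ultimately show ?thesis using True by simp
  next
   case False
   then have p: "0 < g z" using adm_g[OF z] by simp
   have "(\<lambda>k. ennreal (?l k z)) \<longlonglongrightarrow> ennreal (ln (M / (g z + 0)))"
    using p adm_pos by (intro tendsto_intros e0) auto
   then show ?thesis using False by simp
  qed
  then show "?X z = liminf (\<lambda>k. ennreal (?l k z))" by (simp add: lim_imp_Liminf)
 qed
 also note fat
 also have "liminf (\<lambda>k. \<integral>\<^sup>+z. ennreal (?l k z) \<partial>ds) \<le> liminf (\<lambda>k. ennreal B)"
  unfolding eq by (intro Liminf_mono always_eventually allI ennreal_leI le e)
 also have "liminf (\<lambda>k. ennreal B) = ennreal B" by (simp add: Liminf_const)
 finally have fin: "(\<integral>\<^sup>+z. ?X z \<partial>ds) \<le> ennreal B" .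
 have Xm: "?X \<in> meas" by measurable
 have "AE z in ds. ?X z \<noteq> \<infinity>"
  using fin by (intro nn_integral_noteq_infinite Xm) (auto simp: top_unique)
 then have nz: "AE z in ds. g z \<noteq> 0" by eventually_elim auto
 have il: "integrable ds (\<lambda>z. ln (M / g z))"
 proof (rule integrableI_bounded)
  have "(\<integral>\<^sup>+z. ennreal (norm (ln (M / g z))) \<partial>ds) \<le> (\<integral>\<^sup>+z. ?X z \<partial>ds)"
  proof (rule nn_integral_mono)
   fix z assume "z \<in> space ds"
   then have z: "z \<in> circle" by simp
   show "ennreal (norm (ln (M / g z))) \<le> ?X z"
   proof (cases "g z = 0")
    case False
    then have "1 \<le> M / g z" using adm_g[OF z] by (simp add: le_divide_eq)
    then show ?thesis using False by simp
   qed simp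
  qed
  with fin show "(\<integral>\<^sup>+z. ennreal (norm (ln (M / g z))) \<partial>ds) < \<infinity>"
   by (auto intro: le_less_trans order_trans)
 qed measurable
 have "integrable ds (\<lambda>z. ln (cmod (f z)))"
 proof (rule integrable_cong_AE_imp)
  show "integrable ds (\<lambda>z. ln M - ln (M / g z))" using il by auto
  have fm: "(\<lambda>z. cmod (f z)) \<in> meas"
   using adm_measurable f by (subst measurable_cong[of _ _ g]) auto
  then show "(\<lambda>z. ln (cmod (f z))) \<in> meas" by measurable
  show "AE z in ds. ln M - ln (M / g z) = ln (cmod (f z))"
   using nz AE_space
  proof eventually_elim
   case (elim z)
   then have "0 < g z" using adm_g[of z] by (simp add: less_le)
   then show ?case using elim adm_pos f[of z] by (simp add: ln_div)
  qed
 qed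
 moreover have "AE z in ds. f z \<noteq> 0" using nz AE_space by eventually_elim (use f in force)
 ultimately show False using nl by (simp add: log_modulus_integrable_def)
qed

end

section \<open>The inverse shift\<close>

lemma square_quotient_diff_le:
 fixes a b A B :: complex
 assumes a: "cmod a \<le> c * cmod A" and b: "cmod b \<le> c * cmod B" and nz: "A \<noteq> 0" "B \<noteq> 0" and c: "0 \<le> c"
 shows "cmod (a^2 / A - b^2 / B) \<le> (2 * c) * cmod (a - b) + c^2 * cmod (A - B)"
proof -
 have main: "cmod (a^2 / A - b^2 / B) \<le> (2 * c) * cmod (a - b) + c^2 * cmod (A - B)"
  if a: "cmod a \<le> c * cmod A" and b: "cmod b \<le> c * cmod B" and nz: "A \<noteq> 0" "B \<noteq> 0" and le: "cmod B \<le> cmod A" for a b A B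
 proof -
  have bA: "cmod b \<le> c * cmod A" using b mult_left_mono[OF le c] by linarith
  have "a^2 / A - b^2 / B = (a + b) * (a - b) / A + b * b * (B - A) / (A * B)"
   using nz by (simp add: field_simps power2_eq_square)
  then have "cmod (a^2 / A - b^2 / B) \<le> cmod ((a + b) * (a - b) / A) + cmod (b * b * (B - A) / (A * B))"
   by (simp only: norm_triangle_ineq)
  also have "cmod ((a + b) * (a - b) / A) \<le> (2 * c) * cmod (a - b)"
  proof -
   have "cmod (a + b) \<le> 2 * c * cmod A" using norm_triangle_ineq[of a b] a bA by linarith
   then have "cmod (a + b) / cmod A \<le> 2 * c" using nz by (simp add: divide_le_eq)
   then have "cmod (a + b) / cmod A * cmod (a - b) \<le> (2 * c) * cmod (a - b)" by (intro mult_right_mono) auto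
   then show ?thesis by (simp add: norm_mult norm_divide)
  qed
  also have "cmod (b * b * (B - A) / (A * B)) \<le> c^2 * cmod (A - B)"
  proof -
   have "cmod b / cmod A \<le> c" using bA nz by (simp add: divide_le_eq)
   moreover have "cmod b / cmod B \<le> c" using b nz by (simp add: divide_le_eq)
   ultimately have "(cmod b / cmod A) * (cmod b / cmod B) \<le> c * c" using c by (intro mult_mono) auto
   then have "(cmod b / cmod A) * (cmod b / cmod B) * cmod (B - A) \<le> c * c * cmod (B - A)" by (intro mult_right_mono) auto
   then show ?thesis by (simp add: norm_mult norm_divide power2_eq_square norm_minus_commute)
  qed
  finally show ?thesis by simp
 qed
 show ?thesis
 proof (cases "cmod B \<le> cmod A")
  case True then show ?thesis by (rule main[OF a b nz])
 next
  case False
  then have "cmod (b^2 / B - a^2 / A) \<le> (2 * c) * cmod (b - a) + c^2 * cmod (B - A)" by (intro main a b nz) auto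
  then show ?thesis by (simp add: norm_minus_commute)
 qed
qed

text \<open>If \<open>F\<close> is nearly outer with modulus \<open>g + \<epsilon>\<close>, then \<open>F(0) f^2 / F\<close> is small in the Dirichlet space:
 its energy is at most a constant times that of \<open>f\<close> and of \<open>F\<close>, the latter grows at most like
 the integral \<open>l\<close> of \<open>log (1 / (g + \<epsilon>))\<close>, while \<open>\<bar>F(0)\<bar>^2\<close> is of the order of \<open>exp (- l / \<pi>)\<close>.\<close>

theorem approximable_inverse_shift:
 assumes adm: "admissible \<alpha> L C M g" and f: "f \<in> HD"
  and fg: "\<And>z. z \<in> circle ==> cmod (f z) = g z" and nl: "\<not> log_modulus_integrable f"
 shows "approximable (\<lambda>z. (f z)^2) (\<lambda>z. cnj z * (f z)^2)"
proof -
 let ?q = "\<lambda>z. (f z)^2"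
 note ag = adm_g[OF adm] and ap = adm_pos[OF adm]
 have fM: "cmod (f z) \<le> M" if "z \<in> circle" for z using ag(2)[OF that] fg[OF that] by simp
 have fm: "f \<in> meas" by (rule harmonic_measurable[OF f])
 have bf: "bounded_dirichlet f" unfolding bounded_dirichlet_def using f fM by blast
 have bq: "bounded_dirichlet ?q" using bounded_dirichlet_mult[OF bf bf] by (simp add: power2_eq_square)
 have bz: "bounded_dirichlet (\<lambda>z. cnj z)" by (rule bounded_dirichlet_lipschitz[where L=1]) (simp add: cmod_cnj_diff)
 have bzq: "bounded_dirichlet (\<lambda>z. cnj z * ?q z)" by (rule bounded_dirichlet_mult[OF bz bq])
 define E where "E = enn2real (dirE f)"
 have E: "dirE f = ennreal E" "0 \<le> E" using harmonic_dirE[OF f] by (simp_all add: E_def less_top)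
 define k where "k = kap \<alpha>"
 have k0: "0 \<le> k" by (simp add: k_def kap_def[OF adm])
 let ?e = "exp (1::real)"
 define A0 where "A0 = 2 * pi * (?e * M)^2 + 2 * (2 * ?e)^2 * E + 2 * (?e^2)^2 * (16 * pi^2 * L^2 + 1)"
 define A1 where "A1 = 2 * (?e^2)^2 * (8 * M * C * k)"
 have A: "0 \<le> A0" "0 \<le> A1" unfolding A0_def A1_def using ap k0 E by (auto intro!: add_nonneg_nonneg mult_nonneg_nonneg)
 let ?R = "\<lambda>l. (M^2 * (2 + 4 * pi * 1^2)) * (exp (- l / pi) * (A0 + A1 * l))"
 have Rlim: "(?R \<longlongrightarrow> 0) at_top"
 proof -
  have x: "filterlim (\<lambda>l::real. l / pi) at_top at_top"
   using filterlim_tendsto_pos_mult_at_top[OF tendsto_const[of "inverse pi"] _ filterlim_ident] by (simp add: divide_inverse mult.commute)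
  have a: "((\<lambda>l. (l / pi) ^ 0 / exp (l / pi)) \<longlongrightarrow> 0) at_top" by (rule filterlim_compose[OF tendsto_power_div_exp_0 x])
  have b: "((\<lambda>l. (l / pi) ^ 1 / exp (l / pi)) \<longlongrightarrow> 0) at_top" by (rule filterlim_compose[OF tendsto_power_div_exp_0 x])
  have "((\<lambda>l. (M^2 * (2 + 4 * pi * 1^2)) * (A0 * ((l / pi) ^ 0 / exp (l / pi)) + (A1 * pi) * ((l / pi) ^ 1 / exp (l / pi)))) \<longlongrightarrow> (M^2 * (2 + 4 * pi * 1^2)) * (A0 * 0 + (A1 * pi) * 0)) at_top"
   by (intro tendsto_intros a b)
  moreover have "(\<lambda>l. (M^2 * (2 + 4 * pi * 1^2)) * (A0 * ((l / pi) ^ 0 / exp (l / pi)) + (A1 * pi) * ((l / pi) ^ 1 / exp (l / pi)))) = ?R"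
   by (rule ext) (simp add: exp_minus field_simps)
  ultimately show ?thesis by simp
 qed
 show ?thesis
 proof (rule approximable_closed[OF bq])
  show "(\<lambda>z. cnj z * ?q z) \<in> HD" using bzq by (simp add: bounded_dirichlet_def)
  fix \<delta> :: real assume \<delta>: "0 < \<delta>"
  obtain B where B: "\<And>l. B \<le> l ==> ?R l < \<delta>" using order_tendstoD(2)[OF Rlim \<delta>] by (auto simp: eventually_at_top_linorder)
  obtain \<epsilon> where \<epsilon>: "0 < \<epsilon>" "\<epsilon> \<le> 1" "B < logM M g \<epsilon>" using logM_unbounded[OF adm fg nl] by blast
  define l where "l = logM M g \<epsilon>"
  have l0: "0 \<le> l" unfolding l_def logM_def by (rule integral_nonneg_AE) (auto intro!: AE_I2 logM_nonneg[OF adm] \<epsilon>)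
  let ?G = "\<lambda>z. ln (g z + \<epsilon>)"
  have lip: "\<bar>?G x - ?G y\<bar> \<le> (L / \<epsilon>) * cmod (x - y)" if "x \<in> circle" "y \<in> circle" for x y by (rule log_reg_lipschitz[OF adm \<epsilon>(1) that])
  obtain Q where Q: "Q holomorphic_on UNIV" "\<And>z. z \<in> circle ==> \<bar>Re (Q z) - ?G z\<bar> \<le> 1"
   "Re (Q 0) = (LINT z|ds. ?G z) / (2 * pi)" "dirE (\<lambda>z. exp (Q z)) \<le> ennreal (carleson ?G + 1)"
   using outer_approximation[where G="?G" and \<eta>=1, OF lip] by (metis zero_less_one)
  have Gi: "(LINT z|ds. ?G z) = 2 * pi * ln M - l"
  proof -
   have "(LINT z|ds. ?G z) = (LINT z|ds. ln M - ln (M / (g z + \<epsilon>)))"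
   proof (intro Bochner_Integration.integral_cong refl)
    fix z assume "z \<in> space ds"
    then have "0 < g z + \<epsilon>" using ag(1)[of z] \<epsilon> by simp
    then show "?G z = ln M - ln (M / (g z + \<epsilon>))" using ap by (simp add: ln_div)
   qed
   also have "\<dots> = 2 * pi * ln M - l" using logM_integrable[OF adm \<epsilon>(1,2)] by (simp add: l_def logM_def measure_arc_length)
   finally show ?thesis .
  qed
  have Q0: "(cmod (exp (Q 0)))^2 = M^2 * exp (- l / pi)"
  proof -
   have "(cmod (exp (Q 0)))^2 = exp (2 * Re (Q 0))" by (simp add: norm_exp_eq_Re power2_eq_square flip: exp_add)
   also have "2 * Re (Q 0) = 2 * ln M + (- l / pi)" unfolding Q(3) Gi by (simp add: field_simps)
   also have "exp \<dots> = exp (ln M) * exp (ln M) * exp (- l / pi)" by (simp add: exp_add[symmetric])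
   finally show ?thesis using ap by (simp add: power2_eq_square)
  qed
  let ?F = "\<lambda>z. exp (Q z)"
  have Fl: "g z \<le> ?e * cmod (?F z)" "cmod (f z) \<le> ?e * cmod (?F z)" if z: "z \<in> circle" for z
  proof -
   have p: "0 < g z + \<epsilon>" using ag(1)[OF z] \<epsilon> by simp
   have "g z \<le> g z + \<epsilon>" using \<epsilon> by simp
   also have "\<dots> = exp (?G z)" using p by simp
   also have "\<dots> \<le> exp (1 + Re (Q z))" using Q(2)[OF z] by simp
   also have "\<dots> = ?e * cmod (?F z)" by (simp add: exp_add norm_exp_eq_Re)
   finally show "g z \<le> ?e * cmod (?F z)" "cmod (f z) \<le> ?e * cmod (?F z)" by (simp_all add: fg[OF z])
  qed
  let ?w = "\<lambda>z. ?q z * exp (- Q z)"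
  have wq: "?w z = ?q z / ?F z" for z by (simp add: exp_minus divide_inverse)
  have Fm: "?F \<in> meas" "(\<lambda>z. exp (- Q z)) \<in> meas"
   using holomorphic_on_imp_continuous_on[OF Q(1)] by (auto intro!: continuous_on_circle_measurable continuous_intros intro: continuous_on_subset)
  have wm: "?w \<in> meas" using fm Fm(2) by measurable
  have wB: "cmod (?w z) \<le> ?e * M" if z: "z \<in> circle" for z
  proof -
   have "cmod (?w z) = cmod (f z) * (cmod (f z) / cmod (?F z))" unfolding wq by (simp add: norm_divide norm_mult norm_power power2_eq_square)
   also have "\<dots> \<le> M * ?e" using Fl(2)[OF z] fM[OF z] ap by (intro mult_mono) (auto simp: divide_le_eq)
   finally show ?thesis by (simp add: mult.commute)
  qed
  have dw: "dirE ?w \<le> ennreal (2 * (2 * ?e)^2) * dirE f + ennreal (2 * (?e^2)^2) * dirE ?F"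
  proof (rule dirE_add_le[OF fm Fm(1) wm])
   show "cmod (?w x - ?w y) \<le> (2 * ?e) * cmod (f x - f y) + ?e^2 * cmod (?F x - ?F y)" if "x \<in> circle" "y \<in> circle" for x y
    unfolding wq by (rule square_quotient_diff_le[OF Fl(2)[OF that(1)] Fl(2)[OF that(2)]]) auto
  qed auto
  have dF: "dirE ?F \<le> ennreal (16 * pi^2 * L^2 + 8 * M * C * k * l + 1)"
   using carleson_bound[OF adm \<epsilon>(1,2)] by (intro order_trans[OF Q(4)] ennreal_leI) (simp add: l_def k_def)
  have "DN ?w \<le> ennreal (2 * pi * (?e * M)^2) + (ennreal (2 * (2 * ?e)^2) * ennreal E + ennreal (2 * (?e^2)^2) * ennreal (16 * pi^2 * L^2 + 8 * M * C * k * l + 1))"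
   unfolding DN_def E(1)[symmetric] by (intro order_trans[OF dw] add_mono order_refl L2sq_bounded wB mult_left_mono dF) auto
  also have "\<dots> = ennreal (2 * pi * (?e * M)^2 + (2 * (2 * ?e)^2 * E + 2 * (?e^2)^2 * (16 * pi^2 * L^2 + 8 * M * C * k * l + 1)))"
   using E ap k0 l0 by (subst ennreal_plus ennreal_mult; simp add: add_nonneg_nonneg mult_nonneg_nonneg)+
  also have "2 * pi * (?e * M)^2 + (2 * (2 * ?e)^2 * E + 2 * (?e^2)^2 * (16 * pi^2 * L^2 + 8 * M * C * k * l + 1)) = A0 + A1 * l"
   unfolding A0_def A1_def by (simp only: distrib_left distrib_right mult_ac add_ac)
  finally have DNw: "DN ?w \<le> ennreal (A0 + A1 * l)" .
  have wh: "?w \<in> HD" unfolding harmonic_dirichlet_iff using wm DNw by (auto intro: le_less_trans)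
  let ?k = "\<lambda>z. cnj z * ?q z - exp (Q 0) * (cnj z * ?q z * exp (- Q z))"
  have "DN (\<lambda>z. cnj z * ?q z - ?k z) = DN (\<lambda>z. exp (Q 0) * (cnj z * ?w z))" by (simp add: mult.assoc)
  also have "\<dots> = ennreal ((cmod (exp (Q 0)))^2) * DN (\<lambda>z. cnj z * ?w z)"
  proof (rule DN_cmult)
   have "(\<lambda>z. cnj z) \<in> meas" by (rule borel_measurable_arc_length) measurable
   then show "(\<lambda>z. cnj z * ?w z) \<in> meas" using wm by (rule borel_measurable_times)
  qed
  also have "DN (\<lambda>z. cnj z * ?w z) \<le> ennreal (2 + 4 * pi * 1^2) * DN ?w"
   by (rule DN_unimodular[OF bq wh]) (auto simp: cmod_cnj_diff)
  also have "ennreal (2 + 4 * pi * 1^2) * DN ?w \<le> ennreal (2 + 4 * pi * 1^2) * ennreal (A0 + A1 * l)" by (intro mult_left_mono DNw) auto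
  also have "ennreal ((cmod (exp (Q 0)))^2) * (ennreal (2 + 4 * pi * 1^2) * ennreal (A0 + A1 * l)) = ennreal (?R l)"
  proof -
   have n: "0 \<le> A0 + A1 * l" "0 \<le> 2 + 4 * pi * 1^2" using A l0 by (auto intro!: add_nonneg_nonneg)
   have "?R l = (M^2 * exp (- l / pi)) * ((2 + 4 * pi * 1^2) * (A0 + A1 * l))" by (simp only: mult_ac)
   then show ?thesis unfolding Q0 using n by (simp only: ennreal_mult mult_nonneg_nonneg zero_le_power2 exp_ge_zero)
  qed
  also have "\<dots> < ennreal \<delta>" using B[of l] \<epsilon>(3) \<delta> by (intro ennreal_lessI) (auto simp: l_def)
  finally have "DN (\<lambda>z. cnj z * ?q z - ?k z) < ennreal \<delta>" by (simp add: mult_left_mono)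
  then show "\<exists>k. approximable ?q k \<and> DN (\<lambda>z. cnj z * ?q z - k z) < ennreal \<delta>"
   using approximable_analytic_quotient[OF bq Q(1)] by blast
 qed
qed

lemma AE_snd_PP:
 assumes "AE x in ds. P x" shows "AE p in ds2. P (snd p)"
proof -
 obtain N where N: "N \<in> null_sets ds" "{x \<in> space ds. \<not> P x} \<subseteq> N" using assms unfolding eventually_ae_filter by auto
 have "space ds \<times> N \<in> null_sets ds2" by (rule arc.times_in_null_sets2[OF sets.top N(1)])
 then show ?thesis by (rule AE_I') (use N(2) in \<open>auto simp: space_pair_measure\<close>)
qed

context
 fixes q :: "complex \<Rightarrow> complex"
 assumes q: "bounded_dirichlet q" and inv: "approximable q (\<lambda>z. cnj z * q z)"
begin

text \<open>The Fejer means of a bounded \<open>h\<close> are uniformly bounded and a subsequence converges almost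
 everywhere, so that in the energy of \<open>(h - \<sigma>\<^sub>N h) q\<close> the part with the differences of \<open>q\<close> is
 dominated.\<close>

lemma approximable_bounded_mult:
 assumes h: "bounded_dirichlet h" shows "approximable q (\<lambda>z. h z * q z)"
proof -
 obtain B where B: "h \<in> HD" "h \<in> meas" "\<And>z. z \<in> circle ==> cmod (h z) \<le> B" "0 \<le> B"
  using bounded_dirichletE[OF h] by metis
 obtain D where D: "q \<in> HD" "q \<in> meas" "\<And>z. z \<in> circle ==> cmod (q z) \<le> D" "0 \<le> D"
  using bounded_dirichletE[OF q] by metis
 note [measurable] = B(2) D(2)
 define d where "d n z = h z - fejer_mean n h z" for n z
 have dh: "d n \<in> HD" for n unfolding d_def by (intro harmonic_diff B(1) fejer_mean_harmonic)
 have dm[measurable]: "d n \<in> meas" for n by (rule harmonic_measurable[OF dh])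
 have dB: "cmod (d n z) \<le> 2 * B" if "z \<in> circle" for n z
  using norm_triangle_ineq4[of "h z" "fejer_mean n h z"] B(3)[OF that] fejer_mean_bound[OF B(2,3) that, of n] unfolding d_def by linarith
 have lim: "(\<lambda>n. DN (d n)) \<longlonglongrightarrow> 0" unfolding d_def by (rule fejer_mean_tendsto[OF B(1)])
 have L2: "(\<lambda>n. L2sq (d n)) \<longlonglongrightarrow> 0"
  by (rule tendsto_sandwich[OF _ _ tendsto_const lim]) (auto simp: DN_def)
 have i2: "integrable ds (\<lambda>z. (cmod (d n z))^2)" for n using harmonic_L2[OF dh] by (simp add: L2_circle_def)
 have "(\<lambda>n. enn2real (L2sq (d n))) \<longlonglongrightarrow> enn2real 0" using L2 by (intro tendsto_enn2real) auto
 then have "(\<lambda>n. LINT z|ds. norm ((cmod (d n z))^2)) \<longlonglongrightarrow> 0"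
  unfolding L2sq_eq_integral[OF harmonic_L2[OF dh]] by simp
 then obtain r where r: "strict_mono r" "AE z in ds. (\<lambda>n. (cmod (d (r n) z))^2) \<longlonglongrightarrow> 0"
  using tendsto_L1_AE_subseq[where u="\<lambda>n z. (cmod (d n z))^2", OF i2] by blast
 have ae: "AE z in ds. (\<lambda>n. cmod (d (r n) z)) \<longlonglongrightarrow> 0"
  using r(2)
 proof eventually_elim
  case (elim z)
  then have "(\<lambda>n. sqrt ((cmod (d (r n) z))^2)) \<longlonglongrightarrow> sqrt 0" by (rule tendsto_real_sqrt)
  then show ?case by simp
 qed
 let ?PP = "ds2"
 let ?Dq = "\<lambda>p. cmod (q (fst p) - q (snd p)) / cmod (fst p - snd p)"
 let ?J = "\<lambda>n. \<integral>\<^sup>+p. ennreal ((cmod (d n (snd p)) * ?Dq p)^2) \<partial>?PP"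
 have "(\<lambda>n. ?J (r n)) \<longlonglongrightarrow> (\<integral>\<^sup>+p. 0 \<partial>?PP)"
 proof (rule nn_integral_dominated_convergence)
  have "(\<integral>\<^sup>+p. ennreal ((2 * B * ?Dq p)^2) \<partial>?PP) = (\<integral>\<^sup>+p. ennreal ((2 * B)^2) * ennreal ((?Dq p)^2) \<partial>?PP)"
   by (intro nn_integral_cong) (simp only: power_mult_distrib[of "2 * B"] ennreal_mult zero_le_power2)
  also have "\<dots> = ennreal ((2 * B)^2) * dirE q" unfolding dirE_def by (rule nn_integral_cmult) measurable
  also have "\<dots> < \<infinity>" using harmonic_dirE[OF D(1)] by (simp add: ennreal_mult_less_top)
  finally show "(\<integral>\<^sup>+p. ennreal ((2 * B * ?Dq p)^2) \<partial>?PP) < \<infinity>" .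
  show "AE p in ?PP. ennreal ((cmod (d (r n) (snd p)) * ?Dq p)^2) \<le> ennreal ((2 * B * ?Dq p)^2)" for n
  proof (rule AE_I2)
   fix p assume "p \<in> space ?PP"
   then have "cmod (d (r n) (snd p)) \<le> 2 * B" by (intro dB) (auto simp: space_pair_measure)
   then show "ennreal ((cmod (d (r n) (snd p)) * ?Dq p)^2) \<le> ennreal ((2 * B * ?Dq p)^2)"
    by (intro ennreal_leI power_mono mult_right_mono) auto
  qed
  show "AE p in ?PP. (\<lambda>n. ennreal ((cmod (d (r n) (snd p)) * ?Dq p)^2)) \<longlonglongrightarrow> 0"
   using AE_snd_PP[OF ae]
  proof eventually_elim
   case (elim p)
   have "(\<lambda>n. ennreal ((cmod (d (r n) (snd p)) * ?Dq p)^2)) \<longlonglongrightarrow> ennreal ((0 * ?Dq p)^2)" by (intro tendsto_intros elim)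
   then show ?case by simp
  qed
 qed measurable
 then have J: "(\<lambda>n. ?J (r n)) \<longlonglongrightarrow> 0" by simp
 have est: "DN (\<lambda>z. d n z * q z) \<le> ennreal (3 * D^2) * DN (d n) + 2 * ?J n" for n
 proof -
  have "L2sq (\<lambda>z. d n z * q z) \<le> (\<integral>\<^sup>+z. ennreal (D^2) * ennreal ((cmod (d n z))^2) \<partial>ds)"
   unfolding L2sq_def
  proof (rule nn_integral_mono)
   fix z assume "z \<in> space ds"
   then have "(cmod (q z))^2 \<le> D^2" by (intro power_mono D(3)) auto
   then show "ennreal ((cmod (d n z * q z))^2) \<le> ennreal (D^2) * ennreal ((cmod (d n z))^2)"
    by (simp add: norm_mult power_mult_distrib mult.commute[of "(cmod (d n z))^2"] mult_right_mono flip: ennreal_mult)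
  qed
  also have "\<dots> = ennreal (D^2) * L2sq (d n)" unfolding L2sq_def by (rule nn_integral_cmult) measurable
  finally have 1: "L2sq (\<lambda>z. d n z * q z) \<le> ennreal (D^2) * L2sq (d n)" .
  have "dirE (\<lambda>z. d n z * q z) \<le> (\<integral>\<^sup>+p. ennreal (2 * D^2) * ennreal ((cmod (d n (fst p) - d n (snd p)) / cmod (fst p - snd p))^2) + 2 * ennreal ((cmod (d n (snd p)) * ?Dq p)^2) \<partial>?PP)"
   unfolding dirE_def
  proof (rule nn_integral_mono)
   fix p assume "p \<in> space ?PP"
   then have p: "fst p \<in> circle" "snd p \<in> circle" by (auto simp: space_pair_measure)
   let ?X = "cmod (d n (fst p) - d n (snd p)) / cmod (fst p - snd p)"
   have "cmod (d n (fst p) * q (fst p) - d n (snd p) * q (snd p)) \<le> D * cmod (d n (fst p) - d n (snd p)) + cmod (d n (snd p)) * cmod (q (fst p) - q (snd p))"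
    by (rule cmod_mult_diff_le[OF D(3)[OF p(1)] order_refl])
   then have "cmod (d n (fst p) * q (fst p) - d n (snd p) * q (snd p)) / cmod (fst p - snd p)
    \<le> (D * cmod (d n (fst p) - d n (snd p)) + cmod (d n (snd p)) * cmod (q (fst p) - q (snd p))) / cmod (fst p - snd p)"
    by (rule divide_right_mono) simp
   then have "(cmod (d n (fst p) * q (fst p) - d n (snd p) * q (snd p)) / cmod (fst p - snd p))^2 \<le> (D * ?X + 1 * (cmod (d n (snd p)) * ?Dq p))^2"
    by (intro power_mono) (auto simp: add_divide_distrib)
   also have "\<dots> \<le> 2 * D^2 * ?X^2 + 2 * 1^2 * (cmod (d n (snd p)) * ?Dq p)^2" by (rule weighted_square_sum_le)
   finally have "ennreal ((cmod (d n (fst p) * q (fst p) - d n (snd p) * q (snd p)) / cmod (fst p - snd p))^2) \<le> ennreal (2 * D^2 * ?X^2 + 2 * 1^2 * (cmod (d n (snd p)) * ?Dq p)^2)" by (rule ennreal_leI)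
   also have "\<dots> = ennreal (2 * D^2) * ennreal (?X^2) + 2 * ennreal ((cmod (d n (snd p)) * ?Dq p)^2)"
    by (subst ennreal_plus) (simp_all add: ennreal_mult)
   finally show "ennreal ((cmod (d n (fst p) * q (fst p) - d n (snd p) * q (snd p)) / cmod (fst p - snd p))^2) \<le> \<dots>" .
  qed
  also have "\<dots> = ennreal (2 * D^2) * dirE (d n) + 2 * ?J n"
   unfolding dirE_def by (subst nn_integral_add) (auto simp: nn_integral_cmult)
  finally have "DN (\<lambda>z. d n z * q z) \<le> ennreal (D^2) * L2sq (d n) + (ennreal (2 * D^2) * dirE (d n) + 2 * ?J n)"
   unfolding DN_def by (intro add_mono 1)
  also have "\<dots> \<le> ennreal (3 * D^2) * L2sq (d n) + (ennreal (3 * D^2) * dirE (d n) + 2 * ?J n)"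
   by (intro add_mono mult_right_mono ennreal_leI) auto
  finally show ?thesis by (simp add: DN_def distrib_left add.assoc)
 qed
 have lr: "(\<lambda>n. DN (d (r n))) \<longlonglongrightarrow> 0" using LIMSEQ_subseq_LIMSEQ[OF lim r(1)] by (simp add: comp_def)
 have t1: "(\<lambda>n. ennreal (3 * D^2) * DN (d (r n))) \<longlonglongrightarrow> ennreal (3 * D^2) * 0" by (rule ennreal_tendsto_cmult[OF _ lr]) simp
 have t2: "(\<lambda>n. 2 * ?J (r n)) \<longlonglongrightarrow> 2 * 0" by (rule ennreal_tendsto_cmult[OF _ J]) simp
 have "(\<lambda>n. ennreal (3 * D^2) * DN (d (r n)) + 2 * ?J (r n)) \<longlonglongrightarrow> ennreal (3 * D^2) * 0 + 2 * 0" by (rule tendsto_add[OF t1 t2])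
 then have up: "(\<lambda>n. ennreal (3 * D^2) * DN (d (r n)) + 2 * ?J (r n)) \<longlonglongrightarrow> 0" by simp
 show ?thesis
 proof (rule approximable_limit[OF q])
  show "(\<lambda>z. h z * q z) \<in> HD" using bounded_dirichlet_mult[OF h q] by (simp add: bounded_dirichlet_def)
  show "approximable q (\<lambda>z. fejer_mean (r n) h z * q z)" for n
   unfolding fejer_mean_def by (rule approximable_trig_sum[OF q inv approximable_q[OF q]])
  have "(\<lambda>n. DN (\<lambda>z. d (r n) z * q z)) \<longlonglongrightarrow> 0"
  proof (rule tendsto_sandwich[OF _ _ tendsto_const up])
   show "\<forall>\<^sub>F n in sequentially. DN (\<lambda>z. d (r n) z * q z) \<le> ennreal (3 * D^2) * DN (d (r n)) + 2 * ?J (r n)"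
    by (intro always_eventually allI) (rule est)
  qed simp
  then show "(\<lambda>n. DN (\<lambda>z. h z * q z - fejer_mean (r n) h z * q z)) \<longlonglongrightarrow> 0" by (simp add: d_def left_diff_distrib)
 qed
qed

text \<open>The Fejer means of \<open>h\<close> are combinations of two-sided shifts of \<open>1\<close>.\<close>

lemma all_approximable:
 assumes one: "approximable q (\<lambda>_. 1)" and h: "h \<in> HD" shows "approximable q h"
proof (rule approximable_limit[OF q h])
 show "approximable q (fejer_mean n h)" for n
  using approximable_trig_sum[OF q inv one] unfolding fejer_mean_def by simp
 show "(\<lambda>n. DN (\<lambda>z. h z - fejer_mean n h z)) \<longlonglongrightarrow> 0" by (rule fejer_mean_tendsto[OF h])
qed

end

text \<open>A bounded \<open>u\<close> of the space vanishing where \<open>g < c\<close> is \<open>u (cnj f)\<^sup>2 v\<^sup>4\<close> times \<open>f\<^sup>2\<close> with \<open>v = 1 / max g c\<close>, a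
product of \<open>f\<^sup>2\<close> with a bounded function of the space. Applied to \<open>1 - u\<close> for the given cutoffs \<open>u\<close>, this
approximates \<open>1\<close>.\<close>

theorem cyclic_if_small_cutoffs:
 assumes adm: "admissible \<alpha> L C M g" and f: "f \<in> HD"
  and fg: "\<And>z. z \<in> circle ==> cmod (f z) = g z" and nl: "\<not> log_modulus_integrable f"
  and cut: "\<And>\<epsilon>. 0 < \<epsilon> ==> \<exists>u c. bounded_dirichlet u \<and> 0 < c \<and> (\<forall>z\<in>circle. g z < c \<longrightarrow> u z = 1) \<and> DN u < ennreal \<epsilon>"
 shows "cyclic_dirichlet (\<lambda>z. (f z)^2)"
proof -
 let ?q = "\<lambda>z. (f z)^2"
 note ag = adm_g[OF adm] and ap = adm_pos[OF adm]
 have fM: "cmod (f z) \<le> M" if "z \<in> circle" for z using ag(2)[OF that] fg[OF that] by simp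
 have fm: "f \<in> meas" by (rule harmonic_measurable[OF f])
 have bf: "bounded_dirichlet f" unfolding bounded_dirichlet_def using f fM by blast
 have bq: "bounded_dirichlet ?q" using bounded_dirichlet_mult[OF bf bf] by (simp add: power2_eq_square)
 have bc: "bounded_dirichlet (\<lambda>z. cnj (f z))"
 proof -
  have m: "(\<lambda>z. cnj (f z)) \<in> meas" using measurable_compose[OF fm measurable_cnj] .
  have "dirE (\<lambda>z. cnj (f z)) \<le> dirE f" by (intro dirE_contraction) (simp add: cmod_cnj_diff)
  then have "dirE (\<lambda>z. cnj (f z)) < \<infinity>" using harmonic_dirE[OF f] by (rule le_less_trans)
  then have "(\<lambda>z. cnj (f z)) \<in> HD" using harmonic_bounded_iff[OF m, of M] fM by simp
  then show ?thesis unfolding bounded_dirichlet_def using fM by (auto intro!: exI[of _ M])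
 qed
 have inv: "approximable ?q (\<lambda>z. cnj z * ?q z)" by (rule approximable_inverse_shift[OF adm f fg nl])
 have van: "approximable ?q u" if u: "bounded_dirichlet u" and c: "0 < c" and u0: "\<And>z. z \<in> circle ==> g z < c ==> u z = 0" for u c
 proof -
  define v where "v z = complex_of_real (inverse (max (g z) c))" for z
  have bv: "bounded_dirichlet v"
  proof (rule bounded_dirichlet_lipschitz)
   fix x y assume xy: "x \<in> circle" "y \<in> circle"
   let ?a = "max (g x) c" and ?b = "max (g y) c"
   have p: "c \<le> ?a" "c \<le> ?b" "0 < ?a" "0 < ?b" using c by auto
   have "cmod (v x - v y) = \<bar>inverse ?a - inverse ?b\<bar>" unfolding v_def by (metis norm_of_real of_real_diff)
   also have "\<dots> = \<bar>?a - ?b\<bar> / (?a * ?b)" using p by (simp add: inverse_diff_inverse abs_mult divide_inverse abs_minus_commute)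
   also have "\<dots> \<le> \<bar>?a - ?b\<bar> / (c * c)" using p c by (intro divide_left_mono mult_mono mult_pos_pos) auto
   also have "\<dots> \<le> (L * cmod (x - y)) / (c * c)" using adm_lip[OF adm xy] c by (intro divide_right_mono) auto
   finally show "cmod (v x - v y) \<le> (L / (c * c)) * cmod (x - y)" by simp
  qed
  let ?h = "\<lambda>z. u z * (cnj (f z) * cnj (f z)) * ((v z * v z) * (v z * v z))"
  have bh: "bounded_dirichlet ?h" by (intro bounded_dirichlet_mult u bc bv)
  show ?thesis
  proof (rule approximable_cong[OF bq approximable_bounded_mult[OF bq inv bh]])
   fix z assume z: "z \<in> circle"
   show "?h z * ?q z = u z"
   proof (cases "g z < c")
    case True then show ?thesis using u0[OF z] by simp
   next
    case False
    then have gz: "max (g z) c = g z" "g z \<noteq> 0" using c by auto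
    have "f z * cnj (f z) = complex_of_real (g z) * of_real (g z)" unfolding fg[OF z, symmetric] by (simp add: complex_norm_square[symmetric] power2_eq_square)
    then have "?h z * ?q z = u z * (complex_of_real (g z) * of_real (g z)) * (complex_of_real (g z) * of_real (g z)) * ((v z * v z) * (v z * v z))"
     by (simp add: power2_eq_square mult_ac)
    also have "\<dots> = u z" using gz by (simp add: v_def field_simps)
    finally show ?thesis .
   qed
  qed
 qed
 have one_b: "bounded_dirichlet (\<lambda>_. 1)" by (rule bounded_dirichlet_lipschitz[where L=0]) simp
 have one: "approximable ?q (\<lambda>_. 1)"
 proof (rule approximable_closed[OF bq])
  show "(\<lambda>_. 1) \<in> HD" using one_b by (simp add: bounded_dirichlet_def)
  fix \<epsilon> :: real assume "0 < \<epsilon>"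
  then obtain u c where x: "bounded_dirichlet u" "0 < c" "\<forall>z\<in>circle. g z < c \<longrightarrow> u z = 1" "DN u < ennreal \<epsilon>" using cut by blast
  obtain B where B: "u \<in> HD" "\<And>z. z \<in> circle ==> cmod (u z) \<le> B" using bounded_dirichletE[OF x(1)] by metis
  have "bounded_dirichlet (\<lambda>z. 1 - u z)"
   unfolding bounded_dirichlet_def
  proof
   show "(\<lambda>z. 1 - u z) \<in> HD" using one_b B by (intro harmonic_diff) (auto simp: bounded_dirichlet_def)
   show "\<exists>B. \<forall>z\<in>circle. cmod (1 - u z) \<le> B"
    by (intro exI[of _ "1 + B"] ballI order_trans[OF norm_triangle_ineq4] add_mono B) auto
  qed
  then have "approximable ?q (\<lambda>z. 1 - u z)" using x by (intro van[of _ c]) auto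
  moreover have "DN (\<lambda>z. 1 - (1 - u z)) < ennreal \<epsilon>" using x(4) by simp
  ultimately show "\<exists>k. approximable ?q k \<and> DN (\<lambda>z. 1 - k z) < ennreal \<epsilon>" by blast
 qed
 show ?thesis
  unfolding cyclic_dirichlet_def
 proof
  show "?q \<in> HD" using bq by (simp add: bounded_dirichlet_def)
  show "shift_closure ?q = HD"
  proof
   show "shift_closure ?q \<subseteq> HD" by (auto simp: shift_closure_def)
   show "HD \<subseteq> shift_closure ?q"
    using approximable_in_closure[OF bq all_approximable[OF bq inv one]] by blast
  qed
 qed
qed

section \<open>Finite energy from Fourier coefficients, and weak limits\<close>

text \<open>The energies of the smoothed kernels are bounded by the sums. Fatou's lemma applies because these kernels
are bounded below by \<open>- ln 2\<close>.\<close>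

lemma bounded_sums_imp_finite_energy:
 assumes \<mu>: "circle_prob \<mu>" and C: "\<And>N. (\<Sum>n=1..N. (cmod (mu_hat \<mu> (int n)))^2 / real n) \<le> C"
 shows "log_energy \<mu> < \<infinity>"
proof -
 interpret M: prob_space \<mu> by (rule prob_mu[OF \<mu>])
 interpret MM: pair_prob_space \<mu> \<mu> ..
 let ?PP = "\<mu> \<Otimes>\<^sub>M \<mu>"
 let ?P = "\<integral>\<^sup>+(\<zeta>, \<zeta>'). e2ennreal (log_kernel \<zeta> \<zeta>') \<partial>?PP"
 have lm [measurable]: "log_r r \<in> borel_measurable ?PP" for r by (rule log_r_measurable[OF \<mu>])
 have b: "(\<integral>\<^sup>+p. ennreal (log_r (rad k) p + ln 2) \<partial>?PP) \<le> ennreal (C + ln 2)" for k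
 proof -
  note r = rad_bounds[of k]
  have "(\<Sum>n<N. rad k ^ n / real n * (cmod (mu_hat \<mu> (int n)))^2) \<le> C" for N
  proof -
   have "(\<Sum>n<N. rad k ^ n / real n * (cmod (mu_hat \<mu> (int n)))^2) \<le> (\<Sum>n\<in>{0..N}. (cmod (mu_hat \<mu> (int n)))^2 / real n)"
   proof (rule order_trans[OF sum_mono sum_mono2])
    fix n show "rad k ^ n / real n * (cmod (mu_hat \<mu> (int n)))^2 \<le> (cmod (mu_hat \<mu> (int n)))^2 / real n"
     using power_le_one[OF r(1) less_imp_le[OF r(2)], of n] mult_right_mono[of "rad k ^ n" 1 "(cmod (mu_hat \<mu> (int n)))^2 / real n"] by simp
   qed auto
   also have "\<dots> = (\<Sum>n=1..N. (cmod (mu_hat \<mu> (int n)))^2 / real n)" by (simp add: sum.atLeast_Suc_atMost)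
   finally show ?thesis using C[of N] by linarith
  qed
  then have le: "(LINT p|?PP. log_r (rad k) p) \<le> C"
   using log_r_integral_sums[OF \<mu> r] by (intro LIMSEQ_le_const2[of "\<lambda>N. \<Sum>n<N. rad k ^ n / real n * (cmod (mu_hat \<mu> (int n)))^2"]) (auto simp: sums_def)
  have i: "integrable ?PP (\<lambda>p. log_r (rad k) p + ln 2)" using log_r_integrable[OF \<mu> r] by auto
  have "(\<integral>\<^sup>+p. ennreal (log_r (rad k) p + ln 2) \<partial>?PP) = ennreal (LINT p|?PP. log_r (rad k) p + ln 2)"
  proof (rule nn_integral_eq_integral[OF i])
   show "AE p in ?PP. 0 \<le> log_r (rad k) p + ln 2"
    using AE_MM[OF \<mu>] by eventually_elim (use log_r_bounds(1) r in \<open>fastforce\<close>)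
  qed
  also have "(LINT p|?PP. log_r (rad k) p + ln 2) = (LINT p|?PP. log_r (rad k) p) + ln 2"
   using log_r_integrable[OF \<mu> r] by (simp add: MM.P.prob_space)
  also have "ennreal \<dots> \<le> ennreal (C + ln 2)" using le by (intro ennreal_leI) simp
  finally show ?thesis .
 qed
 have lim: "e2ennreal (log_kernel z w) \<le> liminf (\<lambda>k. ennreal (log_r (rad k) (z, w) + ln 2))" if zw: "z \<in> circle" "w \<in> circle" for z w
 proof (cases "z = w")
  case True
  have e: "log_r (rad k) (z, w) = - ln (inverse (real (Suc k)))" for k
  proof -
   have "z * cnj z = 1" by (rule circle_mult_cnj[OF zw(1)])
   then have "log_r (rad k) (z, w) = - ln (cmod (of_real (1 - rad k)))" using True by (simp add: log_r_def)
   then show ?thesis unfolding norm_of_real by (simp add: rad_def del: of_nat_Suc)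
  qed
  have "filterlim (\<lambda>k. log_r (rad k) (z, w) + ln 2) at_top sequentially" unfolding e by real_asymp
  then have "(\<lambda>k. ennreal (log_r (rad k) (z, w) + ln 2)) \<longlonglongrightarrow> top" by (simp only: ennreal_tendsto_top_eq_at_top)
  then show ?thesis by (simp add: lim_imp_Liminf)
 next
  case False
  have x1: "cmod (1 - z * cnj w) = cmod (z - w)" by (rule cmod_one_minus_mult_cnj[OF zw(2)])
  have "(\<lambda>k. - ln (cmod (1 - of_real (rad k) * (z * cnj w))) + ln 2) \<longlonglongrightarrow> - ln (cmod (1 - of_real 1 * (z * cnj w))) + ln 2"
   using False x1 by (intro tendsto_intros rad_tendsto) auto
  then have "(\<lambda>k. ennreal (log_r (rad k) (z, w) + ln 2)) \<longlonglongrightarrow> ennreal (- ln (cmod (z - w)) + ln 2)"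
   unfolding log_r_def by (intro tendsto_ennrealI) (simp add: x1)
  then have "liminf (\<lambda>k. ennreal (log_r (rad k) (z, w) + ln 2)) = ennreal (- ln (cmod (z - w)) + ln 2)" by (simp add: lim_imp_Liminf)
  moreover have "e2ennreal (log_kernel z w) = ennreal (- ln (cmod (z - w)))" using False by (simp add: log_kernel_def e2ennreal_ereal ln_div)
  moreover have "ennreal (- ln (cmod (z - w))) \<le> ennreal (- ln (cmod (z - w)) + ln 2)" by (intro ennreal_leI) simp
  ultimately show ?thesis by simp
 qed
 have "?P \<le> (\<integral>\<^sup>+p. liminf (\<lambda>k. ennreal (log_r (rad k) p + ln 2)) \<partial>?PP)"
  by (rule nn_integral_mono_AE, use AE_MM[OF \<mu>] in eventually_elim) (auto intro!: lim)
 also have "\<dots> \<le> liminf (\<lambda>k. \<integral>\<^sup>+p. ennreal (log_r (rad k) p + ln 2) \<partial>?PP)" by (rule nn_integral_liminf) measurable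
 also have "\<dots> \<le> liminf (\<lambda>k::nat. ennreal (C + ln 2))" by (intro Liminf_mono always_eventually allI b)
 also have "\<dots> < \<infinity>" by (simp add: Liminf_const)
 finally have "enn2ereal ?P < \<infinity>" by (metis enn2ereal_top infinity_ennreal_def less_ennreal.rep_eq)
 moreover have "log_energy \<mu> \<le> enn2ereal ?P" unfolding log_energy_def using enn2ereal_nonneg by (intro ereal_diff_le_self) auto
 ultimately show ?thesis by (rule le_less_trans[rotated])
qed

text \<open>A Borel measurable section of \<open>cis\<close>, with values in a bounded interval.\<close>

definition angle :: "complex \<Rightarrow> real" where
 "angle z = (if 0 \<le> Im z then arccos (max (-1) (min 1 (Re z))) else - arccos (max (-1) (min 1 (Re z))))"

lemma angle_measurable: "angle \<in> borel_measurable borel"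
proof -
 have "(\<lambda>x::real. arccos (max (-1) (min 1 x))) \<in> borel_measurable borel"
  by (intro borel_measurable_continuous_onI continuous_intros) auto
 from measurable_compose[OF _ this] have [measurable]: "(\<lambda>z::complex. arccos (max (-1) (min 1 (Re z)))) \<in> borel_measurable borel"
  by measurable
 show ?thesis unfolding angle_def[abs_def] by measurable
qed

lemma cis_angle: assumes "z \<in> circle" shows "cis (angle z) = z"
proof -
 have s: "(Re z)^2 + (Im z)^2 = 1" using assms by (simp add: cmod_def)
 then have r: "\<bar>Re z\<bar> \<le> 1" using abs_Re_le_cmod[of z] assms by simp
 have "1 - (Re z)^2 = (Im z)^2" using s by simp
 then have "sin (arccos (Re z)) = \<bar>Im z\<bar>" using sin_arccos_abs[OF r] by simp
 moreover have "max (-1) (min 1 (Re z)) = Re z" using r by auto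
 ultimately show ?thesis using r by (auto simp: angle_def complex_eq_iff cos_arccos_abs)
qed

lemma angle_bounds: "- 4 < angle z" "angle z \<le> 4"
proof -
 have "0 \<le> arccos (max (-1) (min 1 (Re z)))" "arccos (max (-1) (min 1 (Re z))) \<le> pi" by (auto intro!: arccos_lbound arccos_ubound)
 then show "- 4 < angle z" "angle z \<le> 4" using pi_less_4 by (auto simp: angle_def)
qed

text \<open>The angles of a sequence of measures form a tight sequence on the real line.\<close>

lemma circle_prob_sequentially_compact:
 fixes M :: "nat \<Rightarrow> complex measure"
 assumes M: "\<And>k. circle_prob (M k)"
 obtains r \<mu> where "strict_mono r" "circle_prob \<mu>"
  "\<And>F::complex \<Rightarrow> complex. F \<in> borel_measurable borel ==> continuous_on circle F ==> (\<lambda>k. LINT z|M (r k). F z) \<longlonglongrightarrow> (LINT z|\<mu>. F z)"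
proof -
 note [measurable] = angle_measurable
 define \<nu> where "\<nu> k = distr (M k) borel angle" for k
 have am: "angle \<in> M k \<rightarrow>\<^sub>M borel" for k by (subst measurable_cong_sets[OF sets_mu[OF M] refl]) measurable
 have rd: "real_distribution (\<nu> k)" for k
  unfolding \<nu>_def by (intro prob_space.real_distribution_distr prob_mu[OF M] am)
 have "tight \<nu>"
  unfolding tight_def
 proof (intro conjI allI impI rd)
  fix \<epsilon> :: real assume e: "0 < \<epsilon>"
  have "measure (\<nu> k) {-4<..4} = 1" for k
  proof -
   have "angle -` {-4<..4} \<inter> space (M k) = space (M k)" using angle_bounds by auto
   then show ?thesis unfolding \<nu>_def using am prob_space.prob_space[OF prob_mu[OF M]] by (simp add: measure_distr)
  qed
  then show "\<exists>a b. a < b \<and> (\<forall>k. 1 - \<epsilon> < measure (\<nu> k) {a<..b})" using e by (intro exI[of _ "-4"] exI[of _ 4]) auto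
 qed
 from tight_imp_convergent_subsubsequence[OF this strict_mono_id]
 obtain r R where r: "strict_mono r" "real_distribution R" "weak_conv_m (\<nu> \<circ> id \<circ> r) R" by blast
 interpret R: real_distribution R by (rule r(2))
 define \<mu> where "\<mu> = distr R borel cis"
 have cm: "cis \<in> R \<rightarrow>\<^sub>M borel" by measurable
 have \<mu>: "circle_prob \<mu>"
  unfolding circle_prob_def
 proof (intro conjI)
  show "prob_space \<mu>" unfolding \<mu>_def by (rule R.prob_space_distr[OF cm])
  have "circle \<in> sets borel" by (simp add: borel_compact)
  then show "AE z in \<mu>. z \<in> circle" unfolding \<mu>_def by (subst AE_distr_iff[OF cm]) auto
 qed (simp add: \<mu>_def)
 show ?thesis
 proof (rule that[OF r(1) \<mu>])
  fix F :: "complex \<Rightarrow> complex" assume Fm[measurable]: "F \<in> borel_measurable borel" and F: "continuous_on circle F"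
  obtain B where B: "\<And>z. z \<in> circle ==> cmod (F z) \<le> B"
   using compact_imp_bounded[OF compact_continuous_image[OF F compact_sphere]] unfolding bounded_iff by blast
  have "continuous_on UNIV (F \<circ> cis)"
   by (rule continuous_on_compose) (auto intro: continuous_on_subset[OF F] continuous_intros simp: norm_cis)
  then have c: "isCont (\<lambda>t. F (cis t)) t" for t by (simp add: continuous_on_eq_continuous_at comp_def)
  have "(\<lambda>k. integral\<^sup>L ((\<nu> \<circ> id \<circ> r) k) (\<lambda>t. F (cis t))) \<longlonglongrightarrow> integral\<^sup>L R (\<lambda>t. F (cis t))"
   by (rule weak_conv_imp_integral_bdd_continuous_conv[OF _ r(2,3) c, where B=B]) (auto intro: rd B)
  also have "integral\<^sup>L R (\<lambda>t. F (cis t)) = (LINT z|\<mu>. F z)" unfolding \<mu>_def by (rule integral_distr[OF cm Fm, symmetric])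
  also have "(\<lambda>k. integral\<^sup>L ((\<nu> \<circ> id \<circ> r) k) (\<lambda>t. F (cis t))) = (\<lambda>k. LINT z|M (r k). F z)"
  proof
   fix k
   have "integral\<^sup>L (\<nu> (r k)) (\<lambda>t. F (cis t)) = (LINT z|M (r k). F (cis (angle z)))"
    unfolding \<nu>_def by (rule integral_distr[OF am]) measurable
   also have "\<dots> = (LINT z|M (r k). F z)"
   proof (rule integral_cong_AE)
    show "AE z in M (r k). F (cis (angle z)) = F z" using AE_mu[OF M] by eventually_elim (simp add: cis_angle)
    show "F \<in> borel_measurable (M (r k))" "(\<lambda>z. F (cis (angle z))) \<in> borel_measurable (M (r k))"
     by (subst measurable_cong_sets[OF sets_mu[OF M] refl], measurable)+
   qed
   finally show "integral\<^sup>L ((\<nu> \<circ> id \<circ> r) k) (\<lambda>t. F (cis t)) = (LINT z|M (r k). F z)" by simp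
  qed
  finally show "(\<lambda>k. LINT z|M (r k). F z) \<longlonglongrightarrow> (LINT z|\<mu>. F z)" .
 qed
qed

section \<open>Functions of nearly minimal norm\<close>

text \<open>The real inner product of \<open>h\<close> with the trigonometric sum of coefficients \<open>c\<close>; \<open>sn\<close> is the square of the norm
of the latter. Testing against trigonometric sums alone keeps all sums finite.\<close>

definition ip :: "(complex \<Rightarrow> complex) \<Rightarrow> (int \<Rightarrow> complex) \<Rightarrow> nat \<Rightarrow> real" where
 "ip h c N = (\<Sum>n\<in>win N. wt n * Re (fc h n * cnj (c n)))"

definition sn :: "(int \<Rightarrow> complex) \<Rightarrow> nat \<Rightarrow> real" where
 "sn c N = (\<Sum>n\<in>win N. wt n * (cmod (c n))^2)"

lemma sn_nonneg: "0 \<le> sn c N"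
 by (simp add: sn_def sum_nonneg)

lemma dirichlet_norm_add_trig_sum:
 assumes h: "h \<in> HD"
 shows "(dnorm (\<lambda>z. of_real a * h z + trig_sum c N z))^2 = a^2 * (dnorm h)^2 + 2 * a * ip h c N + sn c N"
proof -
 let ?w = "\<lambda>n::int. 1 + \<bar>real_of_int n\<bar>" and ?S = "win N"
 let ?F = "\<lambda>h n. ?w n * (cmod (fc h n))^2"
 let ?G = "\<lambda>n. if n \<in> ?S then 2 * a * (?w n * Re (fc h n * cnj (c n))) + ?w n * (cmod (c n))^2 else 0"
 have sq: "(dnorm k)^2 = infsum (?F k) UNIV" for k
  unfolding dirichlet_norm_def by (intro real_sqrt_pow2 infsum_nonneg) simp
 have s: "?F h summable_on UNIV" using h by (simp add: harmonic_dirichlet_def)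
 have fc: "fc (\<lambda>z. of_real a * h z + trig_sum c N z) n = of_real a * fc h n + (if n \<in> ?S then c n else 0)" for n
  using L2_circle_integrable[OF harmonic_L2[OF harmonic_cmult[OF h]]] L2_circle_integrable[OF trig_sum_L2]
  by (simp add: fourier_coeff_add fourier_coeff_cmult fourier_coeff_trig_sum)
 have e: "?F (\<lambda>z. of_real a * h z + trig_sum c N z) n = a^2 * ?F h n + ?G n" for n
 proof (cases "n \<in> ?S")
  case True
  have x: "(cmod (of_real a * x + y))^2 = a^2 * (cmod x)^2 + 2 * a * Re (x * cnj y) + (cmod y)^2" for x y
   by (simp add: cmod_power2) (simp add: power2_eq_square algebra_simps)
  show ?thesis unfolding fc x using True by (simp add: x algebra_simps)
 next
  case False then show ?thesis by (simp only: fc if_False add_0_right norm_mult norm_of_real power_mult_distrib power2_abs mult_ac)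
 qed
 have G: "?G summable_on UNIV" by (rule summable_on_cong_neutral[THEN iffD1, OF _ _ _ summable_on_finite[of ?S ?G]]) auto
 have "infsum ?G UNIV = infsum ?G ?S" by (rule infsum_cong_neutral) auto
 also have "\<dots> = 2 * a * ip h c N + sn c N"
  by (simp add: ip_def sn_def sum.distrib sum_distrib_left)
 finally have iG: "infsum ?G UNIV = 2 * a * ip h c N + sn c N" .
 show ?thesis
  unfolding sq e infsum_add[OF summable_on_cmult_right[OF s] G] infsum_cmult_right'[where c="a^2"] iG by simp
qed

lemma herm_trig_sum_real:
 assumes "herm c" "z \<in> circle" shows "cnj (trig_sum c N z) = trig_sum c N z" "complex_of_real (Re (trig_sum c N z)) = trig_sum c N z"
 using Re_Qp[OF assms, of N, symmetric] by (metis complex_cnj_complex_of_real, metis Re_complex_of_real)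

lemma trig_sum_cmult: "trig_sum (\<lambda>n. a * c n) N z = a * trig_sum c N z"
 by (simp add: trig_sum_def sum_distrib_left mult.assoc)

lemma trig_sum_const: "trig_sum (\<lambda>n. if n = 0 then a else 0) N z = a"
proof -
 have "trig_sum (\<lambda>n. if n = 0 then a else 0) N z = (\<Sum>n\<in>win N. if n = 0 then a else 0)"
  unfolding trig_sum_def by (intro sum.cong) auto
 then show ?thesis by (simp add: sum.delta)
qed

lemma ip_const: "ip h (\<lambda>n. if n = 0 then of_real a else 0) N = a * Re (fc h 0)"
proof -
 have "ip h (\<lambda>n. if n = 0 then of_real a else 0) N = (\<Sum>n\<in>win N. if n = 0 then a * Re (fc h 0) else 0)"
  unfolding ip_def by (intro sum.cong) auto
 then show ?thesis by (simp add: sum.delta)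
qed

lemma sn_const: "sn (\<lambda>n. if n = 0 then of_real a else 0) N = a^2"
proof -
 have "sn (\<lambda>n. if n = 0 then of_real a else 0) N = (\<Sum>n\<in>win N. if n = 0 then a^2 else 0)"
  unfolding sn_def by (intro sum.cong) auto
 then show ?thesis by (simp add: sum.delta)
qed

text \<open>The functions admitted in the extremal problem for the capacity of \<open>{g < c}\<close>; no upper bound is imposed,
which makes the set stable under adding trigonometric sums nonnegative on \<open>{g < c}\<close>.\<close>

definition competitor :: "(complex \<Rightarrow> real) \<Rightarrow> real \<Rightarrow> (complex \<Rightarrow> complex) \<Rightarrow> bool" where
 "competitor g c h \<longleftrightarrow> h \<in> HD \<and> (\<forall>z\<in>circle. cnj (h z) = h z) \<and> (\<forall>z\<in>circle. g z < c \<longrightarrow> 1 \<le> Re (h z))"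

definition near_min :: "(complex \<Rightarrow> real) \<Rightarrow> real \<Rightarrow> real \<Rightarrow> (complex \<Rightarrow> complex) \<Rightarrow> bool" where
 "near_min g c t h \<longleftrightarrow> competitor g c h \<and> (\<forall>w. competitor g c w \<longrightarrow> (dnorm h)^2 \<le> (dnorm w)^2 + t^2)"

lemma competitor_combine:
 assumes h: "competitor g c h" and d: "herm d"
  and 1: "\<And>z. z \<in> circle ==> g z < c ==> 1 \<le> a * Re (h z) + Re (trig_sum d N z)"
 shows "competitor g c (\<lambda>z. of_real a * h z + trig_sum d N z)"
 unfolding competitor_def
proof (intro conjI ballI impI)
 show "(\<lambda>z. of_real a * h z + trig_sum d N z) \<in> HD"
  using h by (intro harmonic_add harmonic_cmult trig_sum_harmonic) (simp add: competitor_def)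
 fix z assume z: "z \<in> circle"
 show "cnj (of_real a * h z + trig_sum d N z) = of_real a * h z + trig_sum d N z"
  using h z herm_trig_sum_real(1)[OF d z] by (simp add: competitor_def)
 assume "g z < c"
 then show "1 \<le> Re (of_real a * h z + trig_sum d N z)" using 1[OF z] by simp
qed

lemma herm_const: "herm (\<lambda>n. if n = 0 then of_real a else 0)"
 by (simp add: herm_def)

lemma dirichlet_norm_const: "(dnorm (\<lambda>z. 1))^2 = 1"
 using dirichlet_norm_add_trig_sum[OF trig_sum_harmonic[of "\<lambda>_. 0" 0], of 0 "\<lambda>n. if n = 0 then of_real 1 else 0" 0]
 by (simp only: trig_sum_const sn_const) simp

lemma near_min_exists:
 assumes t: "0 < t" obtains h where "near_min g c t h" "(dnorm h)^2 \<le> 1 + t^2"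
proof -
 let ?S = "{(dnorm w)^2 | w. competitor g c w}"
 have one: "competitor g c (\<lambda>z. 1)" unfolding competitor_def
  using trig_sum_harmonic[of "\<lambda>n. if n = 0 then 1 else 0" 0] by (simp add: trig_sum_const[abs_def])
 have bdd: "bdd_below ?S" by (rule bdd_belowI[of _ 0]) auto
 have "\<exists>x\<in>?S. x < Inf ?S + t^2" using one t by (intro cInf_lessD) auto
 then obtain h where h: "competitor g c h" "(dnorm h)^2 < Inf ?S + t^2" by auto
 have le: "(dnorm h)^2 \<le> (dnorm w)^2 + t^2" if "competitor g c w" for w
  using cInf_lower[OF _ bdd, of "(dnorm w)^2"] that h(2) by fastforce
 show ?thesis
  using le[OF one] h(1) le unfolding dirichlet_norm_const by (intro that[of h]) (auto simp: near_min_def)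
qed

text \<open>The first variation of the norm at a nearly minimal function is nearly nonnegative in the directions that
preserve the constraint.\<close>

lemma near_min_variation:
 assumes h: "near_min g c t h" and t: "0 < t" and d: "herm d"
  and nn: "\<And>z. z \<in> circle ==> g z < c ==> 0 \<le> Re (trig_sum d N z)"
 shows "- t * (1 + sn d N) \<le> ip h d N"
proof -
 have c: "competitor g c h" and hh: "h \<in> HD" using h by (auto simp: near_min_def competitor_def)
 have "competitor g c (\<lambda>z. of_real 1 * h z + trig_sum (\<lambda>n. of_real t * d n) N z)"
 proof (rule competitor_combine[OF c])
  show "herm (\<lambda>n. of_real t * d n)" using d by (simp add: herm_def)
  fix z assume z: "z \<in> circle" "g z < c"
  have "0 \<le> t * Re (trig_sum d N z)" using nn[OF z] t by simp
  then show "1 \<le> 1 * Re (h z) + Re (trig_sum (\<lambda>n. of_real t * d n) N z)" using c z by (simp add: competitor_def trig_sum_cmult add_increasing2)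
 qed
 then have "(dnorm h)^2 \<le> 1^2 * (dnorm h)^2 + 2 * 1 * ip h (\<lambda>n. of_real t * d n) N + sn (\<lambda>n. of_real t * d n) N + t^2"
  using h unfolding dirichlet_norm_add_trig_sum[OF hh, symmetric] near_min_def by blast
 moreover have "ip h (\<lambda>n. of_real t * d n) N = t * ip h d N" unfolding ip_def sum_distrib_left by (intro sum.cong) (auto simp: algebra_simps)
 moreover have "sn (\<lambda>n. of_real t * d n) N = t^2 * sn d N" unfolding sn_def sum_distrib_left by (intro sum.cong) (auto simp: norm_mult power_mult_distrib algebra_simps)
 ultimately have "0 \<le> t * (2 * ip h d N + t * sn d N + t)" by (simp add: algebra_simps power2_eq_square)
 then have "0 \<le> 2 * ip h d N + t * sn d N + t" using t by (simp add: zero_le_mult_iff)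
 moreover have "0 \<le> t * sn d N" using t sn_nonneg by simp
 ultimately show ?thesis using t by (simp add: algebra_simps)
qed

text \<open>Compared with the convex combination \<open>(1 - t) h + t\<close>, the function \<open>h\<close> is nearly minimal only if its mean
is nearly at least the square of its norm. This keeps the mass of the measures away from zero.\<close>

lemma near_min_mean:
 assumes h: "near_min g c t h" and t: "0 < t" "t \<le> 1/2" and \<epsilon>: "0 \<le> \<epsilon>" "\<epsilon> \<le> (dnorm h)^2"
 shows "\<epsilon> - 2 * t \<le> Re (fc h 0)"
proof -
 let ?a = "Re (fc h 0)" and ?n = "(dnorm h)^2"
 have c: "competitor g c h" and hh: "h \<in> HD" using h by (auto simp: near_min_def competitor_def)
 have "competitor g c (\<lambda>z. of_real (1 - t) * h z + trig_sum (\<lambda>n. if n = 0 then of_real t else 0) 0 z)"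
 proof (rule competitor_combine[OF c herm_const])
  fix z assume z: "z \<in> circle" "g z < c"
  then have "(1 - t) * 1 \<le> (1 - t) * Re (h z)" using c t by (intro mult_left_mono) (auto simp: competitor_def)
  then show "1 \<le> (1 - t) * Re (h z) + Re (trig_sum (\<lambda>n. if n = 0 then of_real t else 0) 0 z)" by (simp add: trig_sum_const)
 qed
 then have "?n \<le> (1 - t)^2 * ?n + 2 * (1 - t) * (t * ?a) + t^2 + t^2"
  using h unfolding sn_const[of t 0, symmetric] ip_const[of h t 0, symmetric] dirichlet_norm_add_trig_sum[OF hh, symmetric] near_min_def by (simp only: sn_const)
 then have "0 \<le> t * (2 * (1 - t) * ?a + 2 * t - ?n * (2 - t))" by (simp add: algebra_simps power2_eq_square)
 then have "?n * (2 - t) \<le> 2 * (1 - t) * ?a + 2 * t" using t by (simp add: zero_le_mult_iff)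
 moreover have "\<epsilon> * (2 - t) \<le> ?n * (2 - t)" using \<epsilon> t by (intro mult_right_mono) auto
 moreover have "t * (4 * t) \<le> t * 2" using t by (intro mult_left_mono) auto
 moreover have "0 \<le> t * \<epsilon>" using t \<epsilon> by simp
 ultimately have "2 * (1 - t) * (\<epsilon> - 2 * t) \<le> 2 * (1 - t) * ?a" by (simp add: algebra_simps)
 then show ?thesis using t by (simp add: mult_le_cancel_left_pos)
qed

text \<open>Truncation to \<open>[0, 1]\<close> decreases the energy and turns a competitor into a cutoff.\<close>

lemma competitor_cutoff:
 assumes h: "competitor g c h" and c: "0 < c"
  and no: "\<And>u. bounded_dirichlet u ==> (\<And>z. z \<in> circle ==> g z < c ==> u z = 1) ==> ennreal \<epsilon> \<le> DN u"
 shows "\<epsilon> / (4 * pi^2) \<le> (dnorm h)^2"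
proof -
 have hh: "h \<in> HD" using h by (simp add: competitor_def)
 note hm = harmonic_measurable[OF hh]
 define u where "u z = complex_of_real (min 1 (max 0 (Re (h z))))" for z
 have um: "u \<in> meas" unfolding u_def using hm by measurable
 have d: "cmod (u x - u y) \<le> cmod (h x - h y)" for x y
 proof -
  have "cmod (u x - u y) = \<bar>min 1 (max 0 (Re (h x))) - min 1 (max 0 (Re (h y)))\<bar>" unfolding u_def by (metis norm_of_real of_real_diff)
  also have "\<dots> \<le> \<bar>Re (h x - h y)\<bar>" by auto
  also have "\<dots> \<le> cmod (h x - h y)" by (rule abs_Re_le_cmod)
  finally show ?thesis .
 qed
 have n: "cmod (u x) \<le> cmod (h x)" for x using abs_Re_le_cmod[of "h x"] unfolding u_def norm_of_real by auto
 have DN: "DN u \<le> DN h"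
  unfolding DN_def L2sq_def by (intro add_mono dirE_contraction d nn_integral_mono ennreal_leI power_mono n) auto
 have "ennreal \<epsilon> \<le> DN u"
 proof (rule no)
  have "u \<in> HD" using um DN hh by (auto simp: harmonic_dirichlet_iff intro: le_less_trans)
  then show "bounded_dirichlet u" unfolding bounded_dirichlet_def by (auto intro!: exI[of _ 1] simp: u_def)
  fix z assume "z \<in> circle" "g z < c"
  then have "1 \<le> Re (h z)" using h by (simp add: competitor_def)
  then show "u z = 1" by (simp add: u_def)
 qed
 also have "\<dots> \<le> ennreal (4 * pi^2 * (dnorm h)^2)" using DN DN_le_dirichlet_norm[OF hh] by (rule order_trans)
 finally have "\<epsilon> \<le> 4 * pi^2 * (dnorm h)^2" by (simp add: ennreal_le_iff)
 then show ?thesis by (simp add: divide_le_eq mult.commute)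
qed

lemma circle_prob_density:
 assumes P: "P \<in> borel_measurable borel" "\<And>z. z \<in> circle ==> 0 \<le> P z" "integrable ds P" "(LINT z|ds. P z) = 1"
 obtains \<mu> where "circle_prob \<mu>"
  "\<And>F::complex \<Rightarrow> complex. F \<in> borel_measurable borel ==> (LINT z|\<mu>. F z) = (LINT z|ds. of_real (P z) * F z)"
proof -
 define D where "D = density ds (\<lambda>z. ennreal (P z))"
 have Pm: "P \<in> meas" by (rule borel_measurable_arc_length[OF P(1)])
 have idm: "(\<lambda>z. z) \<in> D \<rightarrow>\<^sub>M borel" unfolding D_def using id_arc_measurable by simp
 have AP: "AE z in ds. 0 \<le> P z" by (rule AE_I2) (use P(2) in simp)
 have "emeasure D (space D) = (\<integral>\<^sup>+z. ennreal (P z) \<partial>ds)"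
  unfolding D_def space_density using Pm by (subst emeasure_density[OF _ sets.top]) (auto intro!: nn_integral_cong)
 also have "\<dots> = 1" using nn_integral_eq_integral[OF P(3) AP] P(4) by simp
 finally interpret D: prob_space D by (rule prob_spaceI)
 have sD: "space D = circle" by (simp add: D_def)
 have "circle_prob (distr D borel (\<lambda>z. z))"
  unfolding circle_prob_def
 proof (intro conjI)
  show "prob_space (distr D borel (\<lambda>z. z))" by (rule D.prob_space_distr[OF idm])
  have "circle \<in> sets borel" by (simp add: borel_compact)
  then show "AE z in distr D borel (\<lambda>z. z). z \<in> circle" by (subst AE_distr_iff[OF idm]) (auto simp: sD)
 qed simp
 then show ?thesis
 proof (rule that)
  fix F :: "complex \<Rightarrow> complex" assume F: "F \<in> borel_measurable borel"
  have "(LINT z|distr D borel (\<lambda>z. z). F z) = (LINT z|D. F z)" by (rule integral_distr[OF idm F])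
  also have "\<dots> = (LINT z|ds. P z *\<^sub>R F z)"
   unfolding D_def by (rule integral_density[OF borel_measurable_arc_length[OF F] Pm AP])
  finally show "(LINT z|distr D borel (\<lambda>z. z). F z) = (LINT z|ds. of_real (P z) * F z)" by (simp add: scaleR_conv_of_real)
 qed
qed

section \<open>From infinite energy to small cutoffs\<close>

lemma integral_herm_trig_sum:
 assumes e: "herm e" and F: "integrable ds F"
 shows "(LINT z|ds. trig_sum e N z * F z) = 2 * pi * (\<Sum>n\<in>win N. cnj (e n) * fc F n)"
proof -
 have "trig_sum (\<lambda>n. cnj (e n)) N (1 * cnj z) = trig_sum e N z" if "z \<in> circle" for z
 proof -
  have "trig_sum (\<lambda>n. cnj (e n)) N (1 * cnj z) = cnj (trig_sum e N z)" by (simp add: trig_sum_def cnj_powi)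
  then show ?thesis using herm_trig_sum_real(1)[OF e that] by simp
 qed
 then have "(LINT z|ds. trig_sum e N z * F z) = (LINT z|ds. trig_sum (\<lambda>n. cnj (e n)) N (1 * cnj z) * F z)"
  by (intro Bochner_Integration.integral_cong) auto
 also have "\<dots> = 2 * pi * trig_sum (\<lambda>n. cnj (e n) * fc F n) N 1"
  using trig_sum_conv[OF F, of "\<lambda>n. cnj (e n)" N 1] by (simp add: field_simps)
 finally show ?thesis by (simp add: trig_sum_def)
qed

text \<open>The density is that of the nearly minimal \<open>h\<close>, mollified by a Fejer kernel: its value at a point of the circle
is the inner product of \<open>h\<close> with a translate of that kernel, hence at least \<open>- c\<close> by the variational inequality
for the small parameter \<open>t\<close>, and adding \<open>c\<close> makes it nonnegative. The Fourier coefficients of the measure are,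
up to normalization and the Fejer multipliers, \<open>(1 + \<bar>n\<bar>)\<close> times those of \<open>h\<close>, so that its energy is controlled by the norm of \<open>h\<close>. The last conclusion
says that little mass lies outside of \<open>{g < c}\<close>: the Fejer mean of \<open>\<phi>\<close> is at most \<open>s\<close> on that set, whence the
variational inequality applies to \<open>s\<close> minus that mean.\<close>

lemma near_equilibrium:
 fixes k :: nat and g :: "complex \<Rightarrow> real"
 defines "c \<equiv> inverse (real (Suc k))"
 assumes \<epsilon>: "0 < \<epsilon>" "\<epsilon> \<le> 1" and lb: "\<And>h. competitor g c h ==> \<epsilon> \<le> (dnorm h)^2"
 obtains \<mu> where "circle_prob \<mu>" "\<And>N. (\<Sum>n=1..N. (cmod (mu_hat \<mu> (int n)))^2 / real n) \<le> 16 / \<epsilon>^2"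
  "\<And>\<phi> L s. \<phi> \<in> borel_measurable borel ==> 0 \<le> L ==>
    (\<And>x y. x \<in> circle ==> y \<in> circle ==> cmod (complex_of_real (\<phi> x) - of_real (\<phi> y)) \<le> L * cmod (x - y)) ==>
    (\<And>z. z \<in> circle ==> g z < c ==> \<phi> z = 0) ==> s = L * sqrt (2 / (k + 1)) ==>
    Re (LINT z|\<mu>. of_real (\<phi> z)) \<le> (2 / \<epsilon>) * (2 * s + c * (1 + (2 * s^2 + 2 * (dnorm (\<lambda>z. of_real (\<phi> z)))^2) + cmod (fc (\<lambda>z. of_real (\<phi> z)) 0)))"
proof -
 let ?w = "\<lambda>n::int. 1 + \<bar>real_of_int n\<bar>" and ?S = "win k"
 define \<kappa> where "\<kappa> = fejer_mult k"
 have \<kappa>: "0 \<le> \<kappa> n" "\<kappa> n \<le> 1" "\<kappa> (- n) = \<kappa> n" for n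
  using fejer_mult_bounds[of k n] by (auto simp: \<kappa>_def fejer_mult_def)
 have \<kappa>0: "\<kappa> 0 = 1" by (simp add: \<kappa>_def fejer_mult_def)
 have c: "0 < c" "c \<le> 1" by (simp_all add: c_def inverse_le_1_iff)
 define A where "A = (\<Sum>n\<in>?S. ?w n)"
 have A0: "0 \<le> A" unfolding A_def by (intro sum_nonneg) simp
 \<comment> \<open>\<open>A\<close> bounds the squared norm of every translate of the Fejer kernel.\<close>
 define t where "t = \<epsilon> / 4 * c / (1 + A)"
 have tA: "t * (1 + A) = \<epsilon> / 4 * c" unfolding t_def using A0 by (intro nonzero_eq_divide_eq[THEN iffD1, OF _ refl]) simp
 have t: "0 < t" using \<epsilon> c A0 by (simp add: t_def)
 have "t * 1 \<le> t * (1 + A)" using t A0 by (intro mult_left_mono) auto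
 moreover have "\<epsilon> / 4 * c \<le> \<epsilon> / 4 * 1" "\<epsilon> / 4 * c \<le> 1 * c" using c \<epsilon> by (intro mult_left_mono mult_right_mono; simp)+
 ultimately have t4: "t \<le> \<epsilon> / 4" and tc: "t \<le> c" and tAc: "t * (1 + A) \<le> c" unfolding tA by linarith+
 obtain h where h: "near_min g c t h" "(dnorm h)^2 \<le> 1 + t^2" using near_min_exists[OF t] by blast
 have hc: "competitor g c h" and hh: "h \<in> HD" and hr: "\<And>z. z \<in> circle ==> cnj (h z) = h z"
  using h by (auto simp: near_min_def competitor_def)
 have "t^2 \<le> 1" using t t4 \<epsilon> by (simp add: power_le_one)
 then have N2: "(dnorm h)^2 \<le> 2" using h(2) by simp
 have hm: "fc h (- n) = cnj (fc h n)" for n by (rule fourier_coeff_real[OF hr])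
 define a where "a = Re (fc h 0)"
 have a: "fc h 0 = of_real a" using hm[of 0] by (simp add: a_def complex_eq_iff)
 have al: "\<epsilon> / 2 \<le> a"
  using near_min_mean[OF h(1) t _ _ lb[OF hc]] t4 \<epsilon> unfolding a_def by linarith
 have au: "a \<le> 2"
 proof (rule ccontr)
  assume "\<not> a \<le> 2"
  then have "2^2 < a^2" by (intro power_strict_mono) auto
  then show False using sum_dirichlet_le[OF hh, of 0] N2 by (simp add: a)
 qed
 define e where "e n = of_real (?w n * \<kappa> n) * fc h n" for n
 have he: "herm e" by (simp add: herm_def e_def hm \<kappa>)
 have p: "- c \<le> Re (trig_sum e k z)" if z: "z \<in> circle" for z
 proof -
  define d where "d n = of_real (\<kappa> n) * z powi (- n)" for n
  have cz: "cnj (z powi n) = z powi (- n)" for n using z by (metis cnj_powi circle_cnj_powi)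
  have cd: "cnj (d n) = of_real (\<kappa> n) * z powi n" for n
   unfolding d_def complex_cnj_mult complex_cnj_complex_of_real cz[of "- n"] minus_minus ..
  have hd: "herm d" using cz by (simp add: herm_def d_def \<kappa> del: complex_cnj_power_int)
  have T: "trig_sum d k w = of_real (fejer k (w * cnj z))" if "w \<in> circle" for w
   unfolding fejer_eq_trig_sum[OF circle_mult[OF that circle_cnj[OF z]] order_refl] trig_sum_def
   by (intro sum.cong) (auto simp: d_def \<kappa>_def power_int_mult_distrib circle_cnj_powi[OF z])
  have "- t * (1 + sn d k) \<le> ip h d k"
  proof (rule near_min_variation[OF h(1) t hd])
   fix w assume w: "w \<in> circle"
   show "0 \<le> Re (trig_sum d k w)" using kernel_nonneg[OF fejer_kernel circle_mult[OF w circle_cnj[OF z]], of k] by (simp add: T[OF w])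
  qed
  moreover have "sn d k \<le> A"
   unfolding sn_def A_def
  proof (intro sum_mono)
   fix n
   have "(cmod (d n))^2 \<le> 1" using \<kappa>[of n] circle_cmod_powi[OF z, of "- n"] by (simp add: d_def norm_mult power_le_one)
   then show "?w n * (cmod (d n))^2 \<le> ?w n" by (simp add: mult_left_le)
  qed
  then have "t * (1 + sn d k) \<le> t * (1 + A)" using t by simp
  moreover have "ip h d k = Re (trig_sum e k z)"
   unfolding ip_def trig_sum_def Re_sum cd by (intro sum.cong) (auto simp: e_def algebra_simps)
  ultimately show ?thesis using tAc by simp
 qed
 define m where "m = a + c"
 have m: "\<epsilon> / 2 \<le> m" "0 < m" using al c \<epsilon> by (simp_all add: m_def)
 define P where "P z = (Re (trig_sum e k z) + c) / (2 * pi * m)" for z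
 have Pm: "P \<in> borel_measurable borel" unfolding P_def by measurable
 have P0: "0 \<le> P z" if "z \<in> circle" for z using p[OF that] m by (simp add: P_def)
 have iT: "integrable ds (\<lambda>z. trig_sum e k z * F z)" if "integrable ds F" for F
  by (rule integrable_mult_bounded[OF that measurable_trig_sum_arc trig_sum_bound])
 have J: "(LINT z|ds. of_real (P z) * F z) = ((\<Sum>n\<in>?S. cnj (e n) * fc F n) + of_real c * fc F 0) / of_real m"
  if F: "integrable ds F" for F
 proof -
  have "(LINT z|ds. of_real (P z) * F z) = (LINT z|ds. (trig_sum e k z * F z + of_real c * F z) / (2 * pi * m))"
  proof (rule Bochner_Integration.integral_cong[OF refl])
   fix z assume "z \<in> space ds"
   then have "complex_of_real (Re (trig_sum e k z)) = trig_sum e k z" using herm_trig_sum_real(2)[OF he] by simp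
   then show "of_real (P z) * F z = (trig_sum e k z * F z + of_real c * F z) / (2 * pi * m)" by (simp add: P_def algebra_simps)
  qed
  also have "\<dots> = ((LINT z|ds. trig_sum e k z * F z) + of_real c * (LINT z|ds. F z)) / (2 * pi * m)"
   using iT[OF F] F by simp
  also have "(LINT z|ds. F z) = 2 * pi * fc F 0" by (simp add: fourier_coeff_def)
  finally have x: "(LINT z|ds. of_real (P z) * F z) = (2 * pi * (\<Sum>n\<in>?S. cnj (e n) * fc F n) + of_real c * (2 * pi * fc F 0)) / (2 * pi * m)"
   unfolding integral_herm_trig_sum[OF he F] .
  have y: "(q * x + c' * (q * y)) / (q * m') = (x + c' * y) / m'" if "q \<noteq> 0" for q x y c' m' :: complex
   using that by (simp add: mult.left_commute[of c'] distrib_left[symmetric])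
  show ?thesis unfolding x using y[of "2 * pi"] by simp
 qed
 have Sd: "(\<Sum>n\<in>?S. cnj (e n) * fc (\<lambda>z. z powi j) n) = (if j \<in> ?S then cnj (e j) else 0)" for j
  unfolding fourier_coeff_powi by (simp add: if_distrib[of "\<lambda>x. _ * x"] sum.delta cong: if_cong)
 have iP: "integrable ds P"
 proof (rule integrable_arc_bounded[OF borel_measurable_arc_length[OF Pm]])
  fix z assume z: "z \<in> circle"
  have "\<bar>Re (trig_sum e k z) + c\<bar> \<le> (\<Sum>n\<in>?S. cmod (e n)) + c"
   using abs_Re_le_cmod[of "trig_sum e k z"] trig_sum_bound[OF z, of e k] c by linarith
  then show "norm (P z) \<le> ((\<Sum>n\<in>?S. cmod (e n)) + c) / (2 * pi * m)" using m by (simp add: P_def abs_mult divide_right_mono)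
 qed
 have "complex_of_real (LINT z|ds. P z) = (LINT z|ds. of_real (P z) * z powi 0)" by simp
 also have "\<dots> = 1"
 proof -
  have "complex_of_real a + of_real c = of_real m" "m \<noteq> 0" "fc (\<lambda>z. 1) 0 = 1" "cnj (e 0) = of_real a"
   using m fourier_coeff_powi[of 0 0] by (simp_all add: m_def e_def \<kappa>0 a)
  then show ?thesis unfolding J[OF integrable_powi] Sd by simp
 qed
 finally have P1: "(LINT z|ds. P z) = 1" by simp
 obtain \<mu> where \<mu>: "circle_prob \<mu>"
  and I: "\<And>F::complex \<Rightarrow> complex. F \<in> borel_measurable borel ==> (LINT z|\<mu>. F z) = (LINT z|ds. of_real (P z) * F z)"
  using circle_prob_density[OF Pm P0 iP P1] by blast
 show ?thesis
 proof (rule that[OF \<mu>])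
  fix N
  have mh: "(cmod (mu_hat \<mu> (int n)))^2 / real n \<le> 8 / \<epsilon>^2 * (?w n * (cmod (fc h n))^2)" if n: "1 \<le> n" for n :: nat
  proof -
   have f0: "fc (\<lambda>z. z powi int n) 0 = 0" unfolding fourier_coeff_powi using n by simp
   have "mu_hat \<mu> (int n) = (if int n \<in> ?S then cnj (e n) else 0) / of_real m"
    unfolding mu_hat_def I[OF measurable_powi] J[OF integrable_powi] Sd f0 by simp
   then have "cmod (mu_hat \<mu> (int n)) \<le> cmod (e n) / m" using m by (auto simp: norm_divide)
   also have "\<dots> \<le> (?w n * cmod (fc h n)) / m"
   proof (intro divide_right_mono)
    have "\<bar>?w n * \<kappa> n\<bar> \<le> ?w n" using \<kappa>[of n] by (simp add: abs_mult mult_left_le)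
    then show "cmod (e n) \<le> ?w n * cmod (fc h n)" unfolding e_def norm_mult norm_of_real by (rule mult_right_mono) simp
   qed (use m in simp)
   also have "\<dots> \<le> (?w n * cmod (fc h n)) / (\<epsilon> / 2)" using m \<epsilon> by (intro divide_left_mono) auto
   finally have "(cmod (mu_hat \<mu> (int n)))^2 \<le> ((?w n * cmod (fc h n)) / (\<epsilon> / 2))^2" by (rule power_mono) simp
   also have "\<dots> = 4 / \<epsilon>^2 * (?w n)^2 * (cmod (fc h n))^2" by (simp add: power_mult_distrib power_divide)
   finally have "(cmod (mu_hat \<mu> (int n)))^2 / real n \<le> 4 / \<epsilon>^2 * (?w n)^2 * (cmod (fc h n))^2 / real n" by (rule divide_right_mono) simp
   also have "\<dots> = (4 / \<epsilon>^2 * (cmod (fc h n))^2) * ((?w n)^2 / real n)" by simp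
   also have "\<dots> \<le> (4 / \<epsilon>^2 * (cmod (fc h n))^2) * (2 * ?w n)"
   proof (rule mult_left_mono)
    have "?w n * ?w n \<le> ?w n * (2 * real n)" using n by (intro mult_left_mono) auto
    then show "(?w n)^2 / real n \<le> 2 * ?w n" using n by (simp add: divide_le_eq power2_eq_square mult_ac)
   qed simp
   also have "\<dots> = 8 / \<epsilon>^2 * (?w n * (cmod (fc h n))^2)" by (simp add: field_simps)
   finally show ?thesis .
  qed
  have "(\<Sum>n=1..N. (cmod (mu_hat \<mu> (int n)))^2 / real n) \<le> (\<Sum>n=1..N. 8 / \<epsilon>^2 * (?w (int n) * (cmod (fc h (int n)))^2))"
   by (intro sum_mono mh) simp
  also have "\<dots> = 8 / \<epsilon>^2 * (\<Sum>n=1..N. ?w (int n) * (cmod (fc h (int n)))^2)" by (rule sum_distrib_left[symmetric])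
  also have "(\<Sum>n=1..N. ?w (int n) * (cmod (fc h (int n)))^2) = (\<Sum>n\<in>int ` {1..N}. ?w n * (cmod (fc h n))^2)"
   by (subst sum.reindex) (auto simp: comp_def)
  also have "\<dots> \<le> (\<Sum>n\<in>win N. ?w n * (cmod (fc h n))^2)" by (intro sum_mono2) auto
  also have "\<dots> \<le> 2" using sum_dirichlet_le[OF hh] N2 by (rule order_trans)
  finally show "(\<Sum>n=1..N. (cmod (mu_hat \<mu> (int n)))^2 / real n) \<le> 16 / \<epsilon>^2" by (simp add: divide_right_mono)
 next
  fix \<phi> L s
  assume \<phi>m: "\<phi> \<in> borel_measurable borel" and L: "0 \<le> L" and s: "s = L * sqrt (2 / (k + 1))"
   and lip: "\<And>x y. x \<in> circle ==> y \<in> circle ==> cmod (complex_of_real (\<phi> x) - of_real (\<phi> y)) \<le> L * cmod (x - y)"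
   and \<phi>0: "\<And>z. z \<in> circle ==> g z < c ==> \<phi> z = 0"
  let ?f = "\<lambda>z. complex_of_real (\<phi> z)"
  have fh: "?f \<in> HD" by (rule lipschitz_harmonic[OF lip])
  have fi: "integrable ds ?f" by (rule L2_circle_integrable[OF harmonic_L2[OF fh]])
  have fr: "fc ?f (- n) = cnj (fc ?f n)" for n by (rule fourier_coeff_real) simp
  let ?b = "\<lambda>n. of_real (\<kappa> n) * fc ?f n"
  let ?o = "\<lambda>n::int. if n = 0 then complex_of_real s else 0"
  define d where "d n = ?o n + - ?b n" for n
  have hd: "herm d" by (simp add: herm_def d_def fr \<kappa>)
  have s0: "0 \<le> s" using L by (simp add: s)
  have T: "trig_sum d k z = of_real s - fejer_mean k ?f z" for z
  proof -
   have "trig_sum d k z = trig_sum ?o k z - fejer_mean k ?f z"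
    unfolding fejer_mean_def trig_sum_def d_def \<kappa>_def sum_subtractf[symmetric] by (intro sum.cong) (auto simp: algebra_simps)
   then show ?thesis unfolding trig_sum_const .
  qed
  have "- t * (1 + sn d k) \<le> ip h d k"
  proof (rule near_min_variation[OF h(1) t hd])
   fix z assume z: "z \<in> circle" "g z < c"
   have "cmod (fejer_mean k ?f z - ?f z) \<le> s" unfolding s using fejer_mean_lipschitz_close[where h="?f", OF lip z(1) L, of k] by (simp add: add.commute)
   then have "Re (fejer_mean k ?f z) \<le> s" using abs_Re_le_cmod[of "fejer_mean k ?f z"] \<phi>0[OF z] by simp
   then show "0 \<le> Re (trig_sum d k z)" by (simp add: T)
  qed
  moreover have "sn d k \<le> 2 * s^2 + 2 * (dnorm ?f)^2"
  proof -
   have "sn d k \<le> (\<Sum>n\<in>?S. 2 * (?w n * (cmod (?o n))^2) + 2 * (?w n * (cmod (fc ?f n))^2))"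
    unfolding sn_def
   proof (rule sum_mono)
    fix n
    have "(cmod (?b n))^2 \<le> (cmod (fc ?f n))^2"
     using \<kappa>[of n] by (intro power_mono) (auto simp: norm_mult mult_left_le_one_le)
    then have "(cmod (d n))^2 \<le> 2 * (cmod (?o n))^2 + 2 * (cmod (fc ?f n))^2"
     using cmod_sq_add_le[of "?o n" "- ?b n"] unfolding d_def norm_minus_cancel by linarith
    then have "?w n * (cmod (d n))^2 \<le> ?w n * (2 * (cmod (?o n))^2 + 2 * (cmod (fc ?f n))^2)" by (rule mult_left_mono) simp
    then show "?w n * (cmod (d n))^2 \<le> 2 * (?w n * (cmod (?o n))^2) + 2 * (?w n * (cmod (fc ?f n))^2)"
     by (simp only: distrib_left mult.left_commute[of _ 2])
   qed
   also have "\<dots> = 2 * sn ?o k + 2 * (\<Sum>n\<in>?S. ?w n * (cmod (fc ?f n))^2)"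
    unfolding sn_def sum_distrib_left by (simp only: sum.distrib)
   also have "\<dots> \<le> 2 * s^2 + 2 * (dnorm ?f)^2" unfolding sn_const using sum_dirichlet_le[OF fh, of k] by simp
   finally show ?thesis .
  qed
  moreover have "ip h d k = s * a - ip h ?b k"
   unfolding a_def ip_const[of h s k, symmetric] ip_def d_def by (simp add: sum_subtractf[symmetric] algebra_simps)
  moreover have "s * a \<le> s * 2" using s0 au by (rule mult_left_mono[rotated])
  moreover have sn1: "0 \<le> 1 + (2 * s^2 + 2 * (dnorm ?f)^2)" by (simp add: add_nonneg_nonneg)
  have "t * (1 + (2 * s^2 + 2 * (dnorm ?f)^2)) \<le> c * (1 + (2 * s^2 + 2 * (dnorm ?f)^2))" by (rule mult_right_mono[OF tc sn1])
  moreover have "t * (1 + sn d k) \<le> t * (1 + (2 * s^2 + 2 * (dnorm ?f)^2))" if "sn d k \<le> 2 * s^2 + 2 * (dnorm ?f)^2"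
   using that t by simp
  ultimately have ib: "ip h ?b k \<le> 2 * s + c * (1 + (2 * s^2 + 2 * (dnorm ?f)^2))" by linarith
  have "Re (LINT z|\<mu>. ?f z) = (ip h ?b k + c * Re (fc ?f 0)) / m"
  proof -
   have "Re (\<Sum>n\<in>?S. cnj (e n) * fc ?f n) = ip h ?b k"
    unfolding ip_def Re_sum by (intro sum.cong) (auto simp: e_def algebra_simps)
   moreover have "(LINT z|\<mu>. ?f z) = (LINT z|ds. of_real (P z) * ?f z)" by (intro I measurable_compose[OF \<phi>m borel_measurable_of_real])
   ultimately show ?thesis unfolding J[OF fi] by (simp add: Re_divide_of_real)
  qed
  also have "\<dots> \<le> (2 * s + c * (1 + (2 * s^2 + 2 * (dnorm ?f)^2) + cmod (fc ?f 0))) / m"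
  proof (rule divide_right_mono)
   have "c * Re (fc ?f 0) \<le> c * cmod (fc ?f 0)" using c by (intro mult_left_mono complex_Re_le_cmod) simp
   then show "ip h ?b k + c * Re (fc ?f 0) \<le> 2 * s + c * (1 + (2 * s^2 + 2 * (dnorm ?f)^2) + cmod (fc ?f 0))"
    using ib unfolding distrib_left[of c "1 + _"] by linarith
  qed (use m in simp)
  also have "\<dots> \<le> (2 * s + c * (1 + (2 * s^2 + 2 * (dnorm ?f)^2) + cmod (fc ?f 0))) / (\<epsilon> / 2)"
   using m \<epsilon> c s0 by (intro divide_left_mono) (auto intro!: add_nonneg_nonneg mult_nonneg_nonneg)
  finally show "Re (LINT z|\<mu>. ?f z) \<le> (2 / \<epsilon>) * (2 * s + c * (1 + (2 * s^2 + 2 * (dnorm ?f)^2) + cmod (fc ?f 0)))"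
   by (simp add: mult.commute)
 qed
qed

text \<open>A weak limit point of the measures above has finite energy, and it gives no mass to \<open>{g > c}\<close> for any \<open>c > 0\<close>,
as seen by integrating \<open>max 0 (g - c)\<close>.\<close>

theorem cutoffs_if_infinite_energy:
 fixes g :: "complex \<Rightarrow> real"
 assumes L: "0 \<le> L" and lip: "\<And>x y. x \<in> circle ==> y \<in> circle ==> \<bar>g x - g y\<bar> \<le> L * cmod (x - y)"
  and g0: "\<And>z. z \<in> circle ==> 0 \<le> g z"
  and en: "\<And>\<mu>. \<mu> \<in> prob_on {z \<in> circle. g z = 0} ==> \<not> log_energy \<mu> < \<infinity>" and \<epsilon>: "0 < \<epsilon>"
 shows "\<exists>u c. bounded_dirichlet u \<and> 0 < c \<and> (\<forall>z\<in>circle. g z < c \<longrightarrow> u z = 1) \<and> DN u < ennreal \<epsilon>"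
proof (rule ccontr)
 assume no: "\<not> ?thesis"
 define \<delta> where "\<delta> = min 1 (\<epsilon> / (4 * pi^2))"
 have \<delta>: "0 < \<delta>" "\<delta> \<le> 1" using \<epsilon> by (simp_all add: \<delta>_def)
 let ?c = "\<lambda>k::nat. inverse (real (Suc k))"
 have lb: "\<delta> \<le> (dnorm h)^2" if h: "competitor g (?c k) h" for k h
 proof -
  have "\<epsilon> / (4 * pi^2) \<le> (dnorm h)^2"
  proof (rule competitor_cutoff[OF h])
   fix u assume u: "bounded_dirichlet u" "\<And>z. z \<in> circle ==> g z < ?c k ==> u z = 1"
   have "0 < ?c k" by simp
   then have "\<not> DN u < ennreal \<epsilon>" using no u by blast
   then show "ennreal \<epsilon> \<le> DN u" by simp
  qed simp
  then show ?thesis by (simp add: \<delta>_def)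
 qed
 have gc: "continuous_on circle g" by (rule lipschitz_on_continuous_on[of L]) (use lip L in \<open>auto simp: lipschitz_on_def dist_real_def dist_norm\<close>)
 define \<phi> where "\<phi> c z = indicator circle z *\<^sub>R max 0 (g z - c)" for c z
 have \<phi>e: "\<phi> c z = max 0 (g z - c)" if "z \<in> circle" for c z using that by (simp add: \<phi>_def)
 have \<phi>m: "\<phi> c \<in> borel_measurable borel" for c
  unfolding \<phi>_def by (intro borel_measurable_continuous_on_indicator continuous_intros gc) (simp add: borel_compact)
 have \<phi>c: "continuous_on circle (\<lambda>z. complex_of_real (\<phi> c z))" for c
 proof (rule continuous_on_eq)
  show "continuous_on circle (\<lambda>z. complex_of_real (max 0 (g z - c)))" by (intro continuous_intros gc)
 qed (simp add: \<phi>e)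
 have \<phi>l: "cmod (complex_of_real (\<phi> c x) - of_real (\<phi> c y)) \<le> L * cmod (x - y)" if "x \<in> circle" "y \<in> circle" for c x y
  unfolding of_real_lipschitz_cmod[symmetric] using lip[OF that] that by (simp add: \<phi>e)
 define s where "s k = L * sqrt (2 / (k + 1))" for k :: nat
 define B where "B k c = (2 / \<delta>) * (2 * s k + ?c k * (1 + (2 * (s k)^2 + 2 * (dnorm (\<lambda>z. of_real (\<phi> c z)))^2) + cmod (fc (\<lambda>z. of_real (\<phi> c z)) 0)))" for k c
 have ex: "\<exists>\<mu>. circle_prob \<mu> \<and> (\<forall>N. (\<Sum>n=1..N. (cmod (mu_hat \<mu> (int n)))^2 / real n) \<le> 16 / \<delta>^2)
  \<and> (\<forall>c\<ge>?c k. Re (LINT z|\<mu>. of_real (\<phi> c z)) \<le> B k c)" for k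
 proof (rule near_equilibrium[OF \<delta> lb])
  fix \<mu> assume \<mu>: "circle_prob \<mu>" "\<And>N. (\<Sum>n=1..N. (cmod (mu_hat \<mu> (int n)))^2 / real n) \<le> 16 / \<delta>^2"
   and I: "\<And>\<phi> L s. \<phi> \<in> borel_measurable borel ==> 0 \<le> L ==>
    (\<And>x y. x \<in> circle ==> y \<in> circle ==> cmod (complex_of_real (\<phi> x) - of_real (\<phi> y)) \<le> L * cmod (x - y)) ==>
    (\<And>z. z \<in> circle ==> g z < ?c k ==> \<phi> z = 0) ==> s = L * sqrt (2 / (k + 1)) ==>
    Re (LINT z|\<mu>. of_real (\<phi> z)) \<le> (2 / \<delta>) * (2 * s + ?c k * (1 + (2 * s^2 + 2 * (dnorm (\<lambda>z. of_real (\<phi> z)))^2) + cmod (fc (\<lambda>z. of_real (\<phi> z)) 0)))"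
  have "Re (LINT z|\<mu>. of_real (\<phi> c z)) \<le> B k c" if "?c k \<le> c" for c
   unfolding B_def by (rule I[OF \<phi>m L \<phi>l]) (use that in \<open>auto simp: \<phi>e s_def\<close>)
  then show ?thesis using \<mu> by blast
 qed
 from choice[OF allI[OF ex]] obtain M where M0: "\<forall>k. circle_prob (M k) \<and> (\<forall>N. (\<Sum>n=1..N. (cmod (mu_hat (M k) (int n)))^2 / real n) \<le> 16 / \<delta>^2)
  \<and> (\<forall>c\<ge>?c k. Re (LINT z|M k. of_real (\<phi> c z)) \<le> B k c)" by (rule exE)
 have M1: "circle_prob (M k)" for k by (rule conjunct1[OF spec[OF M0]])
 have M2: "(\<Sum>n=1..N. (cmod (mu_hat (M k) (int n)))^2 / real n) \<le> 16 / \<delta>^2" for k N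
  by (rule spec[OF conjunct1[OF conjunct2[OF spec[OF M0, of k]]]])
 have MB: "Re (LINT z|M k. of_real (\<phi> c z)) \<le> B k c" if "?c k \<le> c" for k c
  by (rule mp[OF spec[OF conjunct2[OF conjunct2[OF spec[OF M0]]]] that])
 obtain r \<mu> where r: "strict_mono r" and \<mu>: "circle_prob \<mu>"
  and lim: "\<And>F::complex \<Rightarrow> complex. F \<in> borel_measurable borel ==> continuous_on circle F ==> (\<lambda>k. LINT z|M (r k). F z) \<longlonglongrightarrow> (LINT z|\<mu>. F z)"
  by (rule circle_prob_sequentially_compact[where M=M]) (rule M1, rule that)
 interpret prob_space \<mu> by (rule prob_mu[OF \<mu>])
 have Blim: "(\<lambda>k. B (r k) c) \<longlonglongrightarrow> 0" for c
 proof -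
  have "(\<lambda>k. 2 / real (k + 1)) \<longlonglongrightarrow> 0" by real_asymp
  then have "(\<lambda>k. L * sqrt (2 / real (k + 1))) \<longlonglongrightarrow> L * sqrt 0" by (intro tendsto_intros)
  then have s: "s \<longlonglongrightarrow> 0" by (simp add: s_def[abs_def])
  let ?D = "dnorm (\<lambda>z. of_real (\<phi> c z))" and ?f = "cmod (fc (\<lambda>z. of_real (\<phi> c z)) 0)"
  have "(\<lambda>k. B k c) \<longlonglongrightarrow> (2 / \<delta>) * (2 * 0 + 0 * (1 + (2 * 0^2 + 2 * ?D^2) + ?f))"
   unfolding B_def by (intro tendsto_intros s LIMSEQ_inverse_real_of_nat)
  from LIMSEQ_subseq_LIMSEQ[OF this r] show ?thesis by (simp add: comp_def)
 qed
 have small: "AE z in \<mu>. g z \<le> c" if c: "0 < c" for c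
 proof -
  have i: "integrable \<mu> (\<phi> c)"
  proof (rule integrable_mu_bounded[OF \<mu> \<phi>m])
   fix z assume z: "z \<in> circle"
   show "norm (\<phi> c z) \<le> norm (\<phi> c 1) + 2 * \<bar>L\<bar>"
    by (rule lipschitz_circle_bounded[OF _ z]) (use \<phi>l in \<open>simp add: of_real_lipschitz_cmod real_norm_def\<close>)
  qed
  have "Re (LINT z|\<mu>. complex_of_real (\<phi> c z)) \<le> 0"
  proof (rule LIMSEQ_le[OF tendsto_Re[OF lim[OF measurable_compose[OF \<phi>m borel_measurable_of_real] \<phi>c]] Blim])
   obtain K where K: "?c K < c" using reals_Archimedean[OF c] by auto
   have "Re (LINT z|M (r k). of_real (\<phi> c z)) \<le> B (r k) c" if "K \<le> k" for k
   proof (rule MB)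
    have "K \<le> r k" using that seq_suble[OF r, of k] by simp
    then have "?c (r k) \<le> ?c K" by (intro le_imp_inverse_le) auto
    then show "?c (r k) \<le> c" using K by (rule order_trans[OF _ less_imp_le])
   qed
   then show "\<exists>N. \<forall>n\<ge>N. Re (LINT z|M (r n). of_real (\<phi> c z)) \<le> B (r n) c" by blast
  qed
  then have le: "(LINT z|\<mu>. \<phi> c z) \<le> 0" by simp
  have nn: "AE z in \<mu>. 0 \<le> \<phi> c z" by (rule AE_I2) (simp add: \<phi>_def)
  have "(LINT z|\<mu>. \<phi> c z) = 0" using le integral_nonneg_AE[OF nn] by simp
  then have "AE z in \<mu>. \<phi> c z = 0" using integral_nonneg_eq_0_iff_AE[OF i nn] by simp
  then show ?thesis using AE_mu[OF \<mu>] by eventually_elim (simp add: \<phi>e)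
 qed
 have "AE z in \<mu>. \<forall>k. g z \<le> ?c k" unfolding AE_all_countable using small by simp
 then have AE0: "AE z in \<mu>. z \<in> circle \<and> g z = 0" using AE_mu[OF \<mu>]
 proof eventually_elim
  case (elim z)
  have "g z \<le> 0" by (rule LIMSEQ_le_const[OF LIMSEQ_inverse_real_of_nat]) (use elim in auto)
  then show ?case using g0 elim by force
 qed
 have "closed (circle \<inter> g -` {0})" by (rule continuous_closed_preimage[OF gc]) auto
 then have "compact (circle \<inter> (circle \<inter> g -` {0}))" by (intro compact_Int_closed) auto
 moreover have "circle \<inter> (circle \<inter> g -` {0}) = {z \<in> circle. g z = 0}" by auto
 ultimately have K: "compact {z \<in> circle. g z = 0}" by simp
 have "\<mu> \<in> prob_on {z \<in> circle. g z = 0}"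
  unfolding prob_on_def
 proof (intro CollectI conjI exI[of _ "{z \<in> circle. g z = 0}"] sets_mu[OF \<mu>] prob_mu[OF \<mu>] K subset_refl)
  have m: "- {z \<in> circle. g z = 0} \<in> sets \<mu>" using borel_compact[OF K] by (simp add: sets_mu[OF \<mu>])
  show "emeasure \<mu> (- {z \<in> circle. g z = 0}) = 0"
   using AE_iff_measurable[OF m, of "\<lambda>z. z \<in> circle \<and> g z = 0"] AE0 by (auto simp: space_mu[OF \<mu>])
 qed
 moreover have "log_energy \<mu> < \<infinity>"
 proof (rule bounded_sums_imp_finite_energy[OF \<mu>])
  fix N
  have h: "(\<lambda>k. mu_hat (M (r k)) n) \<longlonglongrightarrow> mu_hat \<mu> n" for n
   unfolding mu_hat_def by (intro lim measurable_powi continuous_intros) auto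
  have "(\<lambda>k. \<Sum>n=1..N. (cmod (mu_hat (M (r k)) (int n)))^2 / real n) \<longlonglongrightarrow> (\<Sum>n=1..N. (cmod (mu_hat \<mu> (int n)))^2 / real n)"
   by (intro tendsto_intros h) auto
  then show "(\<Sum>n=1..N. (cmod (mu_hat \<mu> (int n)))^2 / real n) \<le> 16 / \<delta>^2" by (rule LIMSEQ_le_const2) (intro exI allI impI M2)
 qed
 ultimately show False using en by blast
qed

section \<open>The zero set and the equivalence\<close>

lemma log_energy_lower_bound:
 assumes \<mu>: "circle_prob \<mu>" shows "ereal (- ln 2) \<le> log_energy \<mu>"
proof -
 let ?P = "\<integral>\<^sup>+(\<zeta>, \<zeta>'). e2ennreal (log_kernel \<zeta> \<zeta>') \<partial>(\<mu> \<Otimes>\<^sub>M \<mu>)"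
 let ?N = "\<integral>\<^sup>+(\<zeta>, \<zeta>'). e2ennreal (- log_kernel \<zeta> \<zeta>') \<partial>(\<mu> \<Otimes>\<^sub>M \<mu>)"
 have "enn2ereal ?N \<le> enn2ereal (ennreal (ln 2))" using log_energy_negative_part[OF \<mu>] by (simp only: less_eq_ennreal.rep_eq)
 then have "enn2ereal ?N \<le> ereal (ln 2)" by (simp add: enn2ereal_ennreal)
 then have "0 - ereal (ln 2) \<le> enn2ereal ?P - enn2ereal ?N" by (intro ereal_minus_mono enn2ereal_nonneg)
 then show ?thesis by (simp add: log_energy_def)
qed

lemma shift_closure_cong_AE:
 assumes [measurable]: "h \<in> meas" "k \<in> meas" and ae: "AE z in ds. h z = k z"
 shows "shift_closure h \<subseteq> shift_closure k"
proof
 fix u assume u: "u \<in> shift_closure h"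
 then have uh: "u \<in> HD" by (simp add: shift_closure_def)
 note [measurable] = harmonic_measurable[OF uh] id_arc_measurable
 show "u \<in> shift_closure k"
  unfolding shift_closure_def
 proof (intro CollectI conjI uh allI impI)
  fix \<epsilon> :: real assume "0 < \<epsilon>"
  then obtain N a where N: "dnorm (\<lambda>z. u z - (\<Sum>n<(N::nat). a n * (z ^ n * h z))) < \<epsilon>"
   using u by (auto simp: shift_closure_def shift_span_def)
  have "fc (\<lambda>z. u z - (\<Sum>n<N. a n * (z ^ n * h z))) = fc (\<lambda>z. u z - (\<Sum>n<N. a n * (z ^ n * k z)))"
  proof (rule ext, rule fourier_coeff_cong_AE)
   show "AE z in ds. u z - (\<Sum>n<N. a n * (z ^ n * h z)) = u z - (\<Sum>n<N. a n * (z ^ n * k z))"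
    using ae by eventually_elim simp
  qed measurable
  then have "dnorm (\<lambda>z. u z - (\<Sum>n<N. a n * (z ^ n * k z))) < \<epsilon>" using N by (simp add: dirichlet_norm_def)
  then show "\<exists>p\<in>shift_span k. dnorm (\<lambda>z. u z - p z) < \<epsilon>" by (intro bexI[of _ "\<lambda>z. \<Sum>n<N. a n * (z ^ n * k z)"]) (auto simp: shift_span_def)
 qed
qed

lemma cyclic_cong_AE:
 assumes h: "h \<in> meas" and ae: "AE z in ds. h z = k z"
 shows "cyclic_dirichlet h \<longleftrightarrow> cyclic_dirichlet k"
proof -
 have k: "k \<in> meas" by (rule borel_measurable_arc_AE[OF h ae])
 have ae': "AE z in ds. k z = h z" using ae by eventually_elim simp
 have "shift_closure h = shift_closure k" using shift_closure_cong_AE[OF h k ae] shift_closure_cong_AE[OF k h ae'] by (rule antisym)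
 moreover have "h \<in> HD \<longleftrightarrow> k \<in> HD" using harmonic_cong_AE[OF _ ae] harmonic_cong_AE[OF _ ae'] by blast
 ultimately show ?thesis by (simp add: cyclic_dirichlet_def)
qed

lemma poisson_integral_cong_AE:
 assumes f: "f \<in> meas" and ae: "AE z in ds. f z = h z"
 shows "poisson_integral f = poisson_integral h"
proof
 fix z
 note [measurable] = f borel_measurable_arc_AE[OF f ae]
 have [measurable]: "(\<lambda>\<xi>. complex_of_real ((1 - (cmod z)^2) / (cmod (\<xi> - z))^2)) \<in> meas"
  by (rule borel_measurable_arc_length) measurable
 have "(LINT \<xi>|ds. of_real ((1 - (cmod z)^2) / (cmod (\<xi> - z))^2) * f \<xi>)
   = (LINT \<xi>|ds. of_real ((1 - (cmod z)^2) / (cmod (\<xi> - z))^2) * h \<xi>)"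
 proof (rule integral_cong_AE)
  show "AE \<xi> in ds. complex_of_real ((1 - (cmod z)^2) / (cmod (\<xi> - z))^2) * f \<xi> = of_real ((1 - (cmod z)^2) / (cmod (\<xi> - z))^2) * h \<xi>"
   using ae by eventually_elim simp
 qed measurable
 then show "poisson_integral f z = poisson_integral h z" by (simp add: poisson_integral_def)
qed

text \<open>The Poisson integrals coincide and converge to the functions at every point.\<close>

lemma lipschitz_eq_if_AE_eq:
 assumes h: "\<And>x y. x \<in> circle ==> y \<in> circle ==> cmod (h x - h y) \<le> L * cmod (x - y)"
  and k: "\<And>x y. x \<in> circle ==> y \<in> circle ==> cmod (k x - k y) \<le> L * cmod (x - y)"
  and L: "0 \<le> L" and ae: "AE z in ds. h z = k z" and z: "z \<in> circle"
 shows "h z = k z"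
proof -
 have lim: "(\<lambda>n. poisson_integral u (of_real (rad n) * z)) \<longlonglongrightarrow> u z"
  if u: "\<And>x y. x \<in> circle ==> y \<in> circle ==> cmod (u x - u y) \<le> L * cmod (x - y)" for u
 proof -
  have m: "u \<in> meas" by (rule lipschitz_circle_measurable[OF u])
  have "(\<lambda>n. L * psd n) \<longlonglongrightarrow> 0" using tendsto_mult_right_zero[OF psd_tendsto] .
  then have "(\<lambda>n. conv (pker n) u z - u z) \<longlonglongrightarrow> 0"
   by (rule Lim_null_comparison[rotated]) (intro always_eventually allI conv_pker_close[OF m z L] u z)
  then show ?thesis unfolding poisson_integral_eq_conv[OF z] using LIM_zero_iff by blast
 qed
 have m: "h \<in> meas" by (rule lipschitz_circle_measurable[OF h])
 have "(\<lambda>n. poisson_integral k (of_real (rad n) * z)) \<longlonglongrightarrow> h z" unfolding poisson_integral_cong_AE[OF m ae, symmetric] by (rule lim) (rule h)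
 moreover have "(\<lambda>n. poisson_integral k (of_real (rad n) * z)) \<longlonglongrightarrow> k z" by (rule lim) (rule k)
 ultimately show ?thesis by (rule LIMSEQ_unique)
qed

text \<open>The Poisson integral of \<open>f\<close> is dominated by that of \<open>g\<close>, which converges to \<open>g\<close> everywhere.\<close>

lemma zero_set_if_modulus_zero:
 assumes f: "f \<in> meas" and fg: "\<And>z. z \<in> circle ==> cmod (f z) = g z"
  and lip: "\<And>x y. x \<in> circle ==> y \<in> circle ==> \<bar>g x - g y\<bar> \<le> L * cmod (x - y)" and L: "0 \<le> L"
  and z: "z \<in> circle" "g z = 0"
 shows "z \<in> zero_set f"
proof -
 let ?g = "\<lambda>w. complex_of_real (g w)"
 have lg: "cmod (?g x - ?g y) \<le> L * cmod (x - y)" if "x \<in> circle" "y \<in> circle" for x y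
  using lip[OF that] by (simp add: of_real_lipschitz_cmod)
 have gm: "?g \<in> meas" by (rule lipschitz_circle_measurable[OF lg])
 have gm': "g \<in> meas" by (rule lipschitz_circle_measurable) (use lip in simp)
 have B: "norm (g w) \<le> norm (g 1) + 2 * \<bar>L\<bar>" if "w \<in> circle" for w by (rule lipschitz_circle_bounded[OF _ that]) (use lip in simp)
 have gi: "integrable ds g" by (rule integrable_arc_bounded[OF gm' B])
 have fi: "integrable ds f" by (rule integrable_arc_bounded[OF f, where B="norm (g 1) + 2 * \<bar>L\<bar>"]) (use B fg in force)
 have b: "cmod (poisson_integral f (of_real r * z)) \<le> L * sqrt (2 - 2 * r)" if r: "0 < r" "r < 1" for r
 proof -
  have k: "is_kernel (\<lambda>n. r ^ nat \<bar>n\<bar>) (poisson_kernel r)" using r by (intro poisson_is_kernel) auto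
  have "cmod (poisson_integral f (of_real r * z)) \<le> Re (conv (poisson_kernel r) ?g z)"
   unfolding poisson_integral_eq_conv[OF z(1)] by (rule conv_abs_le[OF k fi z(1) gi]) (simp add: fg)
  also have "\<dots> \<le> cmod (conv (poisson_kernel r) ?g z - ?g z)" using complex_Re_le_cmod[of "conv (poisson_kernel r) ?g z"] z(2) by simp
  also have "\<dots> \<le> L * sqrt (2 - 2 * r)" by (rule conv_lipschitz_at[OF k gm z(1) L lg]) (use r z in auto)
  finally show ?thesis .
 qed
 have "((\<lambda>r. L * sqrt (2 - 2 * r)) \<longlongrightarrow> L * sqrt (2 - 2 * 1)) (at_left 1)" by (intro tendsto_intros)
 then have l0: "((\<lambda>r. L * sqrt (2 - 2 * r)) \<longlongrightarrow> 0) (at_left 1)" by simp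
 have "((\<lambda>r. poisson_integral f (of_real r * z)) \<longlongrightarrow> 0) (at_left 1)"
 proof (rule Lim_null_comparison[OF _ l0])
  show "\<forall>\<^sub>F r in at_left 1. cmod (poisson_integral f (of_real r * z)) \<le> L * sqrt (2 - 2 * r)"
   by (rule eventually_mono[OF eventually_at_left_real[of 0 1]]) (auto intro: b)
 qed
 then show ?thesis using z by (simp add: zero_set_def)
qed

text \<open>The lower bound \<open>- ln 2\<close> for the energy excludes the value \<open>-\<infinity>\<close> of the infimum, for which \<open>1 / -\<infinity> = 0\<close>.\<close>

lemma log_capacity_zero_iff:
 assumes E: "E \<subseteq> circle"
 shows "log_capacity E = 0 \<longleftrightarrow> (\<forall>\<mu>\<in>prob_on E. log_energy \<mu> = \<infinity>)"
proof
 assume z: "log_capacity E = 0"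
 let ?I = "INF \<mu>\<in>prob_on E. log_energy \<mu>"
 have "ereal (- ln 2) \<le> ?I" by (intro INF_greatest log_energy_lower_bound prob_on_circle[OF _ E])
 moreover have "1 / ?I = 0" using z by (simp only: log_capacity_def)
 ultimately have "?I = \<infinity>" by (cases ?I) (auto simp: divide_ereal_def one_ereal_def zero_ereal_def split: if_splits)
 then show "\<forall>\<mu>\<in>prob_on E. log_energy \<mu> = \<infinity>" using INF_lower[of _ "prob_on E" log_energy] by force
next
 assume "\<forall>\<mu>\<in>prob_on E. log_energy \<mu> = \<infinity>"
 then have "\<infinity> \<le> (INF \<mu>\<in>prob_on E. log_energy \<mu>)" by (intro INF_greatest) simp
 then have "(INF \<mu>\<in>prob_on E. log_energy \<mu>) = \<infinity>" by simp
 then show "log_capacity E = 0" by (simp add: log_capacity_def divide_ereal_def)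
qed

lemma log_modulus_integrable_cong_AE:
 assumes f: "f \<in> meas" and ae: "AE z in ds. f z = h z"
 shows "log_modulus_integrable f \<longleftrightarrow> log_modulus_integrable h"
proof -
 note [measurable] = f borel_measurable_arc_AE[OF f ae]
 have "integrable ds (\<lambda>z. ln (cmod (f z))) \<longleftrightarrow> integrable ds (\<lambda>z. ln (cmod (h z)))"
 proof (rule integrable_cong_AE)
  show "AE z in ds. ln (cmod (f z)) = ln (cmod (h z))" using ae by eventually_elim simp
 qed measurable
 moreover have "(AE z in ds. f z \<noteq> 0) \<longleftrightarrow> (AE z in ds. h z \<noteq> 0)"
  by (rule eventually_subst, rule eventually_mono[OF ae]) simp
 ultimately show ?thesis by (simp add: log_modulus_integrable_def)
qed

theorem cyclic_square_iff:
 assumes adm: "admissible \<alpha> L C M g" and f: "f \<in> HD" and fg: "\<And>z. z \<in> circle ==> cmod (f z) = g z"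
 shows "cyclic_dirichlet (\<lambda>z. (f z)^2) \<longleftrightarrow> \<not> log_modulus_integrable f \<and> log_capacity (zero_set f) = 0"
proof
 have fm: "f \<in> meas" by (rule harmonic_measurable[OF f])
 have M: "cmod (f z) \<le> M" if "z \<in> circle" for z using adm_g(2)[OF adm that] by (simp add: fg[OF that])
 have zc: "zero_set f \<subseteq> circle" by (auto simp: zero_set_def)
 {
  assume cyc: "cyclic_dirichlet (\<lambda>z. (f z)^2)"
  show "\<not> log_modulus_integrable f \<and> log_capacity (zero_set f) = 0"
   unfolding log_capacity_zero_iff[OF zc]
   using cyclic_imp_log_not_integrable[OF fm M cyc] cyclic_imp_infinite_energy[OF f M cyc] by blast
 next
  assume r: "\<not> log_modulus_integrable f \<and> log_capacity (zero_set f) = 0"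
  show "cyclic_dirichlet (\<lambda>z. (f z)^2)"
  proof (rule cyclic_if_small_cutoffs[OF adm f fg conjunct1[OF r]])
   fix \<epsilon> :: real assume \<epsilon>: "0 < \<epsilon>"
   show "\<exists>u c. bounded_dirichlet u \<and> 0 < c \<and> (\<forall>z\<in>circle. g z < c \<longrightarrow> u z = 1) \<and> DN u < ennreal \<epsilon>"
   proof (rule cutoffs_if_infinite_energy[OF adm_pos(3)[OF adm] adm_lip[OF adm] adm_g(1)[OF adm] _ \<epsilon>])
    fix \<mu> assume "\<mu> \<in> prob_on {z \<in> circle. g z = 0}"
    moreover have "{z \<in> circle. g z = 0} \<subseteq> zero_set f"
     using zero_set_if_modulus_zero[OF fm fg adm_lip[OF adm] adm_pos(3)[OF adm]] by blast
    ultimately have "\<mu> \<in> prob_on (zero_set f)" by (auto simp: prob_on_def)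
    then show "\<not> log_energy \<mu> < \<infinity>" using r unfolding log_capacity_zero_iff[OF zc] by simp
   qed
  qed
 }
qed

theorem mainTheorem3:
  fixes \<alpha> :: real and f :: "complex \<Rightarrow> complex"
  assumes "0 < \<alpha>" and "\<alpha> < 1"
    and "f \<in> harmonic_dirichlet"
    and "\<exists>g \<in> C1_Lip_circle \<alpha>. AE \<zeta> in arc_length. cmod (f \<zeta>) = g \<zeta>"
  shows "cyclic_dirichlet (\<lambda>\<zeta>. (f \<zeta>)\<^sup>2) \<longleftrightarrow>
         \<not> log_modulus_integrable f \<and> log_capacity (zero_set f) = 0"
proof -
 obtain g where g: "g \<in> C1_Lip_circle \<alpha>" and ae: "AE \<zeta> in ds. cmod (f \<zeta>) = g \<zeta>" using assms(4) by blast
 obtain L C where LC: "0 \<le> L" "0 \<le> C" and lip: "\<And>x y. x \<in> circle ==> y \<in> circle ==> \<bar>g x - g y\<bar> \<le> L * cmod (x - y)"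
  and C: "\<And>x y. x \<in> circle ==> y \<in> circle ==> g x + g (y * y * cnj x) - 2 * g y \<le> C * cmod (x - y) powr (1 + \<alpha>)"
  using C1_Lip_circle_estimates[OF g assms(1)] by blast
 have g0: "0 \<le> g z" if z: "z \<in> circle" for z
 proof -
  have "complex_of_real (g z) = of_real \<bar>g z\<bar>"
  proof (rule lipschitz_eq_if_AE_eq[OF _ _ LC(1) _ z])
   show "AE z in ds. complex_of_real (g z) = of_real \<bar>g z\<bar>"
    using ae by eventually_elim (metis abs_norm_cancel)
   fix x y assume xy: "x \<in> circle" "y \<in> circle"
   show "cmod (complex_of_real (g x) - of_real (g y)) \<le> L * cmod (x - y)" using lip[OF xy] by (simp add: of_real_lipschitz_cmod)
   show "cmod (complex_of_real \<bar>g x\<bar> - of_real \<bar>g y\<bar>) \<le> L * cmod (x - y)"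
    unfolding of_real_lipschitz_cmod[symmetric] using lip[OF xy] by linarith
  qed
  then show ?thesis by (metis abs_ge_zero of_real_eq_iff)
 qed
 have B: "norm (g z) \<le> norm (g 1) + 2 * \<bar>L\<bar>" if "z \<in> circle" for z by (rule lipschitz_circle_bounded[OF _ that]) (use lip in simp)
 define M where "M = norm (g 1) + 2 * \<bar>L\<bar> + 1"
 have adm: "admissible \<alpha> L C M g"
  unfolding admissible_def
 proof (intro conjI ballI assms(1,2) LC lip g0)
  show "0 < M" by (simp add: M_def add_nonneg_pos)
  show "g x + 1 \<le> M" if "x \<in> circle" for x using B[OF that] g0[OF that] by (simp add: M_def)
  fix x y assume xy: "x \<in> circle" "y \<in> circle"
  have "0 \<le> g (y * y * cnj x)" by (intro g0 circle_mult xy circle_cnj)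
  then show "g x \<le> 2 * g y + C * cmod (x - y) powr (1 + \<alpha>)" using C[OF xy] by linarith
 qed
 define f' where "f' z = (if cmod (f z) = g z then f z else of_real (g z))" for z
 have f'g: "cmod (f' z) = g z" if "z \<in> circle" for z using g0[OF that] by (simp add: f'_def)
 have ff': "AE z in ds. f z = f' z" using ae by eventually_elim (simp add: f'_def)
 have fm[measurable]: "f \<in> meas" by (rule harmonic_measurable[OF assms(3)])
 have "cyclic_dirichlet (\<lambda>z. (f z)^2) \<longleftrightarrow> cyclic_dirichlet (\<lambda>z. (f' z)^2)"
 proof (rule cyclic_cong_AE)
  show "AE z in ds. (f z)^2 = (f' z)^2" using ff' by eventually_elim simp
 qed measurable
 moreover have "zero_set f = zero_set f'" unfolding zero_set_def poisson_integral_cong_AE[OF fm ff'] ..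
 ultimately show ?thesis
  using cyclic_square_iff[OF adm harmonic_cong_AE[OF assms(3) ff'] f'g] log_modulus_integrable_cong_AE[OF fm ff'] by simp
qed

end
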